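(* Let $p$ be a prime, let $k$ be a field of characteristic $p$, and let $G$ be a finite group. Let $U$, $V$ be simple $kG$-modules with sources of dimensions prime to $p$ such that $W=U\otimes_k V$ (with diagonal $G$-action) is simple. Assume that $k$ is large enough so that $U$, $V$, $W$ and their sources are absolutely indecomposable. Then the sources of $W$ have dimension prime to $p$, and there exist vertices $Q$, $R$ of $U$, $V$, respectively, such that $Q\cap R$ is a vertex of $W$ and such that $QR$ is a Sylow $p$-subgroup of $G$.
   Context: Modules are finitely generated left modules. For an indecomposable $kG$-module $U$, a vertex of $U$ is a minimal subgroup $Q$ of $G$ such that $U$ is isomorphic to a direct summand of $\mathrm{Ind}_Q^G\mathrm{Res}^G_Q(U)$; it is a $p$-subgroup, unique up to $G$-conjugacy. A source of $U$ (with respect to a vertex $Q$) is an indecomposable direct summand $X$ of $\mathrm{Res}^G_Q(U)$ such that $U$ is isomorphic to a direct summand of $\mathrm{Ind}_Q^G(X)$. Vertex-source pairs $(Q,X)$ of $U$ are unique up to $G$-conjugacy (with $X$ taken up to isomorphism). An indecomposable $kH$-module $M$, for $H$ a finite group, is absolutely indecomposable if $\mathrm{End}_{kH}(M)/J(\mathrm{End}_{kH}(M))\cong k$, where $J$ denotes the Jacobson radical. *)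

theory Defs
  imports
    Complex_Main
    "HOL-Computational_Algebra.Primes"
    "HOL-Library.Function_Algebras"
    "HOL-Algebra.QuotRing"
begin

text \<open>
  Since \<open>G\<close> is finite, a finitely generated left \<open>kG\<close>-module is a finite-dimensional
  \<open>k\<close>-vector space with a linear action of \<open>G\<close>; the vector space is a subspace of an
  ambient space filling the type \<open>'v\<close>, so that submodules, induced modules and tensor
  products are again of this form. Only the action of elements of \<open>carrier G\<close> on \<open>space M\<close>
  matters: the restriction to a subgroup \<open>H\<close> of a module over \<open>G\<close> is the same record,
  now taken as a module over \<open>G\<lparr>carrier := H\<rparr>\<close>.
\<close>

record ('k, 'g, 'v) gmod =
  space :: "'v set"
  scl :: "'k \<Rightarrow> 'v \<Rightarrow> 'v"
  act :: "'g \<Rightarrow> 'v \<Rightarrow> 'v"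

locale kG_module = group G + vector_space "scl M"
  for G :: "('g, 'r) monoid_scheme" (structure)
    and M :: "('k::field, 'g, 'v::ab_group_add) gmod" +
  assumes subspace_space: "subspace (space M)"
    and finite_dim: "\<exists>B. finite B \<and> B \<subseteq> space M \<and> span B = space M"
    and act_closed: "\<lbrakk>g \<in> carrier G; v \<in> space M\<rbrakk> \<Longrightarrow> act M g v \<in> space M"
    and act_add: "\<lbrakk>g \<in> carrier G; v \<in> space M; w \<in> space M\<rbrakk>
                   \<Longrightarrow> act M g (v + w) = act M g v + act M g w"
    and act_scl: "\<lbrakk>g \<in> carrier G; v \<in> space M\<rbrakk> \<Longrightarrow> act M g (scl M c v) = scl M c (act M g v)"
    and act_one: "v \<in> space M \<Longrightarrow> act M \<one> v = v"
    and act_mult: "\<lbrakk>g \<in> carrier G; h \<in> carrier G; v \<in> space M\<rbrakk>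
                   \<Longrightarrow> act M (g \<otimes> h) v = act M g (act M h v)"

definition dim_mod :: "('k::field, 'g, 'v::ab_group_add) gmod \<Rightarrow> nat" where
  "dim_mod M = vector_space.dim (scl M) (space M)"


section \<open>Submodules, homomorphisms, direct summands\<close>

definition submod :: "('g, 'r) monoid_scheme \<Rightarrow> ('k::field, 'g, 'v::ab_group_add) gmod \<Rightarrow> 'v set \<Rightarrow> bool" where
  "submod G M A \<longleftrightarrow> A \<subseteq> space M \<and> module.subspace (scl M) A \<and>
     (\<forall>g\<in>carrier G. \<forall>v\<in>A. act M g v \<in> A)"

abbreviation on_sub :: "('k, 'g, 'v) gmod \<Rightarrow> 'v set \<Rightarrow> ('k, 'g, 'v) gmod" where
  "on_sub M A \<equiv> M\<lparr>space := A\<rparr>"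

definition mod_hom ::
  "('g, 'r) monoid_scheme \<Rightarrow> ('k, 'g, 'v::ab_group_add) gmod \<Rightarrow> ('k, 'g, 'w::ab_group_add) gmod \<Rightarrow> ('v \<Rightarrow> 'w) set" where
  "mod_hom G M N = {f. f ` space M \<subseteq> space N \<and>
     (\<forall>v\<in>space M. \<forall>w\<in>space M. f (v + w) = f v + f w) \<and>
     (\<forall>c. \<forall>v\<in>space M. f (scl M c v) = scl N c (f v)) \<and>
     (\<forall>g\<in>carrier G. \<forall>v\<in>space M. f (act M g v) = act N g (f v))}"

definition mod_iso ::
  "('g, 'r) monoid_scheme \<Rightarrow> ('k, 'g, 'v::ab_group_add) gmod \<Rightarrow> ('k, 'g, 'w::ab_group_add) gmod \<Rightarrow> bool" where
  "mod_iso G M N \<longleftrightarrow> (\<exists>f \<in> mod_hom G M N. bij_betw f (space M) (space N))"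

definition direct_decomp ::
  "('g, 'r) monoid_scheme \<Rightarrow> ('k::field, 'g, 'v::ab_group_add) gmod \<Rightarrow> 'v set \<Rightarrow> 'v set \<Rightarrow> bool" where
  "direct_decomp G M A B \<longleftrightarrow> submod G M A \<and> submod G M B \<and>
     A \<inter> B = {0} \<and> {a + b | a b. a \<in> A \<and> b \<in> B} = space M"

definition direct_summand ::
  "('g, 'r) monoid_scheme \<Rightarrow> ('k::field, 'g, 'v::ab_group_add) gmod \<Rightarrow> 'v set \<Rightarrow> bool" where
  "direct_summand G M A \<longleftrightarrow> (\<exists>B. direct_decomp G M A B)"

definition iso_direct_summand ::
  "('g, 'r) monoid_scheme \<Rightarrow> ('k::field, 'g, 'v::ab_group_add) gmod \<Rightarrow> ('k, 'g, 'w::ab_group_add) gmod \<Rightarrow> bool" where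
  "iso_direct_summand G M N \<longleftrightarrow> (\<exists>A. direct_summand G N A \<and> mod_iso G M (on_sub N A))"

definition indecomposable :: "('g, 'r) monoid_scheme \<Rightarrow> ('k::field, 'g, 'v::ab_group_add) gmod \<Rightarrow> bool" where
  "indecomposable G M \<longleftrightarrow> space M \<noteq> {0} \<and>
     (\<forall>A B. direct_decomp G M A B \<longrightarrow> A = {0} \<or> B = {0})"

definition simple_mod :: "('g, 'r) monoid_scheme \<Rightarrow> ('k::field, 'g, 'v::ab_group_add) gmod \<Rightarrow> bool" where
  "simple_mod G M \<longleftrightarrow> space M \<noteq> {0} \<and>
     (\<forall>A. submod G M A \<longrightarrow> A = {0} \<or> A = space M)"


section \<open>Induced modules and tensor products\<close>

text \<open>
  \<open>kG \<otimes>\<^bsub>kH\<^esub> M\<close> is modelled on functions \<open>f\<close> with \<open>f (x \<otimes> h) = h\<inverse> f x\<close>: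
  such an \<open>f\<close> stands for the sum of the tensors \<open>x \<otimes> f x\<close>, where \<open>x\<close> runs over
  representatives of the cosets \<open>xH\<close>. The choice of the representatives is immaterial as
  \<open>x h \<otimes> h\<inverse> f x = x \<otimes> f x\<close>, and left multiplication by \<open>g\<close> becomes
  \<open>f \<mapsto> (\<lambda>x. f (g\<inverse> x))\<close>.
\<close>

definition induced ::
  "('g, 'r) monoid_scheme \<Rightarrow> 'g set \<Rightarrow> ('k::field, 'g, 'v::ab_group_add) gmod \<Rightarrow> ('k, 'g, 'g \<Rightarrow> 'v) gmod" where
  "induced G H M =
     \<lparr>space = {f. (\<forall>x\<in>carrier G. f x \<in> space M) \<and> (\<forall>x. x \<notin> carrier G \<longrightarrow> f x = 0) \<and>
                  (\<forall>x\<in>carrier G. \<forall>h\<in>H. f (x \<otimes>\<^bsub>G\<^esub> h) = act M (inv\<^bsub>G\<^esub> h) (f x))},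
      scl = (\<lambda>c f x. scl M c (f x)),
      act = (\<lambda>g f x. if x \<in> carrier G then f (inv\<^bsub>G\<^esub> g \<otimes>\<^bsub>G\<^esub> x) else 0)\<rparr>"

text \<open>
  The tensor product over \<open>k\<close> embeds into the dual of the space of bilinear forms, with
  \<open>u \<otimes> v\<close> going to the evaluation of forms at \<open>(u, v)\<close>; it is identified with
  its image there, the span of the pure tensors. The action is the one with
  \<open>g (u \<otimes> v) = g u \<otimes> g v\<close>.
\<close>

definition bilinear_forms ::
  "('k::field, 'g, 'u::ab_group_add) gmod \<Rightarrow> ('k, 'g, 'v::ab_group_add) gmod \<Rightarrow> ('u \<Rightarrow> 'v \<Rightarrow> 'k) set" where
  "bilinear_forms U V = {\<beta>.
     (\<forall>u\<in>space U. \<forall>u'\<in>space U. \<forall>v\<in>space V. \<beta> (u + u') v = \<beta> u v + \<beta> u' v) \<and>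
     (\<forall>u\<in>space U. \<forall>v\<in>space V. \<forall>v'\<in>space V. \<beta> u (v + v') = \<beta> u v + \<beta> u v') \<and>
     (\<forall>c. \<forall>u\<in>space U. \<forall>v\<in>space V. \<beta> (scl U c u) v = c * \<beta> u v \<and> \<beta> u (scl V c v) = c * \<beta> u v)}"

definition pure_tensor ::
  "('k::field, 'g, 'u::ab_group_add) gmod \<Rightarrow> ('k, 'g, 'v::ab_group_add) gmod \<Rightarrow> 'u \<Rightarrow> 'v \<Rightarrow> ('u \<Rightarrow> 'v \<Rightarrow> 'k) \<Rightarrow> 'k" where
  "pure_tensor U V u v = (\<lambda>\<beta>. if \<beta> \<in> bilinear_forms U V then \<beta> u v else 0)"

definition tensor ::
  "('k::field, 'g, 'u::ab_group_add) gmod \<Rightarrow> ('k, 'g, 'v::ab_group_add) gmod \<Rightarrow> ('k, 'g, ('u \<Rightarrow> 'v \<Rightarrow> 'k) \<Rightarrow> 'k) gmod" where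
  "tensor U V =
     \<lparr>space = module.span (\<lambda>c t \<beta>. c * t \<beta>) {pure_tensor U V u v | u v. u \<in> space U \<and> v \<in> space V},
      scl = (\<lambda>c t \<beta>. c * t \<beta>),
      act = (\<lambda>g t \<beta>. t (\<lambda>u v. \<beta> (act U g u) (act V g v)))\<rparr>"


section \<open>Vertices and sources\<close>

definition relatively_projective ::
  "('g, 'r) monoid_scheme \<Rightarrow> 'g set \<Rightarrow> ('k::field, 'g, 'v::ab_group_add) gmod \<Rightarrow> bool" where
  "relatively_projective G Q U \<longleftrightarrow> iso_direct_summand G U (induced G Q U)"

definition vertex :: "('g, 'r) monoid_scheme \<Rightarrow> ('k::field, 'g, 'v::ab_group_add) gmod \<Rightarrow> 'g set \<Rightarrow> bool" where
  "vertex G U Q \<longleftrightarrow> subgroup Q G \<and> relatively_projective G Q U \<and>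
     (\<forall>P. subgroup P G \<and> relatively_projective G P U \<and> P \<subseteq> Q \<longrightarrow> P = Q)"

definition source ::
  "('g, 'r) monoid_scheme \<Rightarrow> ('k::field, 'g, 'v::ab_group_add) gmod \<Rightarrow> 'g set \<Rightarrow> 'v set \<Rightarrow> bool" where
  "source G U Q X \<longleftrightarrow> vertex G U Q \<and>
     direct_summand (G\<lparr>carrier := Q\<rparr>) U X \<and>
     indecomposable (G\<lparr>carrier := Q\<rparr>) (on_sub U X) \<and>
     iso_direct_summand G U (induced G Q (on_sub U X))"


section \<open>Absolute indecomposability\<close>

text \<open>Endomorphisms are extended by zero outside \<open>space M\<close>, so that each has a unique representative.\<close>

definition End_ring :: "('g, 'r) monoid_scheme \<Rightarrow> ('k, 'g, 'v::ab_group_add) gmod \<Rightarrow> ('v \<Rightarrow> 'v) ring" where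
  "End_ring G M =
     \<lparr>carrier = {f \<in> mod_hom G M M. \<forall>v. v \<notin> space M \<longrightarrow> f v = 0},
      mult = (\<circ>),
      one = (\<lambda>v. if v \<in> space M then v else 0),
      zero = (\<lambda>v. 0),
      add = (\<lambda>f g v. f v + g v)\<rparr>"

definition scalar_endo :: "('k, 'g, 'v::ab_group_add) gmod \<Rightarrow> 'k \<Rightarrow> 'v \<Rightarrow> 'v" where
  "scalar_endo M c = (\<lambda>v. if v \<in> space M then scl M c v else 0)"

definition left_ideal :: "'a set \<Rightarrow> ('a, 'r) ring_scheme \<Rightarrow> bool" where
  "left_ideal I R \<longleftrightarrow> additive_subgroup I R \<and> (\<forall>r\<in>carrier R. \<forall>a\<in>I. r \<otimes>\<^bsub>R\<^esub> a \<in> I)"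

definition maximal_left_ideal :: "'a set \<Rightarrow> ('a, 'r) ring_scheme \<Rightarrow> bool" where
  "maximal_left_ideal I R \<longleftrightarrow> left_ideal I R \<and> I \<noteq> carrier R \<and>
     (\<forall>L. left_ideal L R \<and> I \<subseteq> L \<longrightarrow> L = I \<or> L = carrier R)"

definition jacobson_radical :: "('a, 'r) ring_scheme \<Rightarrow> 'a set" where
  "jacobson_radical R = {a \<in> carrier R. \<forall>I. maximal_left_ideal I R \<longrightarrow> a \<in> I}"

definition field_ring :: "'k::field ring" where
  "field_ring = \<lparr>carrier = UNIV, mult = (*), one = 1, zero = 0, add = (+)\<rparr>"

text \<open>
  The isomorphism with \<open>k\<close> is one of \<open>k\<close>-algebras: a proper finite extension of \<open>k\<close> can be
  isomorphic to \<open>k\<close> as a ring.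
\<close>

definition absolutely_indecomposable :: "('g, 'r) monoid_scheme \<Rightarrow> ('k::field, 'g, 'v::ab_group_add) gmod \<Rightarrow> bool" where
  "absolutely_indecomposable G M \<longleftrightarrow> indecomposable G M \<and>
     (let E = End_ring G M; J = jacobson_radical E in
        \<exists>\<phi> \<in> ring_iso (E Quot J) (field_ring :: 'k ring).
          \<forall>c. \<phi> (J +>\<^bsub>E\<^esub> scalar_endo M c) = c)"


section \<open>Sylow subgroups\<close>

definition sylow_subgroup :: "nat \<Rightarrow> ('g, 'r) monoid_scheme \<Rightarrow> 'g set \<Rightarrow> bool" where
  "sylow_subgroup p G P \<longleftrightarrow> subgroup P G \<and> card P = p ^ multiplicity p (order G)"

end

theory Submission
  imports Defs
    "HOL-Algebra.Algebraic_Closure_Type"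
    "HOL-Algebra.Multiplicative_Group"
    "HOL-Algebra.Sylow"
    "HOL-Computational_Algebra.Polynomial"
begin

text \<open>
  By Higman's criterion a module is projective relative to \<open>D\<close> iff its identity is a relative trace
  \<open>Tr\<^sub>D\<^sup>G c\<close> of an endomorphism \<open>c\<close> commuting with \<open>D\<close>. Two facts about such a \<open>c\<close> are used.
  (1) If a \<open>p\<close>-subgroup \<open>H\<close> commutes with some \<open>b\<close> of non-zero trace, then \<open>H\<close> lies in a conjugate of \<open>D\<close>: by
  Mackey, \<open>b = b Tr\<^sub>D\<^sup>G c\<close> is otherwise a sum of traces from proper subgroups of \<open>H\<close>, and these have trace \<open>0\<close>.
  (2) For \<open>p\<close>-groups \<open>D\<close> and \<open>P\<close>, the order \<open>|P|\<close> divides \<open>|D| dim M\<close>, and \<open>|D| dim M / |P| = |G:P| tr c\<close> in \<open>k\<close>; this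
  rests on Green's indecomposability theorem over the algebraic closure.

  If \<open>Q\<close>, \<open>R\<close> are vertices of \<open>U\<close>, \<open>V\<close> inside a Sylow subgroup \<open>P\<close>, with \<open>1 = Tr\<^sub>Q\<^sup>G a\<close> and \<open>1 = Tr\<^sub>R\<^sup>G b\<close>, then the
  identity of \<open>W\<close> is a sum of traces of elements \<open>a \<otimes> g b\<close> from subgroups \<open>Q \<inter> gR\<close>. As these traces are scalars,
  \<open>W\<close> is projective relative to some \<open>H = Q \<inter> gR\<close>. Sources of dimension prime to \<open>p\<close> provide endomorphisms of \<open>U\<close>, \<open>V\<close>
  of non-zero trace commuting with \<open>Q\<close>, \<open>R\<close>, hence some of \<open>W\<close> commuting with \<open>H\<close> and with \<open>Q \<inter> R\<close>. By (1), \<open>H\<close> is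
  a vertex of \<open>W\<close> and \<open>|Q \<inter> R| \<le> |H|\<close>. By (2), \<open>|P|\<close> divides \<open>|Q| dim U\<close> and \<open>|R| dim V\<close>, and it is the exact
  \<open>p\<close>-part of \<open>|H| dim U dim V\<close>, so \<open>|H| |P| \<le> |Q| |R| = |QR| |Q \<inter> R| \<le> |P| |H|\<close> and equality holds throughout.
\<close>

text \<open>Modules are rewritten as matrix representations, where extension of scalars and tensor
  products act on entries. Green's theorem needs the algebraic closure, since an indecomposable
  module may split after extension; but fact (2) speaks only of ranks and traces, which extension
  preserves, so it may be proved over the closure. It is proved there for all idempotents fixed by
  \<open>p\<close>-subgroups, which is what makes an induction possible.

  Divisibility in (2) bounds |Q| and |R| from below. The bound on |H| comes from the equation in
  \<open>k\<close>: \<open>tr c\<close> is not zero for \<open>W\<close>, because relative traces to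
  \<open>G\<close> are scalars and the trace form makes the relative trace self-adjoint; as |G:P| is
  prime to \<open>p\<close>, so is |H| dim W / |P|.

  The subgroup \<open>H\<close> is the intersection of \<open>Q\<close> with a conjugate of
  \<open>R\<close>. Replacing \<open>R\<close> by this conjugate would give the vertex of
  \<open>W\<close>, but the conjugate need not lie in \<open>P\<close>, and the product of the two
  subgroups would be out of control. So \<open>R\<close> stays inside \<open>P\<close>, and counting
  shows that \<open>Q \<inter> R\<close> fills a conjugate of \<open>H\<close>.\<close>

hide_const (open) Divisibility.prime Polynomial.order
no_notation var (\<open>X\<index>\<close>)

section \<open>Sums over cosets\<close>

text \<open>The sum of \<open>f\<close> over the quotient of \<open>K\<close> by the kernel of \<open>q\<close>. The representatives are arbitrary, so this is
  meaningful for \<open>f\<close> constant on the fibres of \<open>q\<close>. With \<open>q = (\<lambda>x. x <# H)\<close> one gets sums over \<open>K/H\<close>.\<close>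

definition qsum :: "'a set \<Rightarrow> ('a \<Rightarrow> 'c) \<Rightarrow> ('a \<Rightarrow> 'b::comm_monoid_add) \<Rightarrow> 'b" where
  "qsum K q f = (\<Sum>C\<in>q ` K. f (SOME x. x \<in> K \<and> q x = C))"

lemma qsum_eq:
  assumes "\<And>x. x \<in> K \<Longrightarrow> g (q x) = f x"
  shows "qsum K q f = sum g (q ` K)"
  unfolding qsum_def
proof (rule sum.cong[OF refl])
  fix C assume "C \<in> q ` K"
  then have "\<exists>x. x \<in> K \<and> q x = C" by blast
  from someI_ex[OF this] show "f (SOME x. x \<in> K \<and> q x = C) = g C"
    using assms by metis
qed

lemma qsum_descend:
  assumes "\<And>x y. \<lbrakk>x \<in> K; y \<in> K; q x = q y\<rbrakk> \<Longrightarrow> f x = f y"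
  obtains g where "\<And>x. x \<in> K \<Longrightarrow> g (q x) = f x"
proof
  fix x assume x: "x \<in> K"
  then have "\<exists>y. y \<in> K \<and> q y = q x" by blast
  from someI_ex[OF this] show "(\<lambda>C. f (SOME x. x \<in> K \<and> q x = C)) (q x) = f x"
    using assms x by metis
qed

lemma qsum_cong:
  assumes "\<And>x. x \<in> K \<Longrightarrow> f x = g x"
  shows "qsum K q f = qsum K q g"
  unfolding qsum_def
proof (rule sum.cong[OF refl])
  fix C assume "C \<in> q ` K"
  then have "\<exists>x. x \<in> K \<and> q x = C" by blast
  from someI_ex[OF this] show "f (SOME x. x \<in> K \<and> q x = C) = g (SOME x. x \<in> K \<and> q x = C)"
    using assms by blast
qed

text \<open>By \<open>r\<close>, the map \<phi> induces an injection from the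
  \<open>r\<close>-classes of \<open>K\<close> to the \<open>q\<close>-classes of \<open>X\<close>,
  and \<open>im\<close> makes it onto. Bijectivity is needed on classes only, so \<phi> may miss
  elements of \<open>X\<close>; translation, conjugation and double cosets are all
  instances.\<close>

lemma qsum_reindex:
  assumes f: "\<And>x y. \<lbrakk>x \<in> X; y \<in> X; q x = q y\<rbrakk> \<Longrightarrow> f x = f y"
    and sub: "\<phi> ` K \<subseteq> X" and im: "q ` X \<subseteq> q ` \<phi> ` K"
    and r: "\<And>x y. \<lbrakk>x \<in> K; y \<in> K\<rbrakk> \<Longrightarrow> r x = r y \<longleftrightarrow> q (\<phi> x) = q (\<phi> y)"
  shows "qsum X q f = qsum K r (\<lambda>x. f (\<phi> x))"
proof -
  obtain g where g: "\<And>x. x \<in> X \<Longrightarrow> g (q x) = f x" using qsum_descend[of X q f] f by blast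
  obtain s where s: "\<And>x. x \<in> K \<Longrightarrow> s (r x) = q (\<phi> x)"
    using qsum_descend[of K r "\<lambda>x. q (\<phi> x)"] r by blast
  have inj: "inj_on s (r ` K)" using s r by (auto simp: inj_on_def)
  have im2: "s ` r ` K = q ` X" using s im sub by (force simp: image_iff)
  have "qsum X q f = sum g (q ` X)" using g by (rule qsum_eq)
  also have "\<dots> = sum (g \<circ> s) (r ` K)" unfolding im2[symmetric] by (rule sum.reindex[OF inj])
  also have "\<dots> = qsum K r (\<lambda>x. f (\<phi> x))"
    by (rule qsum_eq[symmetric]) (use g s sub in auto)
  finally show ?thesis .
qed

text \<open>The classes of \<open>q\<close> refine those of \<open>r\<close>, so the sum may be
  grouped by the value of \<open>r\<close>. Used with \<open>r\<close> the map to cosets of a larger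
  subgroup or to double cosets.\<close>

lemma qsum_partition:
  assumes fin: "finite K" and f: "\<And>x y. \<lbrakk>x \<in> K; y \<in> K; q x = q y\<rbrakk> \<Longrightarrow> f x = f y"
    and r: "\<And>x y. \<lbrakk>x \<in> K; y \<in> K; q x = q y\<rbrakk> \<Longrightarrow> r x = r y"
  shows "qsum K q f = (\<Sum>d\<in>r ` K. qsum {x\<in>K. r x = d} q f)"
proof -
  obtain g where g: "\<And>x. x \<in> K \<Longrightarrow> g (q x) = f x" using qsum_descend[of K q f] f by blast
  obtain s where s: "\<And>x. x \<in> K \<Longrightarrow> s (q x) = r x" using qsum_descend[of K q r] r by blast
  have "qsum K q f = sum g (q ` K)" using g by (rule qsum_eq)
  also have "\<dots> = (\<Sum>d\<in>r ` K. sum g {C\<in>q ` K. s C = d})"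
    by (rule sum.group[symmetric]) (use fin s in auto)
  also have "\<dots> = (\<Sum>d\<in>r ` K. qsum {x\<in>K. r x = d} q f)"
  proof (rule sum.cong[OF refl])
    fix d
    have "{C\<in>q ` K. s C = d} = q ` {x\<in>K. r x = d}" using s by auto
    then show "sum g {C\<in>q ` K. s C = d} = qsum {x\<in>K. r x = d} q f"
      using qsum_eq[of "{x\<in>K. r x = d}" g q f] g by auto
  qed
  finally show ?thesis .
qed

lemma qsum_add: "qsum K q (\<lambda>x. f x + g x) = qsum K q f + qsum K q g"
  by (simp add: qsum_def sum.distrib)

lemma qsum_additive:
  fixes h :: "'b::comm_monoid_add \<Rightarrow> 'e::comm_monoid_add"
  assumes "\<And>x y. h (x + y) = h x + h y" "h 0 = 0"
  shows "h (qsum K q f) = qsum K q (\<lambda>x. h (f x))"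
proof -
  have "h (sum g S) = (\<Sum>x\<in>S. h (g x))" for S :: "'d set" and g
    by (induction S rule: infinite_finite_induct) (use assms in auto)
  then show ?thesis by (simp add: qsum_def)
qed

context group
begin

abbreviation csum :: "'a set \<Rightarrow> 'a set \<Rightarrow> ('a \<Rightarrow> 'm::comm_monoid_add) \<Rightarrow> 'm" where
  "csum K H f \<equiv> qsum K (\<lambda>x. x <# H) f"

abbreviation conjg :: "'a \<Rightarrow> 'a set \<Rightarrow> 'a set" where
  "conjg g H \<equiv> (\<lambda>h. g \<otimes> h \<otimes> inv g) ` H"

lemmas mem_subgroup = subgroup.mem_carrier[of _ G]
  and subset_subgroup = subgroup.subset[of _ G]
  and mult_subgroup = subgroup.m_closed[of _ G]
  and inv_subgroup = subgroup.m_inv_closed[of _ G]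
  and one_subgroup = subgroup.one_closed[of _ G]

lemma inv_mult_cancel [simp]:
  "\<lbrakk>x \<in> carrier G; y \<in> carrier G\<rbrakk> \<Longrightarrow> inv x \<otimes> (x \<otimes> y) = y"
  "\<lbrakk>x \<in> carrier G; y \<in> carrier G\<rbrakk> \<Longrightarrow> x \<otimes> (inv x \<otimes> y) = y"
  by (simp_all add: m_assoc[symmetric])

lemma lcos_mem: "\<lbrakk>x \<in> carrier G; subgroup H G\<rbrakk> \<Longrightarrow> x \<in> x <# H"
  using one_subgroup[of H] by (force simp: l_coset_def)

lemma lcoset_eq_iff:
  assumes "subgroup H G" "x \<in> carrier G" "y \<in> carrier G"
  shows "x <# H = y <# H \<longleftrightarrow> inv x \<otimes> y \<in> H"
proof
  assume "x <# H = y <# H"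
  then have "y \<in> x <# H" using assms lcos_mem by blast
  then obtain h where "h \<in> H" "y = x \<otimes> h" by (auto simp: l_coset_def)
  then show "inv x \<otimes> y \<in> H" using assms by (metis inv_solve_left mem_subgroup)
next
  assume *: "inv x \<otimes> y \<in> H"
  have "y = x \<otimes> (inv x \<otimes> y)" using assms by simp
  then have "y \<in> x <# H" using * by (auto simp: l_coset_def)
  then show "x <# H = y <# H" using assms l_repr_independence by metis
qed

lemma rinv_fibers:
  assumes "subgroup H G" "K \<subseteq> carrier G"
    and "\<And>x h. \<lbrakk>x \<in> K; h \<in> H\<rbrakk> \<Longrightarrow> f (x \<otimes> h) = f x"
    and "x \<in> K" "y \<in> K" "x <# H = y <# H"
  shows "f x = f y"
proof -
  have "inv x \<otimes> y \<in> H" using assms lcoset_eq_iff by (metis subsetD)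
  moreover have "y = x \<otimes> (inv x \<otimes> y)" using assms(2,4,5) by (simp add: subset_iff)
  ultimately show ?thesis using assms(3,4) by metis
qed

lemma conjg_subgroup: "\<lbrakk>subgroup H G; g \<in> carrier G\<rbrakk> \<Longrightarrow> subgroup (conjg g H) G"
proof -
  assume a: "subgroup H G" "g \<in> carrier G"
  show ?thesis
  proof (rule subgroupI)
    show "conjg g H \<subseteq> carrier G" using a mem_subgroup[OF a(1)] by auto
    show "conjg g H \<noteq> {}" using one_subgroup[OF a(1)] by auto
  next
    fix x assume "x \<in> conjg g H"
    then obtain h where h: "h \<in> H" "x = g \<otimes> h \<otimes> inv g" by auto
    then have "inv x = g \<otimes> inv h \<otimes> inv g"
      using a mem_subgroup[OF a(1)] by (simp add: inv_mult_group m_assoc)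
    then show "inv x \<in> conjg g H" using h inv_subgroup[OF a(1)] by auto
  next
    fix x y assume "x \<in> conjg g H" "y \<in> conjg g H"
    then obtain h k where h: "h \<in> H" "x = g \<otimes> h \<otimes> inv g" "k \<in> H" "y = g \<otimes> k \<otimes> inv g" by auto
    have hk: "h \<in> carrier G" "k \<in> carrier G" using h mem_subgroup[OF a(1)] by auto
    have "x \<otimes> y = g \<otimes> h \<otimes> (inv g \<otimes> g) \<otimes> k \<otimes> inv g"
      using h hk a by (simp add: m_assoc del: l_inv r_inv)
    also have "\<dots> = g \<otimes> (h \<otimes> k) \<otimes> inv g" using hk a by (simp add: m_assoc)
    finally show "x \<otimes> y \<in> conjg g H" using h mult_subgroup[OF a(1)] by auto
  qed
qed

lemma conjg_iff:
  assumes "H \<subseteq> carrier G" "g \<in> carrier G" "x \<in> carrier G"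
  shows "x \<in> conjg g H \<longleftrightarrow> inv g \<otimes> x \<otimes> g \<in> H"
proof
  assume "x \<in> conjg g H"
  then obtain h where h: "h \<in> H" "x = g \<otimes> h \<otimes> inv g" by auto
  have hc: "h \<in> carrier G" using h assms by auto
  have "inv g \<otimes> x \<otimes> g = (inv g \<otimes> g) \<otimes> h \<otimes> (inv g \<otimes> g)"
    using h hc assms by (simp add: m_assoc del: l_inv)
  then show "inv g \<otimes> x \<otimes> g \<in> H" using h hc assms by simp
next
  assume "inv g \<otimes> x \<otimes> g \<in> H"
  moreover have "x = g \<otimes> (inv g \<otimes> x \<otimes> g) \<otimes> inv g"
  proof -
    have "g \<otimes> (inv g \<otimes> x \<otimes> g) \<otimes> inv g = (g \<otimes> inv g) \<otimes> x \<otimes> (g \<otimes> inv g)"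
      using assms by (simp add: m_assoc del: r_inv)
    then show ?thesis using assms by simp
  qed
  ultimately show "x \<in> conjg g H" by blast
qed

lemma card_conjg: "\<lbrakk>H \<subseteq> carrier G; g \<in> carrier G\<rbrakk> \<Longrightarrow> card (conjg g H) = card H"
  by (rule card_image, rule inj_onI) (auto simp: subset_iff)

lemma conjg_conjg:
  assumes "H \<subseteq> carrier G" "g \<in> carrier G" "k \<in> carrier G"
  shows "conjg g (conjg k H) = conjg (g \<otimes> k) H"
proof -
  have "g \<otimes> (k \<otimes> h \<otimes> inv k) \<otimes> inv g = (g \<otimes> k) \<otimes> h \<otimes> inv (g \<otimes> k)" if "h \<in> H" for h
    using assms that by (auto simp: inv_mult_group m_assoc subset_iff)
  then show ?thesis by (auto simp: image_image)
qed

lemma conjg_one: "H \<subseteq> carrier G \<Longrightarrow> conjg \<one> H = H"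
  by (auto simp: image_iff subset_iff)

lemma csum_translate:
  assumes "subgroup H G" "subgroup K G" "k \<in> K"
    and "\<And>x h. \<lbrakk>x \<in> K; h \<in> H\<rbrakk> \<Longrightarrow> f (x \<otimes> h) = f x"
  shows "csum K H (\<lambda>x. f (k \<otimes> x)) = csum K H f"
proof (rule qsum_reindex[symmetric])
  have Kc: "K \<subseteq> carrier G" using assms subset_subgroup by auto
  show "f x = f y" if "x \<in> K" "y \<in> K" "x <# H = y <# H" for x y
    using rinv_fibers[OF assms(1) Kc assms(4)] that by blast
  show sub: "(\<lambda>x. k \<otimes> x) ` K \<subseteq> K" using assms mult_subgroup by fastforce
  have "K \<subseteq> (\<lambda>x. k \<otimes> x) ` K"
  proof
    fix x assume x: "x \<in> K"
    have "x = k \<otimes> (inv k \<otimes> x)" using x assms Kc by (auto simp: m_assoc[symmetric] subset_iff)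
    moreover have "inv k \<otimes> x \<in> K" using x assms by (simp add: mult_subgroup inv_subgroup)
    ultimately show "x \<in> (\<lambda>x. k \<otimes> x) ` K" by blast
  qed
  then show "(\<lambda>x. x <# H) ` K \<subseteq> (\<lambda>x. x <# H) ` (\<lambda>x. k \<otimes> x) ` K" by blast
  fix x y assume xy: "x \<in> K" "y \<in> K"
  have c: "k \<in> carrier G" "x \<in> carrier G" "y \<in> carrier G" using xy assms Kc by auto
  have "inv (k \<otimes> x) \<otimes> (k \<otimes> y) = inv x \<otimes> (inv k \<otimes> k) \<otimes> y"
    using c by (simp add: inv_mult_group m_assoc del: l_inv)
  also have "\<dots> = inv x \<otimes> y" using c by simp
  finally show "x <# H = y <# H \<longleftrightarrow> k \<otimes> x <# H = k \<otimes> y <# H"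
    using lcoset_eq_iff[OF assms(1)] c by auto
qed

text \<open>The cosets of \<open>L\<close> inside one coset \<open>x <# H\<close> are the translates
  by \<open>x\<close> of the cosets of \<open>L\<close> in \<open>H\<close>.\<close>

lemma csum_trans:
  assumes fin: "finite (carrier G)" and LHK: "subgroup L G" "subgroup H G" "subgroup K G" "L \<subseteq> H" "H \<subseteq> K"
    and f: "\<And>x h. \<lbrakk>x \<in> K; h \<in> L\<rbrakk> \<Longrightarrow> f (x \<otimes> h) = f x"
  shows "csum K L f = csum K H (\<lambda>x. csum H L (\<lambda>y. f (x \<otimes> y)))"
proof -
  have Kc: "K \<subseteq> carrier G" using LHK subset_subgroup by auto
  have fK: "finite K" using Kc fin finite_subset by auto
  have f': "f x = f y" if "x \<in> K" "y \<in> K" "x <# L = y <# L" for x y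
    using rinv_fibers[OF LHK(1) Kc f] that by blast
  have inner: "qsum {y\<in>K. y <# H = x <# H} (\<lambda>x. x <# L) f = csum H L (\<lambda>y. f (x \<otimes> y))" if x: "x \<in> K" for x
  proof (rule qsum_reindex)
    show "f x = f y" if "x \<in> {y\<in>K. y <# H = z <# H}" "y \<in> {y\<in>K. y <# H = z <# H}" "x <# L = y <# L" for x y z
      using f' that by blast
    have xc: "x \<in> carrier G" using x Kc by auto
    have hc: "h \<in> carrier G" if "h \<in> H" for h using that LHK mem_subgroup by auto
    show "(\<lambda>y. x \<otimes> y) ` H \<subseteq> {y \<in> K. y <# H = x <# H}"
    proof clarsimp
      fix h assume h: "h \<in> H"
      have "x \<otimes> h \<in> K" using h x LHK by (meson mult_subgroup subsetD)
      moreover have "inv x \<otimes> (x \<otimes> h) = h" using xc hc[OF h] by (simp add: m_assoc[symmetric])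
      ultimately show "x \<otimes> h \<in> K \<and> x \<otimes> h <# H = x <# H"
        using lcoset_eq_iff[OF LHK(2) xc] h xc hc[OF h] by (metis m_closed)
    qed
    have "{y \<in> K. y <# H = x <# H} \<subseteq> (\<lambda>y. x \<otimes> y) ` H"
    proof clarsimp
      fix y assume y: "y \<in> K" "y <# H = x <# H"
      then have yc: "y \<in> carrier G" using Kc by auto
      have "inv x \<otimes> y \<in> H" using lcoset_eq_iff[OF LHK(2) xc yc] y by simp
      moreover have "y = x \<otimes> (inv x \<otimes> y)" using xc yc by (simp add: m_assoc[symmetric])
      ultimately show "y \<in> (\<lambda>y. x \<otimes> y) ` H" by blast
    qed
    then show "(\<lambda>x. x <# L) ` {y \<in> K. y <# H = x <# H} \<subseteq> (\<lambda>x. x <# L) ` (\<lambda>y. x \<otimes> y) ` H" by blast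
    fix y z assume "y \<in> H" "z \<in> H"
    then have c: "y \<in> carrier G" "z \<in> carrier G" using hc by auto
    have "inv (x \<otimes> y) \<otimes> (x \<otimes> z) = inv y \<otimes> (inv x \<otimes> x) \<otimes> z"
      using c xc by (simp add: inv_mult_group m_assoc del: l_inv)
    also have "\<dots> = inv y \<otimes> z" using c xc by simp
    finally show "y <# L = z <# L \<longleftrightarrow> x \<otimes> y <# L = x \<otimes> z <# L"
      using lcoset_eq_iff[OF LHK(1)] c xc by auto
  qed
  have LH: "x <# H = y <# H" if xy: "x \<in> K" "y \<in> K" "x <# L = y <# L" for x y
  proof -
    have "x \<in> carrier G" "y \<in> carrier G" using xy Kc by auto
    then show ?thesis
      using xy lcoset_eq_iff[OF LHK(1)] lcoset_eq_iff[OF LHK(2)] LHK(4) by blast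
  qed
  have "csum K L f = (\<Sum>d\<in>(\<lambda>x. x <# H) ` K. qsum {x\<in>K. x <# H = d} (\<lambda>x. x <# L) f)"
    by (rule qsum_partition[OF fK f' LH])
  also have "\<dots> = csum K H (\<lambda>x. csum H L (\<lambda>y. f (x \<otimes> y)))"
    by (rule qsum_eq[symmetric]) (use inner in auto)
  finally show ?thesis .
qed

text \<open>Right multiplication by \<open>g\<close> carries a coset of \<open>conjg g H\<close> to
  a coset of \<open>H\<close>, because the factor \<open>inv g\<close> at the end of
  \<open>conjg g H\<close> is cancelled.\<close>

lemma csum_conj:
  assumes "subgroup H G" "g \<in> carrier G"
    and "\<And>x h. \<lbrakk>x \<in> carrier G; h \<in> H\<rbrakk> \<Longrightarrow> f (x \<otimes> h) = f x"
  shows "csum (carrier G) (conjg g H) (\<lambda>x. f (x \<otimes> g)) = csum (carrier G) H f"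
proof (rule qsum_reindex[symmetric])
  show "f x = f y" if "x \<in> carrier G" "y \<in> carrier G" "x <# H = y <# H" for x y
    using rinv_fibers[OF assms(1) subset_refl assms(3)] that by blast
  show "(\<lambda>x. x \<otimes> g) ` carrier G \<subseteq> carrier G" using assms by auto
  have "carrier G \<subseteq> (\<lambda>x. x \<otimes> g) ` carrier G"
  proof
    fix x assume "x \<in> carrier G"
    then have "x = (x \<otimes> inv g) \<otimes> g" "x \<otimes> inv g \<in> carrier G" using assms by (auto simp: m_assoc)
    then show "x \<in> (\<lambda>x. x \<otimes> g) ` carrier G" by blast
  qed
  then show "(\<lambda>x. x <# H) ` carrier G \<subseteq> (\<lambda>x. x <# H) ` (\<lambda>x. x \<otimes> g) ` carrier G" by blast
  fix x y assume c: "x \<in> carrier G" "y \<in> carrier G"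
  have "inv (x \<otimes> g) \<otimes> (y \<otimes> g) = inv g \<otimes> (inv x \<otimes> y) \<otimes> g"
    using c assms by (simp add: inv_mult_group m_assoc)
  then show "x <# conjg g H = y <# conjg g H \<longleftrightarrow> x \<otimes> g <# H = y \<otimes> g <# H"
    using lcoset_eq_iff[OF assms(1)] lcoset_eq_iff[OF conjg_subgroup[OF assms(1,2)]] c assms
      conjg_iff[OF subset_subgroup[OF assms(1)] assms(2), of "inv x \<otimes> y"] by auto
qed

text \<open>\<open>T\<close> represents the double cosets of \<open>H\<close> and \<open>D\<close>.
  The cosets of \<open>D\<close> in the double coset of \<open>g\<close> are those of
  \<open>h \<otimes> g\<close> with \<open>h \<in> H\<close>, and two such agree iff the
  \<open>h\<close> agree modulo \<open>H \<inter> conjg g D\<close>. One \<open>T\<close> serves all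
  functions \<open>f\<close>.\<close>

lemma csum_Mackey:
  assumes fin: "finite (carrier G)" and H: "subgroup H G" and D: "subgroup D G"
  obtains T where "finite T" "T \<subseteq> carrier G"
    "\<And>f :: 'a \<Rightarrow> 'm::comm_monoid_add. (\<And>x d. \<lbrakk>x \<in> carrier G; d \<in> D\<rbrakk> \<Longrightarrow> f (x \<otimes> d) = f x) \<Longrightarrow>
      csum (carrier G) D f = (\<Sum>g\<in>T. csum H (H \<inter> conjg g D) (\<lambda>h. f (h \<otimes> g)))"
proof -
  \<comment> \<open>The double coset of \<open>g\<close>.\<close>
  define r where "r = (\<lambda>g. {h \<otimes> (g \<otimes> d) | h d. h \<in> H \<and> d \<in> D})"
  have Hc: "h \<in> H \<Longrightarrow> h \<in> carrier G" for h using H mem_subgroup by auto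
  have Dc: "h \<in> D \<Longrightarrow> h \<in> carrier G" for h using D mem_subgroup by auto
  have rself: "g \<in> r g" if "g \<in> carrier G" for g
  proof -
    have "g = \<one> \<otimes> (g \<otimes> \<one>)" using that by simp
    then show ?thesis unfolding r_def using one_subgroup[OF H] one_subgroup[OF D] by blast
  qed
  have rsub: "r x \<subseteq> r g" if "x \<in> r g" "g \<in> carrier G" for x g
  proof
    fix y assume "y \<in> r x"
    then obtain h d where hd: "h \<in> H" "d \<in> D" "y = h \<otimes> (x \<otimes> d)" by (auto simp: r_def)
    obtain h' d' where hd': "h' \<in> H" "d' \<in> D" "x = h' \<otimes> (g \<otimes> d')" using \<open>x \<in> r g\<close> by (auto simp: r_def)
    have "y = (h \<otimes> h') \<otimes> (g \<otimes> (d' \<otimes> d))" using hd hd' Hc Dc that by (simp add: m_assoc)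
    then show "y \<in> r g" unfolding r_def using hd hd' mult_subgroup[OF H] mult_subgroup[OF D] by blast
  qed
  have rsym: "g \<in> r x" if xg: "x \<in> r g" "g \<in> carrier G" for x g
  proof -
    obtain h' d' where hd': "h' \<in> H" "d' \<in> D" "x = h' \<otimes> (g \<otimes> d')" using xg by (auto simp: r_def)
    have "g = inv h' \<otimes> (x \<otimes> inv d')" using hd' Hc[OF hd'(1)] Dc[OF hd'(2)] xg
      by (simp add: m_assoc)
    then show ?thesis unfolding r_def using hd' inv_subgroup[OF H] inv_subgroup[OF D] by blast
  qed
  have rc: "r g \<subseteq> carrier G" if "g \<in> carrier G" for g using that Hc Dc by (auto simp: r_def)
  have req: "r x = r g \<longleftrightarrow> x \<in> r g" if "x \<in> carrier G" "g \<in> carrier G" for x g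
    using rself rsub rsym that by blast
  obtain s where s: "\<And>E. E \<in> r ` carrier G \<Longrightarrow> s E \<in> carrier G \<and> r (s E) = E"
    using bchoice[of "r ` carrier G" "\<lambda>E x. x \<in> carrier G \<and> r x = E"] by blast
  define T where "T = s ` r ` carrier G"
  have "finite T" using fin by (simp add: T_def)
  moreover have TG: "T \<subseteq> carrier G" using s by (auto simp: T_def)
  moreover have "csum (carrier G) D f = (\<Sum>g\<in>T. csum H (H \<inter> conjg g D) (\<lambda>h. f (h \<otimes> g)))"
    if f: "\<And>x d. \<lbrakk>x \<in> carrier G; d \<in> D\<rbrakk> \<Longrightarrow> f (x \<otimes> d) = f x" for f :: "'a \<Rightarrow> 'm::comm_monoid_add"
  proof -
    have f': "f x = f y" if "x \<in> carrier G" "y \<in> carrier G" "x <# D = y <# D" for x y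
      using rinv_fibers[OF D subset_refl f] that by blast
    have rf: "r x = r y" if xy: "x \<in> carrier G" "y \<in> carrier G" "x <# D = y <# D" for x y
    proof -
      have "inv y \<otimes> x \<in> D" using lcoset_eq_iff[OF D xy(2,1)] xy by simp
      moreover have "x = \<one> \<otimes> (y \<otimes> (inv y \<otimes> x))" using xy by (simp add: m_assoc[symmetric])
      ultimately have "x \<in> r y" unfolding r_def using one_subgroup[OF H] by blast
      then show ?thesis using req xy by simp
    qed
    have inner: "qsum {x\<in>carrier G. r x = r g} (\<lambda>x. x <# D) f = csum H (H \<inter> conjg g D) (\<lambda>h. f (h \<otimes> g))"
      if g: "g \<in> carrier G" for g
    proof (rule qsum_reindex)
      show "f x = f y" if "x \<in> {x\<in>carrier G. r x = r g}" "y \<in> {x\<in>carrier G. r x = r g}" "x <# D = y <# D" for x y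
        using f' that by blast
      have "h \<otimes> g \<in> r g" if "h \<in> H" for h
      proof -
        have "h \<otimes> g = h \<otimes> (g \<otimes> \<one>)" using g by simp
        then show ?thesis unfolding r_def using one_subgroup[OF D] that by blast
      qed
      then show "(\<lambda>h. h \<otimes> g) ` H \<subseteq> {x \<in> carrier G. r x = r g}"
        using req[OF m_closed[OF Hc g] g] g Hc by blast
      show "(\<lambda>x. x <# D) ` {x \<in> carrier G. r x = r g} \<subseteq> (\<lambda>x. x <# D) ` (\<lambda>h. h \<otimes> g) ` H"
      proof clarsimp
        fix x assume x: "x \<in> carrier G" "r x = r g"
        then obtain h d where hd: "h \<in> H" "d \<in> D" "x = h \<otimes> (g \<otimes> d)" using req g by (auto simp: r_def)
        have "inv (h \<otimes> g) \<otimes> x = d" using hd g Hc[OF hd(1)] Dc[OF hd(2)]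
          by (simp add: inv_solve_left' m_assoc)
        then have "x <# D = (h \<otimes> g) <# D"
          using lcoset_eq_iff[OF D, of "h \<otimes> g" x] hd g Hc x by auto
        then show "x <# D \<in> (\<lambda>x. x <# D) ` (\<lambda>h. h \<otimes> g) ` H" using hd by blast
      qed
      fix x y assume xy: "x \<in> H" "y \<in> H"
      have c: "x \<in> carrier G" "y \<in> carrier G" using xy Hc by auto
      have "inv (x \<otimes> g) \<otimes> (y \<otimes> g) = inv g \<otimes> (inv x \<otimes> y) \<otimes> g"
        using c g by (simp add: inv_mult_group m_assoc)
      moreover have "inv x \<otimes> y \<in> H" using xy H by (simp add: mult_subgroup inv_subgroup)
      ultimately show "x <# (H \<inter> conjg g D) = y <# (H \<inter> conjg g D) \<longleftrightarrow> x \<otimes> g <# D = y \<otimes> g <# D"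
        using lcoset_eq_iff[OF D] lcoset_eq_iff[OF subgroups_Inter_pair[OF H conjg_subgroup[OF D g]]] c g
          conjg_iff[OF subset_subgroup[OF D] g, of "inv x \<otimes> y"] by auto
    qed
    have "csum (carrier G) D f = (\<Sum>d\<in>r ` carrier G. qsum {x\<in>carrier G. r x = d} (\<lambda>x. x <# D) f)"
      by (rule qsum_partition[OF fin f' rf])
    also have "\<dots> = (\<Sum>d\<in>r ` carrier G. csum H (H \<inter> conjg (s d) D) (\<lambda>h. f (h \<otimes> s d)))"
    proof (rule sum.cong[OF refl])
      fix d assume "d \<in> r ` carrier G"
      then show "qsum {x\<in>carrier G. r x = d} (\<lambda>x. x <# D) f
          = csum H (H \<inter> conjg (s d) D) (\<lambda>h. f (h \<otimes> s d))"
        using inner[of "s d"] s[of d] by simp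
    qed
    also have "\<dots> = (\<Sum>g\<in>T. csum H (H \<inter> conjg g D) (\<lambda>h. f (h \<otimes> g)))"
    proof -
      have "inj_on s (r ` carrier G)" using s unfolding inj_on_def by metis
      then show ?thesis unfolding T_def by (simp add: sum.reindex)
    qed
    finally show ?thesis .
  qed
  ultimately show ?thesis using that by blast
qed

text \<open>A fibre of a right \<open>H\<close>-invariant function is a disjoint union of left
  cosets, each with |H| elements.\<close>

lemma card_fiber_lcosets:
  assumes "finite (carrier G)" "subgroup H G"
    and f: "\<And>x h. \<lbrakk>x \<in> carrier G; h \<in> H\<rbrakk> \<Longrightarrow> f (x \<otimes> h) = f x"
  shows "card ((\<lambda>x. x <# H) ` {x\<in>carrier G. f x = v}) * card H = card {x\<in>carrier G. f x = v}"
proof -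
  let ?X = "{x\<in>carrier G. f x = v}" and ?C = "(\<lambda>x. x <# H) ` {x\<in>carrier G. f x = v}"
  have Hc: "h \<in> H \<Longrightarrow> h \<in> carrier G" for h using assms(2) mem_subgroup by auto
  have U: "\<Union>?C = ?X"
  proof (intro equalityI subsetI)
    fix y assume "y \<in> \<Union>?C"
    then show "y \<in> ?X" using f Hc by (auto simp: l_coset_def)
  next
    fix y assume "y \<in> ?X"
    then show "y \<in> \<Union>?C" using lcos_mem[OF _ assms(2)] by auto
  qed
  have "card H * card ?C = card (\<Union>?C)"
  proof (rule card_partition)
    show "finite ?C" "finite (\<Union>?C)" using U assms(1) by auto
    show "card c = card H" if "c \<in> ?C" for c
    proof -
      obtain x where x: "x \<in> carrier G" "c = x <# H" using \<open>c \<in> ?C\<close> by auto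
      have "c = (\<lambda>h. x \<otimes> h) ` H" using x by (auto simp: l_coset_def)
      moreover have "inj_on (\<lambda>h. x \<otimes> h) H" using x Hc by (auto simp: inj_on_def)
      ultimately show ?thesis using card_image by blast
    qed
    show "c1 \<inter> c2 = {}" if "c1 \<in> ?C" "c2 \<in> ?C" "c1 \<noteq> c2" for c1 c2
    proof (rule ccontr)
      assume "c1 \<inter> c2 \<noteq> {}"
      then obtain z x y where "z \<in> x <# H" "z \<in> y <# H" "x \<in> carrier G" "y \<in> carrier G" "c1 = x <# H" "c2 = y <# H"
        using \<open>c1 \<in> ?C\<close> \<open>c2 \<in> ?C\<close> by auto
      then have "c1 = c2" using l_repr_independence assms(2) by metis
      then show False using \<open>c1 \<noteq> c2\<close> by simp
    qed
  qed
  then show ?thesis using U by (simp add: mult.commute)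
qed

text \<open>Inversion turns left cosets into right cosets, and there is no evident bijection between
  the two that respects \<open>f\<close>. Comparing both sums with the sum over all of
  \<open>G\<close> would require division by |H|, which may be zero in the target ring. So the sums
  are grouped by the values of \<open>f\<close>: the multiplicity of each value is a natural number,
  in which division by |H| is harmless and which inversion does not change.\<close>

lemma csum_inverse:
  assumes fin: "finite (carrier G)" and H: "subgroup H G"
    and f: "\<And>x h. \<lbrakk>x \<in> carrier G; h \<in> H\<rbrakk> \<Longrightarrow> f (x \<otimes> h) = f x"
    and f2: "\<And>x h. \<lbrakk>x \<in> carrier G; h \<in> H\<rbrakk> \<Longrightarrow> f (h \<otimes> x) = f x"
  shows "csum (carrier G) H (\<lambda>x. f (inv x)) = csum (carrier G) H (f :: 'a \<Rightarrow> 'm::comm_semiring_1)"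
proof -
  have cnt: "csum (carrier G) H f = (\<Sum>v\<in>f ` carrier G. of_nat (card {x\<in>carrier G. f x = v} div card H) * v)"
    if f: "\<And>x h. \<lbrakk>x \<in> carrier G; h \<in> H\<rbrakk> \<Longrightarrow> f (x \<otimes> h) = f x" for f :: "'a \<Rightarrow> 'm"
  proof -
    have cH: "card H > 0" using H fin subgroup.finite_imp_card_positive by blast
    have f': "f x = f y" if "x \<in> carrier G" "y \<in> carrier G" "x <# H = y <# H" for x y
      using rinv_fibers[OF H subset_refl f] that by blast
    have "csum (carrier G) H f = (\<Sum>v\<in>f ` carrier G. qsum {x\<in>carrier G. f x = v} (\<lambda>x. x <# H) f)"
      by (rule qsum_partition[OF fin f' f'])
    also have "\<dots> = (\<Sum>v\<in>f ` carrier G. of_nat (card {x\<in>carrier G. f x = v} div card H) * v)"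
    proof (rule sum.cong[OF refl])
      fix v
      have "qsum {x\<in>carrier G. f x = v} (\<lambda>x. x <# H) f = (\<Sum>C\<in>(\<lambda>x. x <# H) ` {x\<in>carrier G. f x = v}. v)"
        by (rule qsum_eq) auto
      also have "\<dots> = of_nat (card ((\<lambda>x. x <# H) ` {x\<in>carrier G. f x = v})) * v" by simp
      also have "card ((\<lambda>x. x <# H) ` {x\<in>carrier G. f x = v}) = card {x\<in>carrier G. f x = v} div card H"
        using card_fiber_lcosets[OF fin H f, of v, symmetric] cH by simp
      finally show "qsum {x\<in>carrier G. f x = v} (\<lambda>x. x <# H) f = of_nat (card {x\<in>carrier G. f x = v} div card H) * v" .
    qed
    finally show ?thesis .
  qed
  have fi: "f (inv (x \<otimes> h)) = f (inv x)" if "x \<in> carrier G" "h \<in> H" for x h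
  proof -
    have "h \<in> carrier G" using that mem_subgroup[OF H] by simp
    then have *: "inv (x \<otimes> h) = inv h \<otimes> inv x" using that inv_mult_group by blast
    have "f (inv h \<otimes> inv x) = f (inv x)"
      using that by (intro f2 inv_closed inv_subgroup[OF H])
    then show ?thesis unfolding * .
  qed
  have im: "(\<lambda>x. f (inv x)) ` carrier G = f ` carrier G"
  proof (intro equalityI subsetI)
    fix v assume "v \<in> f ` carrier G"
    then obtain x where "x \<in> carrier G" "v = f (inv (inv x))" by auto
    then show "v \<in> (\<lambda>x. f (inv x)) ` carrier G" by blast
  qed auto
  have "card {x\<in>carrier G. f (inv x) = v} = card {x\<in>carrier G. f x = v}" for v
    by (rule bij_betw_same_card[of "\<lambda>x. inv x"], rule bij_betw_byWitness[of _ "\<lambda>x. inv x"]) auto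
  then show ?thesis using cnt[OF f] cnt[of "\<lambda>x. f (inv x)", OF fi] im by simp
qed

end

section \<open>Subgroups of prime power order\<close>

lemma prime_dvd_power_cofactor:
  fixes p :: nat
  assumes "prime p" "m * n = p ^ a" "m \<noteq> 1"
  shows "p dvd m"
  using assms by (metis dvd_triv_left divides_primepow_nat dvd_power_iff_le less_one linorder_not_less dvd_power neq0_conv power_0)

lemma sum_int_pow_mod: "(i::int) = int (nat (i mod int p)) + int p * (i div int p)" if "p > 0"
  using that by simp

context group
begin

definition pgroup :: "nat \<Rightarrow> 'a set \<Rightarrow> bool" where
  "pgroup p H \<longleftrightarrow> (\<exists>a. card H = p ^ a)"

lemma index_mult_card:
  assumes "finite (carrier G)" "subgroup H G"
  shows "csum (carrier G) H (\<lambda>_. 1::nat) * card H = order G"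
proof -
  have "csum (carrier G) H (\<lambda>_. 1::nat) = card ((\<lambda>x. x <# H) ` carrier G)" by (simp add: qsum_def)
  then show ?thesis using card_fiber_lcosets[OF assms, of "\<lambda>_. ()" "()"] by (simp add: Coset.order_def)
qed

lemma index_mult_card':
  assumes "finite (carrier G)" "subgroup H G" "subgroup K G" "H \<subseteq> K"
  shows "csum K H (\<lambda>_. 1::nat) * card H = card K"
proof -
  interpret K: group "G\<lparr>carrier := K\<rparr>" using subgroup.subgroup_is_group[OF assms(3)] is_group by blast
  have "finite (carrier (G\<lparr>carrier := K\<rparr>))"
    using finite_subset[OF subset_subgroup[OF assms(3)] assms(1)] by simp
  moreover have "subgroup H (G\<lparr>carrier := K\<rparr>)" using assms subgroup_incl by blast
  ultimately show ?thesis using K.index_mult_card[of H] by (simp add: Coset.order_def l_coset_def)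
qed

text \<open>The index of \<open>P\<close>, a multiple of \<open>p\<close>, is the sum over double
  cosets of \<open>P\<close> with \<open>P\<close> of the indices of
  \<open>P \<inter> conjg g P\<close> in \<open>P\<close>. Such an index is 1 if \<open>g\<close>
  normalizes \<open>P\<close> and a multiple of \<open>p\<close> otherwise. If only the elements of
  \<open>P\<close> normalized \<open>P\<close>, the sum would be 1 modulo \<open>p\<close>.\<close>

lemma pgroup_normalizer_grows:
  assumes fin: "finite (carrier G)" and p: "prime p" and ord: "order G = p ^ a"
    and P: "subgroup P G" "P \<noteq> carrier G"
  obtains g where "g \<in> carrier G" "g \<notin> P" "conjg g P = P"
proof (rule ccontr)
  assume "\<not> thesis"
  then have no: "g \<in> P" if "g \<in> carrier G" "conjg g P = P" for g using that \<open>(\<And>g. _ g \<Longrightarrow> _ g \<Longrightarrow> _ g \<Longrightarrow> thesis)\<close> by blast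
  have Pc: "P \<subseteq> carrier G" by (rule subset_subgroup[OF P(1)])
  have fP: "finite P" by (rule finite_subset[OF Pc fin])
  obtain T where T: "finite T" "T \<subseteq> carrier G"
    and M: "\<And>f :: 'a \<Rightarrow> nat. (\<And>x d. \<lbrakk>x \<in> carrier G; d \<in> P\<rbrakk> \<Longrightarrow> f (x \<otimes> d) = f x) \<Longrightarrow>
      csum (carrier G) P f = (\<Sum>g\<in>T. csum P (P \<inter> conjg g P) (\<lambda>h. f (h \<otimes> g)))"
    by (rule csum_Mackey[OF fin P(1) P(1), where 'm = nat]) blast
  have conjP: "conjg g P = P" if "g \<in> P" for g
  proof (rule card_subset_eq[OF fP])
    show "conjg g P \<subseteq> P" using that mult_subgroup[OF P(1)] inv_subgroup[OF P(1)] by auto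
    show "card (conjg g P) = card P" using card_conjg[OF Pc] that Pc by auto
  qed
  let ?n = "\<lambda>g. csum P (P \<inter> conjg g P) (\<lambda>_. 1::nat)"
  have nPP: "csum P P (\<lambda>_. 1::nat) = 1"
  proof -
    have "card P > 0" using one_subgroup[OF P(1)] fP by (auto simp: card_gt_0_iff)
    then show ?thesis using index_mult_card'[OF fin P(1) P(1) subset_refl] by simp
  qed
  have inP: "h \<otimes> g \<in> P \<longleftrightarrow> g \<in> P" if "h \<in> P" "g \<in> carrier G" for h g
  proof
    assume "h \<otimes> g \<in> P"
    then have "inv h \<otimes> (h \<otimes> g) \<in> P" using mult_subgroup[OF P(1)] inv_subgroup[OF P(1)] that by blast
    then show "g \<in> P" using that mem_subgroup[OF P(1)] by simp
  qed (use that mult_subgroup[OF P(1)] in blast)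
  have inP': "g \<otimes> h \<in> P \<longleftrightarrow> g \<in> P" if "h \<in> P" "g \<in> carrier G" for h g
  proof
    assume "g \<otimes> h \<in> P"
    then have "g \<otimes> h \<otimes> inv h \<in> P" using mult_subgroup[OF P(1)] inv_subgroup[OF P(1)] that by blast
    then show "g \<in> P" using that mem_subgroup[OF P(1)] by (simp add: m_assoc)
  qed (use that mult_subgroup[OF P(1)] in blast)
  \<comment> \<open>The Mackey formula for the indicator function of \<open>P\<close> shows that
    exactly one representative in \<open>T\<close> lies in \<open>P\<close>.\<close>
  have "csum (carrier G) P (\<lambda>x. if x \<in> P then 1 else 0::nat) = 1"
  proof -
    obtain g where g: "\<And>x. x \<in> carrier G \<Longrightarrow> g (x <# P) = (if x \<in> P then 1 else 0::nat)"
    proof (rule qsum_descend[of "carrier G" "\<lambda>x. x <# P" "\<lambda>x. if x \<in> P then 1 else 0::nat"])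
      show "(if x \<in> P then 1 else 0::nat) = (if y \<in> P then 1 else 0)"
        if "x \<in> carrier G" "y \<in> carrier G" "x <# P = y <# P" for x y
        by (rule rinv_fibers[OF P(1) subset_refl _ that]) (use inP' in simp)
    qed blast
    have "csum (carrier G) P (\<lambda>x. if x \<in> P then 1 else 0::nat) = sum g ((\<lambda>x. x <# P) ` carrier G)"
      using g by (rule qsum_eq)
    also have "\<dots> = (\<Sum>C\<in>(\<lambda>x. x <# P) ` carrier G. if C = \<one> <# P then 1 else 0)"
    proof (rule sum.cong[OF refl], clarify)
      fix x assume x: "x \<in> carrier G"
      show "g (x <# P) = (if x <# P = \<one> <# P then 1 else 0)"
        using g[OF x] lcoset_eq_iff[OF P(1) one_closed x] x by (auto simp: eq_commute[of "x <# P"])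
    qed
    also have "\<dots> = 1" using fin by (simp add: sum.delta)
    finally show ?thesis .
  qed
  then have "(\<Sum>g\<in>T. csum P (P \<inter> conjg g P) (\<lambda>h. if h \<otimes> g \<in> P then 1 else 0::nat)) = 1"
    using M[of "\<lambda>x. if x \<in> P then 1 else 0"] inP' by simp
  moreover have "csum P (P \<inter> conjg g P) (\<lambda>h. if h \<otimes> g \<in> P then 1 else 0::nat) = (if g \<in> P then 1 else 0)"
    if "g \<in> T" for g
  proof -
    have "csum P (P \<inter> conjg g P) (\<lambda>h. if h \<otimes> g \<in> P then 1 else 0::nat)
       = csum P (P \<inter> conjg g P) (\<lambda>h. if g \<in> P then 1 else 0::nat)"
      by (rule qsum_cong) (use inP that T in auto)
    also have "\<dots> = (if g \<in> P then 1 else 0)"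
      using conjP[of g] nPP by (auto simp: qsum_def)
    finally show ?thesis .
  qed
  ultimately have TP: "(\<Sum>g\<in>T. if g \<in> P then 1 else 0::nat) = 1" by simp
  have "p dvd csum (carrier G) P (\<lambda>_. 1::nat)"
  proof (rule prime_dvd_power_cofactor[OF p])
    show *: "csum (carrier G) P (\<lambda>_. 1::nat) * card P = p ^ a" using index_mult_card[OF fin P(1)] ord by simp
    show "csum (carrier G) P (\<lambda>_. 1::nat) \<noteq> 1"
      using * ord P(2) card_subset_eq[OF fin Pc] by (auto simp: Coset.order_def)
  qed
  moreover have "csum (carrier G) P (\<lambda>_. 1::nat) = (\<Sum>g\<in>T. ?n g)" using M[of "\<lambda>_. 1"] by simp
  moreover have nmod: "?n g mod p = (if g \<in> P then 1 else 0) mod p" if g: "g \<in> T" for g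
  proof -
    from g have gc: "g \<in> carrier G" using T by auto
    show ?thesis
    proof (cases "g \<in> P")
      case True
      then show ?thesis using conjP nPP by simp
    next
      case False
      have sub: "subgroup (P \<inter> conjg g P) G" using P gc conjg_subgroup subgroups_Inter_pair by blast
      have idx: "?n g * card (P \<inter> conjg g P) = card P" by (rule index_mult_card'[OF fin sub P(1)]) auto
      have "?n g \<noteq> 1"
      proof
        assume "?n g = 1"
        then have "P \<inter> conjg g P = P" using idx card_subset_eq[OF fP, of "P \<inter> conjg g P"] by auto
        then have "P = conjg g P"
          using card_subset_eq[of "conjg g P" P] card_conjg[OF Pc gc] fP by auto
        then show False using no[OF gc] False by auto
      qed
      moreover have "\<exists>b. card P = p ^ b"
        using divides_primepow_nat[OF p, of "card P" a] ord index_mult_card[OF fin P(1)]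
        by (metis dvd_triv_right)
      ultimately have "p dvd ?n g" using prime_dvd_power_cofactor[OF p] idx by auto
      then show ?thesis using False by auto
    qed
  qed
  ultimately have "(\<Sum>g\<in>T. ?n g) mod p = 0" by simp
  moreover have "(\<Sum>g\<in>T. ?n g) mod p = (\<Sum>g\<in>T. if g \<in> P then 1 else 0) mod p"
    using nmod by (subst (1 2) mod_sum_eq[symmetric]) simp
  ultimately show False using TP prime_gt_1_nat[OF p] by simp
qed

text \<open>\<open>P\<close> is maximal among the proper subgroups above \<open>S\<close>. Since its
  normalizer is larger, \<open>P\<close> is normal; the quotient has no proper non-trivial subgroup,
  hence is cyclic of order \<open>p\<close>, with the class of \<open>h\<close> as a
  generator.\<close>

lemma pgroup_index_p:
  assumes fin: "finite (carrier G)" and p: "prime p" and ord: "order G = p ^ a"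
    and S: "subgroup S G" "S \<noteq> carrier G"
  obtains P h where "subgroup P G" "S \<subseteq> P" "h \<in> carrier G" "h [^] p \<in> P"
    "\<And>x. x \<in> carrier G \<Longrightarrow> conjg x P = P" "order G = p * card P"
    "\<And>f :: 'a \<Rightarrow> 'm::comm_monoid_add. (\<And>x d. \<lbrakk>x \<in> carrier G; d \<in> P\<rbrakk> \<Longrightarrow> f (x \<otimes> d) = f x) \<Longrightarrow>
      csum (carrier G) P f = (\<Sum>i<p. f (h [^] i))"
proof -
  let ?A = "{P. subgroup P G \<and> S \<subseteq> P \<and> P \<noteq> carrier G}"
  have "finite ?A" by (rule finite_subset[of _ "Pow (carrier G)"]) (use fin subset_subgroup in auto)
  moreover have "?A \<noteq> {}" using S by auto
  ultimately have "\<exists>P\<in>?A. \<forall>Q\<in>?A. P \<subseteq> Q \<longrightarrow> P = Q" by (rule finite_has_maximal)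
  then obtain P where PA: "P \<in> ?A" and max: "\<forall>Q\<in>?A. P \<subseteq> Q \<longrightarrow> P = Q" by (rule bexE)
  have P: "subgroup P G" "S \<subseteq> P" "P \<noteq> carrier G" using PA by auto
  have Pc: "P \<subseteq> carrier G" by (rule subset_subgroup[OF P(1)])
  have fP: "finite P" by (rule finite_subset[OF Pc fin])
  have max': "Q = carrier G" if "subgroup Q G" "P \<subseteq> Q" "g \<in> Q" "g \<notin> P" for Q g
  proof (rule ccontr)
    assume "Q \<noteq> carrier G"
    then have "Q \<in> ?A" using that(1,2) P(2) by auto
    then show False using bspec[OF max, of Q] that by auto
  qed
  define N where "N = {x \<in> carrier G. conjg x P = P}"
  have "subgroup N G"
  proof (rule subgroupI)
    show "N \<subseteq> carrier G" by (auto simp: N_def)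
    have "\<one> \<in> N" unfolding N_def using conjg_one[OF Pc] one_closed by blast
    then show "N \<noteq> {}" by blast
    show "inv x \<in> N" if "x \<in> N" for x
      using that conjg_conjg[OF Pc, of "inv x" x] conjg_one[OF Pc] by (auto simp: N_def)
    show "x \<otimes> y \<in> N" if "x \<in> N" "y \<in> N" for x y
      using that conjg_conjg[OF Pc, of x y] by (auto simp: N_def)
  qed
  moreover have "P \<subseteq> N"
  proof
    fix g assume "g \<in> P"
    moreover from this have "conjg g P = P"
    proof (intro card_subset_eq[OF fP])
      show "conjg g P \<subseteq> P" using \<open>g \<in> P\<close> mult_subgroup[OF P(1)] inv_subgroup[OF P(1)] by auto
      show "card (conjg g P) = card P" using card_conjg[OF Pc] \<open>g \<in> P\<close> Pc by auto
    qed
    ultimately show "g \<in> N" using Pc by (auto simp: N_def)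
  qed
  ultimately have N: "subgroup N G" "P \<subseteq> N" by blast+
  have "N = carrier G"
  proof -
    obtain g where g: "g \<in> carrier G" "g \<notin> P" "conjg g P = P"
      by (rule pgroup_normalizer_grows[OF fin p ord P(1,3)])
    then have "g \<in> N" by (simp add: N_def)
    then show "N = carrier G" using max' N g by blast
  qed
  then have norm: "conjg x P = P" if "x \<in> carrier G" for x using that by (auto simp: N_def)
  have norm': "x \<otimes> y \<otimes> inv x \<in> P" if "x \<in> carrier G" "y \<in> P" for x y using norm[OF that(1)] that(2) by blast
  obtain x where x: "x \<in> carrier G" "x \<notin> P" using P Pc by blast
  have ex: "\<exists>j. x [^] (p ^ j) \<in> P"
    using pow_order_eq_1[OF x(1)] ord one_subgroup[OF P(1)] by (intro exI[of _ a]) simp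
  \<comment> \<open>The last iterated \<open>p\<close>-th power of \<open>x\<close> outside
    \<open>P\<close> serves as \<open>h\<close>; its own \<open>p\<close>-th power then lies in
    \<open>P\<close>.\<close>
  define j where "j = (LEAST j. x [^] (p ^ j) \<in> P)"
  have j: "x [^] (p ^ j) \<in> P" unfolding j_def by (rule LeastI_ex[OF ex])
  have "j \<noteq> 0" using j x by (metis nat_pow_eone power_0)
  then obtain i where i: "j = Suc i" by (cases j) auto
  define h where "h = x [^] (p ^ i)"
  have hc: "h \<in> carrier G" using x by (simp add: h_def)
  have hP: "h \<notin> P" using not_less_Least[of i "\<lambda>j. x [^] (p ^ j) \<in> P"] i unfolding h_def j_def by auto
  have hp: "h [^] p \<in> P" using j x unfolding i h_def by (simp add: nat_pow_pow mult.commute)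
  have powP: "y [^] (n::int) \<in> P" if "y \<in> P" for y n
    using that subgroup_int_pow_closed[OF P(1)] by blast
  \<comment> \<open>The subgroup generated by \<open>h\<close> and \<open>P\<close>, which is
    everything by maximality of \<open>P\<close>. Integer exponents make closure under inverses
    immediate.\<close>
  define M where "M = {h [^] (n::int) \<otimes> q | n q. q \<in> P}"
  have hn: "h [^] (n::int) \<in> carrier G" for n using hc by simp
  have "subgroup M G"
  proof (rule subgroupI)
    show "M \<subseteq> carrier G" using hn Pc by (auto simp: M_def)
    show "M \<noteq> {}" using one_subgroup[OF P(1)] by (auto simp: M_def)
  next
    fix y assume "y \<in> M"
    then obtain n q where y: "y = h [^] (n::int) \<otimes> q" "q \<in> P" by (auto simp: M_def)
    have qc: "q \<in> carrier G" using y Pc by auto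
    have "inv y = h [^] (- n) \<otimes> (h [^] n \<otimes> inv q \<otimes> inv (h [^] n))"
      using y qc hc hn by (simp add: inv_mult_group int_pow_neg m_assoc)
    moreover have "h [^] n \<otimes> inv q \<otimes> inv (h [^] n) \<in> P" using norm' hn inv_subgroup[OF P(1) y(2)] by blast
    ultimately show "inv y \<in> M" unfolding M_def by blast
  next
    fix y z assume "y \<in> M" "z \<in> M"
    then obtain n q m r where y: "y = h [^] (n::int) \<otimes> q" "q \<in> P" "z = h [^] (m::int) \<otimes> r" "r \<in> P"
      by (auto simp: M_def)
    have qc: "q \<in> carrier G" "r \<in> carrier G" using y Pc by auto
    have "y \<otimes> z = h [^] (n + m) \<otimes> ((inv (h [^] m) \<otimes> q \<otimes> inv (inv (h [^] m))) \<otimes> r)"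
      using y qc hc hn by (simp add: int_pow_mult m_assoc)
    moreover have "(inv (h [^] m) \<otimes> q \<otimes> inv (inv (h [^] m))) \<otimes> r \<in> P"
      using norm'[of "inv (h [^] m)" q] hn y mult_subgroup[OF P(1)] by blast
    ultimately show "y \<otimes> z \<in> M" unfolding M_def by blast
  qed
  moreover have "P \<subseteq> M"
  proof
    fix q assume q: "q \<in> P"
    then have "q = h [^] (0::int) \<otimes> q" using Pc by auto
    then show "q \<in> M" unfolding M_def using q by blast
  qed
  moreover have "h \<in> M"
  proof -
    have "h = h [^] (1::int) \<otimes> \<one>" using hc by (simp add: int_pow_1)
    then show ?thesis unfolding M_def using one_subgroup[OF P(1)] by blast
  qed
  ultimately have M: "M = carrier G" using max' hP by blast
  have p0: "p > 0" using p prime_gt_0_nat by blast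
  have hpn: "h [^] (int p * n) \<in> P" for n
    using powP[OF hp, of n] hc by (simp add: int_pow_pow[symmetric] int_pow_int)
  have rep: "\<exists>i<p. y <# P = h [^] i <# P" if y: "y \<in> carrier G" for y
  proof -
    obtain n q where nq: "y = h [^] (n::int) \<otimes> q" "q \<in> P" using y unfolding M[symmetric] M_def by blast
    have qc: "q \<in> carrier G" using nq Pc by auto
    let ?i = "nat (n mod int p)"
    have "y = h [^] (int ?i) \<otimes> (h [^] (int p * (n div int p)) \<otimes> q)"
      using nq qc hc sum_int_pow_mod[OF p0, of n] by (metis int_pow_mult m_assoc hn)
    then have "inv (h [^] ?i) \<otimes> y = h [^] (int p * (n div int p)) \<otimes> q"
      using hc qc hn by (simp add: int_pow_int)
    then have "inv (h [^] ?i) \<otimes> y \<in> P" using hpn nq mult_subgroup[OF P(1)] by simp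
    then have "h [^] ?i <# P = y <# P" using lcoset_eq_iff[OF P(1)] hc y by simp
    moreover have "?i < p" using p0 by (simp add: nat_less_iff)
    ultimately show ?thesis by metis
  qed
  have inj: "inj_on (\<lambda>i. h [^] i <# P) {..<p}"
  proof -
    have aux: "h [^] i <# P \<noteq> h [^] k <# P" if "i < k" "k < p" for i k :: nat
    proof
      assume "h [^] i <# P = h [^] k <# P"
      then have "inv (h [^] i) \<otimes> h [^] k \<in> P" using lcoset_eq_iff[OF P(1)] hc by simp
      moreover have "h [^] k = h [^] i \<otimes> h [^] (k - i)" using that hc by (simp add: nat_pow_mult)
      ultimately have d: "h [^] (k - i) \<in> P" using hc by simp
      \<comment> \<open>If a power of \<open>h\<close> with exponent prime to \<open>p\<close> were
        in \<open>P\<close>, then, as \<open>h [^] p\<close> is too, Bezout would put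
        \<open>h\<close> itself into \<open>P\<close>.\<close>
      have "coprime (int (k - i)) (int p)"
        using that p by (metis coprime_commute coprime_int_iff prime_imp_coprime diff_is_0_eq dvd_imp_le less_imp_diff_less linorder_not_less neq0_conv)
      then obtain u v where uv: "u * int (k - i) + v * int p = 1"
        by (metis bezout_int coprime_imp_gcd_eq_1)
      have "h = h [^] (int (k - i) * u + int p * v)" using uv hc by (simp add: mult.commute int_pow_1)
      also have "\<dots> = (h [^] (k - i)) [^] u \<otimes> h [^] (int p * v)"
        using hc by (simp add: int_pow_mult int_pow_pow[symmetric] int_pow_int)
      also have "\<dots> \<in> P" using powP[OF d] hpn mult_subgroup[OF P(1)] by blast
      finally show False using hP by simp
    qed
    show ?thesis by (rule linorder_inj_onI) (use aux in auto)
  qed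
  have sum: "csum (carrier G) P f = (\<Sum>i<p. f (h [^] i))"
    if f: "\<And>x d. \<lbrakk>x \<in> carrier G; d \<in> P\<rbrakk> \<Longrightarrow> f (x \<otimes> d) = f x" for f :: "'a \<Rightarrow> 'm::comm_monoid_add"
  proof -
    obtain g where g: "\<And>x. x \<in> carrier G \<Longrightarrow> g (x <# P) = f x"
    proof (rule qsum_descend[of "carrier G" "\<lambda>x. x <# P" f])
      show "f x = f y" if "x \<in> carrier G" "y \<in> carrier G" "x <# P = y <# P" for x y
        by (rule rinv_fibers[OF P(1) subset_refl _ that]) (use f in simp)
    qed blast
    have "csum (carrier G) P f = sum g ((\<lambda>x. x <# P) ` carrier G)" using g by (rule qsum_eq)
    also have "(\<lambda>x. x <# P) ` carrier G = (\<lambda>i. h [^] i <# P) ` {..<p}" using rep hc by (fastforce simp: image_iff)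
    also have "sum g \<dots> = (\<Sum>i<p. g (h [^] i <# P))" by (simp add: sum.reindex[OF inj])
    also have "\<dots> = (\<Sum>i<p. f (h [^] i))" using g hc by simp
    finally show ?thesis .
  qed
  have sumn: "csum (carrier G) P (\<lambda>_. 1::nat) = p"
  proof -
    have "(\<lambda>x. x <# P) ` carrier G = (\<lambda>i. h [^] i <# P) ` {..<p}" using rep hc by (fastforce simp: image_iff)
    then show ?thesis using card_image[OF inj] by (simp add: qsum_def)
  qed
  have ordP: "order G = p * card P" using index_mult_card[OF fin P(1)] sumn by simp
  show ?thesis by (rule that[OF P(1,2) hc hp norm ordP sum])
qed

end

section \<open>Row-finite matrices\<close>

text \<open>Row-finite matrices over any index type form a ring with \<open>1\<close>, so they are of class \<open>ring_1\<close>. The matrices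
  with rows and columns in a finite set \<open>I\<close> are a corner of this ring, whose identity is \<open>idm I\<close>.\<close>

typedef (overloaded) ('i, 'k) rmat = "{f :: 'i \<Rightarrow> 'i \<Rightarrow> 'k::zero. \<forall>i. finite {j. f i j \<noteq> 0}}"
  morphisms ent Mat
  by (rule exI[of _ "\<lambda>_ _. 0"]) simp

lemma finite_ent [simp]: "finite {j. ent a i j \<noteq> 0}"
  using ent[of a] by simp

lemma ent_Mat: "(\<And>i. finite {j. f i j \<noteq> 0}) \<Longrightarrow> ent (Mat f) = f"
  by (rule Mat_inverse) simp

lemma rmat_eqI: "(\<And>i j. ent a i j = ent b i j) \<Longrightarrow> a = b"
  by (rule ent_inject[THEN iffD1]) (intro ext)

instantiation rmat :: (type, ring_1) ring_1
begin

definition "0 = Mat (\<lambda>_ _. 0)"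
definition "1 = Mat (\<lambda>i j. if i = j then 1 else 0)"
definition "a + b = Mat (\<lambda>i j. ent a i j + ent b i j)"
definition "- a = Mat (\<lambda>i j. - ent a i j)"
definition "a - b = Mat (\<lambda>i j. ent a i j - ent b i j)"
definition "a * b = Mat (\<lambda>i j. \<Sum>l | ent a i l \<noteq> 0. ent a i l * ent b l j)"

lemma ent_zero [simp]: "ent 0 i j = 0"
  by (simp add: zero_rmat_def ent_Mat)

lemma ent_one: "ent 1 i j = (if i = j then 1 else 0)"
  unfolding one_rmat_def by (subst ent_Mat) auto

lemma ent_add [simp]: "ent (a + b) i j = ent a i j + ent b i j"
proof -
  have "finite {j. ent a i j + ent b i j \<noteq> 0}" for i
    by (rule finite_subset[of _ "{j. ent a i j \<noteq> 0} \<union> {j. ent b i j \<noteq> 0}"]) auto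
  then show ?thesis unfolding plus_rmat_def by (subst ent_Mat) auto
qed

lemma ent_uminus [simp]: "ent (- a) i j = - ent a i j"
  unfolding uminus_rmat_def by (subst ent_Mat) auto

lemma ent_diff [simp]: "ent (a - b) i j = ent a i j - ent b i j"
proof -
  have "finite {j. ent a i j - ent b i j \<noteq> 0}" for i
    by (rule finite_subset[of _ "{j. ent a i j \<noteq> 0} \<union> {j. ent b i j \<noteq> 0}"]) auto
  then show ?thesis unfolding minus_rmat_def by (subst ent_Mat) auto
qed

lemma ent_mult: "ent (a * b) i j = (\<Sum>l | ent a i l \<noteq> 0. ent a i l * ent b l j)"
proof -
  have "finite {j. (\<Sum>l | ent a i l \<noteq> 0. ent a i l * ent b l j) \<noteq> 0}" for i
  proof (rule finite_subset[of _ "\<Union>l\<in>{l. ent a i l \<noteq> 0}. {j. ent b l j \<noteq> 0}"])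
    show "{j. (\<Sum>l | ent a i l \<noteq> 0. ent a i l * ent b l j) \<noteq> 0} \<subseteq> (\<Union>l\<in>{l. ent a i l \<noteq> 0}. {j. ent b l j \<noteq> 0})"
      by (auto intro!: sum.neutral)
  qed simp
  then show ?thesis unfolding times_rmat_def by (subst ent_Mat) auto
qed

lemma ent_mult':
  assumes "finite S" "\<And>l. ent a i l \<noteq> 0 \<Longrightarrow> ent b l j \<noteq> 0 \<Longrightarrow> l \<in> S"
  shows "ent (a * b) i j = (\<Sum>l\<in>S. ent a i l * ent b l j)"
  unfolding ent_mult
proof (rule sum.mono_neutral_cong)
  fix l assume "l \<in> {l. ent a i l \<noteq> 0} - S"
  then have "ent b l j = 0" using assms(2)[of l] by auto
  then show "ent a i l * ent b l j = 0" by simp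
qed (use assms in auto)

instance
proof
  fix a b c :: "('a, 'b) rmat"
  show "a * b * c = a * (b * c)"
  proof (rule rmat_eqI)
    fix i j
    let ?S = "{l. ent a i l \<noteq> 0}"
    define T where "T = (\<Union>l\<in>?S. {m. ent b l m \<noteq> 0})"
    have T: "finite T" by (simp add: T_def)
    have ab: "ent (a * b) i m = (\<Sum>l\<in>?S. ent a i l * ent b l m)" for m by (rule ent_mult)
    have "ent (a * b * c) i j = (\<Sum>m\<in>T. ent (a * b) i m * ent c m j)"
    proof (rule ent_mult'[OF T])
      fix m assume "ent (a * b) i m \<noteq> 0"
      then show "m \<in> T" unfolding ab T_def by (metis (mono_tags, lifting) UN_iff mem_Collect_eq mult_zero_right sum.neutral)
    qed
    also have "\<dots> = (\<Sum>l\<in>?S. ent a i l * (\<Sum>m\<in>T. ent b l m * ent c m j))"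
      unfolding ab by (simp add: sum_distrib_left sum_distrib_right mult.assoc) (rule sum.swap)
    also have "\<dots> = ent (a * (b * c)) i j"
      unfolding ent_mult[of a]
      by (intro sum.cong refl arg_cong2[where f = "(*)"] ent_mult'[symmetric] T) (auto simp: T_def)
    finally show "ent (a * b * c) i j = ent (a * (b * c)) i j" .
  qed
  show "(a + b) * c = a * c + b * c"
  proof (rule rmat_eqI)
    fix i j
    let ?S = "{l. ent a i l \<noteq> 0} \<union> {l. ent b i l \<noteq> 0}"
    have "ent ((a + b) * c) i j = (\<Sum>l\<in>?S. ent (a + b) i l * ent c l j)"
      "ent (a * c) i j = (\<Sum>l\<in>?S. ent a i l * ent c l j)"
      "ent (b * c) i j = (\<Sum>l\<in>?S. ent b i l * ent c l j)"
      by (rule ent_mult'; auto)+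
    then show "ent ((a + b) * c) i j = ent (a * c + b * c) i j" by (simp add: distrib_right sum.distrib)
  qed
  show "a * (b + c) = a * b + a * c"
    by (rule rmat_eqI) (simp add: ent_mult distrib_left sum.distrib)
  show "1 * a = a" "a * 1 = a"
  proof (rule_tac [!] rmat_eqI)
    show "ent (1 * a) i j = ent a i j" for i j
      by (subst ent_mult'[of "{i}"]) (auto simp: ent_one split: if_splits)
    show "ent (a * 1) i j = ent a i j" for i j
      by (subst ent_mult'[of "{j}"]) (auto simp: ent_one split: if_splits)
  qed
  show "(0 :: ('a, 'b) rmat) \<noteq> 1"
  proof
    assume "(0 :: ('a, 'b) rmat) = 1"
    then have "ent (0 :: ('a, 'b) rmat) undefined undefined = ent 1 undefined undefined" by simp
    then show False by (simp add: ent_one)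
  qed
qed (rule rmat_eqI; simp add: algebra_simps)+

end

definition sc :: "'k::comm_ring_1 \<Rightarrow> ('i, 'k) rmat \<Rightarrow> ('i, 'k) rmat" where
  "sc c a = Mat (\<lambda>i j. c * ent a i j)"

lemma ent_sc [simp]: "ent (sc c a) i j = c * ent a i j"
proof -
  have "finite {j. c * ent a i j \<noteq> 0}" for i
    by (rule finite_subset[of _ "{j. ent a i j \<noteq> 0}"]) auto
  then show ?thesis unfolding sc_def by (subst ent_Mat) auto
qed

lemma ent_sum: "ent (sum f S) i j = (\<Sum>x\<in>S. ent (f x) i j)"
  by (induction S rule: infinite_finite_induct) auto

interpretation rmat: vector_space "sc :: 'k::field \<Rightarrow> ('i, 'k) rmat \<Rightarrow> ('i, 'k) rmat"
  by unfold_locales (rule rmat_eqI; simp add: algebra_simps)+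

lemma sc_mult: "sc c (a * b) = sc c a * b" "sc c (a * b) = a * sc c b"
proof -
  have "ent (sc c a * b) i j = (\<Sum>l | ent a i l \<noteq> 0. ent (sc c a) i l * ent b l j)" for i j
    by (rule ent_mult') auto
  then show "sc c (a * b) = sc c a * b"
    by (intro rmat_eqI) (simp add: ent_mult sum_distrib_left mult.assoc)
  show "sc c (a * b) = a * sc c b"
    by (rule rmat_eqI) (simp add: ent_mult sum_distrib_left mult.left_commute)
qed

definition idm :: "'i set \<Rightarrow> ('i, 'k::ring_1) rmat" where
  "idm I = Mat (\<lambda>i j. if i = j \<and> i \<in> I then 1 else 0)"

definition unit_mat :: "'i \<Rightarrow> 'i \<Rightarrow> ('i, 'k::ring_1) rmat" where
  "unit_mat a b = Mat (\<lambda>i j. if i = a \<and> j = b then 1 else 0)"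

definition corner :: "'i set \<Rightarrow> ('i, 'k::ring_1) rmat set" where
  "corner I = {a. \<forall>i j. ent a i j \<noteq> 0 \<longrightarrow> i \<in> I \<and> j \<in> I}"

definition mtr :: "'i set \<Rightarrow> ('i, 'k::ring_1) rmat \<Rightarrow> 'k" where
  "mtr I a = (\<Sum>i\<in>I. ent a i i)"

lemma ent_idm: "ent (idm I) i j = (if i = j \<and> i \<in> I then 1 else 0)"
  unfolding idm_def by (subst ent_Mat) auto

lemma ent_unit_mat: "ent (unit_mat a b) i j = (if i = a \<and> j = b then 1 else 0)"
  unfolding unit_mat_def by (subst ent_Mat) auto

lemma ent_idm_mult: "ent (idm I * a) i j = (if i \<in> I then ent a i j else 0)"
  by (subst ent_mult'[of "{i}"]) (auto simp: ent_idm split: if_splits)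

lemma ent_mult_idm: "ent (a * idm I) i j = (if j \<in> I then ent a i j else 0)"
  by (subst ent_mult'[of "{j}"]) (auto simp: ent_idm split: if_splits)

lemma corner_iff: "a \<in> corner I \<longleftrightarrow> idm I * a = a \<and> a * idm I = a"
proof
  assume a: "idm I * a = a \<and> a * idm I = a"
  show "a \<in> corner I"
    unfolding corner_def
  proof (intro CollectI allI impI conjI; rule ccontr)
    fix i j assume "ent a i j \<noteq> 0"
    { assume "i \<notin> I" then show False using \<open>ent a i j \<noteq> 0\<close> a ent_idm_mult[of I a i j] by simp }
    { assume "j \<notin> I" then show False using \<open>ent a i j \<noteq> 0\<close> a ent_mult_idm[of a I i j] by simp }
  qed
next
  assume "a \<in> corner I"
  then have "ent a i j = 0" if "i \<notin> I \<or> j \<notin> I" for i j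
    using that unfolding corner_def by blast
  then show "idm I * a = a \<and> a * idm I = a"
    by (auto simp: ent_idm_mult ent_mult_idm intro!: rmat_eqI)
qed

lemma idm_idem [simp]: "idm I * idm I = idm I"
  by (rule rmat_eqI) (auto simp: ent_idm_mult ent_idm)

lemma corner_closed [simp, intro]:
  "idm I \<in> corner I" "0 \<in> corner I"
  "\<lbrakk>a \<in> corner I; b \<in> corner I\<rbrakk> \<Longrightarrow> a + b \<in> corner I"
  "\<lbrakk>a \<in> corner I; b \<in> corner I\<rbrakk> \<Longrightarrow> a - b \<in> corner I"
  "a \<in> corner I \<Longrightarrow> - a \<in> corner I"
  by (simp_all add: corner_iff distrib_left distrib_right left_diff_distrib right_diff_distrib)

lemma corner_mult [simp, intro]:
  assumes "a \<in> corner I" "b \<in> corner I"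
  shows "a * b \<in> corner I"
proof -
  have "idm I * (a * b) = (idm I * a) * b" "(a * b) * idm I = a * (b * idm I)" by (simp_all only: mult.assoc)
  then show ?thesis using assms unfolding corner_iff by simp
qed

lemma corner_sc [simp, intro]: "a \<in> corner I \<Longrightarrow> sc c a \<in> corner I"
  by (simp add: corner_iff sc_mult[symmetric])

lemma corner_sum [intro]: "(\<And>x. x \<in> S \<Longrightarrow> f x \<in> corner I) \<Longrightarrow> sum f S \<in> corner I"
  by (induction S rule: infinite_finite_induct) auto

lemma corner_finite_rows: "a \<in> corner I \<Longrightarrow> ent a i j \<noteq> 0 \<Longrightarrow> i \<in> I \<and> j \<in> I"
  by (auto simp: corner_def)

lemma mtr_add [simp]: "mtr I (a + b) = mtr I a + mtr I b"
  by (simp add: mtr_def sum.distrib)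

lemma mtr_zero [simp]: "mtr I 0 = 0"
  by (simp add: mtr_def)

lemma mtr_diff [simp]: "mtr I (a - b) = mtr I a - mtr I b"
  by (simp add: mtr_def sum_subtractf)

lemma mtr_sc [simp]: "mtr I (sc c a) = c * mtr I a"
  by (simp add: mtr_def sum_distrib_left)

lemma mtr_sum: "mtr I (sum f S) = (\<Sum>x\<in>S. mtr I (f x))"
  by (induction S rule: infinite_finite_induct) auto

lemma ent_mult_corner:
  assumes "finite I" "a \<in> corner I"
  shows "ent (a * b) i j = (\<Sum>l\<in>I. ent a i l * ent b l j)"
  by (rule ent_mult'[OF assms(1)]) (use corner_finite_rows[OF assms(2)] in simp)

lemma mtr_mult_commute:
  fixes a :: "('i, 'k::comm_ring_1) rmat"
  assumes "finite I" "a \<in> corner I" "b \<in> corner I"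
  shows "mtr I (a * b) = mtr I (b * a)"
proof -
  have "mtr I (a * b) = (\<Sum>i\<in>I. \<Sum>l\<in>I. ent a i l * ent b l i)"
    by (simp add: mtr_def ent_mult_corner[OF assms(1,2)])
  also have "\<dots> = (\<Sum>l\<in>I. \<Sum>i\<in>I. ent b l i * ent a i l)"
    by (subst sum.swap) (simp add: mult.commute)
  also have "\<dots> = mtr I (b * a)"
    by (simp add: mtr_def ent_mult_corner[OF assms(1,3)])
  finally show ?thesis .
qed

lemma unit_mat_sandwich:
  fixes m :: "('i, 'k::comm_ring_1) rmat"
  shows "unit_mat a b * m * unit_mat c d = sc (ent m b c) (unit_mat a d)"
proof (rule rmat_eqI)
  fix i j
  have 1: "ent (unit_mat a b * m) i l = (if i = a then ent m b l else 0)" for l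
    by (subst ent_mult'[of "{b}"]) (auto simp: ent_unit_mat split: if_splits)
  show "ent (unit_mat a b * m * unit_mat c d) i j = ent (sc (ent m b c) (unit_mat a d)) i j"
    by (subst ent_mult'[of "{c}"]) (auto simp: ent_unit_mat 1 split: if_splits)
qed

lemma unit_mat_corner: "a \<in> I \<Longrightarrow> b \<in> I \<Longrightarrow> unit_mat a b \<in> corner I"
  by (auto simp: corner_def ent_unit_mat split: if_splits)

lemma mtr_unit_mult:
  fixes m :: "('i, 'k::comm_ring_1) rmat"
  assumes "finite I" "a \<in> I"
  shows "mtr I (unit_mat a b * m) = ent m b a"
proof -
  have "ent (unit_mat a b * m) i l = (if i = a then ent m b l else 0)" for i l
    by (subst ent_mult'[of "{b}"]) (auto simp: ent_unit_mat split: if_splits)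
  then show ?thesis using assms by (simp add: mtr_def sum.delta)
qed

lemma corner_span:
  assumes "finite I" "(a :: ('i, 'k::field) rmat) \<in> corner I"
  shows "a \<in> rmat.span ((\<lambda>(i, j). unit_mat i j) ` (I \<times> I))"
proof -
  have "a = (\<Sum>(i, j)\<in>I \<times> I. sc (ent a i j) (unit_mat i j))"
  proof (rule rmat_eqI)
    fix x y
    have "ent (\<Sum>(i, j)\<in>I \<times> I. sc (ent a i j) (unit_mat i j)) x y
        = (\<Sum>ij\<in>I \<times> I. if ij = (x, y) then ent a x y else 0)"
      by (auto simp: ent_sum ent_unit_mat intro!: sum.cong)
    also have "\<dots> = ent a x y"
      using assms corner_finite_rows[OF assms(2), of x y] by (auto simp: sum.delta)
    finally show "ent a x y = ent (\<Sum>(i, j)\<in>I \<times> I. sc (ent a i j) (unit_mat i j)) x y" by simp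
  qed
  also have "\<dots> \<in> rmat.span ((\<lambda>(i, j). unit_mat i j) ` (I \<times> I))"
    by (intro rmat.span_sum) (force intro: rmat.span_scale rmat.span_base)
  finally show ?thesis .
qed

text \<open>The corner is spanned by the finitely many matrix units. Applied to the powers of a
  matrix, this yields a polynomial relation. A repetition in the sequence is treated separately,
  since dependence of a set does not see it.\<close>

lemma corner_sequence_dependent:
  fixes v :: "nat \<Rightarrow> ('i, 'k::field) rmat"
  assumes "finite I" "\<And>n. v n \<in> corner I"
  obtains N \<alpha> where "\<exists>i\<le>N. \<alpha> i \<noteq> 0" "(\<Sum>i\<le>N. sc (\<alpha> i) (v i)) = 0"
proof (cases "inj v")
  case False
  then obtain a b where ab: "a < b" "v a = v b"
    by (metis injI linorder_neqE_nat)
  have "(\<Sum>i\<le>b. sc (if i = a then 1 else if i = b then - 1 else 0) (v i))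
      = (\<Sum>i\<in>{a, b}. sc (if i = a then 1 else if i = b then - 1 else 0) (v i))"
    using ab by (intro sum.mono_neutral_right) auto
  also have "\<dots> = 0" using ab by simp
  finally show ?thesis using ab
    by (intro that[of b "\<lambda>i. if i = a then 1 else if i = b then - 1 else 0"]) auto
next
  case True
  define E :: "('i, 'k) rmat set" where "E = (\<lambda>(i, j). unit_mat i j) ` (I \<times> I)"
  have E: "finite E" using assms by (simp add: E_def)
  let ?N = "card E" and ?S = "v ` {..card E}"
  have "rmat.dependent ?S"
  proof (rule ccontr)
    assume "\<not> rmat.dependent ?S"
    then have "card ?S \<le> card E"
      using rmat.independent_span_bound[OF E, of ?S] corner_span[OF assms(1)] assms(2) by (auto simp: E_def)
    moreover have "card ?S = Suc (card E)" using card_image[OF inj_on_subset[OF True]] by simp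
    ultimately show False by simp
  qed
  then obtain u x where u: "x \<in> ?S" "u x \<noteq> 0" "(\<Sum>w\<in>?S. sc (u w) w) = 0"
    using rmat.dependent_finite[of ?S] by auto
  have "(\<Sum>i\<le>?N. sc (u (v i)) (v i)) = 0"
    using u(3) by (subst (asm) sum.reindex) (use True in \<open>auto simp: inj_on_def inj_def\<close>)
  moreover have "\<exists>i\<le>?N. u (v i) \<noteq> 0" using u by auto
  ultimately show ?thesis using that[of ?N "\<lambda>i. u (v i)"] by simp
qed

section \<open>Rank and trace\<close>

lemma (in vector_space_pair) dim_image_inj:
  assumes f: "Vector_Spaces.linear s1 s2 f" and inj: "inj_on f (vs1.span S)"
  shows "vs2.dim (f ` S) = vs1.dim S"
proof -
  interpret f: Vector_Spaces.linear s1 s2 f by fact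
  obtain B where B: "B \<subseteq> S" "vs1.independent B" "S \<subseteq> vs1.span B" "card B = vs1.dim S"
    using vs1.basis_exists by blast
  have "vs1.span S = vs1.span B" using B by (metis vs1.span_mono vs1.span_span subset_antisym)
  then have "vs2.independent (f ` B)" using f.independent_injective_image[OF B(2)] inj by simp
  moreover have "f ` S \<subseteq> vs2.span (f ` B)" using B(3) by (metis f.span_image image_mono)
  moreover have "card (f ` B) = card B" using B inj by (metis card_image inj_on_subset vs1.span_superset)
  ultimately show ?thesis using B by (metis vs2.dim_unique image_mono)
qed

text \<open>The index type is arbitrary: besides column vectors, this covers the ambient space of
  \<open>tensor\<close>, whose elements are functions on bilinear forms.\<close>

interpretation fv: vector_space "\<lambda>(c::'k::field) (x::'i \<Rightarrow> 'k) i. c * x i"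
  by unfold_locales (auto simp: algebra_simps)

definition mvec :: "('i, 'k::comm_ring_1) rmat \<Rightarrow> ('i \<Rightarrow> 'k) \<Rightarrow> 'i \<Rightarrow> 'k" where
  "mvec a x i = (\<Sum>j | ent a i j \<noteq> 0. ent a i j * x j)"

definition rk :: "('i, 'k::field) rmat \<Rightarrow> nat" where
  "rk a = fv.dim (range (mvec a))"

lemma mvec_corner:
  assumes "finite I" "a \<in> corner I"
  shows "mvec a x i = (\<Sum>j\<in>I. ent a i j * x j)"
  unfolding mvec_def using corner_finite_rows[OF assms(2)] assms(1)
  by (intro sum.mono_neutral_left) auto

lemma mvec_mult:
  assumes "finite I" "a \<in> corner I" "b \<in> corner I"
  shows "mvec (a * b) x = mvec a (mvec b x)"
proof
  fix i
  have "mvec (a * b) x i = (\<Sum>j\<in>I. \<Sum>l\<in>I. ent a i l * ent b l j * x j)"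
    using assms by (simp add: mvec_corner[OF assms(1)] ent_mult_corner[OF assms(1)] sum_distrib_right)
  also have "\<dots> = (\<Sum>l\<in>I. \<Sum>j\<in>I. ent a i l * ent b l j * x j)" by (rule sum.swap)
  also have "\<dots> = mvec a (mvec b x) i"
    using assms by (simp add: mvec_corner[OF assms(1)] sum_distrib_left mult.assoc)
  finally show "mvec (a * b) x i = mvec a (mvec b x) i" .
qed

lemma mvec_add_mat:
  assumes "finite I" "a \<in> corner I" "b \<in> corner I"
  shows "mvec (a + b) x = mvec a x + mvec b x"
  using assms by (auto simp: fun_eq_iff mvec_corner[OF assms(1)] distrib_right sum.distrib)

lemma mvec_zero_mat [simp]: "mvec 0 x = 0"
  by (simp add: fun_eq_iff mvec_def)

lemma mvec_add: "mvec a (x + y) = mvec a x + mvec a y"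
  by (simp add: fun_eq_iff mvec_def distrib_left sum.distrib)

lemma mvec_scale: "mvec a (\<lambda>i. c * x i) = (\<lambda>i. c * mvec a x i)"
  by (simp add: fun_eq_iff mvec_def sum_distrib_left mult.left_commute)

lemma mvec_zero [simp]: "mvec a 0 = 0"
  by (simp add: fun_eq_iff mvec_def)

lemma mvec_sum: "mvec a (sum f S) = (\<Sum>x\<in>S. mvec a (f x))"
  by (induction S rule: infinite_finite_induct) (simp_all only: mvec_add sum.infinite sum.empty sum.insert mvec_zero not_False_eq_True)

lemma linear_mvec:
  "Vector_Spaces.linear (\<lambda>c (x::'i \<Rightarrow> 'k::field) i. c * x i) (\<lambda>c x i. c * x i) (mvec a)"
  by unfold_locales (simp_all add: mvec_add mvec_scale)

lemma mvec_unit: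
  assumes "finite I" "a \<in> corner I" "j \<in> I"
  shows "mvec a (\<lambda>l. if l = j then 1 else 0) = (\<lambda>i. ent a i j)"
proof
  fix i
  have "(\<Sum>l\<in>I. ent a i l * (if l = j then 1 else 0)) = (\<Sum>l\<in>I. if l = j then ent a i j else 0)"
    by (rule sum.cong) auto
  then show "mvec a (\<lambda>l. if l = j then 1 else 0) i = ent a i j"
    using assms by (simp add: mvec_corner[OF assms(1,2)] sum.delta)
qed

lemma subspace_range_mvec: "fv.subspace (range (mvec a))"
proof (rule fv.subspaceI)
  show "0 \<in> range (mvec a)" by (rule range_eqI[of _ _ 0]) simp
next
  fix x y assume "x \<in> range (mvec a)" "y \<in> range (mvec a)"
  then obtain u v where "x = mvec a u" "y = mvec a v" by (elim rangeE)
  then show "x + y \<in> range (mvec a)" using mvec_add[of a u v] by (intro range_eqI[of _ _ "u + v"]) simp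
next
  fix c x assume "x \<in> range (mvec a)"
  then obtain u where "x = mvec a u" by (elim rangeE)
  then show "(\<lambda>i. c * x i) \<in> range (mvec a)" using mvec_scale[of a c u] by (intro range_eqI[of _ _ "\<lambda>i. c * u i"]) simp
qed

lemma supported_span:
  fixes x :: "'i \<Rightarrow> 'k::field"
  assumes "finite I" "\<And>i. i \<notin> I \<Longrightarrow> x i = 0"
  shows "x \<in> fv.span ((\<lambda>j i. if i = j then 1 else 0) ` I)"
proof -
  have "x = (\<Sum>j\<in>I. (\<lambda>i. x j * (if i = j then 1 else 0)))"
  proof
    fix i
    have "(\<Sum>j\<in>I. (\<lambda>i. x j * (if i = j then 1 else 0))) i = (\<Sum>j\<in>I. if j = i then x i else 0)"
      by (induction I rule: infinite_finite_induct) auto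
    then show "x i = (\<Sum>j\<in>I. (\<lambda>i. x j * (if i = j then 1 else 0))) i"
      using assms by (simp add: sum.delta)
  qed
  also have "\<dots> \<in> fv.span ((\<lambda>j i. if i = j then 1 else 0) ` I)"
    by (intro fv.span_sum fv.span_scale fv.span_base) auto
  finally show ?thesis .
qed

lemma range_mvec_span:
  assumes "finite I" "(a :: ('i, 'k::field) rmat) \<in> corner I"
  shows "range (mvec a) \<subseteq> fv.span ((\<lambda>j i. if i = j then 1 else 0) ` I)"
proof clarify
  fix x
  have "ent a i j = 0" if "i \<notin> I" for i j using corner_finite_rows[OF assms(2), of i j] that by auto
  then show "mvec a x \<in> fv.span ((\<lambda>j i. if i = j then 1 else 0) ` I)"
    using assms by (intro supported_span) (auto simp: mvec_corner[OF assms])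
qed

lemma rk_basis:
  assumes "finite I" "(a :: ('i, 'k::field) rmat) \<in> corner I"
  obtains B where "finite B" "B \<subseteq> range (mvec a)" "fv.independent B" "range (mvec a) \<subseteq> fv.span B" "card B = rk a"
proof -
  obtain B where B: "B \<subseteq> range (mvec a)" "fv.independent B" "range (mvec a) \<subseteq> fv.span B" "card B = rk a"
    unfolding rk_def by (rule fv.basis_exists)
  have "finite B"
    using fv.independent_span_bound[OF finite_imageI[OF assms(1)] B(2) subset_trans[OF B(1) range_mvec_span[OF assms]]]
    by simp
  then show ?thesis using B by (intro that)
qed

text \<open>Each idempotent is the identity on its own image and zero on the other one, so the union
  of bases of the two images is a basis of the image of the sum.\<close>

lemma rk_add:
  fixes e f :: "('i, 'k::field) rmat"
  assumes I: "finite I" "e \<in> corner I" "f \<in> corner I"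
    and idem: "e * e = e" "f * f = f" and orth: "e * f = 0" "f * e = 0"
  shows "rk (e + f) = rk e + rk f"
proof -
  obtain B where B: "finite B" "B \<subseteq> range (mvec e)" "fv.independent B" "range (mvec e) \<subseteq> fv.span B" "card B = rk e"
    by (rule rk_basis[OF I(1,2)])
  obtain C where C: "finite C" "C \<subseteq> range (mvec f)" "fv.independent C" "range (mvec f) \<subseteq> fv.span C" "card C = rk f"
    by (rule rk_basis[OF I(1,3)])
  have fixB: "mvec e x = x" "mvec f x = 0" if "x \<in> B" for x
  proof -
    obtain y where y: "x = mvec e y" using subsetD[OF B(2) \<open>x \<in> B\<close>] by (elim rangeE)
    show "mvec e x = x" "mvec f x = 0" unfolding y using I idem orth by (simp_all flip: mvec_mult[OF I(1)])
  qed
  have fixC: "mvec f x = x" "mvec e x = 0" if "x \<in> C" for x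
  proof -
    obtain y where y: "x = mvec f y" using subsetD[OF C(2) \<open>x \<in> C\<close>] by (elim rangeE)
    show "mvec f x = x" "mvec e x = 0" unfolding y using I idem orth by (simp_all flip: mvec_mult[OF I(1)])
  qed
  have disj: "B \<inter> C = {}"
  proof (rule ccontr)
    assume "B \<inter> C \<noteq> {}"
    then obtain x where "x \<in> B" "x \<in> C" by blast
    then have "x = 0" using fixB fixC by metis
    then show False using \<open>x \<in> B\<close> B(3) fv.dependent_zero by blast
  qed
  have "fv.independent (B \<union> C)"
  proof
    assume "fv.dependent (B \<union> C)"
    then obtain u x where u: "x \<in> B \<union> C" "u x \<noteq> 0" "(\<Sum>v\<in>B \<union> C. (\<lambda>i. u v * v i)) = 0"
      using fv.dependent_finite[of "B \<union> C"] B C by auto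
    have s: "(\<Sum>v\<in>B. (\<lambda>i. u v * v i)) + (\<Sum>v\<in>C. (\<lambda>i. u v * v i)) = 0"
      using u(3) sum.union_disjoint[OF B(1) C(1) disj] by metis
    have "mvec e (\<Sum>v\<in>B. (\<lambda>i. u v * v i)) = (\<Sum>v\<in>B. (\<lambda>i. u v * v i))"
      unfolding mvec_sum by (rule sum.cong) (auto simp: mvec_scale fixB)
    moreover have "mvec e (\<Sum>v\<in>C. (\<lambda>i. u v * v i)) = 0"
      unfolding mvec_sum by (rule sum.neutral) (auto simp: mvec_scale fixC fun_eq_iff)
    ultimately have sB: "(\<Sum>v\<in>B. (\<lambda>i. u v * v i)) = 0" using arg_cong[OF s, of "mvec e"] by (simp add: mvec_add)
    then have "(\<Sum>v\<in>C. (\<lambda>i. u v * v i)) = 0" using s by simp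
    then show False using sB u(1,2) fv.dependent_finite[OF B(1)] fv.dependent_finite[OF C(1)] B(3) C(3) by auto
  qed
  moreover have "B \<union> C \<subseteq> range (mvec (e + f))"
  proof
    fix x assume "x \<in> B \<union> C"
    then have "x = mvec (e + f) x" using fixB fixC by (auto simp: mvec_add_mat[OF I])
    then show "x \<in> range (mvec (e + f))" by blast
  qed
  moreover have "range (mvec (e + f)) \<subseteq> fv.span (B \<union> C)"
  proof clarify
    fix x
    have "mvec e x \<in> fv.span (B \<union> C)" "mvec f x \<in> fv.span (B \<union> C)"
      using B(4) C(4) fv.span_mono[of B "B \<union> C"] fv.span_mono[of C "B \<union> C"] by auto
    then show "mvec (e + f) x \<in> fv.span (B \<union> C)" unfolding mvec_add_mat[OF I] by (rule fv.span_add)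
  qed
  moreover have "card (B \<union> C) = rk e + rk f" using card_Un_disjoint[OF B(1) C(1) disj] B C by simp
  ultimately show ?thesis unfolding rk_def by (metis fv.dim_unique rk_def)
qed

text \<open>The matrix \<open>v\<close> maps the image of \<open>u * v\<close> onto that of
  \<open>v * u\<close>, with inverse \<open>u\<close>.\<close>

lemma rk_equiv:
  fixes u v :: "('i, 'k::field) rmat"
  assumes I: "finite I" "u \<in> corner I" "v \<in> corner I" and idem: "u * v * u * v = u * v" "v * u * v * u = v * u"
  shows "rk (u * v) = rk (v * u)"
proof -
  interpret p: vector_space_pair "\<lambda>c (x::'i \<Rightarrow> 'k) i. c * x i" "\<lambda>c (x::'i \<Rightarrow> 'k) i. c * x i" ..
  note m = mvec_mult[OF I(1)]
  have 1: "mvec u (mvec v (mvec (u * v) x)) = mvec (u * v) x" for x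
    using I idem by (simp flip: m add: mult.assoc)
  have 2: "mvec v ` range (mvec (u * v)) = range (mvec (v * u))"
  proof (intro equalityI subsetI)
    fix y assume "y \<in> mvec v ` range (mvec (u * v))"
    then obtain x where "y = mvec v (mvec (u * v) x)" by blast
    then have "y = mvec (v * u) (mvec v x)" using I by (simp add: m)
    then show "y \<in> range (mvec (v * u))" by blast
  next
    fix y assume "y \<in> range (mvec (v * u))"
    then obtain x where "y = mvec (v * u) x" by blast
    then have "y = mvec (v * u * v * u) x" using idem by simp
    then have "y = mvec v (mvec (u * v) (mvec u x))" using I by (simp add: m)
    then show "y \<in> mvec v ` range (mvec (u * v))" by blast
  qed
  have span: "fv.span (range (mvec (u * v))) = range (mvec (u * v))"
    using fv.span_eq_iff subspace_range_mvec by blast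
  have "inj_on (mvec v) (fv.span (range (mvec (u * v))))"
    unfolding span by (rule inj_on_inverseI[of _ "mvec u"]) (use 1 in auto)
  then have "fv.dim (mvec v ` range (mvec (u * v))) = fv.dim (range (mvec (u * v)))"
    by (rule p.dim_image_inj[OF linear_mvec])
  then show ?thesis unfolding 2 rk_def by simp
qed

lemma rk_idm:
  assumes "finite I"
  shows "rk (idm I :: ('i, 'k::field) rmat) = card I"
proof -
  let ?d = "\<lambda>j i. if i = j then 1 else 0 :: 'k"
  have c: "idm I \<in> corner I" by simp
  have inj: "inj_on ?d I"
  proof (rule inj_onI)
    fix x y assume "?d x = ?d y"
    then have "?d x x = ?d y x" by (rule fun_cong)
    then show "x = y" by (auto split: if_splits)
  qed
  have "fv.independent (?d ` I)"
  proof
    assume "fv.dependent (?d ` I)"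
    then obtain u x where u: "x \<in> I" "u (?d x) \<noteq> 0" "(\<Sum>v\<in>?d ` I. (\<lambda>i. u v * v i)) = 0"
      using fv.dependent_finite[of "?d ` I"] assms by auto
    have "(\<Sum>j\<in>I. (\<lambda>i. u (?d j) * ?d j i)) = 0" using u(3) by (subst (asm) sum.reindex[OF inj]) (simp add: o_def)
    then have "(\<Sum>j\<in>I. (\<lambda>i. u (?d j) * ?d j i)) x = 0" by simp
    moreover have "(\<Sum>j\<in>I. (\<lambda>i. u (?d j) * ?d j i)) x = (\<Sum>j\<in>I. if j = x then u (?d x) else 0)"
      using assms by (induction I rule: infinite_finite_induct) auto
    ultimately show False using u assms by (simp add: sum.delta)
  qed
  moreover have "?d ` I \<subseteq> range (mvec (idm I))"
  proof clarify
    fix j assume j: "j \<in> I"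
    have "?d j = mvec (idm I) (?d j)" unfolding mvec_unit[OF assms c j] using j by (auto simp: ent_idm)
    then show "?d j \<in> range (mvec (idm I))" by (rule range_eqI[of _ _ "?d j"])
  qed
  ultimately show ?thesis
    unfolding rk_def using card_image[OF inj] by (intro fv.dim_unique[OF _ range_mvec_span[OF assms c]])
qed

lemma rk_zero_iff:
  assumes "finite I" "(a :: ('i, 'k::field) rmat) \<in> corner I" "rk a = 0"
  shows "a = 0"
proof -
  obtain B where B: "finite B" "B \<subseteq> range (mvec a)" "fv.independent B" "range (mvec a) \<subseteq> fv.span B" "card B = rk a"
    by (rule rk_basis[OF assms(1,2)])
  have "range (mvec a) \<subseteq> {0}" using B(1,4,5) assms(3) by simp
  then have 0: "mvec a x = 0" for x by blast
  show ?thesis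
  proof (rule rmat_eqI)
    fix i j
    show "ent a i j = ent 0 i j"
    proof (cases "j \<in> I")
      case True
      then show ?thesis using mvec_unit[OF assms(1,2) True] 0 by (metis ent_zero zero_fun_apply)
    qed (use corner_finite_rows[OF assms(2)] in auto)
  qed
qed

text \<open>Induction on the rank: from a non-zero idempotent one splits off an idempotent of rank 1
  and trace 1. Working over an arbitrary field, this gives ranks modulo the characteristic as
  traces.\<close>

lemma mtr_idempotent:
  fixes e :: "('i, 'k::field) rmat"
  assumes "finite I" "e \<in> corner I" "e * e = e"
  shows "mtr I e = of_nat (rk e)"
  using assms(2,3)
proof (induction "rk e" arbitrary: e rule: less_induct)
  case less
  show ?case
  proof (cases "e = 0")
    case True
    have "rk (0 + 0 :: ('i, 'k) rmat) = rk (0 :: ('i, 'k) rmat) + rk (0 :: ('i, 'k) rmat)"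
      by (rule rk_add[OF assms(1)]) auto
    then show ?thesis using True by simp
  next
    case False
    then obtain i0 j0 where c0: "ent e i0 j0 \<noteq> 0" using rmat_eqI[of e 0] by auto
    let ?c = "ent e i0 j0"
    have ij: "i0 \<in> I" "j0 \<in> I" using corner_finite_rows[OF less.prems(1) c0] by auto
    let ?E = "unit_mat j0 i0 :: ('i, 'k) rmat" and ?F = "unit_mat j0 j0 :: ('i, 'k) rmat"
    have uc: "?E \<in> corner I" "?F \<in> corner I" using unit_mat_corner ij by metis+
    \<comment> \<open>As \<open>?E * e * ?E\<close> is the multiple of \<open>?E\<close> by the
      entry \<open>?c\<close>, division by \<open>?c\<close> makes \<open>e * ?E * e\<close>
      idempotent.\<close>
    define f where "f = sc (1 / ?c) (e * ?E * e)"
    have EeE: "?E * e * ?E = sc ?c ?E" by (rule unit_mat_sandwich)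
    have ee: "e * (e * x) = e * x" for x using less.prems(2) by (metis mult.assoc)
    have ef: "e * f = f" "f * e = f" unfolding f_def
      by (simp_all add: sc_mult[symmetric] mult.assoc ee less.prems(2))
    have "e * ?E * e * (e * ?E * e) = e * (?E * e * ?E) * e"
      by (simp add: mult.assoc ee)
    also have "\<dots> = sc ?c (e * ?E * e)" unfolding EeE by (simp add: sc_mult[symmetric])
    finally have ff: "f * f = f" unfolding f_def using c0 by (simp add: sc_mult[symmetric])
    have fc: "f \<in> corner I" unfolding f_def using less.prems uc by auto
    have trf: "mtr I f = 1"
    proof -
      have "mtr I (e * ?E * e) = mtr I (?E * e)"
        using mtr_mult_commute[OF assms(1), of e "?E * e"] less.prems uc by (simp add: mult.assoc)
      then show ?thesis unfolding f_def using mtr_unit_mult[OF assms(1) ij(2), of i0 e] c0 by simp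
    qed
    have rkf: "rk f = 1"
    proof -
      \<comment> \<open>The two products of \<open>?u\<close> and \<open>?v\<close> are
        \<open>f\<close> and a diagonal matrix unit, so \<open>f\<close> has rank 1.\<close>
      let ?u = "sc (1 / ?c) (e * ?F)" and ?v = "?E * e"
      have FE: "?F * ?E = ?E" by (rule rmat_eqI, subst ent_mult'[of "{j0}"]) (auto simp: ent_unit_mat split: if_splits)
      have "e * ?F * (?E * e) = e * (?F * ?E) * e" by (simp only: mult.assoc)
      then have uv: "?u * ?v = f" unfolding f_def sc_mult(1)[symmetric] FE by simp
      have "?v * ?u = sc (1 / ?c) (?E * (e * e) * ?F)" by (simp add: sc_mult(2)[symmetric] mult.assoc)
      also have "\<dots> = sc (1 / ?c) (?E * e * ?F)" using less.prems by simp
      also have "\<dots> = ?F" unfolding unit_mat_sandwich using c0 by simp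
      finally have vu: "?v * ?u = ?F" .
      have F1: "?F = idm {j0}" by (rule rmat_eqI) (auto simp: ent_unit_mat ent_idm)
      have "rk (?u * ?v) = rk (?v * ?u)"
      proof (rule rk_equiv[OF assms(1)])
        show "?u \<in> corner I" "?v \<in> corner I" using less.prems uc by auto
        show "?u * ?v * ?u * ?v = ?u * ?v" using uv ff by (simp add: mult.assoc)
        show "?v * ?u * ?v * ?u = ?v * ?u" using vu F1 by (simp add: mult.assoc)
      qed
      then have "rk f = rk ?F" unfolding uv vu .
      then show ?thesis using rk_idm[of "{j0}"] unfolding F1 by simp
    qed
    let ?g = "e - f"
    have g: "?g \<in> corner I" "?g * ?g = ?g" "f * ?g = 0" "?g * f = 0"
      using less.prems fc ef ff by (auto simp: algebra_simps)
    have "rk (f + ?g) = rk f + rk ?g" using fc g ff by (intro rk_add[OF assms(1)]) auto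
    then have rke: "rk e = 1 + rk ?g" using rkf by simp
    then have "mtr I ?g = of_nat (rk ?g)" using less.hyps[of ?g] g by simp
    then show ?thesis using rke trf by (simp add: diff_eq_eq add.commute)
  qed
qed

text \<open>Gaussian elimination: subtracting a matrix of rank 1 clears one row of \<open>a\<close>
  and creates no new non-zero row, so induction on the number of non-zero rows applies.\<close>

lemma corner_regular:
  fixes a :: "('i, 'k::field) rmat"
  assumes "finite I" "a \<in> corner I"
  shows "\<exists>w\<in>corner I. a * w * a = a"
  using assms(2)
proof (induction "card {i\<in>I. \<exists>j. ent a i j \<noteq> 0}" arbitrary: a rule: less_induct)
  case less
  show ?case
  proof (cases "a = 0")
    case False
    then obtain i0 j0 where c0: "ent a i0 j0 \<noteq> 0" using rmat_eqI[of a 0] by auto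
    let ?c = "ent a i0 j0"
    have ij: "i0 \<in> I" "j0 \<in> I" using corner_finite_rows[OF less.prems c0] by auto
    \<comment> \<open>With this \<open>y\<close>, the product \<open>a * y * a\<close> is column
      \<open>j0\<close> times row \<open>i0\<close>, divided by the pivot; it agrees with
      \<open>a\<close> in row \<open>i0\<close>.\<close>
    define y :: "('i, 'k) rmat" where "y = sc (1 / ?c) (unit_mat j0 i0)"
    have yc: "y \<in> corner I" unfolding y_def by (intro corner_sc unit_mat_corner ij)
    have aya: "ent (a * y * a) i j = ent a i j0 * ent a i0 j / ?c" for i j
    proof -
      have "ent (a * unit_mat j0 i0) i l = (if l = i0 then ent a i j0 else 0)" for l
        by (subst ent_mult'[of "{j0}"]) (auto simp: ent_unit_mat split: if_splits)
      then have "ent (a * unit_mat j0 i0 * a) i j = ent a i j0 * ent a i0 j"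
        by (subst ent_mult'[of "{i0}"]) (auto split: if_splits)
      then show ?thesis unfolding y_def by (simp add: sc_mult[symmetric])
    qed
    let ?b = "a - a * y * a"
    have bc: "?b \<in> corner I" using less.prems yc by auto
    have "i0 \<in> {i\<in>I. \<exists>j. ent a i j \<noteq> 0}" "i0 \<notin> {i\<in>I. \<exists>j. ent ?b i j \<noteq> 0}"
      using c0 ij by (auto simp: aya)
    moreover have "{i\<in>I. \<exists>j. ent ?b i j \<noteq> 0} \<subseteq> {i\<in>I. \<exists>j. ent a i j \<noteq> 0}"
    proof clarify
      fix i j assume "ent ?b i j \<noteq> 0"
      then have "ent a i j \<noteq> 0 \<or> ent a i j0 \<noteq> 0" by (auto simp: aya)
      then show "\<exists>j. ent a i j \<noteq> 0" by blast
    qed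
    ultimately have "{i\<in>I. \<exists>j. ent ?b i j \<noteq> 0} \<subset> {i\<in>I. \<exists>j. ent a i j \<noteq> 0}"
      by blast
    then have "card {i\<in>I. \<exists>j. ent ?b i j \<noteq> 0} < card {i\<in>I. \<exists>j. ent a i j \<noteq> 0}"
      using assms(1) by (intro psubset_card_mono) auto
    then obtain w where w: "w \<in> corner I" "?b * w * ?b = ?b" using less.hyps bc by blast
    \<comment> \<open>This is the expansion of \<open>y + (1 - y * a) * w * (1 - a * y)\<close>;
      multiplied by \<open>a\<close> on both sides it gives
      \<open>a * y * a + ?b * w * ?b\<close>.\<close>
    let ?w = "y + (w - w * a * y - y * a * w + y * a * w * a * y)"
    have "a * ?w * a = a * y * a + ?b * w * ?b" by (simp add: algebra_simps)
    then have "a * ?w * a = a" using w by simp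
    moreover have "?w \<in> corner I" using w(1) yc less.prems by auto
    ultimately show ?thesis by blast
  qed (auto intro!: bexI[of _ 0])
qed

text \<open>Write \<open>a = a * w * a\<close> by regularity. Then \<open>a\<close> has the same
  trace as \<open>a * (a * w)\<close>, and this matrix vanishes to a power one lower, because each
  factor \<open>a * w\<close> is absorbed by the next \<open>a\<close>. Induction on the exponent
  replaces a triangular form.\<close>

lemma mtr_nilpotent:
  fixes a :: "('i, 'k::field) rmat"
  assumes "finite I" "a \<in> corner I" "a ^ n = 0"
  shows "mtr I a = 0"
  using assms(2,3)
proof (induction n arbitrary: a)
  case (Suc n)
  obtain w where w: "w \<in> corner I" "a * w * a = a" using corner_regular[OF assms(1) Suc.prems(1)] by blast
  have aa: "a * (a * w) \<in> corner I" using w(1) Suc.prems(1) by auto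
  have "(a * (a * w)) ^ k * a = a ^ Suc k" for k
  proof (induction k)
    case (Suc k)
    have "(a * (a * w)) ^ Suc k * a = a * (a * w) * a ^ Suc k" using Suc by (simp add: mult.assoc)
    also have "\<dots> = a * (a * w * a) * a ^ k" by (simp add: mult.assoc)
    finally show ?case unfolding w(2) by (simp add: mult.assoc)
  qed simp
  then have pw: "(a * (a * w)) ^ n * a = 0" using Suc.prems by simp
  have "mtr I a = mtr I ((a * w) * a)" using w by simp
  also have "\<dots> = mtr I (a * (a * w))" using Suc.prems(1) w(1) by (intro mtr_mult_commute[OF assms(1)]) auto
  also have "\<dots> = 0"
  proof (cases n)
    case 0
    then show ?thesis using Suc.prems by simp
  next
    case (Suc m)
    have "(a * (a * w)) ^ n = (a * (a * w)) ^ m * (a * (a * w))" by (simp add: Suc power_commutes)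
    also have "\<dots> = (a * (a * w)) ^ m * a * (a * w)" by (simp add: mult.assoc)
    also have "\<dots> = a ^ Suc m * (a * w)" using \<open>\<And>k. (a * (a * w)) ^ k * a = a ^ Suc k\<close> by simp
    also have "\<dots> = a ^ Suc n * w" by (simp add: Suc power_Suc2 mult.assoc del: power_Suc)
    finally show ?thesis using Suc.IH[OF aa] Suc.prems(2) by simp
  qed
  finally show ?case .
qed simp

section \<open>Fitting decomposition, eigenvalues and Kronecker products\<close>

text \<open>On the part \<open>f\<close> of \<open>e\<close> the matrix \<open>z\<close> is
  nilpotent, on \<open>e - f\<close> it is invertible with inverse \<open>w\<close>. Both
  \<open>f\<close> and \<open>w\<close> are polynomials in \<open>z\<close> with identity
  \<open>e\<close>; the last clause records this, and through it they stay in every algebra of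
  matrices commuting with a given group when \<open>z\<close> and \<open>e\<close> do.\<close>

lemma fitting_decomposition:
  fixes z e :: "('i, 'k::field) rmat"
  assumes I: "finite I" and e: "e \<in> corner I" "e * e = e" and z: "z \<in> corner I" "e * z = z" "z * e = z"
  obtains f w n where "f \<in> corner I" "w \<in> corner I" "f * f = f" "e * f = f" "f * e = f" "e * w = w" "w * e = w"
    "z * w = e - f" "w * z = e - f" "z ^ n * f = 0"
    "\<And>x. \<lbrakk>x * z = z * x; x * e = e * x\<rbrakk> \<Longrightarrow> x * f = f * x \<and> x * w = w * x"
proof -
  have zn: "z ^ n * e \<in> corner I" "e * (z ^ n * e) = z ^ n * e" for n
  proof (induction n)
    case (Suc n)
    { case 1 then show ?case using Suc z by (auto simp: mult.assoc) }
    { case 2 have "e * (z ^ Suc n * e) = (e * z) * (z ^ n * e)" by (simp add: mult.assoc)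
      then show ?case using z by (simp add: mult.assoc) }
  qed (use e in auto)
  obtain N \<alpha> where dep: "\<exists>i\<le>N. \<alpha> i \<noteq> 0" "(\<Sum>i\<le>N. sc (\<alpha> i) (z ^ i * e)) = 0"
    by (rule corner_sequence_dependent[OF I, of "\<lambda>n. z ^ n * e"]) (use zn in blast)+
  define a where "a = (LEAST i. \<alpha> i \<noteq> 0)"
  have a: "\<alpha> a \<noteq> 0" unfolding a_def using dep(1) LeastI[of "\<lambda>i. \<alpha> i \<noteq> 0"] by blast
  have a_min: "\<alpha> i = 0" if "i < a" for i using not_less_Least[of i "\<lambda>i. \<alpha> i \<noteq> 0"] that a_def by blast
  have aN: "a \<le> N"
  proof -
    obtain i where "i \<le> N" "\<alpha> i \<noteq> 0" using dep(1) by blast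
    then show ?thesis using a_min[of i] by (cases "i < a") auto
  qed
  \<comment> \<open>Solving the relation among the powers of \<open>z\<close> for its lowest term,
    of degree \<open>a\<close>, expresses \<open>z ^ a * e\<close> as
    \<open>z ^ Suc a * q\<close>.\<close>
  define q where "q = (\<Sum>i\<in>{a<..N}. sc (- \<alpha> i / \<alpha> a) (z ^ (i - Suc a) * e))"
  have qc: "q \<in> corner I" unfolding q_def using zn by (intro corner_sum) auto
  have eq: "e * q = q" "q * e = q" unfolding q_def using zn(2) e(2)
    by (simp_all add: sum_distrib_left sum_distrib_right sc_mult[symmetric] mult.assoc)
  have comm_q: "x * q = q * x" if x: "x * z = z * x" "x * e = e * x" for x
  proof -
    have p: "x * z ^ n = z ^ n * x" for n using power_commuting_commutes[of z x n] x by simp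
    have "x * (z ^ n * e) = (z ^ n * e) * x" for n
      using p[of n] x(2) by (simp only: mult.assoc[symmetric]) (simp only: mult.assoc)
    then show ?thesis unfolding q_def by (simp add: sum_distrib_left sum_distrib_right sc_mult[symmetric])
  qed
  have zq: "z * q = q * z" by (rule comm_q) (use z in auto)
  have base: "z ^ a * e = z ^ Suc a * q"
  proof -
    have "0 = (\<Sum>i\<in>{a..N}. sc (\<alpha> i) (z ^ i * e))"
      unfolding dep(2)[symmetric] using a_min by (intro sum.mono_neutral_right) auto
    also have "{a..N} = insert a {a<..N}" using aN by auto
    also have "(\<Sum>i\<in>\<dots>. sc (\<alpha> i) (z ^ i * e)) = sc (\<alpha> a) (z ^ a * e) + (\<Sum>i\<in>{a<..N}. sc (\<alpha> i) (z ^ i * e))"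
      by simp
    finally have "sc (\<alpha> a) (z ^ a * e) = - (\<Sum>i\<in>{a<..N}. sc (\<alpha> i) (z ^ i * e))"
      by (simp add: eq_neg_iff_add_eq_0)
    then have "sc (1 / \<alpha> a) (sc (\<alpha> a) (z ^ a * e)) = sc (1 / \<alpha> a) (- (\<Sum>i\<in>{a<..N}. sc (\<alpha> i) (z ^ i * e)))"
      by simp
    then have "z ^ a * e = (\<Sum>i\<in>{a<..N}. sc (- \<alpha> i / \<alpha> a) (z ^ i * e))"
      using a by (simp add: rmat.scale_sum_right sum_negf)
    also have "\<dots> = (\<Sum>i\<in>{a<..N}. z ^ Suc a * sc (- \<alpha> i / \<alpha> a) (z ^ (i - Suc a) * e))"
    proof (rule sum.cong[OF refl])
      fix i assume "i \<in> {a<..N}"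
      then have "z ^ i = z ^ Suc a * z ^ (i - Suc a)" by (simp add: power_add[symmetric] del: power_Suc)
      then show "sc (- \<alpha> i / \<alpha> a) (z ^ i * e) = z ^ Suc a * sc (- \<alpha> i / \<alpha> a) (z ^ (i - Suc a) * e)"
        by (simp only: sc_mult(2)[symmetric] mult.assoc)
    qed
    also have "\<dots> = z ^ Suc a * q" unfolding q_def by (simp only: sum_distrib_left)
    finally show ?thesis .
  qed
  let ?b = "Suc a"
  have zqk: "z * q ^ k = q ^ k * z" for k using power_commuting_commutes[of q z k] zq by simp
  have zzq: "z ^ m * q ^ k = q ^ k * z ^ m" for m k using power_commuting_commutes[of z "q ^ k" m] zqk by simp
  have eqk: "e * q ^ k * e = q ^ k * e" for k
  proof (induction k)
    case (Suc k)
    have "e * q ^ Suc k * e = (e * q) * (q ^ k * e)" by (simp add: mult.assoc)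
    then show ?case using eq by (simp add: mult.assoc)
  qed (use e in simp)
  have ez: "z ^ m * e = e * z ^ m" for m using power_commuting_commutes[of z e m] z by simp
  \<comment> \<open>With \<open>k = ?b\<close> this says that \<open>z ^ ?b\<close> is unchanged by
    the factor \<open>z ^ ?b * q ^ ?b\<close>, which makes that factor idempotent.\<close>
  have iter: "z ^ ?b * e = z ^ (?b + k) * q ^ k * e" for k
  proof (induction k)
    case (Suc k)
    have "z ^ (?b + Suc k) * q ^ Suc k * e = z ^ (?b + k) * (z * q) * q ^ k * e"
    proof -
      have "z ^ (?b + Suc k) = z ^ (?b + k) * z" by (simp only: add_Suc_right power_Suc2)
      then show ?thesis by (simp only: power_Suc[of q] mult.assoc)
    qed
    also have "\<dots> = z ^ (?b + k) * (z * q) * (e * q ^ k * e)" unfolding eqk by (simp add: mult.assoc)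
    also have "\<dots> = z ^ (?b + k) * ((z * q) * e) * (q ^ k * e)" by (simp add: mult.assoc)
    also have "(z * q) * e = z * q" using eq by (simp add: mult.assoc)
    also have "z ^ (?b + k) * (z * q) * (q ^ k * e) = z ^ k * z * (z ^ Suc a * q) * (q ^ k * e)"
    proof -
      have "z ^ (?b + k) * z = z ^ (k + 1 + Suc a)" by (simp only: power_Suc2[symmetric]) (simp add: add.commute)
      also have "\<dots> = z ^ k * z * z ^ Suc a" by (simp only: power_add power_one_right)
      finally have *: "z ^ (?b + k) * z = z ^ k * z * z ^ Suc a" .
      have "z ^ (?b + k) * (z * q) * (q ^ k * e) = (z ^ (?b + k) * z) * q * (q ^ k * e)" by (simp only: mult.assoc)
      then show ?thesis unfolding * by (simp only: mult.assoc)
    qed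
    also have "\<dots> = z ^ k * z * (z ^ a * e) * (q ^ k * e)" unfolding base ..
    also have "\<dots> = z ^ (?b + k) * (e * q ^ k * e)"
    proof -
      have "z ^ (?b + k) = z ^ (k + 1 + a)" by (simp add: add.commute)
      also have "\<dots> = z ^ k * z * z ^ a" by (simp only: power_add power_one_right)
      finally show ?thesis by (simp only: mult.assoc)
    qed
    also have "\<dots> = z ^ (?b + k) * q ^ k * e" unfolding eqk by (simp add: mult.assoc)
    finally show ?case using Suc by simp
  qed simp
  \<comment> \<open>The projection to the invertible part. As \<open>?b\<close> is
    \<open>Suc a\<close>, one factor \<open>z\<close> can be left out, and what remains is the
    inverse \<open>w\<close> of \<open>z\<close> there.\<close>
  define g where "g = z ^ ?b * q ^ ?b * e"
  define w where "w = z ^ a * q ^ ?b * e"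
  have eg: "e * g = g" "g * e = g"
  proof -
    have "e * g = (e * z ^ ?b) * (q ^ ?b * e)" by (simp add: g_def mult.assoc)
    also have "\<dots> = z ^ ?b * (e * q ^ ?b * e)" unfolding ez[symmetric] by (simp add: mult.assoc)
    also have "\<dots> = g" unfolding eqk g_def by (simp add: mult.assoc)
    finally show "e * g = g" .
    show "g * e = g" using e by (simp add: g_def mult.assoc)
  qed
  have zbg: "z ^ ?b * g = z ^ ?b * e"
    unfolding iter[of ?b] g_def by (simp only: mult.assoc power_add)
  have gg: "g * g = g"
  proof -
    have "g * g = z ^ ?b * q ^ ?b * (e * g)" by (simp add: g_def mult.assoc)
    also have "\<dots> = q ^ ?b * (z ^ ?b * g)" unfolding eg zzq by (simp add: mult.assoc)
    also have "\<dots> = (q ^ ?b * z ^ ?b) * e" unfolding zbg by (simp add: mult.assoc)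
    finally show ?thesis unfolding zzq[symmetric] g_def .
  qed
  have comm_w: "x * w = w * x \<and> x * g = g * x" if x: "x * z = z * x" "x * e = e * x" for x
  proof -
    have p: "x * z ^ n = z ^ n * x" for n using power_commuting_commutes[of z x n] x by simp
    have r: "x * q ^ n = q ^ n * x" for n using power_commuting_commutes[of q x n] comm_q[OF x] by simp
    have "x * (z ^ n * q ^ m * e) = (z ^ n * q ^ m * e) * x" for n m
    proof -
      have "x * (z ^ n * q ^ m * e) = (x * z ^ n) * (q ^ m * e)" by (simp only: mult.assoc)
      also have "\<dots> = z ^ n * (x * q ^ m) * e" by (simp only: p mult.assoc)
      also have "\<dots> = z ^ n * q ^ m * (x * e)" by (simp only: r mult.assoc)
      finally show ?thesis by (simp only: x(2) mult.assoc)
    qed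
    then show ?thesis unfolding w_def g_def by blast
  qed
  have zw: "z * w = g" by (simp add: w_def g_def mult.assoc)
  have wz: "w * z = g" using comm_w[of z] zw z by simp
  have ew: "e * w = w" "w * e = w"
  proof -
    have "e * w = (e * z ^ a) * (q ^ ?b * e)" by (simp add: w_def mult.assoc)
    also have "\<dots> = z ^ a * (e * q ^ ?b * e)" unfolding ez[symmetric] by (simp add: mult.assoc)
    also have "\<dots> = w" unfolding eqk w_def by (simp add: mult.assoc)
    finally show "e * w = w" .
    show "w * e = w" using e by (simp add: w_def mult.assoc)
  qed
  have qk: "q ^ k * e \<in> corner I" for k
    by (induction k) (use qc e in \<open>auto simp: mult.assoc\<close>)
  have wc: "w \<in> corner I"
  proof -
    have "w = (z ^ a * e) * (q ^ ?b * e)"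
    proof -
      have "(z ^ a * e) * (q ^ ?b * e) = z ^ a * (e * q ^ ?b * e)" by (simp only: mult.assoc)
      then show ?thesis unfolding eqk w_def by (simp only: mult.assoc)
    qed
    then show ?thesis using corner_mult[OF zn(1)[of a] qk[of ?b]] by simp
  qed
  have gc: "g \<in> corner I" unfolding zw[symmetric] by (rule corner_mult[OF z(1) wc])
  show ?thesis
  proof (rule that[of "e - g" w ?b])
    show "x * (e - g) = (e - g) * x \<and> x * w = w * x" if "x * z = z * x" "x * e = e * x" for x
      using comm_w[OF that] that by (simp add: algebra_simps)
    show "z ^ ?b * (e - g) = 0" using zbg by (simp add: right_diff_distrib)
  qed (use gc wc e eg gg ew zw wz in \<open>auto simp: algebra_simps\<close>)
qed

text \<open>The value of \<open>P\<close> at \<open>z\<close> in the ring with identity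
  \<open>e\<close>: the factor \<open>e\<close> turns the constant term into a multiple of
  \<open>e\<close>.\<close>

definition evp :: "'k::field poly \<Rightarrow> ('i, 'k) rmat \<Rightarrow> ('i, 'k) rmat \<Rightarrow> ('i, 'k) rmat" where
  "evp P z e = (\<Sum>i\<le>degree P. sc (coeff P i) (z ^ i * e))"

lemma evp_eq: "degree P \<le> n \<Longrightarrow> evp P z e = (\<Sum>i\<le>n. sc (coeff P i) (z ^ i * e))"
  unfolding evp_def by (rule sum.mono_neutral_left) (auto simp: coeff_eq_0 not_le)

lemma evp_linear_factor:
  assumes "z * e = z" "e * z = z" "e * e = e"
  shows "evp ([:- c, 1:] * Q) z e = (z - sc c e) * evp Q z e"
proof -
  have ee: "e * (z ^ n * e) = z ^ n * e" for n
  proof (induction n)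
    case (Suc n)
    have "e * (z ^ Suc n * e) = (e * z) * (z ^ n * e)" by (simp add: mult.assoc)
    then show ?case using assms by (simp add: mult.assoc)
  qed (use assms in simp)
  have d: "degree ([:- c, 1:] * Q) \<le> Suc (degree Q)"
    using degree_mult_le[of "[:- c, 1:]" Q] by simp
  have "evp ([:- c, 1:] * Q) z e = (\<Sum>i\<le>Suc (degree Q). sc (coeff (pCons 0 Q) i - c * coeff Q i) (z ^ i * e))"
    unfolding evp_eq[OF d] by (intro sum.cong) (simp_all add: algebra_simps)
  also have "\<dots> = (\<Sum>i\<le>Suc (degree Q). sc (coeff (pCons 0 Q) i) (z ^ i * e)) - (\<Sum>i\<le>Suc (degree Q). sc (c * coeff Q i) (z ^ i * e))"
    by (simp only: rmat.scale_left_diff_distrib sum_subtractf)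
  also have "(\<Sum>i\<le>Suc (degree Q). sc (coeff (pCons 0 Q) i) (z ^ i * e)) = z * evp Q z e"
    by (simp add: sum.atMost_Suc_shift evp_def sum_distrib_left sc_mult(2)[symmetric] mult.assoc del: sum.atMost_Suc)
  also have "(\<Sum>i\<le>Suc (degree Q). sc (c * coeff Q i) (z ^ i * e)) = sc c e * evp Q z e"
    unfolding evp_eq[of Q "Suc (degree Q)", OF le_SucI[OF le_refl]] sum_distrib_left
    by (intro sum.cong refl) (simp add: sc_mult[symmetric] ee)
  finally show ?thesis by (simp add: left_diff_distrib)
qed

text \<open>Take a root \<open>c\<close> of the minimal polynomial of \<open>z\<close>. Were
  \<open>z - sc c e\<close> invertible on the left, it could be cancelled, and the cofactor of the
  root would be an annihilating polynomial of smaller degree.\<close>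

lemma eigenvalue_exists:
  fixes z e :: "('i, 'k::alg_closed_field) rmat"
  assumes I: "finite I" and e: "e \<in> corner I" "e * e = e" "e \<noteq> 0" and z: "z \<in> corner I" "e * z = z" "z * e = z"
  obtains c where "\<And>w. w * (z - sc c e) \<noteq> e"
proof -
  have zn: "z ^ n * e \<in> corner I" "e * (z ^ n * e) = z ^ n * e" for n
  proof (induction n)
    case (Suc n)
    { case 1 then show ?case using Suc z by (auto simp: mult.assoc) }
    { case 2 have "e * (z ^ Suc n * e) = (e * z) * (z ^ n * e)" by (simp add: mult.assoc)
      then show ?case using z by (simp add: mult.assoc) }
  qed (use e in auto)
  obtain N \<alpha> where dep: "\<exists>i\<le>N. \<alpha> i \<noteq> 0" "(\<Sum>i\<le>N. sc (\<alpha> i) (z ^ i * e)) = 0"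
    by (rule corner_sequence_dependent[OF I, of "\<lambda>n. z ^ n * e"]) (use zn in blast)+
  define P0 where "P0 = (\<Sum>i\<le>N. monom (\<alpha> i) i)"
  have c0: "coeff P0 i = (if i \<le> N then \<alpha> i else 0)" for i
    by (simp add: P0_def coeff_sum sum.delta)
  have "degree P0 \<le> N" by (rule degree_le) (simp add: c0)
  then have "evp P0 z e = 0" unfolding evp_eq[OF \<open>degree P0 \<le> N\<close>] using dep(2) by (simp add: c0)
  moreover have "P0 \<noteq> 0" using dep(1) c0 by (metis coeff_0)
  ultimately have ex: "\<exists>P. P \<noteq> 0 \<and> evp P z e = 0" by blast
  define P where "P = (ARG_MIN degree P. P \<noteq> 0 \<and> evp P z e = 0)"
  have P: "P \<noteq> 0" "evp P z e = 0" and min: "\<And>Q. Q \<noteq> 0 \<Longrightarrow> evp Q z e = 0 \<Longrightarrow> degree P \<le> degree Q"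
    using arg_min_nat_lemma[of "\<lambda>P. P \<noteq> 0 \<and> evp P z e = 0" _ degree] ex unfolding P_def by blast+
  have "degree P > 0"
  proof (rule ccontr)
    assume "\<not> degree P > 0"
    then obtain a where "P = [:a:]" by (metis degree_eq_zeroE neq0_conv)
    then have "sc a e = 0" "a \<noteq> 0" using P by (auto simp: evp_def)
    then show False using e(3) rmat.scale_eq_0_iff by blast
  qed
  then obtain c where "poly P c = 0" using alg_closed_imp_poly_has_root by blast
  then obtain Q where Q: "P = [:- c, 1:] * Q" by (metis poly_eq_0_iff_dvd dvdE)
  have "Q \<noteq> 0" using P Q by auto
  then have dQ: "degree Q < degree P" unfolding Q by (subst degree_mult_eq) auto
  have eQ: "e * evp Q z e = evp Q z e"
    by (simp add: evp_def sum_distrib_left sc_mult(2)[symmetric] zn)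
  show ?thesis
  proof (rule that)
    fix w
    show "w * (z - sc c e) \<noteq> e"
    proof
      assume w: "w * (z - sc c e) = e"
      have "w * ((z - sc c e) * evp Q z e) = 0"
        using P(2) evp_linear_factor[OF z(3,2) e(2), of c Q] unfolding Q by simp
      moreover have "w * ((z - sc c e) * evp Q z e) = evp Q z e"
        by (simp only: mult.assoc[symmetric] w eQ)
      ultimately have "evp Q z e = 0" by simp
      then show False using min[OF \<open>Q \<noteq> 0\<close>] dQ by simp
    qed
  qed
qed

section \<open>Extension of scalars to the algebraic closure, and Kronecker products\<close>

definition map_mat :: "('i, 'k::field) rmat \<Rightarrow> ('i, 'k alg_closure) rmat" where
  "map_mat a = Mat (\<lambda>i j. to_ac (ent a i j))"

lemma ent_map_mat [simp]: "ent (map_mat a) i j = to_ac (ent a i j)"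
  unfolding map_mat_def by (subst ent_Mat) auto

lemma map_mat_hom [simp]:
  "map_mat (a + b) = map_mat a + map_mat b" "map_mat (a - b) = map_mat a - map_mat b"
  "map_mat (a * b) = map_mat a * map_mat b" "map_mat 0 = 0" "map_mat (idm I) = idm I"
  by (auto intro!: rmat_eqI simp: ent_mult to_ac_sum ent_idm)

lemma mtr_map_mat [simp]: "mtr I (map_mat a) = to_ac (mtr I a)"
  by (simp add: mtr_def to_ac_sum)

lemma map_mat_corner [simp]: "map_mat a \<in> corner I \<longleftrightarrow> a \<in> corner I"
  by (auto simp: corner_def)

definition kron :: "('i, 'k::comm_ring_1) rmat \<Rightarrow> ('j, 'k) rmat \<Rightarrow> ('i \<times> 'j, 'k) rmat" where
  "kron a b = Mat (\<lambda>x y. ent a (fst x) (fst y) * ent b (snd x) (snd y))"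

lemma ent_kron [simp]: "ent (kron a b) x y = ent a (fst x) (fst y) * ent b (snd x) (snd y)"
proof -
  have "finite {y. ent a (fst x) (fst y) * ent b (snd x) (snd y) \<noteq> 0}" for x
    by (rule finite_subset[of _ "{i. ent a (fst x) i \<noteq> 0} \<times> {j. ent b (snd x) j \<noteq> 0}"]) auto
  then show ?thesis unfolding kron_def by (subst ent_Mat) auto
qed

lemma kron_mult: "kron a b * kron c d = kron (a * c) (b * d)"
proof (rule rmat_eqI)
  fix x y
  let ?A = "{i. ent a (fst x) i \<noteq> 0}" and ?B = "{j. ent b (snd x) j \<noteq> 0}"
  have "ent (kron a b * kron c d) x y = (\<Sum>l\<in>?A \<times> ?B. ent (kron a b) x l * ent (kron c d) l y)"
    by (rule ent_mult') auto
  also have "\<dots> = (\<Sum>i\<in>?A. \<Sum>j\<in>?B. (ent a (fst x) i * ent c i (fst y)) * (ent b (snd x) j * ent d j (snd y)))"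
    by (simp add: sum.cartesian_product' mult_ac)
  also have "\<dots> = ent (kron (a * c) (b * d)) x y"
    by (simp add: ent_mult sum_product)
  finally show "ent (kron a b * kron c d) x y = ent (kron (a * c) (b * d)) x y" .
qed

lemma kron_add: "kron (a + a') b = kron a b + kron a' b" "kron a (b + b') = kron a b + kron a b'"
  by (auto intro!: rmat_eqI simp: algebra_simps)

lemma kron_zero [simp]: "kron 0 b = 0" "kron a 0 = 0"
  by (auto intro!: rmat_eqI)

lemma kron_idm: "kron (idm I) (idm J) = idm (I \<times> J)"
  by (auto intro!: rmat_eqI simp: ent_idm)

lemma kron_corner: "\<lbrakk>a \<in> corner I; b \<in> corner J\<rbrakk> \<Longrightarrow> kron a b \<in> corner (I \<times> J)"
  unfolding corner_iff by (simp add: kron_idm[symmetric] kron_mult)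

lemma mtr_kron: "mtr (I \<times> J) (kron a b) = mtr I a * mtr J b"
  by (simp add: mtr_def sum.cartesian_product' sum_product)

lemma kron_sc: "kron (sc c a) b = sc c (kron a b)"
  by (auto intro!: rmat_eqI)

text \<open>Compare the entries at a fixed diagonal position of the identity factor; one exists as
  this factor is not zero. This carries the property that all \<open>G\<close>-endomorphisms are
  scalars from a tensor product to its factors.\<close>

lemma kron_idm_cancel:
  fixes a a' :: "('i, 'k::comm_ring_1) rmat" and b b' :: "('j, 'k) rmat"
  shows "\<lbrakk>kron a (idm J) = kron a' (idm J); (idm J :: ('j, 'k) rmat) \<noteq> 0\<rbrakk> \<Longrightarrow> a = a'"
    and "\<lbrakk>kron (idm I) b = kron (idm I) b'; (idm I :: ('i, 'k) rmat) \<noteq> 0\<rbrakk> \<Longrightarrow> b = b'"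
proof -
  have ne: "\<exists>j. j \<in> K" if "(idm K :: ('l, 'k) rmat) \<noteq> 0" for K :: "'l set"
  proof (rule ccontr)
    assume "\<nexists>j. j \<in> K"
    then have "(idm K :: ('l, 'k) rmat) = 0" by (intro rmat_eqI) (simp add: ent_idm)
    then show False using that by simp
  qed
  show "a = a'" if e: "kron a (idm J) = kron a' (idm J)" "(idm J :: ('j, 'k) rmat) \<noteq> 0"
  proof (rule rmat_eqI)
    obtain j where j: "j \<in> J" using ne[OF e(2)] by blast
    fix i l
    show "ent a i l = ent a' i l"
      using arg_cong[OF e(1), of "\<lambda>w. ent w (i, j) (l, j)"] j by (simp add: ent_idm)
  qed
  show "b = b'" if e: "kron (idm I) b = kron (idm I) b'" "(idm I :: ('i, 'k) rmat) \<noteq> 0"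
  proof (rule rmat_eqI)
    obtain j where j: "j \<in> I" using ne[OF e(2)] by blast
    fix i l
    show "ent b i l = ent b' i l"
      using arg_cong[OF e(1), of "\<lambda>w. ent w (j, i) (j, l)"] j by (simp add: ent_idm)
  qed
qed

lemma kron_sc_right: "kron a (sc c b) = sc c (kron a b)"
  by (rule rmat_eqI) (simp add: mult.left_commute)

section \<open>Matrix representations and relative traces\<close>

context group
begin

lemma csum_self:
  assumes "subgroup H G" "\<And>x. x \<in> H \<Longrightarrow> f x = a"
  shows "csum H H f = a"
proof -
  have "csum H H f = (\<Sum>C\<in>(\<lambda>x. x <# H) ` H. a)"
    by (rule qsum_eq) (use assms in auto)
  also have "(\<lambda>x. x <# H) ` H = {\<one> <# H}"
  proof -
    have "x <# H = \<one> <# H" if "x \<in> H" for x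
      using lcoset_eq_iff[OF assms(1) one_closed, of x] that mem_subgroup[OF assms(1)] by simp
    then have "(\<lambda>x. x <# H) ` H = (\<lambda>_. \<one> <# H) ` H" by (intro image_cong refl)
    then show ?thesis using one_subgroup[OF assms(1)] by (simp add: image_constant_conv) blast
  qed
  finally show ?thesis by simp
qed

lemma csum_const:
  "csum K H (\<lambda>_. a :: 'm::semiring_1) = of_nat (csum K H (\<lambda>_. 1::nat)) * a"
  by (simp add: qsum_def)

lemma pgroup_index_p_sub:
  assumes fin: "finite (carrier G)" and p: "prime p" and H: "subgroup H G" "pgroup p H"
    and S: "subgroup S G" "S \<subset> H"
  obtains P h where "subgroup P G" "S \<subseteq> P" "P \<subseteq> H" "h \<in> H" "h [^] p \<in> P"
    "\<And>x. x \<in> H \<Longrightarrow> conjg x P = P" "card H = p * card P"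
    "\<And>f :: 'a \<Rightarrow> 'm::comm_monoid_add. (\<And>x d. \<lbrakk>x \<in> H; d \<in> P\<rbrakk> \<Longrightarrow> f (x \<otimes> d) = f x) \<Longrightarrow>
      csum H P f = (\<Sum>i<p. f (h [^] i))"
proof -
  let ?H = "G\<lparr>carrier := H\<rparr>"
  interpret H: group ?H using subgroup.subgroup_is_group[OF H(1)] is_group by blast
  obtain a where a: "card H = p ^ a" using H(2) by (auto simp: pgroup_def)
  have 1: "finite (carrier ?H)" using finite_subset[OF subset_subgroup[OF H(1)] fin] by simp
  have 2: "order ?H = p ^ a" using a by (simp add: Coset.order_def)
  have 3: "subgroup S ?H" using subgroup_incl[OF S(1) H(1)] S by blast
  have 4: "S \<noteq> carrier ?H" using S by simp
  have lc: "x <#\<^bsub>?H\<^esub> K = x <# K" for x K by (simp add: l_coset_def)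
  have pw: "x [^]\<^bsub>?H\<^esub> (n::nat) = x [^] n" for x n using nat_pow_consistent by metis
  obtain P h where Ph: "subgroup P ?H" "S \<subseteq> P" "h \<in> carrier ?H" "h [^]\<^bsub>?H\<^esub> p \<in> P"
    "\<And>x. x \<in> carrier ?H \<Longrightarrow> H.conjg x P = P" "order ?H = p * card P"
    "\<And>f :: 'a \<Rightarrow> 'm. (\<And>x d. \<lbrakk>x \<in> carrier ?H; d \<in> P\<rbrakk> \<Longrightarrow> f (x \<otimes>\<^bsub>?H\<^esub> d) = f x) \<Longrightarrow>
      H.csum (carrier ?H) P f = (\<Sum>i<p. f (h [^]\<^bsub>?H\<^esub> i))"
    by (rule H.pgroup_index_p[OF 1 p 2 3 4, where 'm = 'm]) blast
  show ?thesis
  proof (rule that[of P h])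
    show "subgroup P G" by (rule incl_subgroup[OF H(1) Ph(1)])
    show "P \<subseteq> H" using subgroup.subset[OF Ph(1)] by simp
    show "conjg x P = P" if "x \<in> H" for x
      using Ph(5)[of x] that m_inv_consistent[OF H(1) that] by simp
    show "csum H P f = (\<Sum>i<p. f (h [^] i))"
      if "\<And>x d. \<lbrakk>x \<in> H; d \<in> P\<rbrakk> \<Longrightarrow> f (x \<otimes> d) = f x" for f :: "'a \<Rightarrow> 'm"
      using Ph(7)[of f] that by (simp add: lc pw)
  qed (use Ph pw in \<open>auto simp: Coset.order_def\<close>)
qed

end

section \<open>Fixed algebras and relative traces of a matrix representation\<close>

locale mrep = group G for G :: "('g, 'r) monoid_scheme" (structure) +
  fixes I :: "'i set" and \<rho> :: "'g \<Rightarrow> ('i, 'k::field) rmat"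
  assumes finG: "finite (carrier G)" and finI: "finite I"
    and rho_one: "\<rho> \<one> = idm I"
    and rho_mult: "\<lbrakk>g \<in> carrier G; h \<in> carrier G\<rbrakk> \<Longrightarrow> \<rho> (g \<otimes> h) = \<rho> g * \<rho> h"
begin

definition cj :: "'g \<Rightarrow> ('i, 'k) rmat \<Rightarrow> ('i, 'k) rmat" where
  "cj g a = \<rho> g * a * \<rho> (inv g)"

text \<open>The algebra of \<open>H\<close>-endomorphisms. Commutation, equivalent to being fixed
  under \<open>cj\<close> by \<open>fixA_iff\<close>, involves no inverses and is evidently
  preserved by products.\<close>

definition fixA :: "'g set \<Rightarrow> ('i, 'k) rmat set" where
  "fixA H = {a \<in> corner I. \<forall>h\<in>H. \<rho> h * a = a * \<rho> h}"

definition Tr :: "'g set \<Rightarrow> 'g set \<Rightarrow> ('i, 'k) rmat \<Rightarrow> ('i, 'k) rmat" where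
  "Tr K H a = csum K H (\<lambda>x. cj x a)"

lemma rho_corner [simp]: "g \<in> carrier G \<Longrightarrow> \<rho> g \<in> corner I"
  unfolding corner_iff using rho_mult[of \<one> g] rho_mult[of g \<one>] rho_one by simp

lemma rho_inv: "g \<in> carrier G \<Longrightarrow> \<rho> g * \<rho> (inv g) = idm I" "g \<in> carrier G \<Longrightarrow> \<rho> (inv g) * \<rho> g = idm I"
  using rho_mult[of g "inv g"] rho_mult[of "inv g" g] rho_one by simp_all

lemma idm_corner: "a \<in> corner I \<Longrightarrow> idm I * a = a" "a \<in> corner I \<Longrightarrow> a * idm I = a"
  by (auto simp: corner_iff)

lemma rho_inv_cancel:
  assumes "g \<in> carrier G" "a \<in> corner I"
  shows "\<rho> g * (\<rho> (inv g) * a) = a" "\<rho> (inv g) * (\<rho> g * a) = a"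
  using assms rho_inv idm_corner by (simp_all add: mult.assoc[symmetric])

lemma fixA_corner: "a \<in> fixA H \<Longrightarrow> a \<in> corner I"
  by (simp add: fixA_def)

lemma fixA_comm: "a \<in> fixA H \<Longrightarrow> h \<in> H \<Longrightarrow> \<rho> h * a = a * \<rho> h"
  by (simp add: fixA_def)

lemma fixA_mono: "H \<subseteq> K \<Longrightarrow> fixA K \<subseteq> fixA H"
  by (auto simp: fixA_def)

lemma cj_corner [simp]: "\<lbrakk>g \<in> carrier G; a \<in> corner I\<rbrakk> \<Longrightarrow> cj g a \<in> corner I"
  by (simp add: cj_def)

lemma cj_one: "a \<in> corner I \<Longrightarrow> cj \<one> a = a"
  by (simp add: cj_def rho_one idm_corner)

lemma cj_cj: "\<lbrakk>g \<in> carrier G; h \<in> carrier G\<rbrakk> \<Longrightarrow> cj g (cj h a) = cj (g \<otimes> h) a"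
  by (simp add: cj_def rho_mult inv_mult_group mult.assoc)

lemma cj_mult: "\<lbrakk>g \<in> carrier G; a \<in> corner I; b \<in> corner I\<rbrakk> \<Longrightarrow> cj g (a * b) = cj g a * cj g b"
  unfolding cj_def by (simp add: mult.assoc rho_inv_cancel)

lemma cj_add: "cj g (a + b) = cj g a + cj g b"
  by (simp add: cj_def distrib_left distrib_right)

lemma cj_diff: "cj g (a - b) = cj g a - cj g b"
  by (simp add: cj_def left_diff_distrib right_diff_distrib)

lemma cj_zero [simp]: "cj g 0 = 0"
  by (simp add: cj_def)

lemma cj_sc: "cj g (sc c a) = sc c (cj g a)"
  by (simp add: cj_def sc_mult[symmetric])

lemma cj_sum: "cj g (sum f S) = (\<Sum>x\<in>S. cj g (f x))"
  by (induction S rule: infinite_finite_induct) (auto simp: cj_add)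

lemma cj_idm [simp]: "g \<in> carrier G \<Longrightarrow> cj g (idm I) = idm I"
  by (simp add: cj_def idm_corner rho_inv)

lemma cj_fix: "\<lbrakk>a \<in> fixA H; h \<in> H; h \<in> carrier G\<rbrakk> \<Longrightarrow> cj h a = a"
  unfolding cj_def by (simp add: fixA_comm fixA_corner mult.assoc rho_inv idm_corner)

lemma fixA_iff: 
  assumes "H \<subseteq> carrier G"
  shows "a \<in> fixA H \<longleftrightarrow> a \<in> corner I \<and> (\<forall>h\<in>H. cj h a = a)"
proof
  assume a: "a \<in> corner I \<and> (\<forall>h\<in>H. cj h a = a)"
  have "\<rho> h * a = a * \<rho> h" if "h \<in> H" for h
  proof -
    have h: "h \<in> carrier G" using that assms by auto
    have "a * \<rho> h = \<rho> h * a * \<rho> (inv h) * \<rho> h" using a that by (simp add: cj_def)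
    then show ?thesis using a h by (simp add: mult.assoc rho_inv idm_corner)
  qed
  then show "a \<in> fixA H" using a by (simp add: fixA_def)
next
  assume a: "a \<in> fixA H"
  show "a \<in> corner I \<and> (\<forall>h\<in>H. cj h a = a)"
    using fixA_corner[OF a] cj_fix[OF a] assms by (simp add: subset_iff)
qed

lemma fixA_closed [simp, intro]:
  assumes "a \<in> fixA H" "b \<in> fixA H"
  shows "a + b \<in> fixA H" "a - b \<in> fixA H" "a * b \<in> fixA H"
proof -
  have "\<rho> h * (a * b) = a * b * \<rho> h" if "h \<in> H" for h
  proof -
    have "\<rho> h * (a * b) = (\<rho> h * a) * b" by (simp only: mult.assoc)
    also have "\<dots> = a * (\<rho> h * b)" unfolding fixA_comm[OF assms(1) that] by (simp only: mult.assoc)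
    finally show ?thesis unfolding fixA_comm[OF assms(2) that] by (simp only: mult.assoc)
  qed
  then show "a * b \<in> fixA H" using assms by (simp add: fixA_def)
qed (use assms in \<open>auto simp: fixA_def distrib_left distrib_right left_diff_distrib right_diff_distrib\<close>)

lemma fixA_sc [simp, intro]: "a \<in> fixA H \<Longrightarrow> sc c a \<in> fixA H"
  by (auto simp: fixA_def sc_mult[symmetric])

lemma fixA_zero [simp, intro]: "0 \<in> fixA H"
  by (auto simp: fixA_def)

lemma fixA_sum [intro]: "(\<And>x. x \<in> S \<Longrightarrow> f x \<in> fixA H) \<Longrightarrow> sum f S \<in> fixA H"
  by (induction S rule: infinite_finite_induct) auto

lemma fixA_idm [simp, intro]: "H \<subseteq> carrier G \<Longrightarrow> idm I \<in> fixA H"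
  by (auto simp: fixA_def subset_iff idm_corner)

lemma fixA_cj:
  assumes "subgroup H G" "g \<in> carrier G" "a \<in> fixA H"
  shows "cj g a \<in> fixA (conjg g H)"
proof -
  note Hc = mem_subgroup[OF assms(1)]
  have "cj (g \<otimes> h \<otimes> inv g) (cj g a) = cj g a" if "h \<in> H" for h
  proof -
    have "cj (g \<otimes> h \<otimes> inv g) (cj g a) = cj (g \<otimes> h) a" using that Hc assms by (simp add: cj_cj m_assoc)
    also have "\<dots> = cj g (cj h a)" using that Hc assms by (simp add: cj_cj)
    finally show ?thesis using cj_fix[OF assms(3) that Hc[OF that]] by simp
  qed
  then show ?thesis
    using assms fixA_corner by (subst fixA_iff[OF subset_subgroup[OF conjg_subgroup[OF assms(1,2)]]]) auto
qed

lemma cj_rinv: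
  assumes "subgroup H G" "a \<in> fixA H" "x \<in> carrier G" "h \<in> H"
  shows "cj (x \<otimes> h) a = cj x a"
  using assms mem_subgroup[OF assms(1)] by (simp add: cj_cj[symmetric] cj_fix)

lemma Tr_additive:
  assumes "\<And>x y. f (x + y) = f x + f y" "f 0 = (0 :: ('i, 'k) rmat)"
  shows "f (Tr K H a) = csum K H (\<lambda>x. f (cj x a))"
  unfolding Tr_def by (rule qsum_additive) (use assms in auto)

lemma Tr_corner: "K \<subseteq> carrier G \<Longrightarrow> a \<in> corner I \<Longrightarrow> Tr K H a \<in> corner I"
proof -
  assume a: "K \<subseteq> carrier G" "a \<in> corner I"
  have "idm I * Tr K H a = csum K H (\<lambda>x. idm I * cj x a)" by (rule Tr_additive) (auto simp: distrib_left)
  also have "\<dots> = Tr K H a" unfolding Tr_def by (rule qsum_cong) (use a in \<open>auto simp: idm_corner\<close>)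
  finally have 1: "idm I * Tr K H a = Tr K H a" .
  have "Tr K H a * idm I = csum K H (\<lambda>x. cj x a * idm I)" by (rule Tr_additive) (auto simp: distrib_right)
  also have "\<dots> = Tr K H a" unfolding Tr_def by (rule qsum_cong) (use a in \<open>auto simp: idm_corner\<close>)
  finally show ?thesis using 1 by (simp add: corner_iff)
qed

lemma Tr_fix:
  assumes "subgroup H G" "subgroup K G" "H \<subseteq> K" "a \<in> fixA H"
  shows "Tr K H a \<in> fixA K"
proof -
  have Kc: "K \<subseteq> carrier G" by (rule subset_subgroup[OF assms(2)])
  have "cj k (Tr K H a) = Tr K H a" if k: "k \<in> K" for k
  proof -
    have "cj k (Tr K H a) = csum K H (\<lambda>x. cj k (cj x a))" by (rule Tr_additive) (auto simp: cj_add)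
    also have "\<dots> = csum K H (\<lambda>x. cj (k \<otimes> x) a)"
      by (rule qsum_cong) (use k Kc in \<open>auto simp: cj_cj subset_iff\<close>)
    also have "\<dots> = Tr K H a" unfolding Tr_def
      by (rule csum_translate[OF assms(1,2) k]) (use cj_rinv[OF assms(1,4)] Kc in auto)
    finally show ?thesis .
  qed
  then show ?thesis using Tr_corner[OF Kc fixA_corner[OF assms(4)]] by (simp add: fixA_iff[OF Kc])
qed

text \<open>A factor fixed by \<open>K\<close> equals all its conjugates under \<open>K\<close> and
  may be pulled into the sum. Hence the relative traces to \<open>K\<close> form an ideal of
  \<open>fixA K\<close>.\<close>

lemma Tr_mult:
  assumes "K \<subseteq> carrier G" "b \<in> fixA K" "a \<in> corner I"
  shows "b * Tr K H a = Tr K H (b * a)" "Tr K H a * b = Tr K H (a * b)"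
proof -
  have bc: "b \<in> corner I" and bf: "\<And>x. x \<in> K \<Longrightarrow> cj x b = b"
    using assms fixA_corner cj_fix by auto
  have "b * Tr K H a = csum K H (\<lambda>x. b * cj x a)" by (rule Tr_additive) (auto simp: distrib_left)
  also have "\<dots> = Tr K H (b * a)" unfolding Tr_def
    by (rule qsum_cong) (use assms bc bf in \<open>auto simp: cj_mult subset_iff\<close>)
  finally show "b * Tr K H a = Tr K H (b * a)" .
  have "Tr K H a * b = csum K H (\<lambda>x. cj x a * b)" by (rule Tr_additive) (auto simp: distrib_right)
  also have "\<dots> = Tr K H (a * b)" unfolding Tr_def
    by (rule qsum_cong) (use assms bc bf in \<open>auto simp: cj_mult subset_iff\<close>)
  finally show "Tr K H a * b = Tr K H (a * b)" .
qed

lemma Tr_add: "Tr K H (a + b) = Tr K H a + Tr K H b"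
  by (simp add: Tr_def cj_add qsum_add)

lemma Tr_zero [simp]: "Tr K H 0 = 0"
  by (simp add: Tr_def qsum_def)

lemma Tr_sum: "Tr K H (sum f S) = (\<Sum>x\<in>S. Tr K H (f x))"
  by (induction S rule: infinite_finite_induct) (auto simp: Tr_add)

lemma Tr_sc: "Tr K H (sc c a) = sc c (Tr K H a)"
  by (simp add: Tr_def cj_sc qsum_def rmat.scale_sum_right)

lemma Tr_self: "subgroup H G \<Longrightarrow> a \<in> fixA H \<Longrightarrow> Tr H H a = a"
  unfolding Tr_def by (rule csum_self) (auto simp: cj_fix mem_subgroup)

lemma Tr_trans:
  assumes "subgroup L G" "subgroup H G" "subgroup K G" "L \<subseteq> H" "H \<subseteq> K" "a \<in> fixA L"
  shows "Tr K H (Tr H L a) = Tr K L a"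
proof -
  have Kc: "K \<subseteq> carrier G" by (rule subset_subgroup[OF assms(3)])
  have "Tr K L a = csum K H (\<lambda>x. csum H L (\<lambda>y. cj (x \<otimes> y) a))"
    unfolding Tr_def by (rule csum_trans[OF finG assms(1-5)]) (use cj_rinv[OF assms(1,6)] Kc in auto)
  also have "\<dots> = csum K H (\<lambda>x. cj x (Tr H L a))"
  proof (rule qsum_cong)
    fix x assume x: "x \<in> K"
    have "cj x (Tr H L a) = csum H L (\<lambda>y. cj x (cj y a))" by (rule Tr_additive) (auto simp: cj_add)
    also have "\<dots> = csum H L (\<lambda>y. cj (x \<otimes> y) a)"
      by (rule qsum_cong) (use x assms(5) Kc in \<open>auto simp: cj_cj subset_iff\<close>)
    finally show "csum H L (\<lambda>y. cj (x \<otimes> y) a) = cj x (Tr H L a)" ..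
  qed
  finally show ?thesis by (simp add: Tr_def)
qed

lemma Tr_conj:
  assumes "subgroup H G" "g \<in> carrier G" "a \<in> fixA H"
  shows "Tr (carrier G) (conjg g H) (cj g a) = Tr (carrier G) H a"
proof -
  have "Tr (carrier G) H a = csum (carrier G) (conjg g H) (\<lambda>x. cj (x \<otimes> g) a)"
    unfolding Tr_def by (rule csum_conj[OF assms(1,2), symmetric]) (rule cj_rinv[OF assms(1,3)])
  also have "\<dots> = Tr (carrier G) (conjg g H) (cj g a)"
    unfolding Tr_def by (rule qsum_cong) (use assms in \<open>simp add: cj_cj\<close>)
  finally show ?thesis ..
qed

lemma Tr_Mackey:
  assumes "subgroup H G" "subgroup D G" "c \<in> fixA D"
  obtains T where "finite T" "T \<subseteq> carrier G"
    "Tr (carrier G) D c = (\<Sum>g\<in>T. Tr H (H \<inter> conjg g D) (cj g c))"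
proof -
  obtain T where T: "finite T" "T \<subseteq> carrier G"
    "\<And>f :: 'g \<Rightarrow> ('i, 'k) rmat. (\<And>x d. \<lbrakk>x \<in> carrier G; d \<in> D\<rbrakk> \<Longrightarrow> f (x \<otimes> d) = f x) \<Longrightarrow>
      csum (carrier G) D f = (\<Sum>g\<in>T. csum H (H \<inter> conjg g D) (\<lambda>h. f (h \<otimes> g)))"
    by (rule csum_Mackey[OF finG assms(1,2), where 'm = "('i, 'k) rmat"]) blast
  have "Tr (carrier G) D c = (\<Sum>g\<in>T. csum H (H \<inter> conjg g D) (\<lambda>h. cj (h \<otimes> g) c))"
    unfolding Tr_def by (rule T(3)) (rule cj_rinv[OF assms(2,3)])
  also have "\<dots> = (\<Sum>g\<in>T. Tr H (H \<inter> conjg g D) (cj g c))"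
  proof (rule sum.cong[OF refl])
    fix g assume "g \<in> T"
    then have "g \<in> carrier G" using T(2) by blast
    then show "csum H (H \<inter> conjg g D) (\<lambda>h. cj (h \<otimes> g) c) = Tr H (H \<inter> conjg g D) (cj g c)"
      unfolding Tr_def by (intro qsum_cong) (simp add: cj_cj mem_subgroup[OF assms(1)])
  qed
  finally show ?thesis by (rule that[OF T(1,2)])
qed

section \<open>Matrix traces of relative traces, and the control of subgroups up to
  conjugacy\<close>

lemma mtr_cj: "\<lbrakk>g \<in> carrier G; a \<in> corner I\<rbrakk> \<Longrightarrow> mtr I (cj g a) = mtr I a"
proof -
  assume a: "g \<in> carrier G" "a \<in> corner I"
  have "mtr I (cj g a) = mtr I (\<rho> (inv g) * (\<rho> g * a))"
    unfolding cj_def using a by (intro mtr_mult_commute[OF finI]) auto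
  then show ?thesis using a by (simp add: rho_inv_cancel)
qed

lemma mtr_csum: "mtr I (csum K H f) = csum K H (\<lambda>x. mtr I (f x))"
  by (rule qsum_additive) auto

lemma mtr_Tr:
  assumes "K \<subseteq> carrier G" "a \<in> corner I"
  shows "mtr I (Tr K H a) = of_nat (csum K H (\<lambda>_. 1::nat)) * mtr I a"
proof -
  have "mtr I (Tr K H a) = csum K H (\<lambda>x. mtr I (cj x a))" unfolding Tr_def by (rule mtr_csum)
  also have "\<dots> = csum K H (\<lambda>_. mtr I a)" by (rule qsum_cong) (use assms in \<open>auto simp: mtr_cj subset_iff\<close>)
  also have "\<dots> = of_nat (csum K H (\<lambda>_. 1::nat)) * mtr I a" by (rule csum_const)
  finally show ?thesis .
qed

text \<open>Both sides are the sum of \<open>tr (c \<cdot> \<^bsup>g\<^esup>b)\<close> over \<open>g \<in> G/D\<close>, resp.\ \<open>g \<in> D\G\<close>: multiplied by \<open>|D|\<close>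
  they would be the same sum over \<open>G\<close>.\<close>

lemma mtr_Tr_symmetric:
  assumes D: "subgroup D G" and b: "b \<in> fixA D" and c: "c \<in> fixA D"
  shows "mtr I (c * Tr (carrier G) D b) = mtr I (Tr (carrier G) D c * b)"
proof -
  have bc: "b \<in> corner I" "c \<in> corner I" using b c fixA_corner by auto
  let ?F = "\<lambda>x. mtr I (c * cj x b)"
  have "mtr I (c * Tr (carrier G) D b) = mtr I (csum (carrier G) D (\<lambda>x. c * cj x b))"
    by (subst Tr_additive) (auto simp: distrib_left)
  also have "\<dots> = csum (carrier G) D ?F" by (rule mtr_csum)
  also have "\<dots> = csum (carrier G) D (\<lambda>x. ?F (inv x))"
  proof (rule csum_inverse[OF finG D, symmetric])
    fix x h assume x: "x \<in> carrier G" "h \<in> D"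
    have h: "h \<in> carrier G" using x mem_subgroup[OF D] by blast
    show "?F (x \<otimes> h) = ?F x" using cj_rinv[OF D b x] by simp
    have "mtr I (c * cj (h \<otimes> x) b) = mtr I (cj h (c * cj x b))"
      using x h bc cj_fix[OF c x(2) h] by (simp add: cj_mult cj_cj)
    then show "?F (h \<otimes> x) = ?F x" using x h bc by (simp add: mtr_cj)
  qed
  also have "\<dots> = csum (carrier G) D (\<lambda>x. mtr I (cj x c * b))"
  proof (rule qsum_cong)
    fix x assume x: "x \<in> carrier G"
    have "mtr I (c * cj (inv x) b) = mtr I (cj x (c * cj (inv x) b))" using x bc by (simp add: mtr_cj)
    also have "cj x (c * cj (inv x) b) = cj x c * b" using x bc by (simp add: cj_mult cj_cj cj_one)
    finally show "mtr I (c * cj (inv x) b) = mtr I (cj x c * b)" .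
  qed
  also have "\<dots> = mtr I (csum (carrier G) D (\<lambda>x. cj x c * b))" by (rule mtr_csum[symmetric])
  also have "\<dots> = mtr I (Tr (carrier G) D c * b)"
    by (subst Tr_additive) (auto simp: distrib_right)
  finally show ?thesis .
qed

text \<open>The index of a proper subgroup of a \<open>p\<close>-group is a multiple of
  \<open>p\<close>, so zero in \<open>k\<close>. This is why a relative trace from a proper subgroup
  of a \<open>p\<close>-group has matrix trace zero.\<close>

lemma pgroup_index_char:
  assumes "prime p" "CHAR('k) = p" "subgroup S G" "subgroup H G" "S \<subseteq> H" "pgroup p H"
    and "of_nat (csum H S (\<lambda>_. 1::nat)) \<noteq> (0::'k)"
  shows "S = H"
proof -
  obtain a where a: "card H = p ^ a" using assms(6) by (auto simp: pgroup_def)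
  have "\<not> p dvd csum H S (\<lambda>_. 1::nat)" using assms(2,7) by (simp add: of_nat_eq_0_iff_char_dvd)
  moreover have *: "csum H S (\<lambda>_. 1::nat) * card S = card H" by (rule index_mult_card'[OF finG assms(3,4,5)])
  ultimately have "csum H S (\<lambda>_. 1::nat) = 1"
    using prime_dvd_power_cofactor[OF assms(1), of _ "card S" a] a by auto
  then show ?thesis
    using * card_subset_eq[OF finite_subset[OF subset_subgroup[OF assms(4)] finG] assms(5)] by simp
qed

lemma conj_contained:
  assumes "prime p" "CHAR('k) = p" and D: "subgroup D G" "c \<in> fixA D" "Tr (carrier G) D c = idm I"
    and H: "subgroup H G" "pgroup p H" and b: "b \<in> fixA H" "mtr I b \<noteq> 0"
  shows "\<exists>g\<in>carrier G. H \<subseteq> conjg g D"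
proof -
  note Hc = subset_subgroup[OF H(1)]
  obtain T where T: "finite T" "T \<subseteq> carrier G"
    "Tr (carrier G) D c = (\<Sum>g\<in>T. Tr H (H \<inter> conjg g D) (cj g c))"
    by (rule Tr_Mackey[OF H(1) D(1,2)])
  have bc: "b \<in> corner I" "c \<in> corner I" using b D fixA_corner by auto
  have "b = b * (\<Sum>g\<in>T. Tr H (H \<inter> conjg g D) (cj g c))" using T(3)[symmetric] D(3) bc by (simp add: idm_corner)
  also have "\<dots> = (\<Sum>g\<in>T. Tr H (H \<inter> conjg g D) (b * cj g c))"
    unfolding sum_distrib_left by (rule sum.cong) (use T bc b Tr_mult(1)[OF Hc] in auto)
  finally have "mtr I b = mtr I (\<Sum>g\<in>T. Tr H (H \<inter> conjg g D) (b * cj g c))" by (rule arg_cong)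
  also have "\<dots> = (\<Sum>g\<in>T. mtr I (Tr H (H \<inter> conjg g D) (b * cj g c)))" by (rule mtr_sum)
  finally have "(\<Sum>g\<in>T. mtr I (Tr H (H \<inter> conjg g D) (b * cj g c))) \<noteq> 0" using b(2) by simp
  then obtain g where g: "g \<in> T" "mtr I (Tr H (H \<inter> conjg g D) (b * cj g c)) \<noteq> 0"
    by (rule sum.not_neutral_contains_not_neutral)
  have gc: "g \<in> carrier G" using g T by auto
  have "of_nat (csum H (H \<inter> conjg g D) (\<lambda>_. 1::nat)) \<noteq> (0::'k)"
    using g(2) gc bc by (auto simp: mtr_Tr[OF Hc])
  then have "H \<inter> conjg g D = H"
    using H gc D by (intro pgroup_index_char[OF assms(1,2)] subgroups_Inter_pair conjg_subgroup) auto
  then show ?thesis using gc by blast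
qed

lemma mtr_Tr_idm:
  assumes "c \<in> corner I"
  shows "mtr I (c * Tr (carrier G) H (idm I)) = of_nat (csum (carrier G) H (\<lambda>_. 1::nat)) * mtr I c"
proof -
  have "c * Tr (carrier G) H (idm I) = csum (carrier G) H (\<lambda>x. c * cj x (idm I))"
    by (rule Tr_additive) (auto simp: distrib_left)
  also have "\<dots> = csum (carrier G) H (\<lambda>x. c)" by (rule qsum_cong) (use assms in \<open>simp add: idm_corner\<close>)
  finally have "mtr I (c * Tr (carrier G) H (idm I)) = csum (carrier G) H (\<lambda>x. mtr I c)" by (simp only: mtr_csum)
  also have "\<dots> = of_nat (csum (carrier G) H (\<lambda>_. 1::nat)) * mtr I c" by (rule csum_const)
  finally show ?thesis .
qed

section \<open>Primitive idempotents and their local corner rings\<close>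

definition inv_in :: "'g set \<Rightarrow> ('i, 'k) rmat \<Rightarrow> ('i, 'k) rmat \<Rightarrow> bool" where
  "inv_in H e x \<longleftrightarrow> (\<exists>w\<in>fixA H. e * w = w \<and> w * e = w \<and> x * w = e \<and> w * x = e)"

definition primitive_in :: "'g set \<Rightarrow> ('i, 'k) rmat \<Rightarrow> bool" where
  "primitive_in H e \<longleftrightarrow> e \<in> fixA H \<and> e * e = e \<and> e \<noteq> 0 \<and>
     (\<forall>f\<in>fixA H. f * f = f \<longrightarrow> e * f = f \<longrightarrow> f * e = f \<longrightarrow> f = 0 \<or> f = e)"

text \<open>The nilpotent part \<open>f\<close> of the Fitting decomposition of \<open>x\<close>
  commutes with everything commuting with \<open>x\<close> and \<open>e\<close>, in particular with
  \<open>H\<close>. So \<open>f\<close> is an idempotent of \<open>fixA H\<close> below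
  \<open>e\<close>, and primitivity leaves only \<open>0\<close> and \<open>e\<close>. This is the
  dichotomy of a local ring, here the ring with identity \<open>e\<close>.\<close>

lemma inv_or_nilpotent:
  assumes e: "primitive_in H e" and x: "x \<in> fixA H" "e * x = x" "x * e = x"
  shows "inv_in H e x \<or> (\<exists>n. x ^ n * e = 0)"
proof -
  have e': "e \<in> fixA H" "e \<in> corner I" "e * e = e" using e fixA_corner by (auto simp: primitive_in_def)
  obtain f w n where f: "f \<in> corner I" "w \<in> corner I" "f * f = f" "e * f = f" "f * e = f" "e * w = w" "w * e = w"
    "x * w = e - f" "w * x = e - f" "x ^ n * f = 0"
    and comm: "\<And>y. \<lbrakk>y * x = x * y; y * e = e * y\<rbrakk> \<Longrightarrow> y * f = f * y \<and> y * w = w * y"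
    by (rule fitting_decomposition[OF finI e'(2,3) fixA_corner[OF x(1)] x(2,3)]) blast
  have ff: "f \<in> fixA H" "w \<in> fixA H"
    using f(1,2) comm fixA_comm[OF x(1)] fixA_comm[OF e'(1)] by (auto simp: fixA_def)
  then have "f = 0 \<or> f = e" using e f by (auto simp: primitive_in_def)
  then show ?thesis
  proof
    assume "f = 0"
    then show ?thesis using f ff by (auto simp: inv_in_def)
  qed (use f in auto)
qed

lemma inv_in_one_minus_nilpotent:
  assumes e: "e \<in> fixA H" "e * e = e" and x: "x \<in> fixA H" "e * x = x" "x * e = x" and n: "x ^ n * e = 0"
  shows "inv_in H e (e - x)"
proof -
  have xn: "x ^ i * e \<in> fixA H" "e * (x ^ i * e) = x ^ i * e" for i
  proof (induction i)
    case (Suc i)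
    { case 1 then show ?case using Suc x by (simp add: mult.assoc) }
    { case 2 have "e * (x ^ Suc i * e) = (e * x) * (x ^ i * e)" by (simp add: mult.assoc)
      then show ?case using x by (simp add: mult.assoc) }
  qed (use e in auto)
  \<comment> \<open>The geometric series for the inverse of \<open>e - x\<close>.\<close>
  define w where "w = (\<Sum>i<n. x ^ i * e)"
  have 1: "(e - x) * (\<Sum>i<m. x ^ i * e) = e - x ^ m * e" for m
  proof (induction m)
    case (Suc m)
    have "(e - x) * (x ^ m * e) = x ^ m * e - x ^ Suc m * e" using xn(2)[of m] by (simp add: left_diff_distrib mult.assoc)
    then show ?case using Suc by (simp add: distrib_left)
  qed simp
  have ew: "e * w = w" "w * e = w"
    using xn e by (simp_all add: w_def sum_distrib_left sum_distrib_right mult.assoc)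
  have xw: "x * w = w * x"
    unfolding w_def sum_distrib_left sum_distrib_right
  proof (rule sum.cong[OF refl])
    fix i
    have "x * (x ^ i * e) = x ^ i * (x * e)" by (simp only: mult.assoc[symmetric] power_commutes)
    also have "\<dots> = x ^ i * (e * x)" using x by simp
    finally show "x * (x ^ i * e) = x ^ i * e * x" by (simp only: mult.assoc)
  qed
  have "w \<in> fixA H" unfolding w_def using xn by auto
  moreover have "(e - x) * w = e" using 1[of n] n by (simp add: w_def)
  moreover have "w * (e - x) = e" using calculation(2) xw ew by (simp add: left_diff_distrib right_diff_distrib)
  ultimately show ?thesis using ew by (auto simp: inv_in_def)
qed

text \<open>If \<open>v\<close> is inverse to \<open>x * w\<close>, then \<open>w * v\<close> is a
  right inverse of \<open>x\<close>; it is a left inverse too because \<open>w\<close> has the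
  inverse \<open>u\<close>.\<close>

lemma inv_in_cancel:
  assumes w: "w \<in> fixA H" "e * w = w" "w * e = w" "u * w = e" "w * u = e" and u: "e * u = u"
    and x: "x * e = x" "e * x = x" and "inv_in H e (x * w)"
  shows "inv_in H e x"
proof -
  obtain v where v: "v \<in> fixA H" "e * v = v" "v * e = v" "x * w * v = e" "v * (x * w) = e"
    using assms(9) by (auto simp: inv_in_def)
  have "v * x = v * (x * w) * u" using w x by (simp add: mult.assoc)
  then have vx: "v * x = u" using v u by simp
  have "w * v \<in> fixA H" using w v by auto
  moreover have "e * (w * v) = w * v" "w * v * e = w * v" "x * (w * v) = e" "w * v * x = e"
    using w v vx by (simp_all add: mult.assoc) (simp add: mult.assoc[symmetric])
  ultimately show ?thesis unfolding inv_in_def by blast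
qed

text \<open>With \<open>w\<close> inverse to \<open>x + y\<close>, the elements \<open>x * w\<close>
  and \<open>y * w\<close> add up to \<open>e\<close>. If the first is not a unit, it is nilpotent,
  and then the second is a unit.\<close>

lemma inv_in_add:
  assumes e: "primitive_in H e" and x: "x \<in> fixA H" "e * x = x" "x * e = x" and y: "y \<in> fixA H" "e * y = y" "y * e = y"
    and "inv_in H e (x + y)"
  shows "inv_in H e x \<or> inv_in H e y"
proof -
  have e': "e \<in> fixA H" "e * e = e" using e by (auto simp: primitive_in_def)
  obtain w where w: "w \<in> fixA H" "e * w = w" "w * e = w" "(x + y) * w = e" "w * (x + y) = e"
    using assms(8) by (auto simp: inv_in_def)
  have u: "e * (x + y) = x + y" using x y by (simp add: distrib_left)
  have xw: "x * w \<in> fixA H" "e * (x * w) = x * w" "x * w * e = x * w"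
    using x w by (auto simp: mult.assoc) (simp add: mult.assoc[symmetric])
  from inv_or_nilpotent[OF e xw] show ?thesis
  proof
    assume "inv_in H e (x * w)"
    then show ?thesis using inv_in_cancel[OF w u x(3,2)] by blast
  next
    assume "\<exists>n. (x * w) ^ n * e = 0"
    then have "inv_in H e (e - x * w)" using inv_in_one_minus_nilpotent[OF e' xw] by blast
    moreover have "e - x * w = y * w" using w(4) by (simp add: distrib_right) (metis add_diff_cancel_left')
    ultimately show ?thesis using inv_in_cancel[OF w u y(3,2)] by simp
  qed
qed

text \<open>This plays the role of Rosenberg's lemma: when a primitive idempotent is a sum of
  relative traces, one of the traces is already a unit, so a single double coset in a Mackey formula
  suffices.\<close>

lemma inv_in_sum:
  assumes e: "primitive_in H e" and "finite T"
    and "\<And>t. t \<in> T \<Longrightarrow> x t \<in> fixA H \<and> e * x t = x t \<and> x t * e = x t"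
    and "inv_in H e (sum x T)"
  shows "\<exists>t\<in>T. inv_in H e (x t)"
  using assms(2-4)
proof (induction T rule: finite_induct)
  case empty
  then show ?case using e by (auto simp: inv_in_def primitive_in_def)
next
  case (insert t T)
  have "sum x T \<in> fixA H" using insert.prems by auto
  moreover have "e * sum x T = sum x T" "sum x T * e = sum x T"
    using insert.prems by (simp_all add: sum_distrib_left sum_distrib_right)
  ultimately have "inv_in H e (x t) \<or> inv_in H e (sum x T)"
    using insert by (intro inv_in_add[OF e]) auto
  then show ?case using insert by auto
qed

end

section \<open>Dimensions and relative traces\<close>

locale mrep_closed = mrep G I \<rho>
  for G :: "('g, 'r) monoid_scheme" (structure)
    and I :: "'i set" and \<rho> :: "'g \<Rightarrow> ('i, 'k::alg_closed_field) rmat"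
begin

text \<open>Generalized eigenspaces for different eigenvalues meet in zero. If \<open>t\<close> were
  not zero, the last non-zero \<open>y ^ i * t\<close> would be annihilated by \<open>y\<close>, so
  \<open>y + sc c e\<close> would act on it as the non-zero scalar \<open>c\<close>, contradicting
  nilpotency.\<close>

lemma nilpotent_shift_orthogonal:
  assumes t: "y * t = t * y" "e * t = t" and n: "y ^ n * t = 0"
    and m: "(y + sc c e) ^ m * t = 0" and c: "c \<noteq> 0" and y: "e * y = y" "y * e = y"
  shows "(t :: ('i, 'k) rmat) = 0"
proof (rule ccontr)
  assume t0: "t \<noteq> 0"
  define j where "j = (LEAST j. y ^ j * t = 0)"
  have j: "y ^ j * t = 0" unfolding j_def using n by (rule LeastI)
  with t0 obtain i where i: "j = Suc i" by (cases j) auto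
  have s0: "y ^ i * t \<noteq> 0" using not_less_Least[of i "\<lambda>j. y ^ j * t = 0"] i unfolding j_def by auto
  define s where "s = y ^ i * t"
  have ys: "y * s = 0" using j by (simp add: s_def i mult.assoc)
  have ey: "e * (y ^ k * t) = y ^ k * t" for k
  proof (induction k)
    case (Suc k)
    have "e * (y ^ Suc k * t) = (e * y) * (y ^ k * t)" by (simp add: mult.assoc)
    then show ?case using y by (simp add: mult.assoc)
  qed (use t in simp)
  have es: "e * s = s" unfolding s_def by (rule ey)
  have shift: "(y + sc c e) ^ k * s = sc (c ^ k) s" for k
  proof (induction k)
    case (Suc k)
    have "(y + sc c e) ^ Suc k * s = (y + sc c e) * ((y + sc c e) ^ k * s)" by (simp add: mult.assoc)
    also have "\<dots> = (y + sc c e) * sc (c ^ k) s" unfolding Suc ..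
    also have "\<dots> = sc (c ^ k) ((y + sc c e) * s)" by (simp only: sc_mult(2))
    also have "(y + sc c e) * s = sc c s" using ys es by (simp add: distrib_right sc_mult(1)[symmetric])
    finally show ?case by (simp add: mult.commute)
  qed simp
  have "y * (y + sc c e) = (y + sc c e) * y"
    using y by (simp add: distrib_left distrib_right sc_mult[symmetric])
  then have "(y + sc c e) ^ m * y ^ i = y ^ i * (y + sc c e) ^ m"
    by (metis power_commuting_commutes)
  then have "(y + sc c e) ^ m * s = y ^ i * ((y + sc c e) ^ m * t)"
    unfolding s_def by (simp only: mult.assoc[symmetric])
  then have "sc (c ^ m) s = 0" using m shift by simp
  then show False using s0 c by (simp add: s_def)
qed

text \<open>The idempotent \<open>f\<close> projects to a generalized eigenspace of
  \<open>z\<close>, for an eigenvalue \<open>c\<close>. Conjugation by \<open>h [^] i\<close> adds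
  \<open>i\<close> to \<open>z\<close>, so the conjugate of \<open>f\<close> belongs to the
  eigenvalue \<open>c - i\<close>. These are distinct for \<open>i < p\<close> in characteristic
  \<open>p\<close>, whence orthogonality.\<close>

lemma commuting_conj_idempotents:
  fixes z e :: "('i, 'k) rmat"
  assumes p: "prime p" "CHAR('k) = p"
    and P: "subgroup P G" and h: "h \<in> carrier G" "h [^] p \<in> P" "conjg h P = P"
    and e: "e \<in> fixA P" "e * e = e" "e \<noteq> 0" "cj h e = e"
    and z: "z \<in> fixA P" "e * z = z" "z * e = z" "cj h z = z + e"
  obtains f where "f \<in> fixA P" "f * f = f" "e * f = f" "f * e = f" "f \<noteq> 0"
    "\<And>i j. \<lbrakk>i < p; j < p; i \<noteq> j\<rbrakk> \<Longrightarrow> cj (h [^] i) f * cj (h [^] j) f = 0"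
proof -
  have ec: "e \<in> corner I" and zc: "z \<in> corner I" using e z fixA_corner by auto
  \<comment> \<open>That \<open>z - sc c e\<close> has no left inverse ensures that its nilpotent
    part \<open>f\<close> is not zero.\<close>
  obtain c where c: "\<And>w. w * (z - sc c e) \<noteq> e"
    by (rule eigenvalue_exists[OF finI ec e(2,3) zc z(2,3)]) blast
  define y where "y = z - sc c e"
  have y: "y \<in> fixA P" "y \<in> corner I" "e * y = y" "y * e = y"
    using e z ec zc by (auto simp: y_def right_diff_distrib left_diff_distrib sc_mult[symmetric])
  obtain f w n where f: "f \<in> corner I" "w \<in> corner I" "f * f = f" "e * f = f" "f * e = f" "e * w = w" "w * e = w"
    "y * w = e - f" "w * y = e - f" "y ^ n * f = 0"
    and comm: "\<And>x. \<lbrakk>x * y = y * x; x * e = e * x\<rbrakk> \<Longrightarrow> x * f = f * x \<and> x * w = w * x"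
    by (rule fitting_decomposition[OF finI ec e(2) y(2,3,4)]) blast
  have f0: "f \<noteq> 0" using f(9) c[of w] by (auto simp: y_def)
  have ff: "f \<in> fixA P"
    using f(1) comm fixA_comm[OF y(1)] fixA_comm[OF e(1)] by (auto simp: fixA_def)
  have hi: "h [^] (i::nat) \<in> carrier G" for i using h by simp
  have cje: "cj (h [^] (i::nat)) e = e" for i
  proof (induction i)
    case (Suc i)
    then show ?case using h e ec by (simp add: cj_cj[symmetric])
  qed (use ec in \<open>simp add: cj_one\<close>)
  have cjy: "cj (h [^] i) y = y + sc (of_nat i) e" for i
  proof (induction i)
    case (Suc i)
    have "cj (h [^] Suc i) y = cj (h [^] i) (cj h y)" using h by (simp add: cj_cj)
    also have "cj h y = y + e" using z e by (simp add: y_def cj_diff cj_sc)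
    finally show ?case using Suc cje[of i] by (simp add: cj_add rmat.scale_left_distrib add.assoc add.commute)
  qed (use y in \<open>simp add: cj_one\<close>)
  have orth: "f * cj (h [^] i) f = 0 \<and> cj (h [^] i) f * f = 0" if i: "0 < i" "i < p" for i
  proof -
    let ?f = "cj (h [^] i) f" and ?c = "of_nat i :: 'k"
    have fc: "?f \<in> corner I" using f hi by simp
    have ef: "e * ?f = ?f" "?f * e = ?f"
      using cj_mult[OF hi ec f(1), of i] cj_mult[OF hi f(1) ec, of i] f(4,5) cje by simp_all
    have "f * y = y * f" using comm[of y] y by simp
    \<comment> \<open>Conjugation of the commutation of \<open>f\<close> with \<open>y\<close>.
      Since \<open>?f\<close> commutes with \<open>e\<close>, it commutes with \<open>y\<close> as
      well, and therefore with \<open>f\<close>, which is a polynomial in \<open>y\<close>.\<close>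
    then have "?f * (y + sc ?c e) = (y + sc ?c e) * ?f"
      using f y hi[of i] unfolding cjy[symmetric] by (simp add: cj_mult[symmetric])
    then have fy: "?f * y = y * ?f" using ef by (simp add: distrib_left distrib_right sc_mult[symmetric])
    then have fcomm: "?f * f = f * ?f" using comm[of ?f] ef by simp
    have "cj (h [^] i) (y ^ k * f) = (y + sc ?c e) ^ k * ?f" for k
    proof (induction k)
      case (Suc k)
      have c: "y ^ k * f \<in> corner I" by (induction k) (use f y in \<open>auto simp: mult.assoc\<close>)
      have "cj (h [^] i) (y ^ Suc k * f) = cj (h [^] i) (y * (y ^ k * f))" by (simp add: mult.assoc)
      also have "\<dots> = (y + sc ?c e) * ((y + sc ?c e) ^ k * ?f)"
        using cj_mult[OF hi y(2) c] Suc cjy by simp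
      finally show ?case by (simp add: mult.assoc)
    qed simp
    then have n2: "(y + sc ?c e) ^ n * ?f = 0" using f(10) by (metis cj_zero)
    have "\<not> p dvd i" using i by (auto dest: dvd_imp_le)
    then have i0: "?c \<noteq> 0" using p by (simp add: of_nat_eq_0_iff_char_dvd)
    have "f * ?f = 0"
    proof (rule nilpotent_shift_orthogonal[of y _ e n ?c n])
      show "y * (f * ?f) = f * ?f * y"
        using \<open>f * y = y * f\<close> fy by (metis mult.assoc)
      show "e * (f * ?f) = f * ?f" using f by (simp add: mult.assoc[symmetric])
      show "y ^ n * (f * ?f) = 0" using f(10) by (simp add: mult.assoc[symmetric])
      show "(y + sc ?c e) ^ n * (f * ?f) = 0" using n2 by (simp add: fcomm[symmetric] mult.assoc[symmetric])
    qed (use i0 y in auto)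
    then show ?thesis using fcomm by simp
  qed
  show ?thesis
  proof (rule that[OF ff f(3,4,5) f0])
    have *: "cj (h [^] i) f * cj (h [^] j) f = 0 \<and> cj (h [^] j) f * cj (h [^] i) f = 0"
      if "i < j" "j < p" for i j
    proof -
      have "cj (h [^] j) f = cj (h [^] i) (cj (h [^] (j - i)) f)"
        using h that by (simp add: cj_cj nat_pow_mult)
      then show ?thesis
        using orth[of "j - i"] that f hi by (simp add: cj_mult[symmetric])
    qed
    show "cj (h [^] i) f * cj (h [^] j) f = 0" if "i < p" "j < p" "i \<noteq> j" for i j
      using *[of i j] *[of j i] that by (cases "i < j") auto
  qed
qed

text \<open>Green's indecomposability theorem in disguise: over an algebraically closed field a primitive
  idempotent that is a trace from a normal subgroup of index \<open>p\<close> is the orthogonal sum of \<open>p\<close> conjugates.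
  With \<open>e = \<Sum>\<^sub>i \<^bsup>h\<^sup>i\<^esup>c\<close>, the element \<open>z = - \<Sum>\<^sub>i i \<cdot> \<^bsup>h\<^sup>i\<^esup>c\<close> satisfies \<open>\<^bsup>h\<^esup>z = z + e\<close>, so that conjugation
  by \<open>h\<close> permutes the generalized eigenspaces of \<open>z\<close> freely.\<close>

lemma primitive_trace_split:
  assumes p: "prime p" "CHAR('k) = p" and H: "subgroup H G"
    and P: "subgroup P G" "P \<subseteq> H" and h: "h \<in> H" "h [^] p \<in> P"
    and norm: "\<And>x. x \<in> H \<Longrightarrow> conjg x P = P"
    and sum: "\<And>f :: 'g \<Rightarrow> ('i, 'k) rmat. (\<And>x d. \<lbrakk>x \<in> H; d \<in> P\<rbrakk> \<Longrightarrow> f (x \<otimes> d) = f x) \<Longrightarrow>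
      csum H P f = (\<Sum>i<p. f (h [^] i))"
    and e: "primitive_in H e" and c: "c \<in> fixA P" "e * c = c" "c * e = c" "Tr H P c = e"
  obtains f where "f \<in> fixA P" "f * f = f" "Tr H P f = e" "rk e = p * rk f"
proof -
  note Hc = mem_subgroup[OF H]
  have hc: "h \<in> carrier G" using h Hc by blast
  have hi: "h [^] (i::nat) \<in> carrier G" "h [^] i \<in> H" for i
    using hc h(1) subgroup_int_pow_closed[OF H h(1), of "int i"] by (simp_all add: int_pow_int)
  have e': "e \<in> fixA H" "e \<in> corner I" "e * e = e" "e \<noteq> 0" using e fixA_corner by (auto simp: primitive_in_def)
  have eP: "e \<in> fixA P" using e'(1) fixA_mono[OF P(2)] by blast
  have cjh: "cj (h [^] (i::nat)) a \<in> fixA P" if "a \<in> fixA P" for a i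
    using fixA_cj[OF P(1) hi(1) that] norm[OF hi(2)] by metis
  have cje: "cj (h [^] (i::nat)) e = e" for i using cj_fix[OF e'(1) hi(2) hi(1)] .
  have TrP: "Tr H P a = (\<Sum>i<p. cj (h [^] i) a)" if "a \<in> fixA P" for a
    unfolding Tr_def by (rule sum) (use cj_rinv[OF P(1) that] Hc in blast)
  define z where "z = - (\<Sum>i<p. sc (of_nat i) (cj (h [^] i) c))"
  have cc: "c \<in> corner I" using c fixA_corner by blast
  have cje2: "e * cj (h [^] (i::nat)) c = cj (h [^] i) c" "cj (h [^] (i::nat)) c * e = cj (h [^] i) c" for i
  proof -
    have "cj (h [^] i) (e * c) = e * cj (h [^] i) c" "cj (h [^] i) (c * e) = cj (h [^] i) c * e"
      using cje[of i] hi(1)[of i] e'(2) cc by (simp_all add: cj_mult)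
    then show "e * cj (h [^] i) c = cj (h [^] i) c" "cj (h [^] i) c * e = cj (h [^] i) c" using c by simp_all
  qed
  have ezz: "e * z = z" "z * e = z"
    by (simp_all add: z_def sum_distrib_left sum_distrib_right sc_mult[symmetric] cje2)
  have "(\<Sum>i<p. sc (of_nat i) (cj (h [^] i) c)) \<in> fixA P" using cjh c by (intro fixA_sum fixA_sc)
  then have zP: "z \<in> fixA P" unfolding z_def by (metis fixA_closed(2) fixA_zero diff_0)
  have hpc: "cj (h [^] p) c = c" using cj_fix[OF c(1) h(2)] hc by simp
  have p0: "p > 0" using p prime_gt_0_nat by blast
  have chz: "cj h z = z + e"
  proof -
    let ?g = "\<lambda>i. sc (of_nat i - 1) (cj (h [^] i) c)"
    have "cj h z = - (\<Sum>i<p. sc (of_nat i) (cj h (cj (h [^] i) c)))"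
      using cj_diff[of h 0 "\<Sum>i<p. sc (of_nat i) (cj (h [^] i) c)"] by (simp add: z_def cj_sum cj_sc)
    also have "(\<Sum>i<p. sc (of_nat i) (cj h (cj (h [^] i) c))) = (\<Sum>i<p. ?g (Suc i))"
    proof (rule sum.cong[OF refl])
      fix i
      have "h \<otimes> h [^] i = h [^] Suc i" by (rule nat_pow_Suc2[OF hc, symmetric])
      then show "sc (of_nat i) (cj h (cj (h [^] i) c)) = ?g (Suc i)" using hc by (simp only: cj_cj hi) simp
    qed
    \<comment> \<open>The shifted sum closes up cyclically: \<open>h [^] p\<close> lies in
      \<open>P\<close> and fixes \<open>c\<close>, while the coefficients at \<open>p\<close> and at
      \<open>0\<close> agree in characteristic \<open>p\<close>.\<close>
    also have "\<dots> = (\<Sum>i<p. ?g i)"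
    proof -
      have "of_nat p = (0::'k)" using of_nat_CHAR[where 'a = 'k] p(2) by simp
      then have "?g p = ?g 0" using hpc cc by (simp add: cj_one)
      moreover have "(\<Sum>i<Suc p. ?g i) = ?g 0 + (\<Sum>i<p. ?g (Suc i))" by (rule sum.lessThan_Suc_shift)
      ultimately show ?thesis by simp
    qed
    also have "\<dots> = (\<Sum>i<p. sc (of_nat i) (cj (h [^] i) c)) - (\<Sum>i<p. cj (h [^] i) c)"
      by (simp add: rmat.scale_left_diff_distrib sum_subtractf)
    finally show ?thesis using TrP[OF c(1)] c(4) by (simp add: z_def)
  qed
  have cjhe: "cj h e = e" using cje[of 1] hc by simp
  obtain f where f: "f \<in> fixA P" "f * f = f" "e * f = f" "f * e = f" "f \<noteq> 0"
    "\<And>i j. \<lbrakk>i < p; j < p; i \<noteq> j\<rbrakk> \<Longrightarrow> cj (h [^] i) f * cj (h [^] j) f = 0"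
    by (rule commuting_conj_idempotents[OF p P(1) hc h(2) norm[OF h(1)] eP e'(3,4) cjhe zP ezz chz]) blast
  let ?f = "\<lambda>i::nat. cj (h [^] i) f"
  have fcc: "f \<in> corner I" using f fixA_corner by blast
  have fi: "?f i \<in> corner I" "?f i * ?f i = ?f i" "e * ?f i = ?f i" "?f i * e = ?f i" for i
  proof -
    show "?f i \<in> corner I" using fcc hi by simp
    have "cj (h [^] i) (f * f) = ?f i * ?f i" "cj (h [^] i) (e * f) = e * ?f i" "cj (h [^] i) (f * e) = ?f i * e"
      using fcc e'(2) hi(1)[of i] cje by (simp_all add: cj_mult)
    then show "?f i * ?f i = ?f i" "e * ?f i = ?f i" "?f i * e = ?f i" using f by simp_all
  qed
  have rki: "rk (?f i) = rk f" for i
  proof -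
    have "rk ((\<rho> (h [^] i) * f) * \<rho> (inv (h [^] i))) = rk (\<rho> (inv (h [^] i)) * (\<rho> (h [^] i) * f))"
      using fcc hi(1)[of i] fi(2)[of i] f(2)
      by (intro rk_equiv[OF finI]) (auto simp: cj_def mult.assoc rho_inv_cancel)
    then show ?thesis using fcc hi by (simp add: cj_def rho_inv_cancel)
  qed
  have part: "(\<Sum>i<k. ?f i) \<in> corner I \<and> (\<Sum>i<k. ?f i) * (\<Sum>i<k. ?f i) = (\<Sum>i<k. ?f i)
      \<and> rk (\<Sum>i<k. ?f i) = k * rk f \<and> (\<forall>j<p. k \<le> j \<longrightarrow> (\<Sum>i<k. ?f i) * ?f j = 0 \<and> ?f j * (\<Sum>i<k. ?f i) = 0)"
    if "k \<le> p" for k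
    using that
  proof (induction k)
    case 0
    have "rk (0 :: ('i, 'k) rmat) = 0" using rk_add[OF finI, of 0 0] by simp
    then show ?case by simp
  next
    case (Suc k)
    let ?s = "\<Sum>i<k. ?f i"
    have IH: "?s \<in> corner I" "?s * ?s = ?s" "rk ?s = k * rk f" "?s * ?f k = 0" "?f k * ?s = 0"
      "\<And>j. \<lbrakk>j < p; k \<le> j\<rbrakk> \<Longrightarrow> ?s * ?f j = 0 \<and> ?f j * ?s = 0"
      using Suc by auto
    have "rk (?s + ?f k) = rk ?s + rk (?f k)" using IH fi by (intro rk_add[OF finI]) auto
    moreover have "?f k * ?f j = 0" "?f j * ?f k = 0" if "Suc k \<le> j" "j < p" for j
      using f(6)[of k j] f(6)[of j k] that by auto
    ultimately show ?case using IH fi[of k] rki[of k]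
      by (simp add: distrib_left distrib_right)
  qed
  let ?F = "\<Sum>i<p. ?f i"
  have TrF: "Tr H P f = ?F" by (rule TrP[OF f(1)])
  have FH: "?F \<in> fixA H" using Tr_fix[OF P(1) H P(2) f(1)] TrF by simp
  have FF: "?F * ?F = ?F" "rk ?F = p * rk f" using part[of p] by auto
  have eF: "e * ?F = ?F" "?F * e = ?F" by (simp_all add: sum_distrib_left sum_distrib_right fi)
  have "?F \<noteq> 0"
  proof
    assume "?F = 0"
    then have "(\<Sum>i<p. ?f i * ?f 0) = 0" unfolding sum_distrib_right[symmetric] by simp
    also have "(\<Sum>i<p. ?f i * ?f 0) = (\<Sum>i<p. if i = 0 then ?f 0 else 0)"
    proof (rule sum.cong[OF refl])
      fix i assume "i \<in> {..<p}"
      then show "?f i * ?f 0 = (if i = 0 then ?f 0 else 0)"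
        using f(6)[of i 0] fi(2)[of 0] p0 by (auto simp del: nat_pow_0)
    qed
    finally show False using p0 f(5) fcc by (simp add: sum.delta cj_one)
  qed
  \<comment> \<open>The conjugates of \<open>f\<close> add up to a non-zero idempotent fixed by
    \<open>H\<close> and lying below \<open>e\<close>, so primitivity applies. Thus the element
    \<open>c\<close> with trace \<open>e\<close> has been replaced by an idempotent.\<close>
  then have "?F = e" using e FH FF eF unfolding primitive_in_def by blast
  then show ?thesis using that[OF f(1,2)] TrF FF by simp
qed

text \<open>Both sides are additive in \<open>e\<close>, so \<open>e\<close> may be taken primitive.
  By Mackey and locality, \<open>e\<close> is then a relative trace from some
  \<open>H \<inter> conjg g D\<close>. If this is \<open>H\<close>, both sides are computed
  directly; otherwise Green's theorem writes \<open>e\<close> as the trace of an idempotent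
  \<open>f\<close> for a subgroup of index \<open>p\<close>, with \<open>p\<close> times smaller
  rank, and neither side changes. Splitting \<open>e\<close> lowers the rank and Green's theorem
  lowers the order of the group, hence the measure.\<close>

lemma rank_formula:
  assumes p: "prime p" "CHAR('k) = p" and D: "subgroup D G" "c \<in> fixA D" "Tr (carrier G) D c = idm I"
    and pD: "pgroup p D"
    and H: "subgroup H G" "pgroup p H" and e: "e \<in> fixA H" "e * e = e"
  shows "card H dvd card D * rk e \<and> of_nat (card D * rk e div card H) = mtr I (c * Tr (carrier G) H e)"
  using H e
proof (induction "card H + rk e" arbitrary: H e rule: less_induct)
  case less
  note H = less.prems(1,2) and e = less.prems(3,4)
  have Hc: "H \<subseteq> carrier G" by (rule subset_subgroup[OF H(1)])
  have ec: "e \<in> corner I" and cc: "c \<in> corner I" using e D fixA_corner by auto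
  have cH: "card H > 0" using H(1) finG subgroup.finite_imp_card_positive by blast
  have rk0: "rk (0 :: ('i, 'k) rmat) = 0" using rk_add[OF finI, of 0 0] by simp
  consider "e = 0" | f where "f \<in> fixA H" "f * f = f" "e * f = f" "f * e = f" "f \<noteq> 0" "f \<noteq> e" | "primitive_in H e"
    using e unfolding primitive_in_def by blast
  then show ?case
  proof cases
    case 1
    then show ?thesis by (simp add: rk0)
  next
    case 2
    let ?g = "e - f"
    have fc: "f \<in> corner I" using 2 fixA_corner by blast
    have g: "?g \<in> fixA H" "?g * ?g = ?g" "f * ?g = 0" "?g * f = 0" "?g \<noteq> 0" "?g \<in> corner I"
      using 2 e ec fc by (auto simp: left_diff_distrib right_diff_distrib)
    have rke: "rk e = rk f + rk ?g" using rk_add[OF finI fc g(6) 2(2) g(2,3,4)] by simp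
    have "rk f > 0" "rk ?g > 0" using rk_zero_iff[OF finI fc] rk_zero_iff[OF finI g(6)] 2 g by auto
    then have f': "card H dvd card D * rk f" "of_nat (card D * rk f div card H) = mtr I (c * Tr (carrier G) H f)"
      and g': "card H dvd card D * rk ?g" "of_nat (card D * rk ?g div card H) = mtr I (c * Tr (carrier G) H ?g)"
      using less.hyps[of H f] less.hyps[of H ?g] H 2 g rke by auto
    have "Tr (carrier G) H e = Tr (carrier G) H f + Tr (carrier G) H ?g" by (simp flip: Tr_add)
    moreover have "card D * rk e div card H = card D * rk f div card H + card D * rk ?g div card H"
      unfolding rke distrib_left using f'(1) by (rule div_plus_div_distrib_dvd_left)
    ultimately show ?thesis using f' g' rke by (simp add: distrib_left dvd_add)
  next
    case 3
    obtain T where T: "finite T" "T \<subseteq> carrier G"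
      "Tr (carrier G) D c = (\<Sum>g\<in>T. Tr H (H \<inter> conjg g D) (cj g c))"
      by (rule Tr_Mackey[OF H(1) D(1,2)])
    let ?x = "\<lambda>g. Tr H (H \<inter> conjg g D) (e * cj g c * e)"
    have S: "subgroup (H \<inter> conjg g D) G" if "g \<in> T" for g
      using H D T that by (intro subgroups_Inter_pair conjg_subgroup) auto
    have cg: "cj g c \<in> fixA (conjg g D)" "cj g c \<in> corner I" if "g \<in> T" for g
      using fixA_cj[OF D(1) _ D(2), of g] fixA_corner that T by auto
    have eS: "e * cj g c * e \<in> fixA (H \<inter> conjg g D)" if "g \<in> T" for g
      using fixA_mono[of "H \<inter> conjg g D" "conjg g D"] fixA_mono[of "H \<inter> conjg g D" H] cg[OF that] e
      by (intro fixA_closed) auto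
    have xe: "e * Tr H (H \<inter> conjg g D) (cj g c) * e = ?x g" if "g \<in> T" for g
      using cg[OF that] ec e by (simp add: Tr_mult[OF Hc])
    have xH: "?x g \<in> fixA H \<and> e * ?x g = ?x g \<and> ?x g * e = ?x g" if "g \<in> T" for g
      using Tr_fix[OF S[OF that] H(1) _ eS[OF that]] xe[OF that, symmetric] e
      by (simp add: mult.assoc) (simp add: mult.assoc[symmetric])
    have "(\<Sum>g\<in>T. ?x g) = e * (\<Sum>g\<in>T. Tr H (H \<inter> conjg g D) (cj g c)) * e"
      unfolding sum_distrib_left sum_distrib_right by (rule sum.cong) (use xe in auto)
    also have "\<dots> = e" unfolding T(3)[symmetric] D(3) using ec e by (simp add: idm_corner)
    finally have "inv_in H e (\<Sum>g\<in>T. ?x g)" using e by (auto simp: inv_in_def)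
    then have "\<exists>g\<in>T. inv_in H e (?x g)" by (intro inv_in_sum[OF 3 T(1) xH])
    then obtain g where g: "g \<in> T" "inv_in H e (?x g)" by (rule bexE)
    have gc: "g \<in> carrier G" using g T by auto
    show ?thesis
    proof (cases "H \<subseteq> conjg g D")
      case True
      let ?D = "conjg g D" and ?c = "cj g c"
      note D' = conjg_subgroup[OF D(1) gc]
      have TrHe: "Tr (carrier G) H e \<in> fixA (carrier G)"
        by (rule Tr_fix[OF H(1) subgroup_self Hc e(1)])
      have "mtr I (c * Tr (carrier G) H e) = mtr I (cj g (c * Tr (carrier G) H e))"
        using gc cc fixA_corner[OF TrHe] by (simp add: mtr_cj)
      also have "cj g (c * Tr (carrier G) H e) = ?c * Tr (carrier G) H e"
        using gc cc fixA_corner[OF TrHe] cj_fix[OF TrHe gc gc] by (simp add: cj_mult)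
      \<comment> \<open>Factor the trace of \<open>e\<close> through \<open>?D\<close>, then move
        the trace from \<open>?D\<close> to \<open>carrier G\<close> over to \<open>?c\<close>,
        where it gives the identity. What remains is the index of \<open>H\<close> in
        \<open>?D\<close> times the trace of \<open>e\<close>.\<close>
      also have "mtr I (?c * Tr (carrier G) H e) = mtr I (Tr (carrier G) ?D ?c * Tr ?D H e)"
        using mtr_Tr_symmetric[OF D' Tr_fix[OF H(1) D' True e(1)] cg(1)[OF g(1)]]
        unfolding Tr_trans[OF H(1) D' subgroup_self True subset_subgroup[OF D'] e(1)] .
      also have "Tr (carrier G) ?D ?c = idm I" using Tr_conj[OF D(1) gc D(2)] D(3) by simp
      also have "idm I * Tr ?D H e = Tr ?D H e"
        using Tr_corner[OF subset_subgroup[OF D'] ec] by (rule idm_corner)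
      also have "mtr I \<dots> = of_nat (csum ?D H (\<lambda>_. 1::nat)) * mtr I e"
        by (rule mtr_Tr[OF subset_subgroup[OF D'] ec])
      also have "mtr I e = of_nat (rk e)" by (rule mtr_idempotent[OF finI ec e(2)])
      finally have m: "mtr I (c * Tr (carrier G) H e) = of_nat (csum ?D H (\<lambda>_. 1::nat) * rk e)" by simp
      have "csum ?D H (\<lambda>_. 1::nat) * card H = card D"
        using index_mult_card'[OF finG H(1) D' True] card_conjg[OF subset_subgroup[OF D(1)] gc] by simp
      then have eq: "card D * rk e = card H * (csum ?D H (\<lambda>_. 1::nat) * rk e)" by (metis mult.assoc mult.commute)
      then have "card D * rk e div card H = csum ?D H (\<lambda>_. 1::nat) * rk e"
        using cH by (simp only: nonzero_mult_div_cancel_left)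
      then show ?thesis using m dvdI[OF eq] by (simp only:)
    next
      case False
      let ?S = "H \<inter> conjg g D"
      obtain P h where Ph: "subgroup P G" "?S \<subseteq> P" "P \<subseteq> H" "h \<in> H" "h [^] p \<in> P"
        "\<And>x. x \<in> H \<Longrightarrow> conjg x P = P" "card H = p * card P"
        "\<And>f :: 'g \<Rightarrow> ('i, 'k) rmat. (\<And>x d. \<lbrakk>x \<in> H; d \<in> P\<rbrakk> \<Longrightarrow> f (x \<otimes> d) = f x) \<Longrightarrow>
          csum H P f = (\<Sum>i<p. f (h [^] i))"
        by (rule pgroup_index_p_sub[OF finG p(1) H S[OF g(1)], where 'm = "('i, 'k) rmat"]) (use False in blast)+
      obtain w where w: "w \<in> fixA H" "e * w = w" "w * e = w" "?x g * w = e"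
        using g(2) by (auto simp: inv_in_def)
      have wc: "w \<in> corner I" using w fixA_corner by blast
      \<comment> \<open>The summand \<open>?x g\<close> is only a unit, not \<open>e\<close> itself;
        its inverse \<open>w\<close> is fixed by \<open>H\<close> and corrects the trace from
        \<open>P\<close> to \<open>e\<close>.\<close>
      define c1 where "c1 = Tr P ?S (e * cj g c * e) * w"
      have eP: "e \<in> fixA P" "w \<in> fixA P" using e w fixA_mono[OF Ph(3)] by auto
      have TP: "Tr P ?S (e * cj g c * e) \<in> fixA P" by (rule Tr_fix[OF S[OF g(1)] Ph(1,2) eS[OF g(1)]])
      have c1: "c1 \<in> fixA P" "e * c1 = c1" "c1 * e = c1"
      proof -
        show "c1 \<in> fixA P" using TP eP by (simp add: c1_def)
        show "c1 * e = c1" using w by (simp add: c1_def mult.assoc)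
        have "e * Tr P ?S (e * cj g c * e) = Tr P ?S (e * cj g c * e)"
          using Tr_mult(1)[OF subset_subgroup[OF Ph(1)] eP(1), of "e * cj g c * e"] ec cg(2)[OF g(1)] e(2)
          by (simp add: mult.assoc[symmetric])
        then show "e * c1 = c1" by (simp add: c1_def mult.assoc[symmetric])
      qed
      have "Tr H P c1 = Tr H P (Tr P ?S (e * cj g c * e)) * w"
        unfolding c1_def using Tr_mult(2)[OF Hc w(1) fixA_corner[OF TP]] by simp
      also have "Tr H P (Tr P ?S (e * cj g c * e)) = ?x g"
        by (rule Tr_trans[OF S[OF g(1)] Ph(1) H(1) Ph(2,3) eS[OF g(1)]])
      finally have Trc1: "Tr H P c1 = e" using w by simp
      obtain f where f: "f \<in> fixA P" "f * f = f" "Tr H P f = e" "rk e = p * rk f"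
        by (rule primitive_trace_split[OF p H(1) Ph(1,3,4,5,6,8) 3 c1 Trc1]) blast+
      have pP: "pgroup p P"
      proof -
        obtain a where "card H = p ^ a" using H(2) by (auto simp: pgroup_def)
        then have "card P dvd p ^ a" using Ph(7) by (metis dvd_triv_right)
        then show ?thesis unfolding pgroup_def using divides_primepow_nat[OF p(1)] by blast
      qed
      have "card P > 0" using Ph(1) finG subgroup.finite_imp_card_positive by blast
      then have "card P < card H" using Ph(7) prime_gt_1_nat[OF p(1)] by simp
      moreover have "rk f \<le> rk e" using f(4) prime_gt_0_nat[OF p(1)] by simp
      ultimately have "card P + rk f < card H + rk e" by linarith
      from less.hyps[OF this Ph(1) pP f(1,2)]
      have IH: "card P dvd card D * rk f" "of_nat (card D * rk f div card P) = mtr I (c * Tr (carrier G) P f)"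
        by blast+
      have "Tr (carrier G) P f = Tr (carrier G) H e"
        using Tr_trans[OF Ph(1) H(1) subgroup_self Ph(3) Hc f(1)] f(3) by simp
      moreover have "card D * rk e div card H = card D * rk f div card P"
        unfolding f(4) Ph(7) using prime_gt_0_nat[OF p(1)] by (simp add: mult.left_commute)
      moreover have "card H dvd card D * rk e"
        unfolding f(4) Ph(7) using IH(1) by (metis mult.left_commute mult_dvd_mono dvd_refl)
      ultimately show ?thesis using IH by simp
    qed
  qed
qed

end

context mrep
begin

lemma map_mat_csum: "map_mat (csum K H f) = csum K H (\<lambda>x. map_mat (f x))"
  by (rule qsum_additive) auto

text \<open>The lifting-free form of \<open>dim M = |G:D| \<cdot> tr c\<close>.\<close>

lemma dim_formula:
  assumes p: "prime p" "CHAR('k) = p" and D: "subgroup D G" "c \<in> fixA D" "Tr (carrier G) D c = idm I"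
    and pD: "pgroup p D" and P: "subgroup P G" "pgroup p P"
  shows "card P dvd card D * card I"
    and "of_nat (card D * card I div card P) = of_nat (csum (carrier G) P (\<lambda>_. 1::nat)) * mtr I c"
proof -
  \<comment> \<open>The formula is proved for the same matrices over the closure; since
    \<open>to_ac\<close> is injective, the resulting equation descends to \<open>k\<close>.\<close>
  interpret K: mrep_closed G I "\<lambda>g. map_mat (\<rho> g)"
    by unfold_locales (auto simp: finG finI rho_one rho_mult)
  have fixK: "map_mat a \<in> K.fixA H" if "a \<in> fixA H" for a H
    using that by (auto simp: fixA_def K.fixA_def simp flip: map_mat_hom(3))
  have cjK: "K.cj g (map_mat a) = map_mat (cj g a)" for g a by (simp add: cj_def K.cj_def)
  have TrK: "K.Tr H L (map_mat a) = map_mat (Tr H L a)" for H L a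
    by (simp add: Tr_def K.Tr_def map_mat_csum cjK)
  have cc: "c \<in> corner I" using D fixA_corner by blast
  have "card P dvd card D * rk (idm I :: ('i, 'k alg_closure) rmat) \<and>
    of_nat (card D * rk (idm I :: ('i, 'k alg_closure) rmat) div card P) = mtr I (map_mat c * K.Tr (carrier G) P (idm I))"
  proof (rule K.rank_formula[OF p(1) _ D(1) fixK[OF D(2)] _ pD P])
    show "CHAR('k alg_closure) = p" using p(2) by simp
    show "K.Tr (carrier G) D (map_mat c) = idm I" unfolding TrK D(3) by simp
    show "idm I \<in> K.fixA P" using subset_subgroup[OF P(1)] by simp
  qed simp
  moreover have "mtr I (map_mat c * K.Tr (carrier G) P (idm I))
      = of_nat (csum (carrier G) P (\<lambda>_. 1::nat)) * mtr I (map_mat c)"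
    by (rule K.mtr_Tr_idm) (use cc in simp)
  ultimately have *: "card P dvd card D * card I"
    "(of_nat (card D * card I div card P) :: 'k alg_closure) = of_nat (csum (carrier G) P (\<lambda>_. 1::nat)) * to_ac (mtr I c)"
    by (simp_all add: rk_idm[OF finI])
  show "card P dvd card D * card I" by (rule *(1))
  have "to_ac (of_nat (card D * card I div card P)) = to_ac (of_nat (csum (carrier G) P (\<lambda>_. 1::nat)) * mtr I c)"
    unfolding to_ac_mult to_ac_of_nat by (rule *(2))
  then show "of_nat (card D * card I div card P) = of_nat (csum (carrier G) P (\<lambda>_. 1::nat)) * mtr I c"
    by (simp only: to_ac_eq_iff)
qed

end

section \<open>Vertices of tensor products of matrix representations\<close>

context group
begin

text \<open>For each element \<open>s\<close> of the product set choose a factor \<open>q s\<close>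
  in \<open>Q\<close>. A pair \<open>(x, y)\<close> with product \<open>s\<close> is recovered from
  \<open>s\<close> and from \<open>inv (q s) \<otimes> x\<close>, which lies in \<open>Q\<close> and
  also in \<open>R\<close>. The product set need not be a subgroup.\<close>

lemma card_set_mult_ge:
  assumes Q: "subgroup Q G" and R: "subgroup R G" and fin: "finite (carrier G)"
  shows "card Q * card R \<le> card (Q <#> R) * card (Q \<inter> R)"
proof -
  have Qc: "Q \<subseteq> carrier G" and Rc: "R \<subseteq> carrier G" using Q R subset_subgroup by auto
  have fQ: "finite Q" "finite R" using finite_subset[OF Qc fin] finite_subset[OF Rc fin] by auto
  define q where "q = (\<lambda>s. SOME x. x \<in> Q \<and> (\<exists>y\<in>R. s = x \<otimes> y))"
  have q: "q (x \<otimes> y) \<in> Q \<and> (\<exists>z\<in>R. x \<otimes> y = q (x \<otimes> y) \<otimes> z)" if "x \<in> Q" "y \<in> R" for x y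
    unfolding q_def by (rule someI[of _ x]) (use that in auto)
  let ?f = "\<lambda>(x, y). (x \<otimes> y, inv (q (x \<otimes> y)) \<otimes> x)"
  have "inj_on ?f (Q \<times> R)"
  proof (rule inj_onI, clarify)
    fix x y x' y' assume a: "x \<in> Q" "y \<in> R" "x' \<in> Q" "y' \<in> R"
      and e: "x \<otimes> y = x' \<otimes> y'" "inv (q (x \<otimes> y)) \<otimes> x = inv (q (x' \<otimes> y')) \<otimes> x'"
    have c: "x \<in> carrier G" "y \<in> carrier G" "x' \<in> carrier G" "y' \<in> carrier G" using a Qc Rc by auto
    have "q (x \<otimes> y) \<in> carrier G" using q[OF a(1,2)] Qc by auto
    then have "x = x'" using e c by simp
    then show "x = x' \<and> y = y'" using e c by simp
  qed
  moreover have "?f ` (Q \<times> R) \<subseteq> (Q <#> R) \<times> (Q \<inter> R)"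
  proof clarify
    fix x y assume a: "x \<in> Q" "y \<in> R"
    have c: "x \<in> carrier G" "y \<in> carrier G" using a Qc Rc by auto
    obtain z where z: "q (x \<otimes> y) \<in> Q" "z \<in> R" "x \<otimes> y = q (x \<otimes> y) \<otimes> z" using q[OF a] by auto
    have zc: "q (x \<otimes> y) \<in> carrier G" "z \<in> carrier G" using z Qc Rc by auto
    have "inv (q (x \<otimes> y)) \<otimes> x = inv (q (x \<otimes> y)) \<otimes> (x \<otimes> y) \<otimes> inv y" using c zc by (simp add: m_assoc)
    also have "\<dots> = inv (q (x \<otimes> y)) \<otimes> (q (x \<otimes> y) \<otimes> z) \<otimes> inv y" using z(3) by simp
    also have "\<dots> = z \<otimes> inv y" using c zc by simp
    finally have *: "inv (q (x \<otimes> y)) \<otimes> x = z \<otimes> inv y" .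
    have "inv (q (x \<otimes> y)) \<otimes> x \<in> Q" using z a mult_subgroup[OF Q] inv_subgroup[OF Q] by blast
    moreover have "inv (q (x \<otimes> y)) \<otimes> x \<in> R" unfolding * using z a mult_subgroup[OF R] inv_subgroup[OF R] by blast
    moreover have "x \<otimes> y \<in> Q <#> R" using a by (auto simp: set_mult_def)
    ultimately show "x \<otimes> y \<in> Q <#> R \<and> inv (q (x \<otimes> y)) \<otimes> x \<in> Q \<inter> R" by blast
  qed
  moreover have "finite ((Q <#> R) \<times> (Q \<inter> R))"
    using fQ by (auto simp: set_mult_def)
  ultimately have "card (Q \<times> R) \<le> card ((Q <#> R) \<times> (Q \<inter> R))" by (rule card_inj_on_le)
  then show ?thesis by (simp add: card_cartesian_product)
qed

lemma sylow_exists: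
  assumes fin: "finite (carrier G)" and p: "prime p" and H: "subgroup H G"
  obtains P where "subgroup P G" "P \<subseteq> H" "card P = p ^ multiplicity p (card H)"
    "\<not> p dvd csum H P (\<lambda>_. 1::nat)"
proof -
  let ?H = "G\<lparr>carrier := H\<rparr>" and ?a = "multiplicity p (card H)"
  have cH: "card H > 0" using H fin subgroup.finite_imp_card_positive by blast
  interpret H: group ?H using subgroup.subgroup_is_group[OF H] is_group by blast
  obtain m where m: "card H = p ^ ?a * m" "\<not> p dvd m"
    using multiplicity_decompose'[of "card H" p] cH p by (metis mult.commute not_prime_unit less_numeral_extra(3))
  have f: "finite (carrier ?H)" using finite_subset[OF subset_subgroup[OF H] fin] by simp
  have o: "order ?H = p ^ ?a * m" using m(1) by (simp add: Coset.order_def)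
  obtain P where P: "subgroup P ?H" "card P = p ^ ?a"
    using sylow_thm[OF p H.is_group o f] by blast
  have P': "subgroup P G" "P \<subseteq> H"
    using incl_subgroup[OF H P(1)] subgroup.subset[OF P(1)] by auto
  have "csum H P (\<lambda>_. 1::nat) * p ^ ?a = m * p ^ ?a"
    using index_mult_card'[OF fin P'(1) H P'(2)] m P(2) by (simp add: mult.commute)
  then have "csum H P (\<lambda>_. 1::nat) = m" using p by (simp add: prime_gt_0_nat)
  then show ?thesis using that[OF P' P(2)] m by simp
qed

end

section \<open>Vertices in terms of relative traces\<close>

context mrep
begin

text \<open>Higman's criterion taken as the definition; \<open>rproj_iff\<close> identifies it with
  \<open>relatively_projective\<close> for the representation of a module.\<close>

definition rproj :: "'g set \<Rightarrow> bool" where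
  "rproj Q \<longleftrightarrow> (\<exists>c\<in>fixA Q. Tr (carrier G) Q c = idm I)"

definition vtx :: "'g set \<Rightarrow> bool" where
  "vtx Q \<longleftrightarrow> subgroup Q G \<and> rproj Q \<and> (\<forall>P. subgroup P G \<and> rproj P \<and> P \<subseteq> Q \<longrightarrow> P = Q)"

lemma rproj_conj:
  assumes "subgroup Q G" "g \<in> carrier G" "rproj Q"
  shows "rproj (conjg g Q)"
proof -
  obtain c where "c \<in> fixA Q" "Tr (carrier G) Q c = idm I" using assms(3) by (auto simp: rproj_def)
  then show ?thesis
    unfolding rproj_def using fixA_cj[OF assms(1,2)] Tr_conj[OF assms(1,2)] by (intro bexI[of _ "cj g c"]) auto
qed

lemma conjg_inv_conjg: "\<lbrakk>H \<subseteq> carrier G; g \<in> carrier G\<rbrakk> \<Longrightarrow> conjg (inv g) (conjg g H) = H"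
  using conjg_conjg[of H "inv g" g] conjg_one[of H] by simp

lemma vtx_conj:
  assumes "vtx Q" "g \<in> carrier G"
  shows "vtx (conjg g Q)"
  unfolding vtx_def
proof (intro conjI allI impI)
  have Q: "subgroup Q G" "rproj Q" using assms by (auto simp: vtx_def)
  note Qc = subset_subgroup[OF Q(1)]
  show "subgroup (conjg g Q) G" by (rule conjg_subgroup[OF Q(1) assms(2)])
  show "rproj (conjg g Q)" by (rule rproj_conj[OF Q(1) assms(2) Q(2)])
  fix P assume P: "subgroup P G \<and> rproj P \<and> P \<subseteq> conjg g Q"
  then have "conjg (inv g) P \<subseteq> conjg (inv g) (conjg g Q)" by (intro image_mono) blast
  then have "conjg (inv g) P \<subseteq> Q" unfolding conjg_inv_conjg[OF Qc assms(2)] .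
  moreover have "subgroup (conjg (inv g) P) G" "rproj (conjg (inv g) P)"
    using P assms(2) conjg_subgroup rproj_conj inv_closed by blast+
  ultimately have "conjg (inv g) P = Q" using assms(1) by (auto simp: vtx_def)
  then have "conjg g (conjg (inv g) P) = conjg g Q" by simp
  then show "P = conjg g Q"
    using conjg_inv_conjg[of P "inv g"] P assms(2) subset_subgroup[of P] by simp
qed

lemma vtx_below:
  assumes "subgroup Q G" "rproj Q"
  obtains P where "vtx P" "P \<subseteq> Q"
proof -
  let ?A = "{P. subgroup P G \<and> rproj P \<and> P \<subseteq> Q}"
  have "finite Q" by (rule finite_subset[OF subset_subgroup[OF assms(1)] finG])
  then have "finite ?A" by (rule_tac finite_subset[of _ "Pow Q"]) auto
  moreover have "?A \<noteq> {}" using assms by auto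
  ultimately have "\<exists>P\<in>?A. \<forall>R\<in>?A. R \<subseteq> P \<longrightarrow> P = R" by (rule finite_has_minimal)
  then obtain P where P: "P \<in> ?A" "\<forall>R\<in>?A. R \<subseteq> P \<longrightarrow> P = R" by (rule bexE)
  have "vtx P" unfolding vtx_def
  proof (intro conjI allI impI)
    fix R assume R: "subgroup R G \<and> rproj R \<and> R \<subseteq> P"
    then have "R \<in> ?A" using P(1) by auto
    then show "R = P" using P(2) R by auto
  qed (use P in auto)
  then show ?thesis using that P(1) by blast
qed

lemma rproj_carrier: "rproj (carrier G)"
  unfolding rproj_def using Tr_self[OF subgroup_self] by (intro bexI[of _ "idm I"]) auto

lemma Tr_fixed:
  assumes "subgroup K G" "a \<in> fixA K"
  shows "Tr K H a = sc (of_nat (csum K H (\<lambda>_. 1::nat))) a"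
proof -
  have "Tr K H a = csum K H (\<lambda>_. a)"
    unfolding Tr_def by (rule qsum_cong) (use cj_fix[OF assms(2)] mem_subgroup[OF assms(1)] in auto)
  also have "\<dots> = of_nat (csum K H (\<lambda>_. 1::nat)) * a" by (rule csum_const)
  also have "of_nat n * a = sc (of_nat n) a" for n
    by (induction n) (auto simp: distrib_right rmat.scale_left_distrib)
  finally show ?thesis .
qed

text \<open>The index of \<open>P\<close> in \<open>K\<close> is invertible in \<open>k\<close>, so
  dividing \<open>c\<close> by it gives an element whose trace from \<open>P\<close> to
  \<open>K\<close> is \<open>c\<close>. In particular the group itself may be replaced by a Sylow
  subgroup, and a minimal choice is a \<open>p\<close>-group.\<close>

lemma rproj_sylow:
  assumes p: "prime p" "CHAR('k) = p" and K: "subgroup K G" "rproj K" and P: "subgroup P G" "P \<subseteq> K"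
    and idx: "\<not> p dvd csum K P (\<lambda>_. 1::nat)"
  shows "rproj P"
proof -
  obtain c where c: "c \<in> fixA K" "Tr (carrier G) K c = idm I" using K(2) by (auto simp: rproj_def)
  let ?n = "of_nat (csum K P (\<lambda>_. 1::nat)) :: 'k"
  have n: "?n \<noteq> 0" using idx p by (simp add: of_nat_eq_0_iff_char_dvd)
  have c': "sc (1 / ?n) c \<in> fixA K" using c by auto
  have "Tr K P (sc (1 / ?n) c) = c" unfolding Tr_fixed[OF K(1) c'] using n by simp
  moreover have cP: "sc (1 / ?n) c \<in> fixA P" using c' fixA_mono[OF P(2)] by blast
  ultimately have "Tr (carrier G) P (sc (1 / ?n) c) = idm I"
    using Tr_trans[OF P(1) K(1) subgroup_self P(2) subset_subgroup[OF K(1)] cP] c by simp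
  then show ?thesis using cP by (auto simp: rproj_def)
qed

lemma vtx_pgroup:
  assumes p: "prime p" "CHAR('k) = p" and Q: "vtx Q"
  shows "pgroup p Q"
proof -
  have Q': "subgroup Q G" "rproj Q" using Q by (auto simp: vtx_def)
  obtain P where P: "subgroup P G" "P \<subseteq> Q" "card P = p ^ multiplicity p (card Q)" "\<not> p dvd csum Q P (\<lambda>_. 1::nat)"
    by (rule sylow_exists[OF finG p(1) Q'(1)])
  have "P = Q" using rproj_sylow[OF p Q' P(1,2,4)] P Q by (auto simp: vtx_def)
  then show ?thesis using P(3) by (auto simp: pgroup_def)
qed

text \<open>The representation is projective relative to the Sylow subgroup \<open>P\<close>, and
  \<open>b\<close> has non-zero trace, so \<open>conj_contained\<close> with \<open>P\<close> in the
  role of \<open>D\<close> puts \<open>Q\<close> into a conjugate of \<open>P\<close>.\<close>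

lemma conj_into_sylow:
  assumes p: "prime p" "CHAR('k) = p" and Q: "vtx Q" "b \<in> fixA Q" "mtr I b \<noteq> 0"
    and P: "subgroup P G" "\<not> p dvd csum (carrier G) P (\<lambda>_. 1::nat)"
  obtains Q' where "vtx Q'" "Q' \<subseteq> P"
proof -
  have Q': "subgroup Q G" using Q by (auto simp: vtx_def)
  have "rproj P" by (rule rproj_sylow[OF p subgroup_self rproj_carrier P(1) subset_subgroup[OF P(1)] P(2)])
  then obtain c where c: "c \<in> fixA P" "Tr (carrier G) P c = idm I" by (auto simp: rproj_def)
  obtain g where g: "g \<in> carrier G" "Q \<subseteq> conjg g P"
    using conj_contained[OF p P(1) c Q' vtx_pgroup[OF p Q(1)] Q(2,3)] by (rule bexE)
  have "conjg (inv g) Q \<subseteq> conjg (inv g) (conjg g P)" using g(2) by (rule image_mono)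
  then have "conjg (inv g) Q \<subseteq> P" unfolding conjg_inv_conjg[OF subset_subgroup[OF P(1)] g(1)] .
  then show ?thesis using that vtx_conj[OF Q(1), of "inv g"] g(1) by simp
qed

end

text \<open>Here \<open>A\<close>, \<open>B\<close>, \<open>C\<close>, \<open>D\<close> are the
  orders of \<open>P\<close>, \<open>Q\<close>, \<open>R\<close>, \<open>H\<close>, and
  \<open>m\<close>, \<open>n\<close> are the dimensions of the factors. With quotients
  \<open>x\<close>, \<open>y\<close>, \<open>z\<close> of the three divisibilities, multiplying out
  gives \<open>D * A * (x * y) = z * (B * C)\<close>, and \<open>z\<close> is prime to
  \<open>p\<close>.\<close>

lemma prime_power_count:
  fixes p A B C D :: nat
  assumes p: "prime p" and A: "A = p ^ a" "B * b = A" "C * c = A" "D = p ^ d" "B * C = p ^ e"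
    and n: "A dvd B * m" "A dvd C * n" "A dvd D * (m * n)" "\<not> p dvd D * (m * n) div A"
  shows "D * A \<le> B * C"
proof -
  have pos: "A > 0" using A(1) p prime_gt_0_nat by simp
  then have BC: "B > 0" "C > 0" using A(2,3) by (auto intro: Nat.gr0I)
  obtain x y where xy: "B * m = A * x" "C * n = A * y" using n(1,2) by (auto elim!: dvdE)
  obtain z where z: "D * (m * n) = A * z" using n(3) by (auto elim!: dvdE)
  have pz: "\<not> p dvd z" using n(4) z pos by simp
  have "A * (D * A * (x * y)) = D * ((B * m) * (C * n))" unfolding xy by (simp add: mult_ac)
  also have "\<dots> = (D * (m * n)) * (B * C)" by (simp add: mult_ac)
  also have "\<dots> = A * (z * (B * C))" unfolding z by (simp add: mult_ac)
  finally have "D * A * (x * y) = z * (B * C)" using pos by simp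
  then have "p ^ (d + a) dvd z * (B * C)" unfolding A(1,4) power_add by (metis dvd_triv_left)
  moreover have "coprime (p ^ (d + a)) z" using pz p by (simp add: prime_imp_coprime)
  ultimately have "p ^ (d + a) dvd B * C" by (simp add: coprime_dvd_mult_right_iff)
  then show ?thesis using BC A(1,4) by (simp add: power_add dvd_imp_le)
qed

section \<open>The tensor product of two representations\<close>

locale tensor_rep = group G for G :: "('g, 'r) monoid_scheme" (structure) +
  fixes I :: "'i set" and \<rho> :: "'g \<Rightarrow> ('i, 'k::field) rmat"
    and J :: "'j set" and \<sigma> :: "'g \<Rightarrow> ('j, 'k) rmat" and p :: nat
  assumes U: "mrep G I \<rho>" and V: "mrep G J \<sigma>"
    and prime_p: "prime p" and char_p: "CHAR('k) = p"
begin

sublocale U: mrep G I \<rho> by (rule U)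
sublocale V: mrep G J \<sigma> by (rule V)
sublocale W: mrep G "I \<times> J" "\<lambda>g. kron (\<rho> g) (\<sigma> g)"
  by unfold_locales (auto simp: U.finG U.finI V.finI U.rho_one V.rho_one U.rho_mult V.rho_mult kron_idm kron_mult)

lemma cj_kron: "W.cj g (kron a b) = kron (U.cj g a) (V.cj g b)"
  by (simp add: W.cj_def U.cj_def V.cj_def kron_mult)

lemma fixA_kron: "\<lbrakk>a \<in> U.fixA H; b \<in> V.fixA H\<rbrakk> \<Longrightarrow> kron a b \<in> W.fixA H"
  by (auto simp: U.fixA_def V.fixA_def W.fixA_def kron_corner kron_mult)

lemma Tr_kron_left: "W.Tr K H (kron a (idm J)) = kron (U.Tr K H a) (idm J)" if "K \<subseteq> carrier G"
proof -
  have "kron (U.Tr K H a) (idm J) = csum K H (\<lambda>x. kron (U.cj x a) (idm J))"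
    unfolding U.Tr_def by (rule qsum_additive) (auto simp: kron_add)
  also have "\<dots> = W.Tr K H (kron a (idm J))"
    unfolding W.Tr_def by (rule qsum_cong) (use that in \<open>auto simp: cj_kron\<close>)
  finally show ?thesis ..
qed

lemma Tr_kron_right: "W.Tr K H (kron (idm I) b) = kron (idm I) (V.Tr K H b)" if "K \<subseteq> carrier G"
proof -
  have "kron (idm I) (V.Tr K H b) = csum K H (\<lambda>x. kron (idm I) (V.cj x b))"
    unfolding V.Tr_def by (rule qsum_additive) (auto simp: kron_add)
  also have "\<dots> = W.Tr K H (kron (idm I) b)"
    unfolding W.Tr_def by (rule qsum_cong) (use that in \<open>auto simp: cj_kron\<close>)
  finally show ?thesis ..
qed

context
  assumes scalar: "\<And>a. a \<in> W.fixA (carrier G) \<Longrightarrow> \<exists>s. a = sc s (idm (I \<times> J))"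
    and nonzero: "(idm (I \<times> J) :: ('i \<times> 'j, 'k) rmat) \<noteq> 0"
begin

lemma rproj_intersection:
  assumes Q: "subgroup Q G" "U.rproj Q" and R: "subgroup R G" "V.rproj R"
  obtains g where "g \<in> carrier G" "W.rproj (Q \<inter> conjg g R)"
proof -
  obtain a where a: "a \<in> U.fixA Q" "U.Tr (carrier G) Q a = idm I" using Q(2) by (auto simp: U.rproj_def)
  obtain b where b: "b \<in> V.fixA R" "V.Tr (carrier G) R b = idm J" using R(2) by (auto simp: V.rproj_def)
  let ?a = "kron a (idm J)" and ?b = "kron (idm I) b"
  note Qc = subset_subgroup[OF Q(1)] and Rc = subset_subgroup[OF R(1)]
  have ab: "?a \<in> W.fixA Q" "?b \<in> W.fixA R"
    using fixA_kron[OF a(1) V.fixA_idm[OF Qc]] fixA_kron[OF U.fixA_idm[OF Rc] b(1)] by auto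
  have ac: "?a \<in> corner (I \<times> J)" and bc: "?b \<in> corner (I \<times> J)" using ab W.fixA_corner by auto
  have Ta: "W.Tr (carrier G) Q ?a = idm (I \<times> J)" using Tr_kron_left[OF subset_refl] a by (simp add: kron_idm)
  have Tb: "W.Tr (carrier G) R ?b = idm (I \<times> J)" using Tr_kron_right[OF subset_refl] b by (simp add: kron_idm)
  obtain T where T: "finite T" "T \<subseteq> carrier G"
    "W.Tr (carrier G) R ?b = (\<Sum>g\<in>T. W.Tr Q (Q \<inter> conjg g R) (W.cj g ?b))"
    by (rule W.Tr_Mackey[OF Q(1) R(1) ab(2)])
  let ?c = "\<lambda>g. ?a * W.cj g ?b"
  have S: "subgroup (Q \<inter> conjg g R) G" if "g \<in> T" for g
    using Q R T that by (intro subgroups_Inter_pair conjg_subgroup) auto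
  have bg: "W.cj g ?b \<in> W.fixA (conjg g R)" if "g \<in> T" for g
    using W.fixA_cj[OF R(1) _ ab(2)] T that by blast
  have cS: "?c g \<in> W.fixA (Q \<inter> conjg g R)" if "g \<in> T" for g
    using W.fixA_mono[of "Q \<inter> conjg g R" Q] W.fixA_mono[of "Q \<inter> conjg g R" "conjg g R"] ab(1) bg[OF that]
    by (intro W.fixA_closed) auto
  \<comment> \<open>The Mackey sum is the identity. Multiplying it by \<open>?a\<close>, which is
    fixed by \<open>Q\<close>, moves \<open>?a\<close> inside the traces to \<open>Q\<close>; the
    trace from \<open>Q\<close> to \<open>carrier G\<close> then gives the identity on the
    left.\<close>
  have "?a = ?a * (\<Sum>g\<in>T. W.Tr Q (Q \<inter> conjg g R) (W.cj g ?b))"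
    unfolding T(3)[symmetric] Tb using ac by (simp add: W.idm_corner)
  also have "\<dots> = (\<Sum>g\<in>T. W.Tr Q (Q \<inter> conjg g R) (?c g))"
    unfolding sum_distrib_left
    by (rule sum.cong[OF refl], rule W.Tr_mult(1)[OF Qc ab(1)]) (use bg W.fixA_corner in blast)
  finally have "W.Tr (carrier G) Q ?a = W.Tr (carrier G) Q (\<Sum>g\<in>T. W.Tr Q (Q \<inter> conjg g R) (?c g))"
    by (rule arg_cong)
  also have "\<dots> = (\<Sum>g\<in>T. W.Tr (carrier G) (Q \<inter> conjg g R) (?c g))"
    unfolding W.Tr_sum
    by (rule sum.cong[OF refl], rule W.Tr_trans[OF S Q(1) subgroup_self _ Qc cS]) auto
  finally have "(\<Sum>g\<in>T. W.Tr (carrier G) (Q \<inter> conjg g R) (?c g)) \<noteq> 0" using Ta nonzero by simp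
  then obtain g where g: "g \<in> T" "W.Tr (carrier G) (Q \<inter> conjg g R) (?c g) \<noteq> 0"
    by (rule sum.not_neutral_contains_not_neutral)
  have "W.Tr (carrier G) (Q \<inter> conjg g R) (?c g) \<in> W.fixA (carrier G)"
    using g S cS subset_subgroup[OF S] by (intro W.Tr_fix subgroup_self) auto
  then obtain s where s: "W.Tr (carrier G) (Q \<inter> conjg g R) (?c g) = sc s (idm (I \<times> J))" using scalar by blast
  then have "s \<noteq> 0" using g(2) by auto
  then have "W.Tr (carrier G) (Q \<inter> conjg g R) (sc (1 / s) (?c g)) = idm (I \<times> J)" using s by (simp add: W.Tr_sc)
  then have "W.rproj (Q \<inter> conjg g R)"
    unfolding W.rproj_def using cS[OF g(1)] by (intro bexI[of _ "sc (1 / s) (?c g)"]) auto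
  then show ?thesis using that g T by blast
qed

text \<open>The conditions \<open>bU\<close> and \<open>bV\<close> stand for sources of dimension
  prime to \<open>p\<close>. The second conclusion is the same property for the tensor product, from
  which the dimensions of its sources are read off.\<close>

theorem tensor_vertices:
  assumes bU: "\<And>Q. U.vtx Q \<Longrightarrow> \<exists>b\<in>U.fixA Q. mtr I b \<noteq> 0"
    and bV: "\<And>R. V.vtx R \<Longrightarrow> \<exists>b\<in>V.fixA R. mtr J b \<noteq> 0"
  shows "\<exists>Q R. U.vtx Q \<and> V.vtx R \<and> W.vtx (Q \<inter> R) \<and> sylow_subgroup p G (Q <#> R)"
    and "\<And>P. W.vtx P \<Longrightarrow> \<exists>b\<in>W.fixA P. mtr (I \<times> J) b \<noteq> 0"
proof -
  note p = prime_p char_p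
  obtain P where P: "subgroup P G" "card P = p ^ multiplicity p (card (carrier G))"
    "\<not> p dvd csum (carrier G) P (\<lambda>_. 1::nat)"
    by (rule sylow_exists[OF U.finG p(1) subgroup_self])
  have pP: "pgroup p P" using P(2) by (auto simp: pgroup_def)
  have fP: "finite P" by (rule finite_subset[OF subset_subgroup[OF P(1)] U.finG])
  obtain Q0 where Q0: "U.vtx Q0" by (rule U.vtx_below[OF subgroup_self U.rproj_carrier])
  obtain R0 where R0: "V.vtx R0" by (rule V.vtx_below[OF subgroup_self V.rproj_carrier])
  obtain b0 where "b0 \<in> U.fixA Q0" "mtr I b0 \<noteq> 0" using bU[OF Q0] by (rule bexE)
  then obtain Q where Q: "U.vtx Q" "Q \<subseteq> P" by (rule U.conj_into_sylow[OF p Q0 _ _ P(1,3)])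
  obtain c0 where "c0 \<in> V.fixA R0" "mtr J c0 \<noteq> 0" using bV[OF R0] by (rule bexE)
  then obtain R where R: "V.vtx R" "R \<subseteq> P" by (rule V.conj_into_sylow[OF p R0 _ _ P(1,3)])
  have Q': "subgroup Q G" "U.rproj Q" using Q by (auto simp: U.vtx_def)
  have R': "subgroup R G" "V.rproj R" using R by (auto simp: V.vtx_def)
  note Qc = subset_subgroup[OF Q'(1)] and Rc = subset_subgroup[OF R'(1)]
  have pQ: "pgroup p Q" and pR: "pgroup p R" using U.vtx_pgroup[OF p Q(1)] V.vtx_pgroup[OF p R(1)] by auto
  obtain bu where bu: "bu \<in> U.fixA Q" "mtr I bu \<noteq> 0" using bU[OF Q(1)] by (rule bexE)
  obtain bv where bv: "bv \<in> V.fixA R" "mtr J bv \<noteq> 0" using bV[OF R(1)] by (rule bexE)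
  obtain g where g: "g \<in> carrier G" "W.rproj (Q \<inter> conjg g R)" by (rule rproj_intersection[OF Q' R'])
  define H where "H = Q \<inter> conjg g R"
  have H: "subgroup H G" "W.rproj H" unfolding H_def
    using g Q' R' by (auto intro: subgroups_Inter_pair conjg_subgroup)
  note Hc = subset_subgroup[OF H(1)]
  have fin: "finite K" if "K \<subseteq> carrier G" for K using that U.finG finite_subset by blast
  have sub_p: "pgroup p K" if K: "subgroup K G" "K \<subseteq> Q" for K
  proof -
    obtain a where a: "card Q = p ^ a" using pQ by (auto simp: pgroup_def)
    have "card K dvd p ^ a" using index_mult_card'[OF U.finG K(1) Q'(1) K(2)] a by (metis dvd_triv_right)
    then show ?thesis unfolding pgroup_def using divides_primepow_nat[OF p(1)] by blast
  qed
  have pH: "pgroup p H" by (rule sub_p[OF H(1)]) (simp add: H_def)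
  define b where "b = kron bu (V.cj g bv)"
  have b: "b \<in> W.fixA H" unfolding b_def
  proof (rule fixA_kron)
    show "bu \<in> U.fixA H" using U.fixA_mono[of H Q] bu by (auto simp: H_def)
    show "V.cj g bv \<in> V.fixA H" using V.fixA_mono[of H "conjg g R"] V.fixA_cj[OF R'(1) g(1) bv(1)] by (auto simp: H_def)
  qed
  have trb: "mtr (I \<times> J) b \<noteq> 0"
    using bu(2) bv(2) V.fixA_corner[OF bv(1)] g(1) by (simp add: b_def mtr_kron V.mtr_cj)
  obtain c where c: "c \<in> W.fixA H" "W.Tr (carrier G) H c = idm (I \<times> J)" using H(2) by (auto simp: W.rproj_def)
  have cc: "c \<in> corner (I \<times> J)" and bc: "b \<in> corner (I \<times> J)" using c b W.fixA_corner by auto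
  \<comment> \<open>By symmetry of the trace form,
    \<open>tr b = tr (Tr c * b) = tr (c * Tr b)\<close>, and \<open>Tr b\<close> is a scalar
    \<open>s\<close>; so \<open>tr b\<close> is \<open>s\<close> times \<open>tr c\<close>.\<close>
  have trc: "mtr (I \<times> J) c \<noteq> 0"
  proof
    assume 0: "mtr (I \<times> J) c = 0"
    obtain s where s: "W.Tr (carrier G) H b = sc s (idm (I \<times> J))"
      using scalar[OF W.Tr_fix[OF H(1) subgroup_self Hc b]] by blast
    have "mtr (I \<times> J) b = mtr (I \<times> J) (W.Tr (carrier G) H c * b)" using c(2) bc by (simp add: W.idm_corner)
    also have "\<dots> = mtr (I \<times> J) (c * W.Tr (carrier G) H b)" by (rule W.mtr_Tr_symmetric[OF H(1) b c(1), symmetric])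
    also have "\<dots> = mtr (I \<times> J) (sc s c)" unfolding s using cc by (simp add: sc_mult(2)[symmetric] W.idm_corner)
    also have "\<dots> = 0" using 0 by simp
    finally show False using trb by simp
  qed
  \<comment> \<open>A vertex \<open>D\<close> inside \<open>H\<close> contains \<open>H\<close> up
    to conjugacy, because \<open>b\<close> commutes with \<open>H\<close> and has non-zero trace;
    hence the orders agree.\<close>
  have vH: "W.vtx H"
  proof -
    obtain D where D: "W.vtx D" "D \<subseteq> H" by (rule W.vtx_below[OF H])
    then have D': "subgroup D G" "W.rproj D" by (auto simp: W.vtx_def)
    obtain d where d: "d \<in> W.fixA D" "W.Tr (carrier G) D d = idm (I \<times> J)" using D'(2) by (auto simp: W.rproj_def)
    obtain x where x: "x \<in> carrier G" "H \<subseteq> conjg x D"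
      using W.conj_contained[OF p D'(1) d H(1) pH b trb] by (rule bexE)
    have "card H \<le> card D"
      using card_mono[OF fin x(2)] subset_subgroup[OF conjg_subgroup[OF D'(1) x(1)]]
        card_conjg[OF subset_subgroup[OF D'(1)] x(1)] by simp
    then have "D = H" using card_seteq[OF fin[OF Hc] D(2)] by simp
    then show ?thesis using D(1) by simp
  qed
  \<comment> \<open>A conjugate of \<open>H\<close> lies in \<open>P\<close> and is itself
    admissible, so it equals \<open>P\<close> by minimality. Conjugating \<open>b\<close>
    accordingly preserves its trace.\<close>
  show "\<exists>b\<in>W.fixA P. mtr (I \<times> J) b \<noteq> 0" if P: "W.vtx P" for P
  proof -
    have P': "subgroup P G" "W.rproj P" using P by (auto simp: W.vtx_def)
    obtain d where d: "d \<in> W.fixA P" "W.Tr (carrier G) P d = idm (I \<times> J)" using P'(2) by (auto simp: W.rproj_def)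
    obtain x where x: "x \<in> carrier G" "H \<subseteq> conjg x P"
      using W.conj_contained[OF p P'(1) d H(1) pH b trb] by (rule bexE)
    have xi: "inv x \<in> carrier G" using x by simp
    have "conjg (inv x) H \<subseteq> conjg (inv x) (conjg x P)" using x(2) by (rule image_mono)
    then have "conjg (inv x) H \<subseteq> P" unfolding W.conjg_inv_conjg[OF subset_subgroup[OF P'(1)] x(1)] .
    then have "conjg (inv x) H = P"
      using P conjg_subgroup[OF H(1) xi] W.rproj_conj[OF H(1) xi H(2)] unfolding W.vtx_def by blast
    then have "W.cj (inv x) b \<in> W.fixA P" using W.fixA_cj[OF H(1) xi b] by simp
    moreover have "mtr (I \<times> J) (W.cj (inv x) b) \<noteq> 0" using W.mtr_cj[OF xi bc] trb by simp
    ultimately show ?thesis by blast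
  qed
  obtain u where u: "u \<in> U.fixA Q" "U.Tr (carrier G) Q u = idm I" using Q'(2) by (auto simp: U.rproj_def)
  obtain v where v: "v \<in> V.fixA R" "V.Tr (carrier G) R v = idm J" using R'(2) by (auto simp: V.rproj_def)
  have dU: "card P dvd card Q * card I" by (rule U.dim_formula(1)[OF p Q'(1) u pQ P(1) pP])
  have dV: "card P dvd card R * card J" by (rule V.dim_formula(1)[OF p R'(1) v pR P(1) pP])
  have dW: "card P dvd card H * (card I * card J)"
    using W.dim_formula(1)[OF p H(1) c pH P(1) pP] by (simp add: card_cartesian_product)
  have "(of_nat (card H * (card I * card J) div card P) :: 'k) \<noteq> 0"
    using W.dim_formula(2)[OF p H(1) c pH P(1) pP] trc P(3) p
    by (simp add: card_cartesian_product of_nat_eq_0_iff_char_dvd)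
  then have nW: "\<not> p dvd card H * (card I * card J) div card P" using p by (simp add: of_nat_eq_0_iff_char_dvd)
  obtain q r h where qrh: "card Q = p ^ q" "card R = p ^ r" "card H = p ^ h"
    using pQ pR pH by (auto simp: pgroup_def)
  have iQ: "card Q * csum P Q (\<lambda>_. 1::nat) = card P" using index_mult_card'[OF U.finG Q'(1) P(1) Q(2)] by (simp add: mult.commute)
  have iR: "card R * csum P R (\<lambda>_. 1::nat) = card P" using index_mult_card'[OF U.finG R'(1) P(1) R(2)] by (simp add: mult.commute)
  have ge1: "card H * card P \<le> card Q * card R"
    by (rule prime_power_count[OF p(1) P(2) iQ iR qrh(3) _ dU dV dW nW, of "q + r"]) (simp add: qrh power_add)
  have sQR: "subgroup (Q \<inter> R) G" by (rule subgroups_Inter_pair[OF Q'(1) R'(1)])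
  have "kron bu bv \<in> W.fixA (Q \<inter> R)"
    using U.fixA_mono[of "Q \<inter> R" Q] V.fixA_mono[of "Q \<inter> R" R] bu bv by (intro fixA_kron) auto
  moreover have "mtr (I \<times> J) (kron bu bv) \<noteq> 0" using bu(2) bv(2) by (simp add: mtr_kron)
  moreover have "pgroup p (Q \<inter> R)" by (rule sub_p[OF sQR]) simp
  ultimately have "\<exists>x\<in>carrier G. Q \<inter> R \<subseteq> conjg x H"
    by (intro W.conj_contained[OF p H(1) c sQR])
  then obtain x where x: "x \<in> carrier G" "Q \<inter> R \<subseteq> conjg x H" by (rule bexE)
  have cxH: "card (conjg x H) = card H" by (rule card_conjg[OF Hc x(1)])
  have fxH: "finite (conjg x H)" by (rule fin[OF subset_subgroup[OF conjg_subgroup[OF H(1) x(1)]]])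
  have le1: "card (Q \<inter> R) \<le> card H" using card_mono[OF fxH x(2)] cxH by simp
  have QRP: "Q <#> R \<subseteq> P"
    using Q(2) R(2) mult_subgroup[OF P(1)] by (auto simp: set_mult_def)
  have le2: "card (Q <#> R) \<le> card P" by (rule card_mono[OF fP QRP])
  have ge2: "card Q * card R \<le> card (Q <#> R) * card (Q \<inter> R)" by (rule card_set_mult_ge[OF Q'(1) R'(1) U.finG])
  have pos: "card (Q \<inter> R) > 0" "card P > 0"
    using sQR P(1) U.finG subgroup.finite_imp_card_positive by blast+
  have m1: "card (Q <#> R) * card (Q \<inter> R) \<le> card P * card (Q \<inter> R)" using le2 by simp
  have m2: "card P * card (Q \<inter> R) \<le> card P * card H" using le1 by simp
  have "card P * card (Q \<inter> R) = card P * card H" "card (Q <#> R) * card (Q \<inter> R) = card P * card (Q \<inter> R)"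
    using ge1 ge2 m1 m2 unfolding mult.commute[of "card H"] by linarith+
  then have eqs: "card (Q \<inter> R) = card H" "card (Q <#> R) = card P" using pos by simp_all
  have "Q \<inter> R = conjg x H" using card_seteq[OF fxH x(2)] eqs(1) cxH by simp
  then have "W.vtx (Q \<inter> R)" using W.vtx_conj[OF vH x(1)] by simp
  moreover have "Q <#> R = P" using card_seteq[OF fP QRP] eqs(2) by simp
  then have "sylow_subgroup p G (Q <#> R)" using P by (simp add: sylow_subgroup_def Coset.order_def)
  ultimately show "\<exists>Q R. U.vtx Q \<and> V.vtx R \<and> W.vtx (Q \<inter> R) \<and> sylow_subgroup p G (Q <#> R)"
    using Q(1) R(1) by blast
qed

end

end

section \<open>Coordinates of modules\<close>

lemma (in kG_module) act_zero: "g \<in> carrier G \<Longrightarrow> act M g 0 = 0"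
  using act_scl[of g 0 0] subspace_0[OF subspace_space] by simp

text \<open>Additivity is assumed on \<open>C\<close> only, because module actions and homomorphisms
  are unconstrained outside \<open>space M\<close>.\<close>

lemma hom_sum:
  assumes "\<And>x y. \<lbrakk>x \<in> C; y \<in> C\<rbrakk> \<Longrightarrow> x + y \<in> C" "(0 :: 'a::comm_monoid_add) \<in> C"
    and "\<And>x y. \<lbrakk>x \<in> C; y \<in> C\<rbrakk> \<Longrightarrow> f (x + y) = f x + (f y :: 'b::comm_monoid_add)" "f 0 = 0"
    and "\<And>t. t \<in> T \<Longrightarrow> g t \<in> C"
  shows "f (sum g T) = (\<Sum>t\<in>T. f (g t))" "sum g T \<in> C"
proof -
  have "sum g T \<in> C \<and> f (sum g T) = (\<Sum>t\<in>T. f (g t))"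
    using assms(5) by (induction T rule: infinite_finite_induct) (use assms in auto)
  then show "f (sum g T) = (\<Sum>t\<in>T. f (g t))" "sum g T \<in> C" by auto
qed

lemma qsum_hom:
  assumes "\<And>x y. \<lbrakk>x \<in> C; y \<in> C\<rbrakk> \<Longrightarrow> x + y \<in> C" "(0 :: 'a::comm_monoid_add) \<in> C"
    and "\<And>x y. \<lbrakk>x \<in> C; y \<in> C\<rbrakk> \<Longrightarrow> f (x + y) = f x + (f y :: 'b::comm_monoid_add)" "f 0 = 0"
    and "\<And>t. t \<in> K \<Longrightarrow> g t \<in> C"
  shows "f (qsum K q g) = qsum K q (\<lambda>t. f (g t))" "qsum K q g \<in> C"
proof -
  have g: "g (SOME x. x \<in> K \<and> q x = c) \<in> C" if "c \<in> q ` K" for c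
  proof -
    have "\<exists>x. x \<in> K \<and> q x = c" using that by blast
    from someI_ex[OF this] show ?thesis using assms(5) by blast
  qed
  show "f (qsum K q g) = qsum K q (\<lambda>t. f (g t))" "qsum K q g \<in> C"
    unfolding qsum_def using hom_sum[OF assms(1-4), of "q ` K" "\<lambda>c. g (SOME x. x \<in> K \<and> q x = c)"] g
    by blast+
qed

text \<open>The basis is a family and not a set: the basis of a tensor product is then indexed by
  \<open>I \<times> J\<close>, so that its matrices are literally Kronecker products.\<close>

locale kG_coord = kG_module G M
  for G :: "('g, 'r) monoid_scheme" (structure) and M :: "('k::field, 'g, 'v::ab_group_add) gmod" +
  fixes I :: "'i set" and \<beta> :: "'i \<Rightarrow> 'v"
  assumes finG: "finite (carrier G)" and finI: "finite I" and inj_basis: "inj_on \<beta> I"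
    and indep: "independent (\<beta> ` I)" and span_basis: "span (\<beta> ` I) = space M"
begin

definition co :: "'v \<Rightarrow> 'i \<Rightarrow> 'k" where
  "co v i = (if i \<in> I then representation (\<beta> ` I) v (\<beta> i) else 0)"

definition emb :: "('i \<Rightarrow> 'k) \<Rightarrow> 'v" where
  "emb x = (\<Sum>i\<in>I. scl M (x i) (\<beta> i))"

definition lin_endo :: "('v \<Rightarrow> 'v) \<Rightarrow> bool" where
  "lin_endo f \<longleftrightarrow> f ` space M \<subseteq> space M \<and> (\<forall>v\<in>space M. \<forall>w\<in>space M. f (v + w) = f v + f w)
     \<and> (\<forall>c. \<forall>v\<in>space M. f (scl M c v) = scl M c (f v))"

definition mat :: "('v \<Rightarrow> 'v) \<Rightarrow> ('i, 'k) rmat" where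
  "mat f = Mat (\<lambda>i j. if j \<in> I then co (f (\<beta> j)) i else 0)"

text \<open>Passing through \<open>emb\<close> makes all values lie in \<open>space M\<close>, for
  arbitrary \<open>a\<close> and \<open>v\<close>. For \<open>a\<close> in the corner this is the
  operator with matrix \<open>a\<close>, inverse to \<open>mat\<close> on linear
  endomorphisms.\<close>

definition op :: "('i, 'k) rmat \<Rightarrow> 'v \<Rightarrow> 'v" where
  "op a v = emb (\<lambda>i. \<Sum>j\<in>I. ent a i j * co v j)"

lemma beta_space: "i \<in> I \<Longrightarrow> \<beta> i \<in> space M"
  using span_base[of "\<beta> i" "\<beta> ` I"] span_basis by auto

lemma zero_space [simp]: "0 \<in> space M"
  by (rule subspace_0[OF subspace_space])

lemma add_space: "\<lbrakk>v \<in> space M; w \<in> space M\<rbrakk> \<Longrightarrow> v + w \<in> space M"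
  by (rule subspace_add[OF subspace_space])

lemma scl_space: "v \<in> space M \<Longrightarrow> scl M c v \<in> space M"
  by (rule subspace_scale[OF subspace_space])

lemma sum_space: "(\<And>t. t \<in> T \<Longrightarrow> g t \<in> space M) \<Longrightarrow> sum g T \<in> space M"
  by (rule subspace_sum[OF subspace_space])

lemma emb_space [simp]: "emb x \<in> space M"
  unfolding emb_def by (intro sum_space scl_space beta_space)

lemma emb_co: "v \<in> space M \<Longrightarrow> emb (co v) = v"
proof -
  assume v: "v \<in> space M"
  have "emb (co v) = (\<Sum>i\<in>I. scl M (representation (\<beta> ` I) v (\<beta> i)) (\<beta> i))"
    unfolding emb_def by (rule sum.cong) (auto simp: co_def)
  also have "\<dots> = (\<Sum>b\<in>\<beta> ` I. scl M (representation (\<beta> ` I) v b) b)"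
    by (rule sum.reindex_cong[OF inj_basis, symmetric]) auto
  also have "\<dots> = v" by (rule sum_representation_eq) (use v indep span_basis finI in auto)
  finally show ?thesis .
qed

lemma co_add: "\<lbrakk>v \<in> space M; w \<in> space M\<rbrakk> \<Longrightarrow> co (v + w) i = co v i + co w i"
  using representation_add[OF indep] span_basis by (simp add: co_def)

lemma co_scl: "v \<in> space M \<Longrightarrow> co (scl M c v) i = c * co v i"
  using representation_scale[OF indep] span_basis by (simp add: co_def)

lemma co_zero [simp]: "co 0 i = 0"
  using co_scl[of 0 0 i] by simp

lemma co_sum: "(\<And>t. t \<in> T \<Longrightarrow> g t \<in> space M) \<Longrightarrow> co (sum g T) i = (\<Sum>t\<in>T. co (g t) i)"
  by (rule hom_sum(1)[of "space M"]) (auto simp: add_space co_add)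

lemma co_beta: "j \<in> I \<Longrightarrow> co (\<beta> j) i = (if i = j then 1 else 0)"
  using representation_basis[OF indep, of "\<beta> j"] inj_basis by (auto simp: co_def inj_on_def)

lemma co_emb: "co (emb x) i = (if i \<in> I then x i else 0)"
proof -
  have "co (emb x) i = (\<Sum>j\<in>I. x j * (if i = j then 1 else 0))"
    unfolding emb_def by (subst co_sum) (auto simp: scl_space beta_space co_scl co_beta)
  also have "\<dots> = (\<Sum>j\<in>I. if j = i then x i else 0)" by (rule sum.cong) auto
  finally show ?thesis using finI by (simp add: sum.delta)
qed

lemma co_outside: "i \<notin> I \<Longrightarrow> co v i = 0"
  by (simp add: co_def)

lemma co_inject: "\<lbrakk>v \<in> space M; w \<in> space M; \<And>i. i \<in> I \<Longrightarrow> co v i = co w i\<rbrakk> \<Longrightarrow> v = w"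
proof -
  assume vw: "v \<in> space M" "w \<in> space M" "\<And>i. i \<in> I \<Longrightarrow> co v i = co w i"
  have "emb (co v) = emb (co w)" unfolding emb_def by (rule sum.cong) (simp_all add: vw(3))
  then show "v = w" using emb_co vw by simp
qed

lemma ent_mat: "ent (mat f) i j = (if j \<in> I then co (f (\<beta> j)) i else 0)"
proof -
  have "finite {j. (if j \<in> I then co (f (\<beta> j)) i else 0) \<noteq> 0}" for i
    by (rule finite_subset[OF _ finI]) auto
  then show ?thesis unfolding mat_def by (subst ent_Mat) auto
qed

lemma mat_corner [simp]: "mat f \<in> corner I"
  by (auto simp: corner_def ent_mat co_outside split: if_splits intro: ccontr)

lemma op_space [simp]: "op a v \<in> space M"
  by (simp add: op_def)

lemma co_op: "a \<in> corner I \<Longrightarrow> co (op a v) i = (\<Sum>j\<in>I. ent a i j * co v j)"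
proof -
  assume a: "a \<in> corner I"
  have "ent a i j = 0" if "i \<notin> I" for j using corner_finite_rows[OF a, of i j] that by auto
  then show ?thesis by (simp add: op_def co_emb)
qed

lemma lin_endo_space: "lin_endo f \<Longrightarrow> v \<in> space M \<Longrightarrow> f v \<in> space M"
  by (auto simp: lin_endo_def)

lemma lin_endo_zero: "lin_endo f \<Longrightarrow> f 0 = 0"
proof -
  assume "lin_endo f"
  then have "f (0 + 0) = f 0 + f 0" unfolding lin_endo_def by (meson zero_space)
  then show ?thesis by simp
qed

lemma lin_endo_sum:
  assumes "lin_endo f" "\<And>t. t \<in> T \<Longrightarrow> g t \<in> space M"
  shows "f (sum g T) = (\<Sum>t\<in>T. f (g t))"
  by (rule hom_sum(1)[of "space M"])
    (use assms lin_endo_zero[OF assms(1)] in \<open>auto simp: add_space lin_endo_def\<close>)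

lemma op_mat: "lin_endo f \<Longrightarrow> v \<in> space M \<Longrightarrow> op (mat f) v = f v"
proof -
  assume f: "lin_endo f" and v: "v \<in> space M"
  have fb: "f (\<beta> j) \<in> space M" if "j \<in> I" for j using f beta_space[OF that] lin_endo_space by blast
  have "f v = f (\<Sum>j\<in>I. scl M (co v j) (\<beta> j))" using emb_co[OF v] by (simp add: emb_def)
  also have "\<dots> = (\<Sum>j\<in>I. f (scl M (co v j) (\<beta> j)))"
    by (rule lin_endo_sum[OF f]) (simp add: scl_space beta_space)
  also have "\<dots> = (\<Sum>j\<in>I. scl M (co v j) (f (\<beta> j)))"
    using f beta_space by (intro sum.cong) (auto simp: lin_endo_def)
  finally have fv: "f v = (\<Sum>j\<in>I. scl M (co v j) (f (\<beta> j)))" .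
  show ?thesis
  proof (rule co_inject)
    show "f v \<in> space M" by (rule lin_endo_space[OF f v])
    fix i assume "i \<in> I"
    have "co (f v) i = (\<Sum>j\<in>I. co v j * co (f (\<beta> j)) i)"
      unfolding fv by (subst co_sum) (auto simp: scl_space fb co_scl)
    then show "co (op (mat f) v) i = co (f v) i"
      by (simp add: co_op ent_mat mult.commute)
  qed simp
qed

lemma op_add: "op (a + b) v = op a v + op b v"
  by (simp add: op_def emb_def distrib_right sum.distrib scale_left_distrib)

lemma op_zero [simp]: "op 0 v = 0"
  by (simp add: op_def emb_def)

lemma op_diff: "op (a - b) v = op a v - op b v"
  by (simp add: op_def emb_def left_diff_distrib sum_subtractf scale_left_diff_distrib)

lemma op_sc: "op (sc c a) v = scl M c (op a v)"
  by (simp add: op_def emb_def scale_sum_right sum_distrib_left mult.assoc)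

lemma op_mult: "\<lbrakk>a \<in> corner I; b \<in> corner I\<rbrakk> \<Longrightarrow> op (a * b) v = op a (op b v)"
proof (rule co_inject)
  fix i assume ab: "a \<in> corner I" "b \<in> corner I"
  have "co (op (a * b) v) i = (\<Sum>j\<in>I. \<Sum>l\<in>I. ent a i l * ent b l j * co v j)"
    using ab by (simp add: co_op ent_mult_corner[OF finI] sum_distrib_right)
  also have "\<dots> = (\<Sum>l\<in>I. \<Sum>j\<in>I. ent a i l * ent b l j * co v j)" by (rule sum.swap)
  also have "\<dots> = co (op a (op b v)) i"
    using ab by (simp add: co_op sum_distrib_left mult.assoc)
  finally show "co (op (a * b) v) i = co (op a (op b v)) i" .
qed simp_all

lemma op_idm: "v \<in> space M \<Longrightarrow> op (idm I) v = v"
proof (rule co_inject)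
  fix i assume "i \<in> I"
  have "(\<Sum>j\<in>I. ent (idm I) i j * co v j) = (\<Sum>j\<in>I. if j = i then co v i else 0)"
    using \<open>i \<in> I\<close> by (intro sum.cong) (auto simp: ent_idm)
  then show "co (op (idm I) v) i = co v i" using finI \<open>i \<in> I\<close> by (simp add: co_op sum.delta)
qed simp_all

lemma op_lin: "lin_endo (op a)"
proof -
  have "op a (v + w) = op a v + op a w" if "v \<in> space M" "w \<in> space M" for v w
    by (simp add: op_def emb_def co_add[OF that] distrib_left sum.distrib scale_left_distrib)
  moreover have "op a (scl M c v) = scl M c (op a v)" if "v \<in> space M" for c v
    by (simp add: op_def emb_def co_scl[OF that] scale_sum_right sum_distrib_left mult.left_commute)
  ultimately show ?thesis by (auto simp: lin_endo_def)
qed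

lemma op_inject:
  assumes "a \<in> corner I" "b \<in> corner I" "\<And>v. v \<in> space M \<Longrightarrow> op a v = op b v"
  shows "a = b"
proof (rule rmat_eqI)
  fix i j
  have e: "co (op c (\<beta> j)) i = ent c i j" if "j \<in> I" "c \<in> corner I" for c
  proof -
    have "co (op c (\<beta> j)) i = (\<Sum>l\<in>I. if l = j then ent c i j else 0)"
      unfolding co_op[OF that(2)] by (intro sum.cong) (auto simp: co_beta[OF that(1)])
    then show ?thesis using finI that by (simp add: sum.delta)
  qed
  show "ent a i j = ent b i j"
  proof (cases "j \<in> I")
    case True
    then show ?thesis using e[OF True assms(1)] e[OF True assms(2)] assms(3)[OF beta_space[OF True]] by simp
  next
    case False
    then have "ent a i j = 0" "ent b i j = 0"
      using corner_finite_rows[OF assms(1), of i j] corner_finite_rows[OF assms(2), of i j] by blast+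
    then show ?thesis by simp
  qed
qed

text \<open>The value \<open>0\<close> outside the group makes \<open>rep_tensor\<close> an equation
  between functions on the whole type.\<close>

definition rep :: "'g \<Rightarrow> ('i, 'k) rmat" where
  "rep g = (if g \<in> carrier G then mat (act M g) else 0)"

lemma rep_corner [simp]: "rep g \<in> corner I"
  by (simp add: rep_def)

lemma act_lin: "g \<in> carrier G \<Longrightarrow> lin_endo (act M g)"
  by (auto simp: lin_endo_def act_closed act_add act_scl)

lemma op_rep: "\<lbrakk>g \<in> carrier G; v \<in> space M\<rbrakk> \<Longrightarrow> op (rep g) v = act M g v"
  unfolding rep_def using op_mat[OF act_lin] by simp

sublocale R: mrep G I rep
proof unfold_locales
  show "rep \<one> = idm I"
    by (rule op_inject) (auto simp: op_rep op_idm act_one)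
  show "rep (g \<otimes> h) = rep g * rep h" if "g \<in> carrier G" "h \<in> carrier G" for g h
    by (rule op_inject) (use that in \<open>auto simp: op_rep op_mult act_mult act_closed\<close>)
qed (rule finG, rule finI)

lemma fixA_op_iff:
  assumes "H \<subseteq> carrier G"
  shows "a \<in> R.fixA H \<longleftrightarrow> a \<in> corner I \<and> (\<forall>h\<in>H. \<forall>v\<in>space M. act M h (op a v) = op a (act M h v))"
proof -
  have "rep h * a = a * rep h \<longleftrightarrow> (\<forall>v\<in>space M. act M h (op a v) = op a (act M h v))"
    if "a \<in> corner I" "h \<in> carrier G" for h
  proof -
    have 1: "op (rep h * a) v = act M h (op a v)" "op (a * rep h) v = op a (act M h v)" if "v \<in> space M" for v
      using that \<open>a \<in> corner I\<close> \<open>h \<in> carrier G\<close> by (simp_all add: op_mult op_rep)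
    have "rep h * a = a * rep h" if "\<forall>v\<in>space M. act M h (op a v) = op a (act M h v)"
      by (rule op_inject) (use that 1 \<open>a \<in> corner I\<close> in auto)
    then show ?thesis using 1 by metis
  qed
  then show ?thesis using assms by (auto simp: R.fixA_def)
qed

lemma mat_fixA:
  assumes "H \<subseteq> carrier G" "lin_endo f" "\<And>h v. \<lbrakk>h \<in> H; v \<in> space M\<rbrakk> \<Longrightarrow> f (act M h v) = act M h (f v)"
  shows "mat f \<in> R.fixA H"
  unfolding fixA_op_iff[OF assms(1)]
  using assms by (auto simp: op_mat act_closed lin_endo_space subset_iff)

lemma fixA_act: "\<lbrakk>a \<in> R.fixA H; H \<subseteq> carrier G; h \<in> H; v \<in> space M\<rbrakk> \<Longrightarrow> op a (act M h v) = act M h (op a v)"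
  by (simp add: fixA_op_iff)

lemma op_Tr:
  assumes "K \<subseteq> carrier G" "a \<in> corner I" "v \<in> space M"
  shows "op (R.Tr K H a) v = csum K H (\<lambda>x. act M x (op a (act M (inv x) v)))"
proof -
  have "op (R.Tr K H a) v = csum K H (\<lambda>x. op (R.cj x a) v)"
    unfolding R.Tr_def by (rule qsum_additive) (auto simp: op_add)
  also have "\<dots> = csum K H (\<lambda>x. act M x (op a (act M (inv x) v)))"
    by (rule qsum_cong) (use assms in \<open>auto simp: R.cj_def op_mult op_rep act_closed subset_iff\<close>)
  finally show ?thesis .
qed

lemma dim_image_op:
  assumes "a \<in> corner I"
  shows "dim (op a ` space M) = rk a"
proof -
  interpret p: vector_space_pair "\<lambda>c (x::'i \<Rightarrow> 'k) i. c * x i" "scl M" ..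
  have e: "emb (mvec a x) = op a (emb x)" for x
    unfolding op_def by (rule arg_cong[of _ _ emb]) (simp add: fun_eq_iff mvec_corner[OF finI assms] co_emb)
  have im: "op a ` space M = emb ` range (mvec a)"
  proof (intro equalityI subsetI)
    fix w assume "w \<in> op a ` space M"
    then obtain v where "v \<in> space M" "w = op a v" by blast
    then have "w = emb (mvec a (co v))" using e[of "co v"] emb_co by simp
    then show "w \<in> emb ` range (mvec a)" by blast
  next
    fix w assume "w \<in> emb ` range (mvec a)"
    then obtain x where "w = emb (mvec a x)" by blast
    then show "w \<in> op a ` space M" using e by auto
  qed
  have lin: "Vector_Spaces.linear (\<lambda>c (x::'i \<Rightarrow> 'k) i. c * x i) (scl M) emb"
    by unfold_locales (simp_all add: emb_def scale_left_distrib sum.distrib scale_sum_right)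
  have "inj_on emb (range (mvec a))"
  proof (rule inj_onI)
    fix x y assume xy: "x \<in> range (mvec a)" "y \<in> range (mvec a)" "emb x = emb y"
    have z: "mvec a u i = 0" if "i \<notin> I" for u i
      unfolding mvec_corner[OF finI assms] using corner_finite_rows[OF assms, of i] that by (intro sum.neutral) auto
    show "x = y"
    proof
      fix i
      show "x i = y i"
      proof (cases "i \<in> I")
        case True
        then show ?thesis using co_emb[of x i] co_emb[of y i] xy(3) by simp
      next
        case False
        then show ?thesis using xy(1,2) z by auto
      qed
    qed
  qed
  moreover have "fv.span (range (mvec a)) = range (mvec a)"
    using fv.span_eq_iff subspace_range_mvec by blast
  ultimately have "inj_on emb (fv.span (range (mvec a)))" by (simp only:)
  then show ?thesis unfolding im rk_def by (rule p.dim_image_inj[OF lin])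
qed

text \<open>The link between sources and traces: in characteristic \<open>p\<close> the dimension of
  a summand is prime to \<open>p\<close> iff its idempotent has non-zero trace.\<close>

lemma mtr_idempotent_dim:
  assumes "i \<in> corner I" "i * i = i"
  shows "mtr I i = of_nat (dim_mod (on_sub M (op i ` space M)))"
  unfolding dim_mod_def using mtr_idempotent[OF finI assms] dim_image_op[OF assms(1)] by simp

end

section \<open>Direct summands and idempotents\<close>

context kG_coord
begin

lemma subspace_M_iff:
  "module.subspace (scl M) A \<longleftrightarrow> 0 \<in> A \<and> (\<forall>x\<in>A. \<forall>y\<in>A. x + y \<in> A) \<and> (\<forall>c. \<forall>x\<in>A. scl M c x \<in> A)"
  by (rule subspace_def)

text \<open>The idempotent is \<open>op i\<close> followed by the projection to \<open>A\<close>
  along \<open>B\<close>. It commutes with \<open>Q\<close> because both summands are stable under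
  \<open>Q\<close>.\<close>

lemma decomp_idempotent:
  assumes Q: "Q \<subseteq> carrier G" and i: "i \<in> R.fixA Q" "i * i = i"
    and d: "direct_decomp (G\<lparr>carrier := Q\<rparr>) (on_sub M (op i ` space M)) A B"
  obtains j where "j \<in> R.fixA Q" "j * j = j" "i * j = j" "j * i = j" "op j ` space M = A"
    "\<And>v. v \<in> A \<Longrightarrow> op j v = v" "\<And>v. v \<in> B \<Longrightarrow> op j v = 0"
proof -
  let ?X = "op i ` space M"
  have ic: "i \<in> corner I" using i R.fixA_corner by blast
  have opi: "op i v = v" if v: "v \<in> ?X" for v
  proof -
    obtain w where "w \<in> space M" "v = op i w" using v by blast
    then show ?thesis using op_mult[OF ic ic, of w] i(2) by simp
  qed
  have X: "?X \<subseteq> space M" by auto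
  have AB: "A \<subseteq> ?X" "B \<subseteq> ?X" "A \<inter> B = {0}"
    and sA: "0 \<in> A" "\<And>x y. \<lbrakk>x \<in> A; y \<in> A\<rbrakk> \<Longrightarrow> x + y \<in> A" "\<And>c x. x \<in> A \<Longrightarrow> scl M c x \<in> A"
    and sB: "0 \<in> B" "\<And>x y. \<lbrakk>x \<in> B; y \<in> B\<rbrakk> \<Longrightarrow> x + y \<in> B" "\<And>c x. x \<in> B \<Longrightarrow> scl M c x \<in> B"
    and gA: "\<And>g x. \<lbrakk>g \<in> Q; x \<in> A\<rbrakk> \<Longrightarrow> act M g x \<in> A" and gB: "\<And>g x. \<lbrakk>g \<in> Q; x \<in> B\<rbrakk> \<Longrightarrow> act M g x \<in> B"
    and sum: "?X = {a + b | a b. a \<in> A \<and> b \<in> B}"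
    using d unfolding direct_decomp_def submod_def by (auto simp: subspace_M_iff)
  have negA: "- x \<in> A" if "x \<in> A" for x using sA(3)[OF that, of "- 1"] by simp
  have negB: "- x \<in> B" if "x \<in> B" for x using sB(3)[OF that, of "- 1"] by simp
  have uniq: "a = a'" if "a \<in> A" "a' \<in> A" "b \<in> B" "b' \<in> B" "a + b = a' + b'" for a a' b b'
  proof -
    have e: "a + - a' = b' + - b" using that(5) by (simp add: algebra_simps)
    have "a + - a' \<in> A" using that sA(2) negA by blast
    moreover have "a + - a' \<in> B" unfolding e using that sB(2) negB by blast
    ultimately have "a + - a' \<in> A \<inter> B" by blast
    then show ?thesis using AB(3) by auto
  qed
  define \<pi> where "\<pi> = (\<lambda>v. SOME a. a \<in> A \<and> (\<exists>b\<in>B. v = a + b))"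
  have pi: "\<pi> (a + b) = a" if "a \<in> A" "b \<in> B" for a b
  proof -
    have "\<exists>x. x \<in> A \<and> (\<exists>y\<in>B. a + b = x + y)" using that by blast
    from someI_ex[OF this] have "\<pi> (a + b) \<in> A \<and> (\<exists>y\<in>B. a + b = \<pi> (a + b) + y)" unfolding \<pi>_def .
    then obtain y where y: "\<pi> (a + b) \<in> A" "y \<in> B" "a + b = \<pi> (a + b) + y" by blast
    show ?thesis using uniq[OF that(1) y(1) that(2) y(2,3)] by simp
  qed
  have dec: "\<exists>a b. a \<in> A \<and> b \<in> B \<and> op i v = a + b" if "v \<in> space M" for v using that sum by blast
  define f where "f = (\<lambda>v. \<pi> (op i v))"
  have fA: "f v \<in> A" if "v \<in> space M" for v using dec[OF that] pi unfolding f_def by auto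
  have AM: "A \<subseteq> space M" and BM: "B \<subseteq> space M" using AB X by auto
  have lin: "lin_endo f" unfolding lin_endo_def
  proof (intro conjI ballI allI)
    show "f ` space M \<subseteq> space M" using fA AM by auto
    fix v assume v: "v \<in> space M"
    obtain a b where ab: "a \<in> A" "b \<in> B" "op i v = a + b" using dec[OF v] by blast
    { fix w assume w: "w \<in> space M"
      obtain a' b' where ab': "a' \<in> A" "b' \<in> B" "op i w = a' + b'" using dec[OF w] by blast
      have "op i (v + w) = op i v + op i w" using op_lin v w by (auto simp: lin_endo_def)
      then have "op i (v + w) = (a + a') + (b + b')" using ab(3) ab'(3) by (simp add: algebra_simps)
      then show "f (v + w) = f v + f w"
        unfolding f_def using pi[of a b] pi[of a' b'] pi[of "a + a'" "b + b'"] sA sB ab ab' by simp }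
    fix c
    have "op i (scl M c v) = scl M c (op i v)" using op_lin v by (auto simp: lin_endo_def)
    then have "op i (scl M c v) = scl M c a + scl M c b" using ab(3) by (simp add: scale_right_distrib)
    then show "f (scl M c v) = scl M c (f v)"
      unfolding f_def using pi[of a b] pi[of "scl M c a" "scl M c b"] sA sB ab by simp
  qed
  have eqv: "f (act M h v) = act M h (f v)" if h: "h \<in> Q" and v: "v \<in> space M" for h v
  proof -
    obtain a b where ab: "a \<in> A" "b \<in> B" "op i v = a + b" using dec[OF v] by blast
    have hc: "h \<in> carrier G" using h Q by blast
    have "op i (act M h v) = act M h (op i v)" by (rule fixA_act[OF i(1) Q h v])
    also have "\<dots> = act M h a + act M h b" unfolding ab(3) using ab AM BM by (intro act_add[OF hc]) auto
    finally show ?thesis unfolding f_def using pi[of a b] pi[of "act M h a" "act M h b"] gA gB h ab by simp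
  qed
  let ?j = "mat f"
  have opj: "op ?j v = f v" if "v \<in> space M" for v by (rule op_mat[OF lin that])
  have fi: "f v = v" if "v \<in> A" for v
    using pi[OF that sB(1)] opi[of v] that AB by (auto simp: f_def)
  have fB: "f v = 0" if "v \<in> B" for v
    using pi[OF sA(1) that] opi[of v] that AB by (auto simp: f_def)
  show ?thesis
  proof (rule that[of ?j])
    show "?j \<in> R.fixA Q" by (rule mat_fixA[OF Q lin eqv])
    show "?j * ?j = ?j"
    proof (rule op_inject)
      fix v assume v: "v \<in> space M"
      have "f v \<in> space M" using fA[OF v] AM by blast
      then show "op (?j * ?j) v = op ?j v" using op_mult[OF mat_corner mat_corner] opj fi[OF fA[OF v]] v by simp
    qed auto
    show "i * ?j = ?j"
    proof (rule op_inject)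
      fix v assume v: "v \<in> space M"
      have "op i (f v) = f v" using fA[OF v] AB(1) by (intro opi) blast
      then show "op (i * ?j) v = op ?j v" using op_mult[OF ic mat_corner] opj[OF v] by simp
    qed (use ic in auto)
    show "?j * i = ?j"
    proof (rule op_inject)
      fix v assume v: "v \<in> space M"
      then show "op (?j * i) v = op ?j v" using op_mult[OF mat_corner ic] opj opi[of "op i v"] by (simp add: f_def)
    qed (use ic in auto)
    show "op ?j ` space M = A"
    proof (intro equalityI subsetI)
      fix v assume "v \<in> A"
      then have "op ?j v = v" "v \<in> space M" using opj fi AM by auto
      then show "v \<in> op ?j ` space M" by (metis imageI)
    qed (use opj fA in auto)
    show "op ?j v = v" if "v \<in> A" for v using opj fi AM that by auto
    show "op ?j v = 0" if "v \<in> B" for v using opj fB BM that by auto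
  qed
qed

lemma idempotent_decomp:
  assumes Q: "Q \<subseteq> carrier G" and i: "i \<in> R.fixA Q" "i * i = i" and j: "j \<in> R.fixA Q" "j * j = j" "i * j = j" "j * i = j"
  shows "direct_decomp (G\<lparr>carrier := Q\<rparr>) (on_sub M (op i ` space M)) (op j ` space M) (op (i - j) ` space M)"
proof -
  have sub: "submod (G\<lparr>carrier := Q\<rparr>) (on_sub M (op i ` space M)) (op k ` space M)"
    if k: "k \<in> R.fixA Q" "i * k = k" for k
  proof -
    have ic: "i \<in> corner I" "k \<in> corner I" using i k R.fixA_corner by auto
    have 1: "op k ` space M \<subseteq> op i ` space M"
    proof
      fix x assume "x \<in> op k ` space M"
      then obtain v where "x = op k v" by blast
      then have "x = op i (op k v)" using op_mult[OF ic] k(2) by metis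
      then show "x \<in> op i ` space M" by simp
    qed
    have 2: "module.subspace (scl M) (op k ` space M)"
      unfolding subspace_M_iff
    proof (intro conjI ballI allI)
      show "0 \<in> op k ` space M" using lin_endo_zero[OF op_lin, of k] zero_space by (metis imageI)
      fix x assume "x \<in> op k ` space M"
      then obtain v where v: "v \<in> space M" "x = op k v" by blast
      { fix y assume "y \<in> op k ` space M"
        then obtain w where w: "w \<in> space M" "y = op k w" by blast
        have "x + y = op k (v + w)" using op_lin[of k] v w by (auto simp: lin_endo_def)
        then show "x + y \<in> op k ` space M" using add_space v w by blast }
      fix c
      have "scl M c x = op k (scl M c v)" using op_lin[of k] v by (auto simp: lin_endo_def)
      then show "scl M c x \<in> op k ` space M" using scl_space v by blast
    qed
    have "act M g x \<in> op k ` space M" if g: "g \<in> Q" and x: "x \<in> op k ` space M" for g x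
    proof -
      obtain v where v: "v \<in> space M" "x = op k v" using x by blast
      have "act M g x = op k (act M g v)" using fixA_act[OF k(1) Q g v(1)] v by simp
      then show ?thesis using act_closed v g Q by auto
    qed
    then show ?thesis unfolding submod_def using 1 2 by simp
  qed
  have c: "i \<in> corner I" "j \<in> corner I" using i j R.fixA_corner by auto
  have k: "i - j \<in> R.fixA Q" "i * (i - j) = i - j" using i j by (auto simp: right_diff_distrib)
  have jk: "j * (i - j) = 0" "(i - j) * (i - j) = i - j" using i j by (auto simp: right_diff_distrib left_diff_distrib)
  show ?thesis unfolding direct_decomp_def
  proof (intro conjI)
    show "op j ` space M \<inter> op (i - j) ` space M = {0}"
    proof -
      have "x = 0" if x: "x \<in> op j ` space M" "x \<in> op (i - j) ` space M" for x
      proof -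
        obtain v w where vw: "x = op j v" "x = op (i - j) w" using x by blast
        have "x = op j x" using vw(1) op_mult[OF c(2,2), of v] j(2) by simp
        also have "\<dots> = op (j * (i - j)) w" using vw(2) op_mult[OF c(2), of "i - j" w] c by simp
        finally show ?thesis unfolding jk by simp
      qed
      moreover have "op k 0 = 0" for k by (rule lin_endo_zero[OF op_lin])
      moreover have "0 \<in> op k ` space M" for k
        using lin_endo_zero[OF op_lin, of k] zero_space by (metis imageI)
      ultimately show ?thesis by blast
    qed
    show "{a + b |a b. a \<in> op j ` space M \<and> b \<in> op (i - j) ` space M} = space (on_sub M (op i ` space M))"
    proof (intro equalityI subsetI)
      fix x assume "x \<in> {a + b |a b. a \<in> op j ` space M \<and> b \<in> op (i - j) ` space M}"
      then obtain v w where vw: "x = op j v + op (i - j) w" by blast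
      have "op i x = op i (op j v) + op i (op (i - j) w)" unfolding vw using op_lin[of i] by (auto simp: lin_endo_def)
      also have "\<dots> = x" unfolding vw using op_mult[OF c(1,2), of v] op_mult[OF c(1), of "i - j" w] c j(3) k(2) by simp
      finally have "x = op i x" ..
      moreover have "x \<in> space M" unfolding vw by (intro add_space op_space)
      ultimately show "x \<in> space (on_sub M (op i ` space M))" by auto
    next
      fix x assume "x \<in> space (on_sub M (op i ` space M))"
      then obtain v where v: "v \<in> space M" "x = op i v" by auto
      have "x = op j v + op (i - j) v" using v by (simp flip: op_add)
      then show "x \<in> {a + b |a b. a \<in> op j ` space M \<and> b \<in> op (i - j) ` space M}" using v by blast
    qed
  qed (use sub j k in auto)
qed

lemma op_idm_image: "op (idm I) ` space M = space M"
  using op_idm by force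

lemma on_sub_self [simp]: "on_sub M (space M) = M"
  by simp

lemma primitive_of_indecomposable:
  assumes Q: "Q \<subseteq> carrier G" and i: "i \<in> R.fixA Q" "i * i = i"
    and ind: "indecomposable (G\<lparr>carrier := Q\<rparr>) (on_sub M (op i ` space M))"
  shows "R.primitive_in Q i"
  unfolding R.primitive_in_def
proof (intro conjI ballI impI i)
  have ic: "i \<in> corner I" using i R.fixA_corner by blast
  have z: "k = 0" if "k \<in> corner I" "op k ` space M = {0}" for k
    by (rule op_inject) (use that in auto)
  show "i \<noteq> 0" proof
    assume "i = 0"
    moreover have "space M \<noteq> {}" by (metis zero_space empty_iff)
    ultimately have "op i ` space M = {0}" by (auto simp: image_constant_conv)
    then show False using ind by (simp add: indecomposable_def)
  qed
  fix f assume f: "f \<in> R.fixA Q" "f * f = f" "i * f = f" "f * i = f"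
  have fc: "f \<in> corner I" using f R.fixA_corner by blast
  have "op f ` space M = {0} \<or> op (i - f) ` space M = {0}"
    using idempotent_decomp[OF Q i f] ind unfolding indecomposable_def by blast
  then have "f = 0 \<or> i - f = 0" using z[OF fc] z[of "i - f"] ic fc by auto
  then show "f = 0 \<or> f = i" by auto
qed

end

section \<open>Higman's criterion\<close>

text \<open>The retraction \<open>P\<close> sends \<open>F v + b\<close>, with \<open>b\<close> in a
  complement of the image of \<open>F\<close>, to \<open>v\<close>. On the side of \<open>N\<close>
  only linearity of scalars and additivity of the action are assumed, which are easily checked for
  induced modules.\<close>

lemma iso_direct_summand_split:
  fixes M :: "('k::field, 'g, 'v::ab_group_add) gmod" and N :: "('k, 'g, 'w::ab_group_add) gmod"
  assumes N: "vector_space (scl N)"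
    and addN: "\<And>g x y. \<lbrakk>g \<in> carrier G; x \<in> space N; y \<in> space N\<rbrakk> \<Longrightarrow> act N g (x + y) = act N g x + act N g y"
    and M: "\<And>v w. \<lbrakk>v \<in> space M; w \<in> space M\<rbrakk> \<Longrightarrow> v + w \<in> space M"
      "\<And>c v. v \<in> space M \<Longrightarrow> scl M c v \<in> space M"
      "\<And>g v. \<lbrakk>g \<in> carrier G; v \<in> space M\<rbrakk> \<Longrightarrow> act M g v \<in> space M"
    and iso: "iso_direct_summand G M N"
  obtains F P where "F \<in> mod_hom G M N" "P \<in> mod_hom G N M" "\<And>v. v \<in> space M \<Longrightarrow> P (F v) = v"
proof -
  interpret N: vector_space "scl N" by (rule N)
  obtain A B F where d: "direct_decomp G N A B" and F: "F \<in> mod_hom G M (on_sub N A)" and bij: "bij_betw F (space M) A"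
    using iso by (auto simp: iso_direct_summand_def direct_summand_def mod_iso_def)
  have AB: "A \<subseteq> space N" "B \<subseteq> space N" "A \<inter> B = {0}"
    and sA: "0 \<in> A" "\<And>x y. \<lbrakk>x \<in> A; y \<in> A\<rbrakk> \<Longrightarrow> x + y \<in> A" "\<And>c x. x \<in> A \<Longrightarrow> scl N c x \<in> A"
    and sB: "0 \<in> B" "\<And>x y. \<lbrakk>x \<in> B; y \<in> B\<rbrakk> \<Longrightarrow> x + y \<in> B" "\<And>c x. x \<in> B \<Longrightarrow> scl N c x \<in> B"
    and gA: "\<And>g x. \<lbrakk>g \<in> carrier G; x \<in> A\<rbrakk> \<Longrightarrow> act N g x \<in> A" and gB: "\<And>g x. \<lbrakk>g \<in> carrier G; x \<in> B\<rbrakk> \<Longrightarrow> act N g x \<in> B"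
    and sum: "space N = {a + b | a b. a \<in> A \<and> b \<in> B}"
    using d unfolding direct_decomp_def submod_def by (auto simp: N.subspace_def)
  have Fadd: "F (v + w) = F v + F w" if "v \<in> space M" "w \<in> space M" for v w using F that by (simp add: mod_hom_def)
  have Fscl: "F (scl M c v) = scl N c (F v)" if "v \<in> space M" for c v using F that by (simp add: mod_hom_def)
  have Fact: "F (act M g v) = act N g (F v)" if "g \<in> carrier G" "v \<in> space M" for g v using F that by (simp add: mod_hom_def)
  define P where "P = (\<lambda>x. SOME v. v \<in> space M \<and> (\<exists>b\<in>B. x = F v + b))"
  have inj: "v = w" if "v \<in> space M" "w \<in> space M" "F v = F w" for v w
    using bij that by (auto simp: bij_betw_def inj_on_def)
  have FA: "F v \<in> A" if "v \<in> space M" for v using bij that by (auto simp: bij_betw_def)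
  have P: "P (F v + b) = v" if v: "v \<in> space M" and b: "b \<in> B" for v b
  proof -
    have "\<exists>x. x \<in> space M \<and> (\<exists>y\<in>B. F v + b = F x + y)" using v b by blast
    from someI_ex[OF this] have "P (F v + b) \<in> space M \<and> (\<exists>y\<in>B. F v + b = F (P (F v + b)) + y)" unfolding P_def .
    then obtain y where y: "P (F v + b) \<in> space M" "y \<in> B" "F v + b = F (P (F v + b)) + y" by blast
    let ?w = "P (F v + b)"
    have e: "F v + scl N (- 1) (F ?w) = y + scl N (- 1) b" using y(3) by (simp add: algebra_simps)
    have "F v + scl N (- 1) (F ?w) \<in> A" by (intro sA(2,3) FA v y(1))
    moreover have "F v + scl N (- 1) (F ?w) \<in> B" unfolding e by (intro sB(2,3) y(2) b)
    ultimately have "F v + scl N (- 1) (F ?w) \<in> A \<inter> B" by blast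
    then have "F v = F ?w" using AB(3) by auto
    then show ?thesis using inj[OF v y(1)] by simp
  qed
  have dec: "\<exists>v b. v \<in> space M \<and> b \<in> B \<and> x = F v + b" if x: "x \<in> space N" for x
  proof -
    obtain a b where ab: "a \<in> A" "b \<in> B" "x = a + b" using x unfolding sum by blast
    have "a \<in> F ` space M" using ab(1) bij by (simp add: bij_betw_def)
    then obtain v where "v \<in> space M" "a = F v" by (elim imageE)
    then show ?thesis using ab by blast
  qed
  have "P \<in> mod_hom G N M"
    unfolding mod_hom_def
  proof (intro CollectI conjI ballI allI)
    show "P ` space N \<subseteq> space M" using dec P by force
    fix x assume x: "x \<in> space N"
    obtain v b where vb: "v \<in> space M" "b \<in> B" "x = F v + b" using dec[OF x] by blast
    { fix y assume y: "y \<in> space N"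
      obtain w c where wc: "w \<in> space M" "c \<in> B" "y = F w + c" using dec[OF y] by blast
      have "x + y = F (v + w) + (b + c)" using vb wc Fadd by (simp add: algebra_simps)
      also have "P \<dots> = v + w" by (rule P[OF M(1)[OF vb(1) wc(1)] sB(2)[OF vb(2) wc(2)]])
      finally show "P (x + y) = P x + P y" using P[OF vb(1,2)] P[OF wc(1,2)] vb(3) wc(3) by simp }
    { fix c
      have "scl N c x = F (scl M c v) + scl N c b" using vb Fscl by (simp add: N.scale_right_distrib)
      also have "P \<dots> = scl M c v" by (rule P[OF M(2)[OF vb(1)] sB(3)[OF vb(2)]])
      finally show "P (scl N c x) = scl M c (P x)" using P[OF vb(1,2)] vb(3) by simp }
    { fix g assume g: "g \<in> carrier G"
      have "act N g x = act N g (F v) + act N g b" unfolding vb(3) using FA[OF vb(1)] vb(2) AB by (intro addN[OF g]) auto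
      then have "act N g x = F (act M g v) + act N g b" using Fact[OF g vb(1)] by simp
      also have "P \<dots> = act M g v" by (rule P[OF M(3)[OF g vb(1)] gB[OF g vb(2)]])
      finally show "P (act N g x) = act M g (P x)" using P[OF vb(1,2)] vb(3) by simp }
  qed
  moreover have "F \<in> mod_hom G M N" using F AB(1) by (auto simp: mod_hom_def)
  moreover have "P (F v) = v" if "v \<in> space M" for v using P[OF that sB(1)] by simp
  ultimately show ?thesis by (intro that)
qed

context kG_coord
begin

lemma induced_sel:
  "scl (induced G Q N) = (\<lambda>c f x. scl N c (f x))"
  "act (induced G Q N) = (\<lambda>g f x. if x \<in> carrier G then f (inv g \<otimes> x) else 0)"
  "f \<in> space (induced G Q N) \<longleftrightarrow> (\<forall>x\<in>carrier G. f x \<in> space N) \<and> (\<forall>x. x \<notin> carrier G \<longrightarrow> f x = 0) \<and>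
     (\<forall>x\<in>carrier G. \<forall>h\<in>Q. f (x \<otimes> h) = act N (inv h) (f x))"
  by (auto simp: induced_def)

lemma vector_space_induced: "vector_space (scl (induced G Q (on_sub M A)))"
  unfolding induced_sel by unfold_locales (auto simp: fun_eq_iff scale_right_distrib scale_left_distrib)

text \<open>One half of Higman's criterion, with a summand of the restriction in place of the whole
  restriction. By Frobenius reciprocity the maps \<open>F\<close> and \<open>P\<close> correspond to
  \<open>Q\<close>-maps \<alpha> and \<gamma>, and \<open>P \<circ> F\<close>, the identity, becomes
  the relative trace of their composite.\<close>

lemma Tr_of_summand_induced:
  assumes Q: "subgroup Q G" and i: "i \<in> R.fixA Q" "i * i = i"
    and iso: "iso_direct_summand G M (induced G Q (on_sub M (op i ` space M)))"
  obtains a b where "a \<in> R.fixA Q" "b \<in> R.fixA Q" "R.Tr (carrier G) Q (a * i * b) = idm I"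
proof -
  note Qc = subset_subgroup[OF Q]
  let ?X = "op i ` space M" and ?N = "induced G Q (on_sub M (op i ` space M))"
  have ic: "i \<in> corner I" using i R.fixA_corner by blast
  have opi: "op i v = v" if v: "v \<in> ?X" for v
  proof -
    obtain w where "w \<in> space M" "v = op i w" using v by blast
    then show ?thesis using op_mult[OF ic ic, of w] i(2) by simp
  qed
  have XM: "?X \<subseteq> space M" by auto
  have X0: "0 \<in> ?X" using lin_endo_zero[OF op_lin, of i] zero_space by (metis imageI)
  have Xact: "act M h v \<in> ?X" if h: "h \<in> Q" and v: "v \<in> ?X" for h v
  proof -
    obtain w where w: "w \<in> space M" "v = op i w" using v by blast
    then have "act M h v = op i (act M h w)" using fixA_act[OF i(1) Qc h] by simp
    then show ?thesis using act_closed w h Qc by blast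
  qed
  obtain F P where F: "F \<in> mod_hom G M ?N" and P: "P \<in> mod_hom G ?N M" and PF: "\<And>v. v \<in> space M \<Longrightarrow> P (F v) = v"
    by (rule iso_direct_summand_split[OF vector_space_induced _ add_space scl_space act_closed iso])
      (auto simp: induced_sel fun_eq_iff)
  have FN: "F v \<in> space ?N" if "v \<in> space M" for v using F that by (auto simp: mod_hom_def)
  have FX: "F v x \<in> ?X" if "v \<in> space M" "x \<in> carrier G" for v x using FN[OF that(1)] that(2) by (simp add: induced_sel)
  have Fact: "F (act M g v) = (\<lambda>x. if x \<in> carrier G then F v (inv g \<otimes> x) else 0)" if "g \<in> carrier G" "v \<in> space M" for g v
    using F that by (simp add: mod_hom_def induced_sel)
  have Fh: "F v (x \<otimes> h) = act M (inv h) (F v x)" if "v \<in> space M" "x \<in> carrier G" "h \<in> Q" for v x h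
    using FN[OF that(1)] that by (simp add: induced_sel)
  define \<alpha> where "\<alpha> = (\<lambda>v. F v \<one>)"
  \<comment> \<open>The function supported on \<open>Q\<close> with value \<open>n\<close> at
    \<open>\<one>\<close>; it stands for the tensor of \<open>\<one>\<close> with
    \<open>n\<close>.\<close>
  define \<delta> where "\<delta> = (\<lambda>n x. if x \<in> Q then act M (inv x) n else 0)"
  have \<alpha>lin: "lin_endo \<alpha>"
    unfolding lin_endo_def \<alpha>_def using FX XM F by (auto simp: mod_hom_def induced_sel)
  have \<alpha>X: "\<alpha> v \<in> ?X" if "v \<in> space M" for v unfolding \<alpha>_def by (rule FX[OF that one_closed])
  have \<alpha>F: "\<alpha> (act M (inv x) v) = F v x" if "x \<in> carrier G" "v \<in> space M" for x v
    unfolding \<alpha>_def using Fact[of "inv x" v] that by simp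
  have \<alpha>eq: "\<alpha> (act M h v) = act M h (\<alpha> v)" if h: "h \<in> Q" and v: "v \<in> space M" for h v
  proof -
    have hc: "h \<in> carrier G" using h Qc by auto
    have "\<alpha> (act M h v) = F v (inv h)" using \<alpha>F[of "inv h" v] hc v by simp
    also have "\<dots> = F v (\<one> \<otimes> inv h)" using hc by simp
    also have "\<dots> = act M (inv (inv h)) (F v \<one>)" using v h inv_subgroup[OF Q] by (intro Fh) auto
    finally show ?thesis using hc by (simp add: \<alpha>_def)
  qed
  have \<delta>N: "\<delta> n \<in> space ?N" if n: "n \<in> ?X" for n
  proof -
    have nM: "n \<in> space M" using n XM by blast
    have "\<delta> n (x \<otimes> h) = act M (inv h) (\<delta> n x)" if x: "x \<in> carrier G" and h: "h \<in> Q" for x h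
    proof -
      have hc: "h \<in> carrier G" using h Qc by auto
      have iff: "x \<otimes> h \<in> Q \<longleftrightarrow> x \<in> Q"
      proof
        assume "x \<otimes> h \<in> Q"
        then have "x \<otimes> h \<otimes> inv h \<in> Q" using mult_subgroup[OF Q] inv_subgroup[OF Q h] by blast
        then show "x \<in> Q" using x hc by (simp add: m_assoc)
      qed (use mult_subgroup[OF Q] h in blast)
      show ?thesis unfolding \<delta>_def iff using x hc nM by (simp add: inv_mult_group act_mult act_zero)
    qed
    moreover have "\<delta> n x \<in> ?X" for x
      unfolding \<delta>_def using X0 Xact[OF inv_subgroup[OF Q] n] by simp
    ultimately show ?thesis using mem_subgroup[OF Q] by (auto simp: induced_sel \<delta>_def)
  qed
  have \<delta>add: "\<delta> (m + n) = \<delta> m + \<delta> n" if "m \<in> space M" "n \<in> space M" for m n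
    using that act_add mem_subgroup[OF Q] by (auto simp: \<delta>_def fun_eq_iff)
  have \<delta>scl: "\<delta> (scl M c n) = (\<lambda>x. scl M c (\<delta> n x))" if "n \<in> space M" for c n
    using that act_scl mem_subgroup[OF Q] by (auto simp: \<delta>_def fun_eq_iff)
  have \<delta>act: "\<delta> (act M h n) = act ?N h (\<delta> n)" if h: "h \<in> Q" and n: "n \<in> space M" for h n
  proof
    fix x
    have hc: "h \<in> carrier G" using h Qc by auto
    show "\<delta> (act M h n) x = act ?N h (\<delta> n) x"
    proof (cases "x \<in> carrier G")
      case True
      have "inv h \<otimes> x \<in> Q \<longleftrightarrow> x \<in> Q"
      proof
        assume "inv h \<otimes> x \<in> Q"
        then have "h \<otimes> (inv h \<otimes> x) \<in> Q" using mult_subgroup[OF Q h] by blast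
        then show "x \<in> Q" using True hc by simp
      qed (use mult_subgroup[OF Q] inv_subgroup[OF Q h] in blast)
      then show ?thesis using True hc n by (simp add: induced_sel \<delta>_def inv_mult_group act_mult)
    next
      case False
      then show ?thesis using mem_subgroup[OF Q] by (auto simp: induced_sel \<delta>_def)
    qed
  qed
  have Padd: "P (x + y) = P x + P y" if "x \<in> space ?N" "y \<in> space ?N" for x y using P that by (simp add: mod_hom_def)
  have Pscl: "P (\<lambda>y. scl M c (x y)) = scl M c (P x)" if "x \<in> space ?N" for c x using P that by (auto simp: mod_hom_def induced_sel)
  have Pact: "P (act ?N g x) = act M g (P x)" if "g \<in> carrier G" "x \<in> space ?N" for g x using P that by (simp add: mod_hom_def)
  have PM: "P x \<in> space M" if "x \<in> space ?N" for x using P that by (auto simp: mod_hom_def)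
  define \<gamma> where "\<gamma> = (\<lambda>v. P (\<delta> (op i v)))"
  have oiX: "op i v \<in> ?X" if "v \<in> space M" for v using that by blast
  have \<gamma>lin: "lin_endo \<gamma>"
    unfolding lin_endo_def \<gamma>_def
  proof (intro conjI ballI allI)
    show "(\<lambda>v. P (\<delta> (op i v))) ` space M \<subseteq> space M" using PM \<delta>N oiX by auto
    fix v assume v: "v \<in> space M"
    { fix w assume w: "w \<in> space M"
      have "op i (v + w) = op i v + op i w" using op_lin[of i] v w by (simp add: lin_endo_def)
      then show "P (\<delta> (op i (v + w))) = P (\<delta> (op i v)) + P (\<delta> (op i w))"
        using Padd[OF \<delta>N[OF oiX[OF v]] \<delta>N[OF oiX[OF w]]] \<delta>add by simp }
    fix c
    have "op i (scl M c v) = scl M c (op i v)" using op_lin[of i] v by (simp add: lin_endo_def)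
    then show "P (\<delta> (op i (scl M c v))) = scl M c (P (\<delta> (op i v)))"
      using Pscl[OF \<delta>N[OF oiX[OF v]]] \<delta>scl by simp
  qed
  have \<gamma>eq: "\<gamma> (act M h v) = act M h (\<gamma> v)" if h: "h \<in> Q" and v: "v \<in> space M" for h v
    unfolding \<gamma>_def using fixA_act[OF i(1) Qc h v] \<delta>act[OF h] Pact \<delta>N[OF oiX[OF v]] h Qc by auto
  let ?a = "mat \<gamma>" and ?b = "mat \<alpha>"
  have ab: "?a \<in> R.fixA Q" "?b \<in> R.fixA Q"
    using \<gamma>eq \<alpha>eq by (auto intro!: mat_fixA[OF Qc] \<gamma>lin \<alpha>lin)
  have opab: "op (?a * i * ?b) v = P (\<delta> (\<alpha> v))" if v: "v \<in> space M" for v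
  proof -
    have "op (?a * i * ?b) v = op ?a (op i (op ?b v))" using ic by (simp add: op_mult)
    also have "\<dots> = P (\<delta> (op i (op i (\<alpha> v))))" using op_mat[OF \<alpha>lin v] op_mat[OF \<gamma>lin] by (simp add: \<gamma>_def)
    finally show ?thesis using opi[OF \<alpha>X[OF v]] by simp
  qed
  have "R.Tr (carrier G) Q (?a * i * ?b) = idm I"
  proof (rule op_inject)
    show "R.Tr (carrier G) Q (?a * i * ?b) \<in> corner I" using ic by (intro R.Tr_corner) auto
    fix v assume v: "v \<in> space M"
    let ?g = "\<lambda>x. act ?N x (\<delta> (F v x))"
    have gN: "?g x \<in> space ?N" if x: "x \<in> carrier G" for x
    proof -
      have d: "\<delta> (F v x) \<in> space ?N" by (rule \<delta>N[OF FX[OF v x]])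
      then show ?thesis using x Qc by (auto simp: induced_sel m_assoc[symmetric] subset_iff)
    qed
    have "op (R.Tr (carrier G) Q (?a * i * ?b)) v
        = csum (carrier G) Q (\<lambda>x. act M x (op (?a * i * ?b) (act M (inv x) v)))"
      using ic v by (intro op_Tr) auto
    also have "\<dots> = csum (carrier G) Q (\<lambda>x. P (?g x))"
    proof (rule qsum_cong)
      fix x assume x: "x \<in> carrier G"
      have "act M (inv x) v \<in> space M" using x v act_closed by simp
      then show "act M x (op (?a * i * ?b) (act M (inv x) v)) = P (?g x)"
        using opab \<alpha>F[OF x v] Pact[OF x \<delta>N[OF FX[OF v x]]] by simp
    qed
    also have "\<dots> = P (csum (carrier G) Q ?g)"
    proof (rule qsum_hom(1)[symmetric, where C = "space ?N"])
      interpret N: vector_space "scl ?N" by (rule vector_space_induced)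
      show N0: "0 \<in> space ?N" using X0 act_zero Qc by (auto simp: induced_sel subset_iff)
      show "x + y \<in> space ?N" if "x \<in> space ?N" "y \<in> space ?N" for x y
      proof -
        have "a + b \<in> ?X" if a: "a \<in> ?X" and b: "b \<in> ?X" for a b
        proof -
          obtain u w where uw: "u \<in> space M" "a = op i u" "w \<in> space M" "b = op i w" using a b by blast
          have "a + b = op i (u + w)" using op_lin[of i] uw by (simp add: lin_endo_def)
          then show ?thesis using add_space uw by blast
        qed
        moreover have "act M (inv h) (x z + y z) = act M (inv h) (x z) + act M (inv h) (y z)"
          if "z \<in> carrier G" "h \<in> Q" for z h
        proof -
          have "x z \<in> space M" "y z \<in> space M"
            using \<open>x \<in> space ?N\<close> \<open>y \<in> space ?N\<close> that XM by (auto simp: induced_sel)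
          then show ?thesis using that Qc by (intro act_add) auto
        qed
        ultimately show ?thesis using that by (simp add: induced_sel)
      qed
      show "P 0 = 0" using Padd[OF N0 N0] by simp
      show "P (x + y) = P x + P y" if "x \<in> space ?N" "y \<in> space ?N" for x y by (rule Padd[OF that])
    qed (rule gN)
    \<comment> \<open>Every element of the induced module is the sum of its parts on the cosets of
      \<open>Q\<close>: at a point \<open>y\<close>, only the coset of \<open>y\<close>
      contributes.\<close>
    also have "csum (carrier G) Q ?g = F v"
    proof
      fix y
      have "csum (carrier G) Q ?g y = csum (carrier G) Q (\<lambda>x. ?g x y)"
        by (rule qsum_additive[of "\<lambda>f. f y"]) auto
      also have "\<dots> = F v y"
      proof (cases "y \<in> carrier G")
        case False
        have "csum (carrier G) Q (\<lambda>x. ?g x y) = csum (carrier G) Q (\<lambda>x. 0)"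
          by (rule qsum_cong) (use False in \<open>simp add: induced_sel\<close>)
        then show ?thesis using False FN[OF v] by (simp add: induced_sel qsum_def)
      next
        case True
        have "?g x y = (if x <# Q = y <# Q then F v y else 0)" if x: "x \<in> carrier G" for x
        proof (cases "inv x \<otimes> y \<in> Q")
          case q: True
          have "F v (x \<otimes> (inv x \<otimes> y)) = act M (inv (inv x \<otimes> y)) (F v x)" by (rule Fh[OF v x q])
          then show ?thesis using q True x lcoset_eq_iff[OF Q x True] by (simp add: induced_sel \<delta>_def)
        next
          case q: False
          then show ?thesis using True x lcoset_eq_iff[OF Q x True] by (simp add: induced_sel \<delta>_def)
        qed
        then have "csum (carrier G) Q (\<lambda>x. ?g x y) = (\<Sum>C\<in>(\<lambda>x. x <# Q) ` carrier G. if C = y <# Q then F v y else 0)"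
          by (intro qsum_eq) auto
        also have "\<dots> = F v y" using finG True by (simp add: sum.delta)
        finally show ?thesis .
      qed
      finally show "csum (carrier G) Q ?g y = F v y" .
    qed
    finally show "op (R.Tr (carrier G) Q (?a * i * ?b)) v = op (idm I) v" using PF[OF v] op_idm[OF v] by simp
  qed simp
  then show ?thesis using that ab by blast
qed

text \<open>The other half: \<open>F\<close> sends \<open>v\<close> to the function
  \<open>x \<mapsto> i (inv x v)\<close>, and \<open>P\<close> sends \<open>f\<close> to the sum of
  \<open>x (a (f x))\<close> over the cosets of \<open>Q\<close>. The composite
  \<open>P \<circ> F\<close> is the relative trace of \<open>a * i\<close>, the identity, so the
  image of \<open>F\<close> is complemented by the kernel of \<open>P\<close>.\<close>

lemma summand_induced_of_Tr:
  assumes Q: "subgroup Q G" and i: "i \<in> R.fixA Q" "i * i = i" and a: "a \<in> R.fixA Q"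
    and Tr: "R.Tr (carrier G) Q (a * i) = idm I"
  shows "iso_direct_summand G M (induced G Q (on_sub M (op i ` space M)))"
proof -
  note Qc = subset_subgroup[OF Q]
  let ?X = "op i ` space M" and ?N = "induced G Q (on_sub M (op i ` space M))"
  interpret N: vector_space "scl ?N" by (rule vector_space_induced)
  have ic: "i \<in> corner I" "a \<in> corner I" using i a R.fixA_corner by auto
  have NM: "f x \<in> space M" if "f \<in> space ?N" "x \<in> carrier G" for f x using that by (auto simp: induced_sel)
  have Nh: "f (x \<otimes> h) = act M (inv h) (f x)" if "f \<in> space ?N" "x \<in> carrier G" "h \<in> Q" for f x h
    using that by (simp add: induced_sel)
  have Xadd: "u + w \<in> ?X" if uw: "u \<in> ?X" "w \<in> ?X" for u w
  proof -
    obtain x y where xy: "x \<in> space M" "u = op i x" "y \<in> space M" "w = op i y" using uw by blast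
    have "u + w = op i (x + y)" using op_lin[of i] xy by (simp add: lin_endo_def)
    then show ?thesis using add_space xy by blast
  qed
  have Xscl: "scl M c u \<in> ?X" if u: "u \<in> ?X" for c u
  proof -
    obtain x where x: "x \<in> space M" "u = op i x" using u by blast
    have "scl M c u = op i (scl M c x)" using op_lin[of i] x by (simp add: lin_endo_def)
    then show ?thesis using scl_space x by blast
  qed
  have X0: "0 \<in> ?X" using lin_endo_zero[OF op_lin, of i] zero_space by (metis imageI)
  have Nadd: "f + g \<in> space ?N" if fg: "f \<in> space ?N" "g \<in> space ?N" for f g
  proof -
    have "act M (inv h) (f z + g z) = act M (inv h) (f z) + act M (inv h) (g z)" if "z \<in> carrier G" "h \<in> Q" for z h
      using NM[OF fg(1) that(1)] NM[OF fg(2) that(1)] that Qc by (intro act_add) auto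
    then show ?thesis using fg Xadd by (simp add: induced_sel)
  qed
  have Nscl: "scl ?N c f \<in> space ?N" if f: "f \<in> space ?N" for c f
  proof -
    have "act M (inv h) (scl M c (f z)) = scl M c (act M (inv h) (f z))" if "z \<in> carrier G" "h \<in> Q" for z h
      using NM[OF f that(1)] that Qc by (intro act_scl) auto
    then show ?thesis using f Xscl by (simp add: induced_sel)
  qed
  have N0: "0 \<in> space ?N" using X0 act_zero Qc by (auto simp: induced_sel subset_iff)
  have Nact: "act ?N g f \<in> space ?N" if "g \<in> carrier G" "f \<in> space ?N" for g f
    using that Qc by (auto simp: induced_sel m_assoc[symmetric] subset_iff)
  define F where "F = (\<lambda>v x. if x \<in> carrier G then op i (act M (inv x) v) else 0)"
  define P where "P = (\<lambda>f. csum (carrier G) Q (\<lambda>x. act M x (op a (f x))))"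
  have FN: "F v \<in> space ?N" if v: "v \<in> space M" for v
  proof -
    have "op i (act M (inv (x \<otimes> h)) v) = act M (inv h) (op i (act M (inv x) v))" if x: "x \<in> carrier G" and h: "h \<in> Q" for x h
    proof -
      have hc: "h \<in> carrier G" using h Qc by auto
      have "act M (inv (x \<otimes> h)) v = act M (inv h) (act M (inv x) v)" using x hc v by (simp add: inv_mult_group act_mult)
      then show ?thesis using fixA_act[OF i(1) Qc inv_subgroup[OF Q h], of "act M (inv x) v"] x v act_closed by simp
    qed
    then show ?thesis using v Qc act_closed by (auto simp: induced_sel F_def)
  qed
  have term_M: "act M x (op a (f x)) \<in> space M" if "f \<in> space ?N" "x \<in> carrier G" for f x
    using that act_closed by simp
  have term_inv: "act M (x \<otimes> h) (op a (f (x \<otimes> h))) = act M x (op a (f x))"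
    if f: "f \<in> space ?N" and x: "x \<in> carrier G" and h: "h \<in> Q" for f x h
  proof -
    have hc: "h \<in> carrier G" using h Qc by auto
    have "op a (f (x \<otimes> h)) = act M (inv h) (op a (f x))"
      unfolding Nh[OF f x h] using fixA_act[OF a Qc inv_subgroup[OF Q h] NM[OF f x]] .
    then show ?thesis using x hc by (simp add: act_mult[symmetric] m_assoc)
  qed
  have PM: "P f \<in> space M" if "f \<in> space ?N" for f
    unfolding P_def by (rule qsum_hom(2)[where f = id]) (use term_M[OF that] add_space in auto)
  have Padd: "P (f + g) = P f + P g" if fg: "f \<in> space ?N" "g \<in> space ?N" for f g
  proof -
    have "P (f + g) = csum (carrier G) Q (\<lambda>x. act M x (op a (f x)) + act M x (op a (g x)))"
      unfolding P_def
    proof (rule qsum_cong)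
      fix x assume x: "x \<in> carrier G"
      have "op a (f x + g x) = op a (f x) + op a (g x)"
        using op_lin[of a] NM[OF fg(1) x] NM[OF fg(2) x] by (simp add: lin_endo_def)
      then show "act M x (op a ((f + g) x)) = act M x (op a (f x)) + act M x (op a (g x))"
        using act_add[OF x] by simp
    qed
    then show ?thesis by (simp add: P_def qsum_add)
  qed
  have Pscl: "P (scl ?N c f) = scl M c (P f)" if f: "f \<in> space ?N" for c f
  proof -
    have "P (scl ?N c f) = csum (carrier G) Q (\<lambda>x. scl M c (act M x (op a (f x))))"
      unfolding P_def
    proof (rule qsum_cong)
      fix x assume x: "x \<in> carrier G"
      have "op a (scl M c (f x)) = scl M c (op a (f x))" using op_lin[of a] NM[OF f x] by (simp add: lin_endo_def)
      then show "act M x (op a (scl ?N c f x)) = scl M c (act M x (op a (f x)))"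
        using act_scl[OF x] by (simp add: induced_sel)
    qed
    also have "\<dots> = scl M c (P f)" unfolding P_def
      by (rule qsum_additive[symmetric]) (auto simp: scale_right_distrib)
    finally show ?thesis .
  qed
  have Pact: "P (act ?N g f) = act M g (P f)" if g: "g \<in> carrier G" and f: "f \<in> space ?N" for g f
  proof -
    let ?t = "\<lambda>x. act M x (op a (f x))"
    have "P (act ?N g f) = csum (carrier G) Q (\<lambda>x. act M g (?t (inv g \<otimes> x)))"
      unfolding P_def
    proof (rule qsum_cong)
      fix x assume x: "x \<in> carrier G"
      have "act M g (?t (inv g \<otimes> x)) = act M (g \<otimes> (inv g \<otimes> x)) (op a (f (inv g \<otimes> x)))"
        using g x by (subst act_mult) auto
      then show "act M x (op a (act ?N g f x)) = act M g (?t (inv g \<otimes> x))" using g x by (simp add: induced_sel)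
    qed
    also have "\<dots> = act M g (csum (carrier G) Q (\<lambda>x. ?t (inv g \<otimes> x)))"
      by (rule qsum_hom(1)[symmetric, where C = "space M"])
        (use g add_space act_add act_zero term_M[OF f] in auto)
    also have "csum (carrier G) Q (\<lambda>x. ?t (inv g \<otimes> x)) = csum (carrier G) Q ?t"
      using term_inv[OF f] g by (intro csum_translate[OF Q subgroup_self]) auto
    finally show ?thesis unfolding P_def .
  qed
  have PF: "P (F v) = v" if v: "v \<in> space M" for v
  proof -
    have "P (F v) = csum (carrier G) Q (\<lambda>x. act M x (op (a * i) (act M (inv x) v)))"
      unfolding P_def by (rule qsum_cong) (use ic in \<open>simp add: F_def op_mult\<close>)
    also have "\<dots> = op (R.Tr (carrier G) Q (a * i)) v" using ic v by (intro op_Tr[symmetric]) auto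
    finally show ?thesis using Tr op_idm[OF v] by simp
  qed
  have Fadd: "F (v + w) = F v + F w" if "v \<in> space M" "w \<in> space M" for v w
    using that act_add act_closed op_lin[of i] by (auto simp: F_def fun_eq_iff lin_endo_def)
  have Fscl: "F (scl M c v) = scl ?N c (F v)" if "v \<in> space M" for c v
    using that act_scl act_closed op_lin[of i] by (auto simp: F_def fun_eq_iff lin_endo_def induced_sel)
  have Fact: "F (act M g v) = act ?N g (F v)" if "g \<in> carrier G" "v \<in> space M" for g v
    using that by (auto simp: F_def fun_eq_iff induced_sel inv_mult_group act_mult)
  let ?A = "F ` space M" and ?B = "{f \<in> space ?N. P f = 0}"
  have subA: "submod G ?N ?A"
    unfolding submod_def N.subspace_def
  proof (intro conjI ballI allI)
    show "?A \<subseteq> space ?N" using FN by auto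
    have "F 0 = 0" using Fadd[of 0 0] by simp
    then show "0 \<in> ?A" by (metis imageI zero_space)
    fix x assume "x \<in> ?A"
    then obtain v where v: "v \<in> space M" "x = F v" by (elim imageE)
    { fix y assume "y \<in> ?A"
      then obtain w where w: "w \<in> space M" "y = F w" by (elim imageE)
      show "x + y \<in> ?A" by (rule image_eqI[of _ _ "v + w"]) (simp_all add: v w Fadd add_space) }
    { fix c show "scl ?N c x \<in> ?A" by (rule image_eqI[of _ _ "scl M c v"]) (simp_all add: v Fscl scl_space) }
    { fix g assume "g \<in> carrier G"
      then show "act ?N g x \<in> ?A" by (intro image_eqI[of _ _ "act M g v"]) (simp_all add: v Fact act_closed) }
  qed
  have P0: "P 0 = 0" using Padd[OF N0 N0] by simp
  have subB: "submod G ?N ?B"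
    unfolding submod_def N.subspace_def
    using N0 P0 Nadd Padd Nscl Pscl Nact Pact act_zero by auto
  \<comment> \<open>Subtraction is written with the scalar \<open>- 1\<close> so that closure of the
    induced module under addition and scalars suffices.\<close>
  have Fdecomp: "f = F (P f) + (f + scl ?N (- 1) (F (P f)))" for f by simp
  have dd: "direct_decomp G ?N ?A ?B"
    unfolding direct_decomp_def
  proof (intro conjI subA subB)
    show "?A \<inter> ?B = {0}"
    proof -
      have "F 0 = 0" using Fadd[of 0 0] by simp
      then have "0 \<in> ?A" by (metis imageI zero_space)
      moreover have "x = 0" if "x \<in> ?A" "x \<in> ?B" for x using that PF \<open>F 0 = 0\<close> by auto
      ultimately show ?thesis using N0 P0 by blast
    qed
    show "{x + y |x y. x \<in> ?A \<and> y \<in> ?B} = space ?N"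
    proof (intro equalityI subsetI)
      fix f assume "f \<in> {x + y |x y. x \<in> ?A \<and> y \<in> ?B}"
      then show "f \<in> space ?N" using FN Nadd by auto
    next
      fix f assume f: "f \<in> space ?N"
      let ?y = "f + scl ?N (- 1) (F (P f))"
      have FPf: "F (P f) \<in> space ?N" by (rule FN[OF PM[OF f]])
      have "P ?y = P f + P (scl ?N (- 1) (F (P f)))" by (rule Padd[OF f Nscl[OF FPf]])
      also have "\<dots> = P f + scl M (- 1) (P (F (P f)))" by (simp only: Pscl[OF FPf])
      finally have "P ?y = 0" using PF[OF PM[OF f]] by simp
      then have "?y \<in> ?B" by (intro CollectI conjI Nadd[OF f Nscl[OF FPf]])
      moreover have "F (P f) \<in> ?A" using PM[OF f] by simp
      ultimately show "f \<in> {x + y |x y. x \<in> ?A \<and> y \<in> ?B}" using Fdecomp[of f] by blast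
    qed
  qed
  have "F \<in> mod_hom G M (on_sub ?N ?A)"
    unfolding mod_hom_def using Fadd Fscl Fact by auto
  moreover have "bij_betw F (space M) ?A" by (intro bij_betw_imageI inj_on_inverseI[of _ P] PF refl)
  ultimately show ?thesis
    unfolding iso_direct_summand_def direct_summand_def mod_iso_def using dd by (intro exI[of _ ?A]) auto
qed

end

section \<open>Absolute indecomposability\<close>

lemma End_ring_sel:
  "f \<in> carrier (End_ring G M) \<longleftrightarrow> f \<in> mod_hom G M M \<and> (\<forall>v. v \<notin> space M \<longrightarrow> f v = 0)"
  "f \<otimes>\<^bsub>End_ring G M\<^esub> g = f \<circ> g" "f \<oplus>\<^bsub>End_ring G M\<^esub> g = (\<lambda>v. f v + g v)" "\<zero>\<^bsub>End_ring G M\<^esub> = (\<lambda>v. 0)"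
  by (auto simp: End_ring_def)

text \<open>The radical is an intersection of left ideals. Membership of the results in the carrier
  is assumed, which avoids verifying the ring axioms for \<open>End_ring\<close>.\<close>

lemma jacobson_radical_closed:
  assumes "a \<in> jacobson_radical R"
  shows "\<And>b. b \<in> jacobson_radical R \<Longrightarrow> a \<oplus>\<^bsub>R\<^esub> b \<in> carrier R \<Longrightarrow> a \<oplus>\<^bsub>R\<^esub> b \<in> jacobson_radical R"
    and "\<And>r. r \<in> carrier R \<Longrightarrow> r \<otimes>\<^bsub>R\<^esub> a \<in> carrier R \<Longrightarrow> r \<otimes>\<^bsub>R\<^esub> a \<in> jacobson_radical R"
  using assms unfolding jacobson_radical_def maximal_left_ideal_def left_ideal_def
  by (auto dest: additive_subgroup.a_closed)

context kG_coord
begin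

text \<open>Higman's criterion, from the two preceding results with the identity as idempotent,
  whose image is the whole module.\<close>

lemma rproj_iff: 
  assumes "subgroup Q G"
  shows "relatively_projective G Q M \<longleftrightarrow> R.rproj Q"
proof
  have i: "idm I \<in> R.fixA Q" using subset_subgroup[OF assms] by simp
  have ii: "op (idm I) ` space M = space M" by (rule op_idm_image)
  {
    assume "relatively_projective G Q M"
    then have "iso_direct_summand G M (induced G Q (on_sub M (op (idm I) ` space M)))"
      by (simp add: relatively_projective_def ii)
    then obtain a b where ab: "a \<in> R.fixA Q" "b \<in> R.fixA Q" "R.Tr (carrier G) Q (a * idm I * b) = idm I"
      by (rule Tr_of_summand_induced[OF assms i idm_idem])
    then show "R.rproj Q" using i unfolding R.rproj_def by (intro bexI[of _ "a * idm I * b"]) auto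
  }
  assume "R.rproj Q"
  then obtain c where c: "c \<in> R.fixA Q" "R.Tr (carrier G) Q c = idm I" by (auto simp: R.rproj_def)
  then have "R.Tr (carrier G) Q (c * idm I) = idm I" using R.idm_corner R.fixA_corner by metis
  then have "iso_direct_summand G M (induced G Q (on_sub M (op (idm I) ` space M)))"
    by (rule summand_induced_of_Tr[OF assms i idm_idem c(1)])
  then show "relatively_projective G Q M" by (simp add: relatively_projective_def ii)
qed

lemma vertex_iff: "vertex G M Q \<longleftrightarrow> R.vtx Q"
  unfolding vertex_def R.vtx_def using rproj_iff by blast

text \<open>Modulo the radical, \<open>y\<close> is a scalar \<open>s\<close>. The difference lies
  in the radical and so is not a unit; in the local ring of the primitive idempotent
  \<open>i\<close>, a non-unit is nilpotent.\<close>

lemma abs_indec_scalar_nilpotent: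
  assumes Q: "Q \<subseteq> carrier G" and i: "i \<in> R.fixA Q" "i * i = i"
    and abs: "absolutely_indecomposable (G\<lparr>carrier := Q\<rparr>) (on_sub M (op i ` space M))"
    and y: "y \<in> R.fixA Q" "i * y = y" "y * i = y"
  obtains s n where "(y - sc s i) ^ n * i = 0"
proof -
  define Y where "Y = op i ` space M"
  let ?G = "G\<lparr>carrier := Q\<rparr>"
  let ?E = "End_ring ?G (on_sub M Y)" and ?N = "on_sub M Y"
  let ?J = "jacobson_radical ?E"
  have ic: "i \<in> corner I" and yc: "y \<in> corner I" using i y R.fixA_corner by auto
  have prim: "R.primitive_in Q i"
    using primitive_of_indecomposable[OF Q i] abs by (simp add: absolutely_indecomposable_def)
  obtain \<phi> where phi: "\<phi> \<in> ring_iso (?E Quot ?J) (field_ring :: 'k ring)"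
    "\<And>c. \<phi> (?J +>\<^bsub>?E\<^esub> scalar_endo ?N c) = c"
    using abs[folded Y_def] unfolding absolutely_indecomposable_def Let_def by blast
  have opi: "op i v = v" if v: "v \<in> Y" for v
  proof -
    obtain w where "w \<in> space M" "v = op i w" using v unfolding Y_def by blast
    then show ?thesis using op_mult[OF ic ic, of w] i(2) by simp
  qed
  have XM: "Y \<subseteq> space M" unfolding Y_def by auto
  have X0: "0 \<in> Y" unfolding Y_def using lin_endo_zero[OF op_lin, of i] zero_space by (metis imageI)
  have Xadd: "u + w \<in> Y" if uw: "u \<in> Y" "w \<in> Y" for u w
  proof -
    obtain x y where xy: "x \<in> space M" "u = op i x" "y \<in> space M" "w = op i y" using uw unfolding Y_def by blast
    have "u + w = op i (x + y)" using op_lin[of i] xy by (simp add: lin_endo_def)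
    then show ?thesis unfolding Y_def using add_space xy by blast
  qed
  have Xscl: "scl M c u \<in> Y" if u: "u \<in> Y" for c u
  proof -
    obtain x where x: "x \<in> space M" "u = op i x" using u unfolding Y_def by blast
    have "scl M c u = op i (scl M c x)" using op_lin[of i] x by (simp add: lin_endo_def)
    then show ?thesis unfolding Y_def using scl_space x by blast
  qed
  have Xact: "act M h v \<in> Y" if h: "h \<in> Q" and v: "v \<in> Y" for h v
  proof -
    obtain w where w: "w \<in> space M" "v = op i w" using v unfolding Y_def by blast
    then have "act M h v = op i (act M h w)" using fixA_act[OF i(1) Q h] by simp
    then show ?thesis unfolding Y_def using act_closed w h Q by blast
  qed
  \<comment> \<open>The representative of the restriction of \<open>op a\<close> required by
    \<open>End_ring\<close>: zero outside the submodule.\<close>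
  define fn where "fn = (\<lambda>a v. if v \<in> Y then op a v else 0)"
  have fnE: "fn a \<in> carrier ?E" if a: "a \<in> R.fixA Q" "i * a = a" for a
  proof -
    have ac: "a \<in> corner I" using a R.fixA_corner by blast
    have aX: "op a v \<in> Y" for v unfolding Y_def using op_mult[OF ic ac, of v] a(2) by (metis imageI op_space)
    have add: "op a (v + w) = op a v + op a w" if "v \<in> Y" "w \<in> Y" for v w
      using op_lin[of a] subsetD[OF XM that(1)] subsetD[OF XM that(2)] unfolding lin_endo_def by blast
    have scal: "op a (scl M c v) = scl M c (op a v)" if "v \<in> Y" for c v
      using op_lin[of a] subsetD[OF XM that] unfolding lin_endo_def by blast
    have ac': "op a (act M h v) = act M h (op a v)" if "h \<in> Q" "v \<in> Y" for h v
      using fixA_act[OF a(1) Q that(1)] that(2) XM by blast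
    show ?thesis
      unfolding End_ring_sel mod_hom_def
    proof (intro conjI CollectI ballI allI impI)
      show "fn a ` space ?N \<subseteq> space ?N" using aX by (auto simp: fn_def)
      show "fn a (v + w) = fn a v + fn a w" if "v \<in> space ?N" "w \<in> space ?N" for v w
        using add[of v w] Xadd[of v w] that by (simp add: fn_def)
      show "fn a (scl ?N c v) = scl ?N c (fn a v)" if "v \<in> space ?N" for c v
        using scal[of v c] Xscl[of v c] that by (simp add: fn_def)
      show "fn a (act ?N h v) = act ?N h (fn a v)" if "h \<in> carrier ?G" "v \<in> space ?N" for h v
        using ac'[of h v] Xact[of h v] that by (simp add: fn_def)
      show "fn a v = 0" if "v \<notin> space ?N" for v using that by (simp add: fn_def)
    qed
  qed
  have scal_fn: "scalar_endo ?N c = fn (sc c i)" for c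
  proof
    fix v show "scalar_endo ?N c v = fn (sc c i) v"
      using opi[of v] by (simp add: scalar_endo_def fn_def op_sc)
  qed
  have scalE: "scalar_endo ?N c \<in> carrier ?E" for c
    unfolding scal_fn using i by (intro fnE R.fixA_sc) (simp_all add: sc_mult(2)[symmetric])
  have zeroE: "(\<lambda>v. 0) \<in> carrier ?E"
    unfolding End_ring_sel mod_hom_def
  proof (intro conjI CollectI ballI allI impI)
    show "(\<lambda>v. 0) ` space ?N \<subseteq> space ?N" using X0 by auto
    show "0 = act ?N h 0" if "h \<in> carrier ?G" for h using act_zero[of h] that Q by auto
  qed simp_all
  have zeroJ: "(\<lambda>v. 0) \<in> ?J"
    unfolding jacobson_radical_def
  proof (intro CollectI conjI allI impI zeroE)
    fix L assume "maximal_left_ideal L ?E"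
    then have "additive_subgroup L ?E" by (simp add: maximal_left_ideal_def left_ideal_def)
    then show "(\<lambda>v. 0) \<in> L" using additive_subgroup.zero_closed[of L ?E] by (simp only: End_ring_sel(4))
  qed
  have coset: "?J +>\<^bsub>?E\<^esub> f = (\<lambda>j. (\<lambda>v. j v + f v)) ` ?J" for f
    unfolding a_r_coset_def' End_ring_sel(3) by blast
  have addE: "(\<lambda>v. f v + g v) \<in> carrier ?E" if f: "f \<in> carrier ?E" and g: "g \<in> carrier ?E" for f g
  proof -
    have "f ` Y \<subseteq> Y" "g ` Y \<subseteq> Y" using f g by (simp_all add: End_ring_sel mod_hom_def)
    then have "f v \<in> Y" "g v \<in> Y" if "v \<in> Y" for v using that by (simp_all only: image_subset_iff)
    moreover have "act M h (f v + g v) = act M h (f v) + act M h (g v)" if "h \<in> Q" "v \<in> Y" for h v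
      using calculation(1)[OF that(2)] calculation(2)[OF that(2)]
      by (intro act_add subsetD[OF Q that(1)] subsetD[OF XM])
    moreover have "f (v + w) = f v + f w" "g (v + w) = g v + g w" if "v \<in> Y" "w \<in> Y" for v w
      using f g that by (simp_all add: End_ring_sel mod_hom_def)
    moreover have "f (scl M c v) = scl M c (f v)" "g (scl M c v) = scl M c (g v)" if "v \<in> Y" for c v
      using f g that by (simp_all add: End_ring_sel mod_hom_def)
    moreover have "f (act M h v) = act M h (f v)" "g (act M h v) = act M h (g v)" if "h \<in> Q" "v \<in> Y" for h v
      using f g that by (simp_all add: End_ring_sel mod_hom_def)
    moreover have fg0: "f v = 0" "g v = 0" if "v \<notin> Y" for v
      using f g that by (simp_all add: End_ring_sel)
    note fg = calculation
    show ?thesis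
      unfolding End_ring_sel mod_hom_def
    proof (intro conjI CollectI ballI allI impI)
      show "(\<lambda>v. f v + g v) ` space ?N \<subseteq> space ?N"
        using fg(1,2) Xadd by (simp add: image_subset_iff)
      show "f (v + w) + g (v + w) = f v + g v + (f w + g w)" if "v \<in> space ?N" "w \<in> space ?N" for v w
        using fg(4,5)[of v w] that by simp
      show "f (scl ?N c v) + g (scl ?N c v) = scl ?N c (f v + g v)" if "v \<in> space ?N" for c v
        using fg(6,7)[of v c] that by (simp add: scale_right_distrib)
      show "f (act ?N h v) + g (act ?N h v) = act ?N h (f v + g v)" if "h \<in> carrier ?G" "v \<in> space ?N" for h v
        using fg(3,8,9)[of h v] that by simp
      show "f v + g v = 0" if "v \<notin> space ?N" for v using fg0[of v] that by simp
    qed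
  qed
  have addJ: "(\<lambda>v. f v + g v) \<in> ?J" if "f \<in> ?J" "g \<in> ?J" for f g
    using jacobson_radical_closed(1)[OF that] addE that by (simp add: End_ring_sel(3) jacobson_radical_def)
  have multJ: "f \<circ> g \<in> ?J" if "f \<in> carrier ?E" "g \<in> ?J" "f \<circ> g \<in> carrier ?E" for f g
    using jacobson_radical_closed(2)[OF that(2,1)] that(3) by (simp add: End_ring_sel(2))
  have JE: "f \<in> carrier ?E" if "f \<in> ?J" for f using that by (simp add: jacobson_radical_def)
  have fn_comp: "fn (a * b) = fn a \<circ> fn b" if a: "a \<in> R.fixA Q" and b: "b \<in> R.fixA Q" "i * b = b" for a b
  proof
    fix v
    have c: "a \<in> corner I" "b \<in> corner I" using a b R.fixA_corner by auto
    have "op b v \<in> Y" unfolding Y_def using op_mult[OF ic c(2), of v] b(2) by (metis imageI op_space)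
    then show "fn (a * b) v = (fn a \<circ> fn b) v"
      using op_mult[OF c] X0 lin_endo_zero[OF op_lin, of a] by (simp add: fn_def)
  qed
  \<comment> \<open>Otherwise the scalars 1 and 0 would have the same class, although \<phi> takes
    different values on these classes.\<close>
  have one_notin: "scalar_endo ?N 1 \<notin> ?J"
  proof
    assume one: "scalar_endo ?N 1 \<in> ?J"
    have m1: "scalar_endo ?N (- 1) \<in> ?J"
    proof -
      have "scalar_endo ?N (- 1) \<circ> scalar_endo ?N 1 = scalar_endo ?N (- 1)"
        using X0 by (auto simp: scalar_endo_def fun_eq_iff)
      then show ?thesis using multJ[OF scalE one, of "- 1"] scalE by simp
    qed
    have "?J +>\<^bsub>?E\<^esub> scalar_endo ?N 1 = ?J +>\<^bsub>?E\<^esub> scalar_endo ?N 0"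
      unfolding coset
    proof (intro equalityI subsetI)
      fix f assume "f \<in> (\<lambda>j. (\<lambda>v. j v + scalar_endo ?N 1 v)) ` ?J"
      then obtain j where j: "j \<in> ?J" "f = (\<lambda>v. j v + scalar_endo ?N 1 v)" by blast
      then have "f \<in> ?J" using addJ one by simp
      moreover have "f = (\<lambda>v. f v + scalar_endo ?N 0 v)" by (rule ext) (simp add: scalar_endo_def)
      ultimately show "f \<in> (\<lambda>j. (\<lambda>v. j v + scalar_endo ?N 0 v)) ` ?J" by (intro image_eqI[of f _ f])
    next
      fix f assume "f \<in> (\<lambda>j. (\<lambda>v. j v + scalar_endo ?N 0 v)) ` ?J"
      then obtain j where j: "j \<in> ?J" "f = (\<lambda>v. j v + scalar_endo ?N 0 v)" by blast
      then have "f = j" by (simp add: scalar_endo_def fun_eq_iff)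
      then have "f = (\<lambda>v. (j v + scalar_endo ?N (- 1) v) + scalar_endo ?N 1 v)"
        by (auto simp: scalar_endo_def)
      then show "f \<in> (\<lambda>j. (\<lambda>v. j v + scalar_endo ?N 1 v)) ` ?J" by (rule image_eqI[OF _ addJ[OF j(1) m1]])
    qed
    then show False using phi(2)[of 1] phi(2)[of 0] by simp
  qed
  have inj: "?J +>\<^bsub>?E\<^esub> f = ?J +>\<^bsub>?E\<^esub> g"
    if "f \<in> carrier ?E" "g \<in> carrier ?E" "\<phi> (?J +>\<^bsub>?E\<^esub> f) = \<phi> (?J +>\<^bsub>?E\<^esub> g)" for f g
  proof -
    have "inj_on \<phi> (carrier (?E Quot ?J))" using phi(1) by (auto simp: ring_iso_def bij_betw_def)
    moreover have "?J +>\<^bsub>?E\<^esub> f \<in> carrier (?E Quot ?J)" if "f \<in> carrier ?E" for f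
      using that by (auto simp: FactRing_def A_RCOSETS_def')
    ultimately show ?thesis using that by (meson inj_onD)
  qed
  \<comment> \<open>Since \<phi> is injective and sends the class of each scalar to that scalar,
    \<open>y\<close> and \<open>s\<close> have the same class.\<close>
  define s where "s = \<phi> (?J +>\<^bsub>?E\<^esub> fn y)"
  let ?x = "y - sc s i"
  have x: "?x \<in> R.fixA Q" "i * ?x = ?x" "?x * i = ?x"
    using y i by (auto simp: right_diff_distrib left_diff_distrib sc_mult[symmetric])
  have "?J +>\<^bsub>?E\<^esub> fn y = ?J +>\<^bsub>?E\<^esub> scalar_endo ?N s"
    by (rule inj[OF fnE[OF y(1,2)] scalE]) (simp add: phi(2) s_def)
  moreover have "fn y \<in> ?J +>\<^bsub>?E\<^esub> fn y"
    unfolding coset using zeroJ by (intro image_eqI[of _ _ "\<lambda>v. 0"]) auto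
  ultimately obtain j where j: "j \<in> ?J" "fn y = (\<lambda>v. j v + scalar_endo ?N s v)"
    unfolding coset by blast
  have "j = fn ?x"
  proof
    fix v
    have "fn y v = j v + scalar_endo ?N s v" using j(2) by metis
    then show "j v = fn ?x v" unfolding scal_fn by (auto simp: fn_def op_diff)
  qed
  then have xJ: "fn ?x \<in> ?J" using j by simp
  have "\<not> R.inv_in Q i ?x"
  proof
    assume "R.inv_in Q i ?x"
    then obtain w where w: "w \<in> R.fixA Q" "i * w = w" "w * ?x = i" by (auto simp: R.inv_in_def)
    have "fn w \<circ> fn ?x = fn i" using fn_comp[OF w(1) x(1,2)] w(3) by simp
    moreover have "fn i = scalar_endo ?N 1" unfolding scal_fn by simp
    ultimately have "scalar_endo ?N 1 \<in> ?J" using multJ[OF fnE[OF w(1,2)] xJ] scalE by simp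
    then show False using one_notin by simp
  qed
  then obtain n where "?x ^ n * i = 0" using R.inv_or_nilpotent[OF prim x] by blast
  then show ?thesis by (rule that)
qed

lemma mtr_scalar_nilpotent:
  fixes i y :: "('i, 'k) rmat"
  assumes i: "i \<in> corner I" "i * i = i" and y: "y \<in> corner I" "i * y = y" "y * i = y" and n: "(y - sc s i) ^ n * i = 0"
  shows "mtr I y = s * mtr I i"
proof -
  let ?x = "y - sc s i"
  have xc: "?x \<in> corner I" using i y by auto
  have "i * ?x = ?x" using i y by (simp add: right_diff_distrib sc_mult[symmetric])
  then have "?x ^ Suc n = ?x ^ n * i * ?x" by (simp add: power_commutes mult.assoc)
  then have "?x ^ Suc n = 0" using n by simp
  then have "mtr I ?x = 0" using mtr_nilpotent[OF finI, of ?x "Suc n"] xc by blast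
  then show ?thesis by simp
qed

text \<open>Schur's lemma: write \<open>a\<close> as a scalar plus a nilpotent part. The image of
  the nilpotent part is a submodule, so zero or everything; in the latter case all its powers would
  be surjective, although one of them is zero.\<close>

lemma simple_scalar:
  assumes simple: "simple_mod G M" and abs: "absolutely_indecomposable G M" and a: "a \<in> R.fixA (carrier G)"
  shows "\<exists>s. a = sc s (idm I)"
proof -
  have i: "idm I \<in> R.fixA (carrier G)" by simp
  have ac: "a \<in> corner I" using a R.fixA_corner by blast
  have "absolutely_indecomposable (G\<lparr>carrier := carrier G\<rparr>) (on_sub M (op (idm I) ` space M))"
    using abs by (simp add: op_idm_image)
  then obtain s n where sn: "(a - sc s (idm I)) ^ n * idm I = 0"
    by (rule abs_indec_scalar_nilpotent[OF subset_refl i idm_idem _ a]) (use ac R.idm_corner in auto)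
  let ?x = "a - sc s (idm I)"
  have x: "?x \<in> R.fixA (carrier G)" "?x \<in> corner I" using a i ac by auto
  have lin: "lin_endo (op ?x)" by (rule op_lin)
  have "submod G M (op ?x ` space M)"
    unfolding submod_def subspace_M_iff
  proof (intro conjI ballI allI)
    show "op ?x ` space M \<subseteq> space M" by auto
    show "0 \<in> op ?x ` space M" using lin_endo_zero[OF lin] zero_space by (metis imageI)
    fix u assume "u \<in> op ?x ` space M"
    then obtain v where v: "v \<in> space M" "u = op ?x v" by (elim imageE)
    { fix u' assume "u' \<in> op ?x ` space M"
      then obtain w where w: "w \<in> space M" "u' = op ?x w" by (elim imageE)
      have "u + u' = op ?x (v + w)" using lin v w by (simp add: lin_endo_def)
      then show "u + u' \<in> op ?x ` space M" using add_space v w by blast }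
    { fix c
      have "scl M c u = op ?x (scl M c v)" using lin v by (simp add: lin_endo_def)
      then show "scl M c u \<in> op ?x ` space M" using scl_space v by blast }
    { fix g assume g: "g \<in> carrier G"
      have "act M g u = op ?x (act M g v)" using fixA_act[OF x(1) subset_refl g v(1)] v by simp
      then show "act M g u \<in> op ?x ` space M" using act_closed g v by blast }
  qed
  then have "op ?x ` space M = {0} \<or> op ?x ` space M = space M" using simple by (simp add: simple_mod_def)
  then show ?thesis
  proof
    assume 0: "op ?x ` space M = {0}"
    have "?x = 0" by (rule op_inject) (use x 0 in auto)
    then have "a = sc s (idm I)" by (simp only: right_minus_eq)
    then show ?thesis ..
  next
    assume full: "op ?x ` space M = space M"
    have xk: "?x ^ k * idm I \<in> corner I" for k
    proof (induction k)
      case (Suc k)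
      have "?x ^ Suc k * idm I = ?x * (?x ^ k * idm I)" by (simp only: power_Suc mult.assoc)
      then show ?case using corner_mult[OF x(2) Suc] by simp
    qed simp
    have "op (?x ^ k * idm I) ` space M = space M" for k
    proof (induction k)
      case (Suc k)
      have e: "?x ^ Suc k * idm I = ?x * (?x ^ k * idm I)" by (simp only: power_Suc mult.assoc)
      have "op (?x ^ Suc k * idm I) ` space M = op ?x ` op (?x ^ k * idm I) ` space M"
        unfolding e image_image by (rule image_cong[OF refl]) (rule op_mult[OF x(2) xk])
      then show ?case using Suc full by simp
    qed (simp add: op_idm_image)
    from this[of n] have "space M = {0}"
      unfolding sn image_constant_conv op_zero using zero_space by (metis empty_iff)
    then show ?thesis using simple by (simp add: simple_mod_def)
  qed
qed

end

section \<open>Sources\<close>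

context kG_coord
begin

text \<open>Among the idempotents \<open>i\<close> of \<open>fixA Q\<close> such that the identity
  is the trace of some \<open>a * i\<close>, one of least rank has indecomposable image. If
  \<open>i\<close> splits into two idempotents, the two traces add up to the identity; one of them
  is a non-zero scalar and can be normalized, so minimality of the rank makes the other idempotent
  zero.\<close>

lemma source_exists:
  assumes scalar: "\<And>a. a \<in> R.fixA (carrier G) \<Longrightarrow> \<exists>s. a = sc s (idm I)"
    and nonzero: "(idm I :: ('i, 'k) rmat) \<noteq> 0" and Q: "R.vtx Q"
  obtains i where "i \<in> R.fixA Q" "i * i = i" "source G M Q (op i ` space M)"
proof -
  have Q': "subgroup Q G" "R.rproj Q" using Q by (auto simp: R.vtx_def)
  note Qc = subset_subgroup[OF Q'(1)]
  let ?P = "\<lambda>i. i \<in> R.fixA Q \<and> i * i = i \<and> (\<exists>a\<in>R.fixA Q. R.Tr (carrier G) Q (a * i) = idm I)"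
  obtain c where c: "c \<in> R.fixA Q" "R.Tr (carrier G) Q c = idm I" using Q'(2) by (auto simp: R.rproj_def)
  have "?P (idm I)"
    using c Qc R.idm_corner(2)[OF R.fixA_corner[OF c(1)]] by (intro conjI bexI[of _ c]) auto
  then have ex: "\<exists>i. ?P i" by blast
  define i where "i = (ARG_MIN rk i. ?P i)"
  have Pi: "?P i" and min: "\<And>j. ?P j \<Longrightarrow> rk i \<le> rk j"
    using arg_min_nat_lemma[of ?P _ rk] ex unfolding i_def by blast+
  have i: "i \<in> R.fixA Q" "i * i = i" using Pi by auto
  obtain a where a: "a \<in> R.fixA Q" "R.Tr (carrier G) Q (a * i) = idm I" using Pi by blast
  have ic: "i \<in> corner I" and ac: "a \<in> corner I" using i a R.fixA_corner by auto
  have half: "rk i \<le> rk j"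
    if j: "j \<in> R.fixA Q" "j * j = j" and nz: "R.Tr (carrier G) Q (a * j) \<noteq> 0" for j
  proof -
    have "R.Tr (carrier G) Q (a * j) \<in> R.fixA (carrier G)"
      using R.Tr_fix[OF Q'(1) subgroup_self Qc] a(1) j(1) by auto
    then obtain s where s: "R.Tr (carrier G) Q (a * j) = sc s (idm I)" using scalar by blast
    then have "s \<noteq> 0" using nz by auto
    then have "R.Tr (carrier G) Q (sc (1 / s) a * j) = idm I"
      unfolding sc_mult(1)[symmetric] R.Tr_sc s by simp
    moreover have "sc (1 / s) a \<in> R.fixA Q" using a by auto
    ultimately show ?thesis using min[of j] j by blast
  qed
  have "indecomposable (G\<lparr>carrier := Q\<rparr>) (on_sub M (op i ` space M))"
    unfolding indecomposable_def
  proof (intro conjI allI impI)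
    show "space (on_sub M (op i ` space M)) \<noteq> {0}"
    proof
      assume "space (on_sub M (op i ` space M)) = {0}"
      then have "op i v = 0" if "v \<in> space M" for v using that by (auto simp: image_def)
      then have "i = 0" using op_inject[OF ic, of 0] by simp
      then show False using a(2) nonzero by simp
    qed
    fix A B assume d: "direct_decomp (G\<lparr>carrier := Q\<rparr>) (on_sub M (op i ` space M)) A B"
    obtain j where j: "j \<in> R.fixA Q" "j * j = j" "i * j = j" "j * i = j" "op j ` space M = A"
      "\<And>v. v \<in> A \<Longrightarrow> op j v = v" "\<And>v. v \<in> B \<Longrightarrow> op j v = 0"
      by (rule decomp_idempotent[OF Qc i d], rule that)
    let ?k = "i - j"
    have jc: "j \<in> corner I" using j R.fixA_corner by blast
    have k: "?k \<in> R.fixA Q" "?k * ?k = ?k" "?k \<in> corner I" "j * ?k = 0" "?k * j = 0"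
      using i j ic jc by (auto simp: left_diff_distrib right_diff_distrib)
    have rki: "rk i = rk j + rk ?k" using rk_add[OF finI jc k(3) j(2) k(2,4,5)] by simp
    have "a * i = a * j + a * ?k" by (simp add: right_diff_distrib)
    then have "R.Tr (carrier G) Q (a * j) + R.Tr (carrier G) Q (a * ?k) = idm I"
      using a(2) by (simp add: R.Tr_add)
    then consider "R.Tr (carrier G) Q (a * j) \<noteq> 0" | "R.Tr (carrier G) Q (a * ?k) \<noteq> 0" using nonzero by fastforce
    then show "A = {0} \<or> B = {0}"
    proof cases
      case 1
      then have "?k = 0" using half[OF j(1,2)] rki rk_zero_iff[OF finI k(3)] by simp
      then have ij: "i = j" by simp
      have "v = 0" if "v \<in> B" for v
      proof -
        have "v \<in> op i ` space M" using d that by (auto simp: direct_decomp_def submod_def)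
        then obtain w where "v = op i w" by blast
        then have "v = op i v" using op_mult[OF ic ic, of w] i(2) by simp
        then show ?thesis using j(7)[OF that] ij by simp
      qed
      moreover have "0 \<in> B" using d by (auto simp: direct_decomp_def)
      ultimately show ?thesis by blast
    next
      case 2
      then have "j = 0" using half[OF k(1,2)] rki rk_zero_iff[OF finI jc] by simp
      then have "v = 0" if "v \<in> A" for v using j(6)[OF that] by simp
      moreover have "0 \<in> A" using d by (auto simp: direct_decomp_def)
      ultimately show ?thesis by blast
    qed
  qed
  moreover have "direct_summand (G\<lparr>carrier := Q\<rparr>) M (op i ` space M)"
  proof -
    have "direct_decomp (G\<lparr>carrier := Q\<rparr>) (on_sub M (op (idm I) ` space M)) (op i ` space M) (op (idm I - i) ` space M)"
      by (rule idempotent_decomp[OF Qc _ idm_idem i]) (use Qc ic R.idm_corner in auto)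
    then show ?thesis unfolding direct_summand_def by (auto simp: op_idm_image)
  qed
  moreover have "iso_direct_summand G M (induced G Q (on_sub M (op i ` space M)))"
    by (rule summand_induced_of_Tr[OF Q'(1) i a])
  ultimately have "source G M Q (op i ` space M)" using Q by (simp add: source_def vertex_iff)
  then show ?thesis by (rule that[OF i])
qed

text \<open>The idempotent of a source commutes with the vertex, and its trace is the dimension of
  the source, which is not zero in \<open>k\<close>.\<close>

lemma trace_at_vertex:
  assumes p: "prime p" "CHAR('k) = p"
    and scalar: "\<And>a. a \<in> R.fixA (carrier G) \<Longrightarrow> \<exists>s. a = sc s (idm I)"
    and nonzero: "(idm I :: ('i, 'k) rmat) \<noteq> 0" and Q: "R.vtx Q"
    and cop: "\<And>Q X. source G M Q X \<Longrightarrow> coprime p (dim_mod (on_sub M X))"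
  shows "\<exists>b\<in>R.fixA Q. mtr I b \<noteq> 0"
proof -
  obtain i where i: "i \<in> R.fixA Q" "i * i = i" "source G M Q (op i ` space M)"
    by (rule source_exists[OF scalar nonzero Q])
  have "\<not> p dvd dim_mod (on_sub M (op i ` space M))"
    using cop[OF i(3)] p(1) by (metis coprime_absorb_left not_prime_unit)
  then have "mtr I i \<noteq> 0"
    using mtr_idempotent_dim[OF R.fixA_corner[OF i(1)] i(2)] p(2) by (simp add: of_nat_eq_0_iff_char_dvd)
  then show ?thesis using i(1) by blast
qed

text \<open>Let \<open>j\<close> be the idempotent of the source and write the identity as the trace
  of \<open>a * j * a'\<close>. Symmetry of the trace form and scalarity pass non-vanishing from
  \<open>tr b\<close> to the trace of \<open>a * j * a'\<close>. Cyclically rearranged, this is the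
  trace of an endomorphism of the source, which is a scalar plus a nilpotent part; so it is a
  multiple of \<open>tr j\<close>, the dimension of the source in \<open>k\<close>.\<close>

lemma source_dim_coprime:
  assumes p: "prime p" "CHAR('k) = p"
    and scalar: "\<And>a. a \<in> R.fixA (carrier G) \<Longrightarrow> \<exists>s. a = sc s (idm I)"
    and src: "source G M P Z" and abs: "absolutely_indecomposable (G\<lparr>carrier := P\<rparr>) (on_sub M Z)"
    and b: "b \<in> R.fixA P" "mtr I b \<noteq> 0"
  shows "coprime p (dim_mod (on_sub M Z))"
proof -
  have P: "subgroup P G" using src by (auto simp: source_def vertex_def)
  note Pc = subset_subgroup[OF P]
  have iP: "idm I \<in> R.fixA P" using Pc by simp
  obtain B where "direct_decomp (G\<lparr>carrier := P\<rparr>) M Z B" using src by (auto simp: source_def direct_summand_def)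
  then have d: "direct_decomp (G\<lparr>carrier := P\<rparr>) (on_sub M (op (idm I) ` space M)) Z B" by (simp add: op_idm_image)
  obtain j where j: "j \<in> R.fixA P" "j * j = j" "op j ` space M = Z"
    by (rule decomp_idempotent[OF Pc iP idm_idem d])
  have "iso_direct_summand G M (induced G P (on_sub M (op j ` space M)))" using src j(3) by (simp add: source_def)
  then obtain a a' where a: "a \<in> R.fixA P" "a' \<in> R.fixA P" "R.Tr (carrier G) P (a * j * a') = idm I"
    by (rule Tr_of_summand_induced[OF P j(1,2)])
  \<comment> \<open>As \<open>j\<close> is idempotent, \<open>?c\<close> and \<open>?y\<close> are
    the two products of \<open>a * j\<close> and \<open>j * a'\<close>, hence have the same
    trace.\<close>
  let ?c = "a * j * a'" and ?y = "j * a' * a * j"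
  have c: "?c \<in> R.fixA P" using a j by auto
  have cor: "a \<in> corner I" "a' \<in> corner I" "j \<in> corner I" "b \<in> corner I" using a j b R.fixA_corner by auto
  obtain s where s: "R.Tr (carrier G) P b = sc s (idm I)"
    using scalar[OF R.Tr_fix[OF P subgroup_self Pc b(1)]] by blast
  have "mtr I b = mtr I (R.Tr (carrier G) P ?c * b)" using a(3) cor by (simp add: R.idm_corner)
  also have "\<dots> = mtr I (?c * R.Tr (carrier G) P b)" by (rule R.mtr_Tr_symmetric[OF P b(1) c, symmetric])
  also have "\<dots> = s * mtr I ?c" unfolding s using R.idm_corner(2)[OF R.fixA_corner[OF c]] by (simp add: sc_mult(2)[symmetric])
  finally have "mtr I ?c \<noteq> 0" using b(2) by auto
  also have "mtr I ?c = mtr I (a * j * (j * a'))"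
  proof -
    have "a * j * (j * a') = a * (j * j) * a'" by (simp only: mult.assoc)
    then show ?thesis using j(2) by simp
  qed
  also have "\<dots> = mtr I ((j * a') * (a * j))" using cor by (intro mtr_mult_commute[OF finI]) auto
  also have "(j * a') * (a * j) = ?y" by (simp only: mult.assoc)
  finally have tr_y: "mtr I ?y \<noteq> 0" .
  have y: "?y \<in> R.fixA P" "j * ?y = ?y" "?y * j = ?y"
  proof -
    show "?y \<in> R.fixA P" using a j by auto
    have "j * ?y = (j * j) * a' * a * j" "?y * j = j * a' * a * (j * j)" by (simp_all only: mult.assoc)
    then show "j * ?y = ?y" "?y * j = ?y" using j(2) by simp_all
  qed
  obtain s' n where "(?y - sc s' j) ^ n * j = 0"
    by (rule abs_indec_scalar_nilpotent[OF Pc j(1,2) abs[folded j(3)] y])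
  then have "mtr I ?y = s' * mtr I j"
    by (rule mtr_scalar_nilpotent[OF cor(3) j(2) R.fixA_corner[OF y(1)] y(2,3)])
  then have "mtr I j \<noteq> 0" using tr_y by auto
  then have "\<not> p dvd dim_mod (on_sub M Z)"
    using mtr_idempotent_dim[OF cor(3) j(2)] j(3) p(2) by (simp add: of_nat_eq_0_iff_char_dvd)
  then show ?thesis using p(1) by (simp add: prime_imp_coprime)
qed

end

lemma (in kG_module) coordinates_exist:
  assumes "finite (carrier G)"
  obtains B where "kG_coord G M B (\<lambda>x. x)"
proof -
  obtain S where S: "finite S" "S \<subseteq> space M" "span S = space M" using finite_dim by blast
  obtain B where B: "B \<subseteq> space M" "independent B" "space M \<subseteq> span B" by (rule basis_exists[of "space M"])
  have "finite B" using independent_span_bound[OF S(1) B(2)] B(1) S(3) by blast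
  moreover have "span B = space M" using B span_minimal[OF B(1) subspace_space] by blast
  ultimately have "kG_coord G M B (\<lambda>x. x)" using assms B by unfold_locales auto
  then show ?thesis by (rule that)
qed

section \<open>Coordinates of tensor products\<close>

lemma sum_apply_fun: "(\<Sum>t\<in>A. g t) x = (\<Sum>t\<in>A. g t x)"
  for g :: "'a \<Rightarrow> 'b \<Rightarrow> 'c::comm_monoid_add"
  by (induction A rule: infinite_finite_induct) simp_all

locale tensor_coord = U: kG_coord G U I \<beta> + V: kG_coord G V J \<gamma>
  for G :: "('g, 'r) monoid_scheme" (structure)
    and U :: "('k::field, 'g, 'u::ab_group_add) gmod" and I :: "'i set" and \<beta>
    and V :: "('k, 'g, 'v::ab_group_add) gmod" and J :: "'j set" and \<gamma>
begin

lemma bilinear_forms_cong: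
  assumes "f \<in> bilinear_forms U V" "\<And>u v. \<lbrakk>u \<in> space U; v \<in> space V\<rbrakk> \<Longrightarrow> f u v = f' u v"
  shows "f' \<in> bilinear_forms U V"
proof -
  have "f' u v = f u v" if "u \<in> space U" "v \<in> space V" for u v using assms(2)[OF that] ..
  then show ?thesis using assms(1)
    by (simp add: bilinear_forms_def U.add_space V.add_space U.scl_space V.scl_space)
qed

text \<open>Both directions matter: \<open>pure_tensor\<close> is zero on non-bilinear functions, so
  its translate agrees with another pure tensor only if non-bilinear functions stay non-bilinear.
  The converse direction uses the inverse of \<open>g\<close>; agreement on the two spaces is enough
  there.\<close>

lemma bilinear_forms_act:
  assumes g: "g \<in> carrier G"
  shows "(\<lambda>u v. f (act U g u) (act V g v)) \<in> bilinear_forms U V \<longleftrightarrow> f \<in> bilinear_forms U V"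
proof -
  have step: "(\<lambda>u v. f (act U g u) (act V g v)) \<in> bilinear_forms U V"
    if "f \<in> bilinear_forms U V" "g \<in> carrier G" for f g
    using that unfolding bilinear_forms_def
    by (simp add: U.act_add V.act_add U.act_scl V.act_scl U.act_closed V.act_closed)
  have "f \<in> bilinear_forms U V" if fg: "(\<lambda>u v. f (act U g u) (act V g v)) \<in> bilinear_forms U V"
  proof (rule bilinear_forms_cong[OF step[OF fg U.inv_closed[OF g]]])
    fix u v assume "u \<in> space U" "v \<in> space V"
    then show "f (act U g (act U (inv g) u)) (act V g (act V (inv g) v)) = f u v"
      using g by (simp add: U.act_mult[symmetric] V.act_mult[symmetric] U.act_one V.act_one)
  qed
  then show ?thesis using step[OF _ g] by blast
qed

lemma act_pure: "g \<in> carrier G \<Longrightarrow> act (tensor U V) g (pure_tensor U V u v) = pure_tensor U V (act U g u) (act V g v)"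
  by (rule ext) (simp add: tensor_def pure_tensor_def bilinear_forms_act)

lemma act_tensor_linear:
  "act (tensor U V) g (s + t) = act (tensor U V) g s + act (tensor U V) g t"
  "act (tensor U V) g (\<lambda>f. c * t f) = (\<lambda>f. c * act (tensor U V) g t f)"
  "act (tensor U V) g 0 = 0"
  by (simp_all add: tensor_def fun_eq_iff)

definition tensor_basis :: "'i \<times> 'j \<Rightarrow> ('u \<Rightarrow> 'v \<Rightarrow> 'k) \<Rightarrow> 'k" where
  "tensor_basis x = pure_tensor U V (\<beta> (fst x)) (\<gamma> (snd x))"

text \<open>The forms dual to \<open>tensor_basis\<close>: evaluating a tensor at such a form reads
  off one of its coordinates, which gives linear independence as well as matrix entries.\<close>

definition co_form :: "'i \<times> 'j \<Rightarrow> 'u \<Rightarrow> 'v \<Rightarrow> 'k" where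
  "co_form x u v = U.co u (fst x) * V.co v (snd x)"

lemma pure_co_form:
  "pure_tensor U V u v (co_form x) = U.co u (fst x) * V.co v (snd x)"
proof -
  have "co_form x \<in> bilinear_forms U V"
    by (simp add: bilinear_forms_def co_form_def U.co_add V.co_add U.co_scl V.co_scl algebra_simps)
  then show ?thesis by (simp add: pure_tensor_def co_form_def)
qed

lemma tensor_basis_co_form:
  "y \<in> I \<times> J \<Longrightarrow> tensor_basis y (co_form x) = (if x = y then 1 else 0)"
  by (auto simp: tensor_basis_def pure_co_form U.co_beta V.co_beta prod_eq_iff)

lemma pure_linear:
  assumes "u \<in> space U" "v \<in> space V"
  shows "u' \<in> space U \<Longrightarrow> pure_tensor U V (u + u') v = pure_tensor U V u v + pure_tensor U V u' v"
    and "v' \<in> space V \<Longrightarrow> pure_tensor U V u (v + v') = pure_tensor U V u v + pure_tensor U V u v'"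
    and "pure_tensor U V (scl U c u) v = (\<lambda>f. c * pure_tensor U V u v f)"
    and "pure_tensor U V u (scl V c v) = (\<lambda>f. c * pure_tensor U V u v f)"
  using assms by (auto simp: pure_tensor_def bilinear_forms_def fun_eq_iff)

lemma pure_zero:
  "v \<in> space V \<Longrightarrow> pure_tensor U V 0 v = 0" "u \<in> space U \<Longrightarrow> pure_tensor U V u 0 = 0"
  using pure_linear(3)[of 0 v 0] pure_linear(4)[of u 0 0] by (auto simp: fun_eq_iff)

lemma tensor_sel:
  "space (tensor U V) = fv.span {pure_tensor U V u v | u v. u \<in> space U \<and> v \<in> space V}"
  "scl (tensor U V) = (\<lambda>c t f. c * t f)"
  by (simp_all add: tensor_def)

lemma span_tensor_basis: "fv.span (tensor_basis ` (I \<times> J)) = space (tensor U V)"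
proof (rule antisym)
  let ?T = "fv.span (tensor_basis ` (I \<times> J))"
  show "?T \<subseteq> space (tensor U V)"
    unfolding tensor_sel tensor_basis_def by (rule fv.span_mono) (use U.beta_space V.beta_space in force)
  have T: "0 \<in> ?T" "\<And>s t. \<lbrakk>s \<in> ?T; t \<in> ?T\<rbrakk> \<Longrightarrow> s + t \<in> ?T" "\<And>c t. t \<in> ?T \<Longrightarrow> (\<lambda>f. c * t f) \<in> ?T"
    using fv.span_zero fv.span_add fv.span_scale by blast+
  have 1: "pure_tensor U V u (\<gamma> j) \<in> ?T" if "u \<in> space U" and j: "j \<in> J" for u j
  proof -
    have "U.subspace {u \<in> space U. pure_tensor U V u (\<gamma> j) \<in> ?T}"
      using T j V.beta_space[OF j] pure_linear(1,3)[OF _ V.beta_space[OF j]]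
      by (auto simp: U.subspace_def U.add_space U.scl_space pure_zero)
    moreover have "\<beta> ` I \<subseteq> {u \<in> space U. pure_tensor U V u (\<gamma> j) \<in> ?T}"
      using j U.beta_space fv.span_base[of _ "tensor_basis ` (I \<times> J)"] by (auto simp: tensor_basis_def image_def)
    ultimately have "U.span (\<beta> ` I) \<subseteq> {u \<in> space U. pure_tensor U V u (\<gamma> j) \<in> ?T}" by (rule U.span_minimal[rotated])
    then show ?thesis using that U.span_basis by auto
  qed
  have 2: "pure_tensor U V u v \<in> ?T" if u: "u \<in> space U" and "v \<in> space V" for u v
  proof -
    have "V.subspace {v \<in> space V. pure_tensor U V u v \<in> ?T}"
      using T u pure_linear(2,4)[OF u] by (auto simp: V.subspace_def V.add_space V.scl_space pure_zero)
    moreover have "\<gamma> ` J \<subseteq> {v \<in> space V. pure_tensor U V u v \<in> ?T}"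
      using 1[OF u] V.beta_space by auto
    ultimately have "V.span (\<gamma> ` J) \<subseteq> {v \<in> space V. pure_tensor U V u v \<in> ?T}" by (rule V.span_minimal[rotated])
    then show ?thesis using that V.span_basis by auto
  qed
  show "space (tensor U V) \<subseteq> ?T"
    unfolding tensor_sel by (rule fv.span_minimal) (use 2 fv.subspace_span in auto)
qed

lemma inj_tensor_basis: "inj_on tensor_basis (I \<times> J)"
proof (rule inj_onI)
  fix x y assume xy: "x \<in> I \<times> J" "y \<in> I \<times> J" "tensor_basis x = tensor_basis y"
  show "x = y"
    using tensor_basis_co_form[OF xy(1), of x] tensor_basis_co_form[OF xy(2), of x] xy(3)
    by (simp split: if_splits)
qed

lemma sum_tensor_basis_co_form:
  assumes "x \<in> I \<times> J"
  shows "(\<Sum>y\<in>I \<times> J. c y * tensor_basis y (co_form x)) = c x"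
proof -
  have "(\<Sum>y\<in>I \<times> J. c y * tensor_basis y (co_form x)) = (\<Sum>y\<in>I \<times> J. if y = x then c x else 0)"
    by (rule sum.cong) (auto simp: tensor_basis_co_form)
  then show ?thesis using assms U.finI V.finI by (simp add: sum.delta)
qed

lemma indep_tensor_basis: "fv.independent (tensor_basis ` (I \<times> J))"
proof -
  have main: "c t = 0" if s: "(\<Sum>t\<in>tensor_basis ` (I \<times> J). (\<lambda>f. c t * t f)) = 0" and t: "t \<in> tensor_basis ` (I \<times> J)" for c t
  proof -
    obtain x where x: "x \<in> I \<times> J" "t = tensor_basis x" using t by (elim imageE)
    have "(\<Sum>t\<in>tensor_basis ` (I \<times> J). c t * t (co_form x)) = 0"
      using arg_cong[OF s, of "\<lambda>t. t (co_form x)"] by (simp only: sum_apply_fun zero_fun_apply)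
    moreover have "(\<Sum>t\<in>tensor_basis ` (I \<times> J). c t * t (co_form x)) =
        (\<Sum>y\<in>I \<times> J. c (tensor_basis y) * tensor_basis y (co_form x))"
      by (rule sum.reindex_cong[OF inj_tensor_basis]) (rule refl)+
    moreover have "\<dots> = c t" unfolding x(2) by (rule sum_tensor_basis_co_form[OF x(1), of "\<lambda>y. c (tensor_basis y)"])
    ultimately show ?thesis by (simp only:)
  qed
  have fin: "finite (tensor_basis ` (I \<times> J))" using U.finI V.finI by simp
  show ?thesis
  proof
    assume "fv.dependent (tensor_basis ` (I \<times> J))"
    then obtain c t where ct: "t \<in> tensor_basis ` (I \<times> J)" "c t \<noteq> 0"
      "(\<Sum>t\<in>tensor_basis ` (I \<times> J). (\<lambda>f. c t * t f)) = 0"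
      unfolding fv.dependent_finite[OF fin] by (elim exE conjE bexE)
    show False using ct(2) main[OF ct(3,1)] by (rule notE)
  qed
qed

lemma tensor_span_cases:
  assumes "t \<in> space (tensor U V)"
    and "\<And>u v. \<lbrakk>u \<in> space U; v \<in> space V\<rbrakk> \<Longrightarrow> P (pure_tensor U V u v)"
    and "P 0" "\<And>s t. \<lbrakk>P s; P t\<rbrakk> \<Longrightarrow> P (s + t)" "\<And>c t. P t \<Longrightarrow> P (\<lambda>f. c * t f)"
  shows "P t"
proof -
  have "fv.subspace (Collect P)" using assms(3-5) by (simp add: fv.subspace_def)
  then have "space (tensor U V) \<subseteq> Collect P"
    unfolding tensor_sel by (intro fv.span_minimal) (use assms(2) in auto)
  then show ?thesis using assms(1) by blast
qed

lemma pure_space: "\<lbrakk>u \<in> space U; v \<in> space V\<rbrakk> \<Longrightarrow> pure_tensor U V u v \<in> space (tensor U V)"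
  unfolding tensor_sel by (rule fv.span_base) blast

lemma tensor_space_closed:
  "0 \<in> space (tensor U V)"
  "\<lbrakk>s \<in> space (tensor U V); t \<in> space (tensor U V)\<rbrakk> \<Longrightarrow> s + t \<in> space (tensor U V)"
  "t \<in> space (tensor U V) \<Longrightarrow> (\<lambda>f. c * t f) \<in> space (tensor U V)"
  unfolding tensor_sel by (fact fv.span_zero fv.span_add fv.span_scale)+

lemma kG_coord_tensor: "kG_coord G (tensor U V) (I \<times> J) tensor_basis"
proof -
  have "kG_module_axioms G (tensor U V)"
  proof (unfold kG_module_axioms_def tensor_sel(2), intro conjI allI impI)
    show "fv.subspace (space (tensor U V))" unfolding tensor_sel by (rule fv.subspace_span)
    have "tensor_basis ` (I \<times> J) \<subseteq> space (tensor U V)" unfolding span_tensor_basis[symmetric] by (rule fv.span_superset)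
    then show "\<exists>B. finite B \<and> B \<subseteq> space (tensor U V) \<and> fv.span B = space (tensor U V)"
      using U.finI V.finI span_tensor_basis by (intro exI[of _ "tensor_basis ` (I \<times> J)"]) simp
    fix g assume g: "g \<in> carrier G"
    show "act (tensor U V) g t \<in> space (tensor U V)" if "t \<in> space (tensor U V)" for t
      using that by (rule tensor_span_cases)
        (simp_all only: g act_pure act_tensor_linear U.act_closed V.act_closed pure_space tensor_space_closed)
    show "act (tensor U V) g (s + t) = act (tensor U V) g s + act (tensor U V) g t" for s t
      by (rule act_tensor_linear)
    show "act (tensor U V) g (\<lambda>f. c * t f) = (\<lambda>f. c * act (tensor U V) g t f)" for t c
      by (rule act_tensor_linear)
    fix h assume h: "h \<in> carrier G"
    show "act (tensor U V) (g \<otimes> h) t = act (tensor U V) g (act (tensor U V) h t)" if "t \<in> space (tensor U V)" for t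
      using that by (rule tensor_span_cases)
        (simp_all only: g h act_pure act_tensor_linear U.m_closed U.act_mult V.act_mult)
  next
    fix t assume "t \<in> space (tensor U V)"
    then show "act (tensor U V) \<one> t = t"
      by (rule tensor_span_cases) (simp_all only: act_pure act_tensor_linear U.one_closed U.act_one V.act_one)
  qed
  moreover have "vector_space (scl (tensor U V))" unfolding tensor_sel by unfold_locales
  ultimately have "kG_module G (tensor U V)" by (intro kG_module.intro U.group_axioms)
  moreover have "kG_coord_axioms G (tensor U V) (I \<times> J) tensor_basis"
    by (rule kG_coord_axioms.intro)
      (simp_all add: U.finG U.finI V.finI inj_tensor_basis indep_tensor_basis span_tensor_basis tensor_sel(2))
  ultimately show ?thesis by (rule kG_coord.intro)
qed

sublocale W: kG_coord G "tensor U V" "I \<times> J" tensor_basis by (rule kG_coord_tensor)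

lemma co_tensor:
  assumes "t \<in> space (tensor U V)" "x \<in> I \<times> J"
  shows "W.co t x = t (co_form x)"
proof -
  have "t (co_form x) = W.emb (W.co t) (co_form x)" using W.emb_co[OF assms(1)] by simp
  also have "\<dots> = (\<Sum>y\<in>I \<times> J. W.co t y * tensor_basis y (co_form x))"
    by (simp add: W.emb_def tensor_sel(2) sum_apply_fun)
  also have "\<dots> = W.co t x" by (rule sum_tensor_basis_co_form[OF assms(2)])
  finally show ?thesis ..
qed

text \<open>The diagonal action sends a basis tensor to a pure tensor, whose coordinates are
  products of coordinates; this is the entry of the Kronecker product. Hence the results on
  \<open>tensor_rep\<close> apply to the coordinates of \<open>tensor U V\<close>.\<close>

lemma rep_tensor: "W.rep = (\<lambda>g. kron (U.rep g) (V.rep g))"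
proof
  fix g
  show "W.rep g = kron (U.rep g) (V.rep g)"
  proof (cases "g \<in> carrier G")
    case True
    show ?thesis
    proof (rule rmat_eqI)
      fix x y
      have "W.co (act (tensor U V) g (tensor_basis y)) x =
        U.co (act U g (\<beta> (fst y))) (fst x) * V.co (act V g (\<gamma> (snd y))) (snd x)" if "y \<in> I \<times> J"
      proof (cases "x \<in> I \<times> J")
        case x: True
        have "W.co (act (tensor U V) g (tensor_basis y)) x = act (tensor U V) g (tensor_basis y) (co_form x)"
          by (rule co_tensor[OF W.act_closed[OF True W.beta_space[OF that]] x])
        then show ?thesis by (simp add: tensor_basis_def act_pure[OF True] pure_co_form)
      next
        case x: False
        then show ?thesis by (cases x) (auto simp: W.co_outside U.co_outside V.co_outside)
      qed
      then show "ent (W.rep g) x y = ent (kron (U.rep g) (V.rep g)) x y"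
        using True by (cases y) (auto simp: W.rep_def U.rep_def V.rep_def W.ent_mat U.ent_mat V.ent_mat)
    qed
  qed (simp add: W.rep_def U.rep_def V.rep_def)
qed

theorem tensor_vertices_sources:
  assumes p: "prime p" "CHAR('k) = p"
    and simple: "simple_mod G (tensor U V)" and abs: "absolutely_indecomposable G (tensor U V)"
    and copU: "\<And>Q X. source G U Q X \<Longrightarrow> coprime p (dim_mod (on_sub U X))"
    and copV: "\<And>R Y. source G V R Y \<Longrightarrow> coprime p (dim_mod (on_sub V Y))"
  shows "\<exists>Q R. vertex G U Q \<and> vertex G V R \<and> vertex G (tensor U V) (Q \<inter> R) \<and> sylow_subgroup p G (Q <#> R)"
    and "\<And>P Z. \<lbrakk>source G (tensor U V) P Z; absolutely_indecomposable (G\<lparr>carrier := P\<rparr>) (on_sub (tensor U V) Z)\<rbrakk>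
      \<Longrightarrow> coprime p (dim_mod (on_sub (tensor U V) Z))"
proof -
  interpret X: tensor_rep G I U.rep J V.rep p
    using p by (intro tensor_rep.intro tensor_rep_axioms.intro U.group_axioms U.R.mrep_axioms V.R.mrep_axioms)
  have scalar: "\<exists>s. a = sc s (idm (I \<times> J))" if "a \<in> W.R.fixA (carrier G)" for a
    by (rule W.simple_scalar[OF simple abs that])
  note scalar' = scalar[unfolded rep_tensor]
  have nonzero: "(idm (I \<times> J) :: ('i \<times> 'j, 'k) rmat) \<noteq> 0"
  proof
    assume 0: "(idm (I \<times> J) :: ('i \<times> 'j, 'k) rmat) = 0"
    have "t = 0" if "t \<in> space (tensor U V)" for t using W.op_idm[OF that] 0 by simp
    then have "space (tensor U V) = {0}" using tensor_space_closed(1) by blast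
    then show False using simple by (simp add: simple_mod_def)
  qed
  then have nz: "(idm I :: ('i, 'k) rmat) \<noteq> 0" "(idm J :: ('j, 'k) rmat) \<noteq> 0"
    unfolding kron_idm[symmetric] by auto
  \<comment> \<open>An endomorphism of \<open>U\<close> tensored with the identity of
    \<open>V\<close> is an endomorphism of the tensor product, hence a scalar, and the identity
    factor is cancelled.\<close>
  have scalarU: "\<exists>s. a = sc s (idm I)" if a: "a \<in> U.R.fixA (carrier G)" for a
  proof -
    obtain s where "kron a (idm J) = sc s (idm (I \<times> J))"
      using scalar'[OF X.fixA_kron[OF a V.R.fixA_idm[OF subset_refl]]] by (rule exE)
    then have "kron a (idm J) = kron (sc s (idm I)) (idm J)" by (simp add: kron_sc kron_idm)
    then show ?thesis using kron_idm_cancel(1)[OF _ nz(2)] by blast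
  qed
  have scalarV: "\<exists>s. b = sc s (idm J)" if b: "b \<in> V.R.fixA (carrier G)" for b
  proof -
    obtain s where "kron (idm I) b = sc s (idm (I \<times> J))"
      using scalar'[OF X.fixA_kron[OF U.R.fixA_idm[OF subset_refl] b]] by (rule exE)
    then have "kron (idm I) b = kron (idm I) (sc s (idm J))" by (simp add: kron_sc_right kron_idm)
    then show ?thesis using kron_idm_cancel(2)[OF _ nz(1)] by blast
  qed
  have bU: "\<exists>b\<in>U.R.fixA Q. mtr I b \<noteq> 0" if "U.R.vtx Q" for Q
    by (rule U.trace_at_vertex[OF p scalarU nz(1) that copU])
  have bV: "\<exists>b\<in>V.R.fixA R. mtr J b \<noteq> 0" if "V.R.vtx R" for R
    by (rule V.trace_at_vertex[OF p scalarV nz(2) that copV])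
  note tv = X.tensor_vertices[OF scalar' nonzero bU bV, folded rep_tensor]
  show "\<exists>Q R. vertex G U Q \<and> vertex G V R \<and> vertex G (tensor U V) (Q \<inter> R) \<and> sylow_subgroup p G (Q <#> R)"
    unfolding U.vertex_iff V.vertex_iff W.vertex_iff by (rule tv(1))
  show "coprime p (dim_mod (on_sub (tensor U V) Z))"
    if src: "source G (tensor U V) P Z"
      and ab: "absolutely_indecomposable (G\<lparr>carrier := P\<rparr>) (on_sub (tensor U V) Z)" for P Z
  proof -
    have "W.R.vtx P" using src by (simp add: source_def W.vertex_iff)
    then obtain b where b: "b \<in> W.R.fixA P" "mtr (I \<times> J) b \<noteq> 0" using tv(2) by blast
    show ?thesis by (rule W.source_dim_coprime[OF p scalar src ab b])
  qed
qed

end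

theorem corollary2:
  fixes p :: nat
    and G :: "('g, 'r) monoid_scheme" (structure)
    and U :: "('k::field, 'g, 'u::ab_group_add) gmod"
    and V :: "('k, 'g, 'v::ab_group_add) gmod"
    and W :: "('k, 'g, ('u \<Rightarrow> 'v \<Rightarrow> 'k) \<Rightarrow> 'k) gmod"
  assumes "prime p" and "CHAR('k) = p"
    and "group G" and "finite (carrier G)"
    and "kG_module G U" and "kG_module G V"
    and "simple_mod G U" and "simple_mod G V"
    and "\<forall>Q X. source G U Q X \<longrightarrow> coprime p (dim_mod (on_sub U X))"
    and "\<forall>R Y. source G V R Y \<longrightarrow> coprime p (dim_mod (on_sub V Y))"
    and "W = tensor U V"
    and "simple_mod G W"
    and "absolutely_indecomposable G U"
    and "absolutely_indecomposable G V"
    and "absolutely_indecomposable G W"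
    and "\<forall>Q X. source G U Q X \<longrightarrow> absolutely_indecomposable (G\<lparr>carrier := Q\<rparr>) (on_sub U X)"
    and "\<forall>R Y. source G V R Y \<longrightarrow> absolutely_indecomposable (G\<lparr>carrier := R\<rparr>) (on_sub V Y)"
    and "\<forall>P Z. source G W P Z \<longrightarrow> absolutely_indecomposable (G\<lparr>carrier := P\<rparr>) (on_sub W Z)"
  shows "(\<forall>P Z. source G W P Z \<longrightarrow> coprime p (dim_mod (on_sub W Z))) \<and>
         (\<exists>Q R. vertex G U Q \<and> vertex G V R \<and> vertex G W (Q \<inter> R) \<and>
                sylow_subgroup p G (Q <#> R))"
proof -
  obtain B where B: "kG_coord G U B (\<lambda>x. x)" by (rule kG_module.coordinates_exist[OF assms(5,4)])
  obtain C where C: "kG_coord G V C (\<lambda>x. x)" by (rule kG_module.coordinates_exist[OF assms(6,4)])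
  interpret tensor_coord G U B "\<lambda>x. x" V C "\<lambda>x. x" by (intro tensor_coord.intro B C)
  have "simple_mod G (tensor U V)" "absolutely_indecomposable G (tensor U V)"
    using assms(11,12,15) by simp_all
  note t = tensor_vertices_sources[OF assms(1,2) this]
  have copU: "coprime p (dim_mod (on_sub U X))" if "source G U Q X" for Q X using assms(9) that by (elim allE impE)
  have copV: "coprime p (dim_mod (on_sub V Y))" if "source G V R Y" for R Y using assms(10) that by (elim allE impE)
  show ?thesis
  proof (intro conjI allI impI)
    show "\<exists>Q R. vertex G U Q \<and> vertex G V R \<and> vertex G W (Q \<inter> R) \<and> sylow_subgroup p G (Q <#> R)"
      unfolding assms(11) by (rule t(1)[OF copU copV])
    fix P Z assume src: "source G W P Z"
    then have "absolutely_indecomposable (G\<lparr>carrier := P\<rparr>) (on_sub W Z)" using assms(18) by (elim allE impE)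
    then show "coprime p (dim_mod (on_sub W Z))"
      using src unfolding assms(11) by (intro t(2)[OF copU copV])
  qed
qed

end
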